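(* Let $\Omega$ be a domain in $\mathbb{C}^n$ and let $E\subset b\Omega$ be a totally real $n$-dimensional $C^1$-manifold. Assume that $b\Omega$ is strictly pseudoconvex and real analytic near $E$. Let $E'$ be a totally real $n'$-dimensional real analytic manifold that is contained in the boundary of a domain $\Omega'\subset\mathbb{C}^{n'}$. Suppose that for a neighborhood $V\supset E'$ in $\mathbb{C}^{n'}$ one has $\Omega'\cap V=\{x'\in V:\rho(x',\bar x')<0\}$, where $\rho$ is a real analytic plurisubharmonic function on $V$ with $d\rho\neq0$. Assume that $U$ is a neighborhood of $E$ in $\mathbb{C}^n$ and $f:\Omega\cap U\to\Omega'\cap V$ is a holomorphic mapping of class $C^2$ on $\overline\Omega\cap U$ such that $f(E)\subset E'$. Then $f$ extends holomorphically to a neighborhood of $E$ and $E$ is a real analytic manifold.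
   Context: $b\Omega$ denotes the boundary of $\Omega$. A real submanifold $E$ of $\mathbb{C}^n$ is totally real if $T_xE\cap iT_xE=\{0\}$ for all $x\in E$. "Of class $C^2$ on $\overline\Omega\cap U$" means that the mapping and its derivatives up to order $2$ extend continuously to $\overline\Omega\cap U$. It is not assumed that $f$ maps $b\Omega$ into $b\Omega'$. *)

theory Defs
  imports "HOL-Analysis.Analysis"
begin

text \<open>
  \<open>C^n\<close> is \<^typ>\<open>complex ^ 'n\<close> with \<open>n = CARD('n)\<close>; it is a real Euclidean space of dimension
  \<open>2n\<close>, and complex scalar multiplication is \<open>*s\<close>.  In this file \<open>subspace\<close>, \<open>dim\<close>
  and derivatives are taken over the reals.
\<close>

definition domain_in :: "'a::euclidean_space set \<Rightarrow> bool" where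
  "domain_in D \<longleftrightarrow> open D \<and> connected D \<and> D \<noteq> {}"


section \<open>Regularity classes\<close>

text \<open>
  \<open>f\<close> is \<open>k\<close> times differentiable on the open set \<open>S\<close>, and \<open>f\<close> and all its (iterated directional)
  derivatives of order at most \<open>k\<close> extend continuously from \<open>S\<close> to \<open>T \<supseteq> S\<close>.
  For \<open>T = S\<close> this says that \<open>f\<close> is of class \<open>C^k\<close> on \<open>S\<close>.
\<close>
primrec Ck_extends ::
    "nat \<Rightarrow> ('a::real_normed_vector \<Rightarrow> 'b::real_normed_vector) \<Rightarrow> 'a set \<Rightarrow> 'a set \<Rightarrow> bool" where
  "Ck_extends 0 f S T \<longleftrightarrow> (\<exists>g. continuous_on T g \<and> (\<forall>x\<in>S. g x = f x))"
| "Ck_extends (Suc k) f S T \<longleftrightarrow>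
     (\<exists>g. continuous_on T g \<and> (\<forall>x\<in>S. g x = f x)) \<and>
     (\<forall>x\<in>S. f differentiable (at x)) \<and>
     (\<forall>v. Ck_extends k (\<lambda>x. frechet_derivative f (at x) v) S T)"

definition C1_on :: "('a::real_normed_vector \<Rightarrow> 'b::real_normed_vector) \<Rightarrow> 'a set \<Rightarrow> bool" where
  "C1_on f S \<longleftrightarrow> Ck_extends 1 f S S"

text \<open>
  Local expansion into a (vector-valued, unconditionally convergent) power series in the
  real coordinates.  Multi-indices are functions \<open>Basis \<rightarrow> nat\<close>, extended by zero.
\<close>
definition real_analytic_on ::
    "('a::euclidean_space \<Rightarrow> 'b::real_normed_vector) \<Rightarrow> 'a set \<Rightarrow> bool" where
  "real_analytic_on f S \<longleftrightarrow>
     (\<forall>a\<in>S. \<exists>c r. r > 0 \<and>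
        (\<forall>x\<in>ball a r.
           ((\<lambda>\<alpha>. (\<Prod>b\<in>Basis. ((x - a) \<bullet> b) ^ \<alpha> b) *\<^sub>R c \<alpha>) has_sum f x)
             {\<alpha>. \<forall>b. b \<notin> Basis \<longrightarrow> \<alpha> b = (0::nat)}))"

definition holomorphic_map_on :: "(complex ^ 'n \<Rightarrow> complex ^ 'm) \<Rightarrow> (complex ^ 'n) set \<Rightarrow> bool" where
  "holomorphic_map_on f S \<longleftrightarrow>
     (\<forall>x\<in>S. \<exists>D. (f has_derivative D) (at x) \<and> (\<forall>c v. D (c *s v) = c *s D v))"


section \<open>Submanifolds\<close>

text \<open>
  Embedded \<open>d\<close>-dimensional submanifolds (not necessarily closed): near each of its points, \<open>M\<close> is
  straightened to a \<open>d\<close>-dimensional linear subspace by a diffeomorphism \<open>\<phi>\<close> with inverse \<open>\<psi>\<close>,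
  both of the regularity class \<open>reg\<close>.
\<close>
definition submanifold ::
    "(('a \<Rightarrow> 'a) \<Rightarrow> 'a set \<Rightarrow> bool) \<Rightarrow> nat \<Rightarrow> 'a::euclidean_space set \<Rightarrow> bool" where
  "submanifold reg d M \<longleftrightarrow>
     (\<forall>p\<in>M. \<exists>W \<phi> \<psi> L.
        open W \<and> p \<in> W \<and> open (\<phi> ` W) \<and>
        reg \<phi> W \<and> reg \<psi> (\<phi> ` W) \<and> (\<forall>x\<in>W. \<psi> (\<phi> x) = x) \<and>
        subspace L \<and> dim L = d \<and> \<phi> ` (W \<inter> M) = \<phi> ` W \<inter> L)"

definition tangent_space :: "'a::real_normed_vector set \<Rightarrow> 'a \<Rightarrow> 'a set" where
  "tangent_space M p =
     {v. \<exists>\<gamma> \<epsilon>. \<epsilon> > 0 \<and> \<gamma> 0 = p \<and> (\<forall>t. \<bar>t\<bar> < \<epsilon> \<longrightarrow> \<gamma> t \<in> M) \<and>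
           (\<gamma> has_vector_derivative v) (at (0::real))}"

definition totally_real :: "(complex ^ 'n) set \<Rightarrow> bool" where
  "totally_real M \<longleftrightarrow>
     (\<forall>p\<in>M. tangent_space M p \<inter> (\<lambda>v. \<i> *s v) ` tangent_space M p = {0})"


section \<open>Defining functions, pseudoconvexity, plurisubharmonicity\<close>

text \<open>
  The conditions imply that \<open>frontier D \<inter> N\<close> is the zero set of \<open>r\<close> in \<open>N\<close>.
\<close>
definition analytic_defining_function ::
    "'a::euclidean_space set \<Rightarrow> 'a set \<Rightarrow> ('a \<Rightarrow> real) \<Rightarrow> bool" where
  "analytic_defining_function D N r \<longleftrightarrow>
     open N \<and> real_analytic_on r N \<and> D \<inter> N = {x \<in> N. r x < 0} \<and>
     (\<forall>x\<in>N. frechet_derivative r (at x) \<noteq> (\<lambda>_. 0))"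

definition dz :: "'n \<Rightarrow> (complex ^ 'n \<Rightarrow> complex) \<Rightarrow> complex ^ 'n \<Rightarrow> complex" where
  "dz j g x =
     (frechet_derivative g (at x) (axis j 1) - \<i> * frechet_derivative g (at x) (axis j \<i>)) / 2"

definition dzbar :: "'n \<Rightarrow> (complex ^ 'n \<Rightarrow> complex) \<Rightarrow> complex ^ 'n \<Rightarrow> complex" where
  "dzbar j g x =
     (frechet_derivative g (at x) (axis j 1) + \<i> * frechet_derivative g (at x) (axis j \<i>)) / 2"

text \<open>
  The Levi form is Hermitian for \<open>r\<close> of class \<open>C^2\<close>, so that \<open>Re\<close> only adjusts the type.
\<close>
definition levi_form :: "(complex ^ 'n \<Rightarrow> real) \<Rightarrow> complex ^ 'n \<Rightarrow> complex ^ 'n \<Rightarrow> real" where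
  "levi_form r x v =
     Re (\<Sum>j\<in>UNIV. \<Sum>k\<in>UNIV.
           dz j (dzbar k (\<lambda>y. complex_of_real (r y))) x * v $ j * cnj (v $ k))"

definition complex_tangent :: "(complex ^ 'n \<Rightarrow> real) \<Rightarrow> complex ^ 'n \<Rightarrow> (complex ^ 'n) set" where
  "complex_tangent r x = {v. (\<Sum>j\<in>UNIV. dz j (\<lambda>y. complex_of_real (r y)) x * v $ j) = 0}"

definition boundary_analytic_strictly_pseudoconvex_near ::
    "(complex ^ 'n) set \<Rightarrow> (complex ^ 'n) set \<Rightarrow> bool" where
  "boundary_analytic_strictly_pseudoconvex_near D E \<longleftrightarrow>
     (\<exists>W. open W \<and> E \<subseteq> W \<and>
       (\<forall>p \<in> frontier D \<inter> W. \<exists>N r. p \<in> N \<and> analytic_defining_function D N r \<and>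
          (\<forall>x \<in> frontier D \<inter> N. \<forall>v \<in> complex_tangent r x. v \<noteq> 0 \<longrightarrow> levi_form r x v > 0)))"

text \<open>
  Upper semicontinuity and the sub-mean value inequality on all closed complex discs in the open
  set \<open>V\<close>.  Only finite (real) values are considered, so the circle means are
  finite and integrability can be demanded.
\<close>
definition plurisubharmonic_on :: "(complex ^ 'n \<Rightarrow> real) \<Rightarrow> (complex ^ 'n) set \<Rightarrow> bool" where
  "plurisubharmonic_on u V \<longleftrightarrow>
     (\<forall>c. openin (top_of_set V) {x \<in> V. u x < c}) \<and>
     (\<forall>a w. (\<forall>\<zeta>. cmod \<zeta> \<le> 1 \<longrightarrow> a + \<zeta> *s w \<in> V) \<longrightarrow>
        (\<lambda>t. u (a + cis t *s w)) integrable_on {0..2 * pi} \<and>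
        u a \<le> integral {0..2 * pi} (\<lambda>t. u (a + cis t *s w)) / (2 * pi))"

end

theory Submission
  imports Defs "HOL-Complex_Analysis.Complex_Analysis"
begin

text \<open>
  The theorem is a reflection principle in several variables.  Conjugation on a totally real
  real-analytic manifold is the restriction of a holomorphic map, which makes an extension by
  reflection possible; but \<open>E\<close> is only \<open>C^1\<close>, so that it has no such reflection a priori.

  The first idea replaces the missing reflection across \<open>E\<close> by the map itself.  A strictly
  pseudoconvex real-analytic hypersurface \<open>r = 0\<close> has a nondegenerate conormal structure: near a
  boundary point the conjugate of \<open>x\<close> is a holomorphic function \<open>Y\<close> of \<open>x\<close> and of a positive
  multiple of the complex gradient of \<open>r\<close> at \<open>x\<close> (\<open>conormal_reflection\<close>; the Levi form is the
  derivative that has to be invertible in the implicit function theorem).  On \<open>E\<close> such a multiple is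
  \<open>g = \<partial>(\<rho> \<circ> f)\<close>: since \<open>\<rho> \<circ> f\<close> is negative inside and zero on \<open>E\<close>, its differential there is a
  nonnegative multiple of that of \<open>r\<close> (\<open>boundary_gradient_proportional\<close>), and the Hopf lemma for
  the plurisubharmonic \<open>\<rho>\<close> makes the multiple positive (\<open>normal_derivative_negative\<close>).
  Moreover \<open>g\<close> has a holomorphic extension into \<open>\<Omega>\<close>.  In the chain rule the derivatives of \<open>f\<close>
  are holomorphic, and the gradient of \<open>\<rho>\<close> on \<open>E'\<close> becomes a holomorphic function once
  \<open>conj z\<close> is replaced by \<open>S' z\<close>, with \<open>S'\<close> the holomorphic function that agrees with
  conjugation on \<open>E'\<close> (\<open>totally_real_reflection\<close>).  Hence \<open>y x = Y (x, g x)\<close> is holomorphic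
  in \<open>\<Omega>\<close>, of class \<open>C^1\<close> up to the boundary because \<open>f\<close> is \<open>C^2\<close>, and equals the conjugate of \<open>x\<close>
  on \<open>E\<close>.

  The second idea uses \<open>y\<close> to flatten \<open>E\<close>.  After a linear change of variables, half the sum of
  \<open>x\<close> and the suitably conjugated \<open>y\<close> is holomorphic in \<open>\<Omega>\<close> and real on \<open>E\<close>; it is invertible near
  \<open>p\<close>, and its inverse \<open>X\<close> maps a wedge \<open>Im w > 0\<close> into \<open>\<Omega>\<close> and the real points to \<open>E\<close>.
  The coordinates of \<open>X\<close> and, by means of \<open>S'\<close>, those of \<open>f \<circ> X\<close> are complex combinations of
  functions that are real on the edge.  By the edge-of-the-wedge theorem both extend to a full
  neighbourhood (\<open>wedge_parametrization\<close>, \<open>extension_and_chart\<close>).  Since \<open>X\<close> is then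
  biholomorphic near \<open>0\<close>, it gives a real-analytic chart of \<open>E\<close>, and \<open>f \<circ> X\<close> composed with the
  inverse of \<open>X\<close> extends \<open>f\<close>.

  The local extensions agree on overlaps of balls, because the intersection of two balls around points of
  \<open>E\<close> is connected and meets \<open>\<Omega>\<close> as soon as it contains one of the centres
  (\<open>patch_local_extensions\<close>).
\<close>

no_notation fps_nth (infixl \<open>$\<close> 75)

section \<open>Holomorphic maps between complex Euclidean spaces\<close>

text \<open>
  One class for \<open>\<complex>\<close>, \<open>\<complex>^n\<close>, their products and tuples of vectors: polarized functions live on
  \<open>\<complex>^n \<times> \<complex>^n\<close>, the unknowns of the implicit functions in \<open>\<complex>^n \<times> \<complex>\<close>, and the partial derivatives of a
  map form a tuple of vectors.
\<close>

class complex_space = euclidean_space +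
  fixes scaleC :: "complex \<Rightarrow> 'a \<Rightarrow> 'a"  (infixr \<open>*\<^sub>C\<close> 75)
  assumes scaleC_add_right: "c *\<^sub>C (x + y) = c *\<^sub>C x + c *\<^sub>C y"
    and scaleC_add_left: "(c + d) *\<^sub>C x = c *\<^sub>C x + d *\<^sub>C x"
    and scaleC_scaleC: "c *\<^sub>C d *\<^sub>C x = (c * d) *\<^sub>C x"
    and scaleC_of_real: "complex_of_real r *\<^sub>C x = r *\<^sub>R x"

instantiation complex :: complex_space
begin
definition "scaleC_complex (c::complex) x = c * x"
instance
  by standard (auto simp: scaleC_complex_def algebra_simps scaleR_conv_of_real)
end

instantiation vec :: (complex_space, finite) complex_space
begin
definition "scaleC_vec c (x :: 'a ^ 'b) = (\<chi> i. c *\<^sub>C (x $ i))"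
instance
  by standard (auto simp: scaleC_vec_def vec_eq_iff scaleC_add_right scaleC_add_left
      scaleC_scaleC scaleC_of_real)
end

instantiation prod :: (complex_space, complex_space) complex_space
begin
definition "scaleC_prod c (x :: 'a \<times> 'b) = (c *\<^sub>C fst x, c *\<^sub>C snd x)"
instance
  by standard (auto simp: scaleC_prod_def scaleC_add_right scaleC_add_left
      scaleC_scaleC scaleC_of_real plus_prod_def scaleR_prod_def)
end

lemma scaleC_complex [simp]: "c *\<^sub>C (x::complex) = c * x"
  by (simp add: scaleC_complex_def)

lemma scaleC_vec_nth [simp]: "(c *\<^sub>C x) $ i = c *\<^sub>C (x $ i)"
  by (simp add: scaleC_vec_def)

lemma scaleC_vector_eq: "c *\<^sub>C (x :: complex ^ 'n) = c *s x"
  by (simp add: vec_eq_iff)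

lemma fst_scaleC [simp]: "fst (c *\<^sub>C x) = c *\<^sub>C fst x"
  and snd_scaleC [simp]: "snd (c *\<^sub>C x) = c *\<^sub>C snd x"
  and scaleC_Pair [simp]: "c *\<^sub>C (a, b) = (c *\<^sub>C a, c *\<^sub>C b)"
  by (simp_all add: scaleC_prod_def)

lemma scaleC_scaleR: "c *\<^sub>C (r *\<^sub>R x) = r *\<^sub>R (c *\<^sub>C x)"
  by (metis mult.commute scaleC_of_real scaleC_scaleC)

lemma scaleC_one [simp]: "1 *\<^sub>C x = (x :: 'a::complex_space)"
  using scaleC_of_real[of 1 x] by simp

lemma scaleC_zero_left [simp]: "0 *\<^sub>C x = (0 :: 'a::complex_space)"
  using scaleC_of_real[of 0 x] by simp

lemma linear_scaleC: "linear (\<lambda>x. c *\<^sub>C (x :: 'a::complex_space))"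
  by (rule linearI) (simp_all add: scaleC_add_right scaleC_scaleR)

lemma scaleC_zero_right [simp]: "c *\<^sub>C (0 :: 'a::complex_space) = 0"
  using linear_0[OF linear_scaleC] .

lemma scaleC_minus_right [simp]: "c *\<^sub>C (- x) = - (c *\<^sub>C (x :: 'a::complex_space))"
  using linear_neg[OF linear_scaleC] .

lemma scaleC_diff_right: "c *\<^sub>C (x - y) = c *\<^sub>C x - c *\<^sub>C (y :: 'a::complex_space)"
  using linear_diff[OF linear_scaleC] .

lemma scaleC_minus_left [simp]: "(- c) *\<^sub>C x = - (c *\<^sub>C (x :: 'a::complex_space))"
  using scaleC_scaleC[of "-1" c x] scaleC_of_real[of "-1" "c *\<^sub>C x"] by simp

lemma scaleC_sum_right: "c *\<^sub>C (\<Sum>i\<in>I. x i) = (\<Sum>i\<in>I. c *\<^sub>C (x i :: 'a::complex_space))"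
  using linear_sum[OF linear_scaleC] .

lemma scaleC_eq_Re_Im: "c *\<^sub>C x = Re c *\<^sub>R x + Im c *\<^sub>R (\<i> *\<^sub>C (x :: 'a::complex_space))"
proof -
  have "c *\<^sub>C x = (of_real (Re c) + of_real (Im c) * \<i>) *\<^sub>C x"
    using complex_eq[of c] by (simp add: mult.commute)
  also have "\<dots> = Re c *\<^sub>R x + Im c *\<^sub>R (\<i> *\<^sub>C x)"
    unfolding scaleC_add_left by (simp add: scaleC_of_real flip: scaleC_scaleC)
  finally show ?thesis .
qed

lemma bounded_bilinear_scaleC: "bounded_bilinear (scaleC :: complex \<Rightarrow> 'a::complex_space \<Rightarrow> 'a)"
proof
  show "\<exists>K. \<forall>c (x::'a). norm (c *\<^sub>C x) \<le> norm c * norm x * K"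
  proof -
    obtain B where B: "\<And>x::'a. norm (\<i> *\<^sub>C x) \<le> B * norm x"
      using linear_bounded[OF linear_scaleC[of \<i>]] by blast
    have "norm (c *\<^sub>C x) \<le> norm c * norm x * (1 + B)" for c and x :: 'a
    proof -
      have "norm (c *\<^sub>C x) \<le> \<bar>Re c\<bar> * norm x + \<bar>Im c\<bar> * norm (\<i> *\<^sub>C x)"
        unfolding scaleC_eq_Re_Im[of c x] by (rule norm_triangle_le) simp
      also have "\<dots> \<le> norm c * norm x + norm c * (B * norm x)"
        by (intro add_mono mult_mono abs_Re_le_cmod abs_Im_le_cmod B) auto
      finally show ?thesis by (simp add: algebra_simps)
    qed
    then show ?thesis by blast
  qed
qed (simp_all add: scaleC_add_left scaleC_add_right scaleC_scaleR,
     metis of_real_mult scaleC_of_real scaleC_scaleC scaleR_conv_of_real)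

interpretation scaleC: bounded_bilinear "scaleC :: complex \<Rightarrow> 'a::complex_space \<Rightarrow> 'a"
  by (rule bounded_bilinear_scaleC)

lemmas [continuous_intros] = scaleC.continuous_on
lemmas [derivative_intros] = scaleC.FDERIV
lemmas [tendsto_intros] = scaleC.tendsto

definition clinear :: "('a::complex_space \<Rightarrow> 'b::complex_space) \<Rightarrow> bool" where
  "clinear D \<longleftrightarrow> linear D \<and> (\<forall>c v. D (c *\<^sub>C v) = c *\<^sub>C D v)"

lemma clinearD: assumes "clinear D" shows "linear D" "D (c *\<^sub>C v) = c *\<^sub>C D v"
  using assms by (auto simp: clinear_def)

lemma clinear_i: "clinear D \<longleftrightarrow> linear D \<and> (\<forall>v. D (\<i> *\<^sub>C v) = \<i> *\<^sub>C D v)"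
proof
  assume "linear D \<and> (\<forall>v. D (\<i> *\<^sub>C v) = \<i> *\<^sub>C D v)"
  then have L: "linear D" and I: "\<And>v. D (\<i> *\<^sub>C v) = \<i> *\<^sub>C D v" by auto
  have "D (c *\<^sub>C v) = c *\<^sub>C D v" for c v
    unfolding scaleC_eq_Re_Im[of c v] scaleC_eq_Re_Im[of c "D v"]
    by (simp add: linear_add[OF L] linear_scale[OF L] I)
  with L show "clinear D" by (simp add: clinear_def)
qed (auto simp: clinear_def)

definition holo_on :: "('a::complex_space \<Rightarrow> 'b::complex_space) \<Rightarrow> 'a set \<Rightarrow> bool" where
  "holo_on f S \<longleftrightarrow> (\<forall>x\<in>S. \<exists>D. (f has_derivative D) (at x) \<and> clinear D)"

lemma holomorphic_map_on_eq_holo_on: "holomorphic_map_on f S = holo_on f S"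
  unfolding holomorphic_map_on_def holo_on_def clinear_def scaleC_vector_eq
  using has_derivative_linear by blast

lemma holo_onE:
  assumes "holo_on f S" "x \<in> S"
  obtains D where "(f has_derivative D) (at x)" "clinear D"
  using assms unfolding holo_on_def by blast

lemma holo_on_subset: "holo_on f S \<Longrightarrow> T \<subseteq> S \<Longrightarrow> holo_on f T"
  unfolding holo_on_def by blast

lemma holo_on_imp_continuous_on: "holo_on f S \<Longrightarrow> continuous_on S f"
  unfolding holo_on_def
  by (meson continuous_at_imp_continuous_on has_derivative_continuous)

lemma holo_on_cong:
  assumes "open S" "\<And>x. x \<in> S \<Longrightarrow> f x = g x" "holo_on f S" shows "holo_on g S"
  using assms unfolding holo_on_def
  by (metis has_derivative_transform_within_open)

lemma clinear_const0: "clinear (\<lambda>x. 0)"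
  by (simp add: clinear_def linear_zero)

lemma holo_on_const [intro, simp]: "holo_on (\<lambda>x. c) S"
  unfolding holo_on_def using clinear_const0 has_derivative_const by blast

lemma holo_on_clinear: "clinear f \<Longrightarrow> holo_on f S"
  unfolding holo_on_def clinear_def using linear_imp_has_derivative by blast

lemma clinear_compose: "clinear f \<Longrightarrow> clinear g \<Longrightarrow> clinear (\<lambda>x. g (f x))"
  unfolding clinear_def using linear_compose[of f g] by (auto simp: o_def)

lemma holo_on_compose:
  assumes "holo_on f S" "holo_on g T" "f ` S \<subseteq> T"
  shows "holo_on (\<lambda>x. g (f x)) S"
  unfolding holo_on_def
proof
  fix x assume x: "x \<in> S"
  obtain D where D: "(f has_derivative D) (at x)" "clinear D" using holo_onE[OF assms(1) x] .
  obtain D' where D': "(g has_derivative D') (at (f x))" "clinear D'"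
    using holo_onE[OF assms(2)] assms(3) x by blast
  show "\<exists>D. ((\<lambda>x. g (f x)) has_derivative D) (at x) \<and> clinear D"
    using has_derivative_compose[OF D(1) D'(1)] clinear_compose[OF D(2) D'(2)] by blast
qed

lemma clinear_Pair: "clinear f \<Longrightarrow> clinear g \<Longrightarrow> clinear (\<lambda>x. (f x, g x))"
  by (auto simp: clinear_def linear_iff)

lemma clinear_fst: "clinear fst" and clinear_snd: "clinear snd" and clinear_id: "clinear (\<lambda>x. x)"
  by (simp_all add: clinear_def linear_iff)

lemma clinear_vec_nth: "clinear (\<lambda>x. x $ i)"
  by (simp add: clinear_def linear_iff)

lemma clinear_scaleC: "clinear (\<lambda>x. c *\<^sub>C x)"
  by (simp add: clinear_def linear_scaleC scaleC_scaleC mult.commute)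

lemma clinear_mult: "clinear (\<lambda>x. c * (x::complex))"
  using clinear_scaleC[of c, where 'a=complex] by simp

lemma clinear_add: "clinear f \<Longrightarrow> clinear g \<Longrightarrow> clinear (\<lambda>x. f x + g x)"
  by (auto simp: clinear_def linear_iff scaleC_add_right scaleC_diff_right algebra_simps)

lemma holo_on_id [intro, simp]: "holo_on (\<lambda>x. x) S"
  by (rule holo_on_clinear[OF clinear_id])

lemma holo_on_Pair:
  assumes "holo_on f S" "holo_on g S" shows "holo_on (\<lambda>x. (f x, g x)) S"
  unfolding holo_on_def
proof
  fix x assume x: "x \<in> S"
  obtain D where D: "(f has_derivative D) (at x)" "clinear D" using holo_onE[OF assms(1) x] .
  obtain D' where D': "(g has_derivative D') (at x)" "clinear D'" using holo_onE[OF assms(2) x] .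
  show "\<exists>D. ((\<lambda>x. (f x, g x)) has_derivative D) (at x) \<and> clinear D"
    using has_derivative_Pair[OF D(1) D'(1)] clinear_Pair[OF D(2) D'(2)] by blast
qed

lemma holo_on_fst: "holo_on f S \<Longrightarrow> holo_on (\<lambda>x. fst (f x)) S"
  and holo_on_snd: "holo_on f S \<Longrightarrow> holo_on (\<lambda>x. snd (f x)) S"
  by (rule holo_on_compose[OF _ holo_on_clinear[OF clinear_fst, of UNIV]], simp_all)
    (rule holo_on_compose[OF _ holo_on_clinear[OF clinear_snd, of UNIV]], simp_all)

lemma holo_on_vec_nth: "holo_on f S \<Longrightarrow> holo_on (\<lambda>x. f x $ i) S"
  by (rule holo_on_compose[where g = "\<lambda>x. x $ i", OF _ holo_on_clinear[OF clinear_vec_nth, where S = UNIV]]) simp_all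

lemma holo_on_add: 
  assumes "holo_on f S" "holo_on g S" shows "holo_on (\<lambda>x. f x + g x) S"
proof -
  have "holo_on (\<lambda>z. fst z + snd z :: 'b) UNIV"
    by (intro holo_on_clinear clinear_add clinear_fst clinear_snd)
  from holo_on_compose[OF holo_on_Pair[OF assms] this] show ?thesis by simp
qed

lemma holo_on_scaleC: "holo_on f S \<Longrightarrow> holo_on (\<lambda>x. c *\<^sub>C f x) S"
  by (rule holo_on_compose[OF _ holo_on_clinear[OF clinear_scaleC, where S = UNIV]]) simp_all

lemma holo_on_uminus: "holo_on f S \<Longrightarrow> holo_on (\<lambda>x. - f x) S"
  using holo_on_scaleC[of f S "-1"] by simp

lemma holo_on_diff: "holo_on f S \<Longrightarrow> holo_on g S \<Longrightarrow> holo_on (\<lambda>x. f x - g x) S"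
  using holo_on_add[OF _ holo_on_uminus, of f S g] by simp

lemma holo_on_sum: "(\<And>i. i \<in> I \<Longrightarrow> holo_on (f i) S) \<Longrightarrow> holo_on (\<lambda>x. \<Sum>i\<in>I. f i x) S"
proof (induction I rule: infinite_finite_induct)
  case (insert i I)
  then show ?case using holo_on_add[of "f i" S "\<lambda>x. \<Sum>i\<in>I. f i x"] by simp
qed simp_all

lemma holo_on_mult:
  fixes f g :: "'a::complex_space \<Rightarrow> complex"
  assumes "holo_on f S" "holo_on g S" shows "holo_on (\<lambda>x. f x * g x) S"
  unfolding holo_on_def
proof
  fix x assume x: "x \<in> S"
  obtain D where D: "(f has_derivative D) (at x)" "clinear D" using holo_onE[OF assms(1) x] .
  obtain D' where D': "(g has_derivative D') (at x)" "clinear D'" using holo_onE[OF assms(2) x] .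
  have "clinear (\<lambda>h. f x * D' h + D h * g x)"
    using D(2) D'(2) by (auto simp: clinear_def linear_iff algebra_simps)
  then show "\<exists>D. ((\<lambda>x. f x * g x) has_derivative D) (at x) \<and> clinear D"
    using has_derivative_mult[OF D(1) D'(1)] by blast
qed

lemma holo_on_power:
  fixes f :: "'a::complex_space \<Rightarrow> complex"
  assumes "holo_on f S" shows "holo_on (\<lambda>x. f x ^ k) S"
proof (induction k)
  case (Suc k)
  then show ?case using holo_on_mult[OF assms Suc] by simp
qed simp

lemma holo_on_prod:
  fixes f :: "'i \<Rightarrow> 'a::complex_space \<Rightarrow> complex"
  shows "(\<And>i. i \<in> I \<Longrightarrow> holo_on (f i) S) \<Longrightarrow> holo_on (\<lambda>x. \<Prod>i\<in>I. f i x) S"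
proof (induction I rule: infinite_finite_induct)
  case (insert i I)
  then show ?case using holo_on_mult[of "f i" S "\<lambda>x. \<Prod>i\<in>I. f i x"] by simp
qed simp_all

lemma has_derivative_vec_nth_iff:
  fixes f :: "'a::euclidean_space \<Rightarrow> 'b::euclidean_space ^ 'n"
  shows "(f has_derivative D) F \<longleftrightarrow> (\<forall>i. ((\<lambda>x. f x $ i) has_derivative (\<lambda>h. D h $ i)) F)"
proof
  assume "(f has_derivative D) F"
  then show "\<forall>i. ((\<lambda>x. f x $ i) has_derivative (\<lambda>h. D h $ i)) F"
    using bounded_linear.has_derivative[OF bounded_linear_vec_nth] by blast
next
  assume *: "\<forall>i. ((\<lambda>x. f x $ i) has_derivative (\<lambda>h. D h $ i)) F"
  show "(f has_derivative D) F"
    unfolding has_derivative_def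
  proof
    show "bounded_linear D"
    proof -
      have "linear (\<lambda>h. D h $ i)" for i
        using * has_derivative_bounded_linear bounded_linear.linear by blast
      then show ?thesis by (simp add: linear_conv_bounded_linear[symmetric] linear_iff vec_eq_iff)
    qed
    show "((\<lambda>y. ((f y - f (Lim F (\<lambda>x. x))) - D (y - Lim F (\<lambda>x. x))) /\<^sub>R norm (y - Lim F (\<lambda>x. x))) \<longlongrightarrow> 0) F"
    proof (rule vec_tendstoI)
      fix i
      have "((\<lambda>y. ((f y $ i - f (Lim F (\<lambda>x. x)) $ i) - D (y - Lim F (\<lambda>x. x)) $ i)
          /\<^sub>R norm (y - Lim F (\<lambda>x. x))) \<longlongrightarrow> 0) F"
        using * unfolding has_derivative_def by blast
      then show "((\<lambda>y. (((f y - f (Lim F (\<lambda>x. x))) - D (y - Lim F (\<lambda>x. x)))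
          /\<^sub>R norm (y - Lim F (\<lambda>x. x))) $ i) \<longlongrightarrow> 0 $ i) F" by simp
    qed
  qed
qed

lemma holo_on_vecI:
  fixes f :: "'a::complex_space \<Rightarrow> 'b::complex_space ^ 'n"
  assumes "\<And>i. holo_on (\<lambda>x. f x $ i) S"
  shows "holo_on f S"
  unfolding holo_on_def
proof
  fix x assume x: "x \<in> S"
  have "\<forall>i. \<exists>D. ((\<lambda>x. f x $ i) has_derivative D) (at x) \<and> clinear D"
    using assms x unfolding holo_on_def by blast
  then obtain D where D: "\<And>i. ((\<lambda>x. f x $ i) has_derivative D i) (at x)" "\<And>i. clinear (D i)"
    by metis
  have "(f has_derivative (\<lambda>h. \<chi> i. D i h)) (at x)"
    unfolding has_derivative_vec_nth_iff using D by simp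
  moreover have "clinear (\<lambda>h. \<chi> i. D i h)"
    using D(2) by (auto simp: clinear_def linear_iff vec_eq_iff)
  ultimately show "\<exists>D. (f has_derivative D) (at x) \<and> clinear D" by blast
qed

section \<open>Cauchy integrals and Osgood's lemma\<close>

lemma has_derivative_continuous_partials:
  fixes f :: "'a::euclidean_space \<Rightarrow> 'b::real_normed_vector"
  assumes S: "open S" "x0 \<in> S"
    and d: "\<And>x b. x \<in> S \<Longrightarrow> b \<in> Basis \<Longrightarrow>
              ((\<lambda>t. f (x + t *\<^sub>R b)) has_vector_derivative d b x) (at 0)"
    and cont: "\<And>b. b \<in> Basis \<Longrightarrow> continuous_on S (d b)"
  shows "(f has_derivative (\<lambda>h. \<Sum>b\<in>Basis. (h \<bullet> b) *\<^sub>R d b x0)) (at x0)"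
proof -
  define P where "P B h = (\<Sum>b\<in>B. (h \<bullet> b) *\<^sub>R b)" for B and h :: 'a
  have normP: "norm (P B h) \<le> real (card B) * norm h" if "B \<subseteq> Basis" for B h
  proof -
    have "norm (P B h) \<le> (\<Sum>b\<in>B. norm h)"
      unfolding P_def using that by (intro sum_norm_le) (auto simp: Basis_le_norm subset_iff)
    then show ?thesis by simp
  qed
  have main: "\<exists>\<delta>>0. \<forall>h. norm h < \<delta> \<longrightarrow>
      norm (f (x0 + P B h) - f x0 - (\<Sum>b\<in>B. (h \<bullet> b) *\<^sub>R d b x0)) \<le> \<epsilon> * norm h"
    if "finite B" "B \<subseteq> Basis" "\<epsilon> > 0" for B \<epsilon>
    using that
  proof (induction B arbitrary: \<epsilon> rule: finite_induct)
    case empty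
    then show ?case by (intro exI[of _ 1]) (auto simp: P_def)
  next
    case (insert b B)
    then have b: "b \<in> Basis" and B: "B \<subseteq> Basis" by auto
    have e2: "\<epsilon> / 2 > 0" using insert.prems by simp
    from insert.IH[OF B e2] obtain \<delta>1 where \<delta>1: "\<delta>1 > 0" "\<And>h. norm h < \<delta>1 \<Longrightarrow>
      norm (f (x0 + P B h) - f x0 - (\<Sum>b\<in>B. (h \<bullet> b) *\<^sub>R d b x0)) \<le> \<epsilon>/2 * norm h" by blast
    obtain r where r: "r > 0" "ball x0 r \<subseteq> S" using S open_contains_ball by blast
    have "continuous (at x0) (d b)"
      using cont[OF b] S continuous_on_eq_continuous_at by blast
    then obtain s where s: "s > 0" "\<And>y. dist y x0 < s \<Longrightarrow> dist (d b y) (d b x0) < \<epsilon>/2"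
      unfolding continuous_at_eps_delta using e2 by blast
    define \<delta> where "\<delta> = min \<delta>1 (min r s / (real (card B) + 2))"
    have "\<delta> > 0" unfolding \<delta>_def using \<delta>1 r s by auto
    moreover have "norm (f (x0 + P (insert b B) h) - f x0 - (\<Sum>b\<in>insert b B. (h \<bullet> b) *\<^sub>R d b x0)) \<le> \<epsilon> * norm h"
      if h: "norm h < \<delta>" for h
    proof -
      define y where "y = x0 + P B h"
      have hb: "\<bar>h \<bullet> b\<bar> \<le> norm h" using b by (rule Basis_le_norm)
      have "norm h * (real (card B) + 2) < min r s"
        using h unfolding \<delta>_def by (simp add: pos_less_divide_eq)
      then have h': "real (card B) * norm h + norm h < min r s"
        using norm_ge_zero[of h] by (simp add: algebra_simps del: norm_ge_zero)
      have near: "dist (y + t *\<^sub>R b) x0 < min r s" if t: "t \<in> closed_segment 0 (h \<bullet> b)" for t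
      proof -
        have "\<bar>t\<bar> \<le> \<bar>h \<bullet> b\<bar>" using t by (auto simp: closed_segment_eq_real_ivl split: if_splits)
        then have "\<bar>t\<bar> \<le> norm h" using hb by simp
        moreover have "norm (P B h + t *\<^sub>R b) \<le> norm (P B h) + \<bar>t\<bar>"
          using b by (intro norm_triangle_le) simp
        ultimately show ?thesis using normP[OF B, of h] h' unfolding y_def by (simp add: dist_norm)
      qed
      define G where "G t = f (y + t *\<^sub>R b) - t *\<^sub>R d b x0" for t
      have Gd: "(G has_derivative (\<lambda>s. s *\<^sub>R (d b (y + t *\<^sub>R b) - d b x0))) (at t within closed_segment 0 (h \<bullet> b))"
        if t: "t \<in> closed_segment 0 (h \<bullet> b)" for t
      proof -
        have yS: "y + t *\<^sub>R b \<in> S" using near[OF t] r by (auto simp: dist_commute)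
        have "((\<lambda>s. f ((y + t *\<^sub>R b) + s *\<^sub>R b)) has_vector_derivative d b (y + t *\<^sub>R b)) (at (t - t))"
          using d[OF yS b] by simp
        then have "((\<lambda>s. f ((y + t *\<^sub>R b) + (s - t) *\<^sub>R b)) has_vector_derivative d b (y + t *\<^sub>R b)) (at t)"
        proof -
          have "((\<lambda>s. s - t) has_derivative (\<lambda>s. s)) (at t)"
            by (auto intro!: derivative_eq_intros)
          moreover have "((\<lambda>s. f ((y + t *\<^sub>R b) + s *\<^sub>R b)) has_derivative (\<lambda>s. s *\<^sub>R d b (y + t *\<^sub>R b))) (at (t - t))"
            using d[OF yS b] by (simp add: has_vector_derivative_def)
          ultimately show ?thesis
            using has_derivative_compose[of "\<lambda>s. s - t" "\<lambda>s. s" t UNIV "\<lambda>s. f ((y + t *\<^sub>R b) + s *\<^sub>R b)"]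
            by (simp add: has_vector_derivative_def)
        qed
        then have "((\<lambda>s. f (y + s *\<^sub>R b)) has_derivative (\<lambda>s. s *\<^sub>R d b (y + t *\<^sub>R b))) (at t)"
          by (simp add: has_vector_derivative_def algebra_simps)
        then have "(G has_derivative (\<lambda>s. s *\<^sub>R d b (y + t *\<^sub>R b) - s *\<^sub>R d b x0)) (at t)"
          unfolding G_def by (auto intro!: derivative_eq_intros)
        then show ?thesis by (simp add: has_derivative_at_withinI scaleR_diff_right)
      qed
      have Gon: "onorm (\<lambda>s. s *\<^sub>R (d b (y + t *\<^sub>R b) - d b x0)) \<le> \<epsilon>/2"
        if t: "t \<in> closed_segment 0 (h \<bullet> b)" for t
      proof (rule onorm_le)
        fix s'
        have "dist (d b (y + t *\<^sub>R b)) (d b x0) < \<epsilon>/2" using near[OF t] s(2) by simp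
        then have "norm (d b (y + t *\<^sub>R b) - d b x0) \<le> \<epsilon>/2" by (simp add: dist_norm)
        from mult_left_mono[OF this, of "\<bar>s'\<bar>"]
        show "norm (s' *\<^sub>R (d b (y + t *\<^sub>R b) - d b x0)) \<le> \<epsilon>/2 * norm s'"
          by (simp add: mult.commute)
      qed
      have "norm (G (h \<bullet> b) - G 0) \<le> \<epsilon>/2 * norm ((h \<bullet> b) - 0)"
        by (rule differentiable_bound[OF convex_closed_segment Gd Gon]) auto
      also have "\<dots> \<le> \<epsilon>/2 * norm h" using hb e2 by (intro mult_left_mono) auto
      finally have 1: "norm (f (y + (h \<bullet> b) *\<^sub>R b) - (h \<bullet> b) *\<^sub>R d b x0 - f y) \<le> \<epsilon>/2 * norm h"
        by (simp add: G_def)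
      have 2: "norm (f y - f x0 - (\<Sum>b\<in>B. (h \<bullet> b) *\<^sub>R d b x0)) \<le> \<epsilon>/2 * norm h"
        unfolding y_def using \<delta>1(2) h unfolding \<delta>_def by simp
      have "f (x0 + P (insert b B) h) - f x0 - (\<Sum>b\<in>insert b B. (h \<bullet> b) *\<^sub>R d b x0) =
        (f (y + (h \<bullet> b) *\<^sub>R b) - (h \<bullet> b) *\<^sub>R d b x0 - f y) + (f y - f x0 - (\<Sum>b\<in>B. (h \<bullet> b) *\<^sub>R d b x0))"
        using insert.hyps unfolding P_def y_def by (simp add: algebra_simps)
      also have "norm \<dots> \<le> \<epsilon>/2 * norm h + \<epsilon>/2 * norm h"
        by (rule norm_triangle_le) (use 1 2 in linarith)
      finally show ?thesis by simp
    qed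
    ultimately show ?case by blast
  qed
  have PB: "P Basis h = h" for h unfolding P_def by (rule euclidean_representation)
  show ?thesis
    unfolding has_derivative_at_alt
  proof (intro conjI allI impI)
    show "bounded_linear (\<lambda>h. \<Sum>b\<in>Basis. (h \<bullet> b) *\<^sub>R d b x0)"
      by (intro bounded_linear_sum bounded_linear_scaleR_left[THEN bounded_linear_compose] bounded_linear_inner_left)
    fix \<epsilon> :: real assume "\<epsilon> > 0"
    from main[OF finite_Basis subset_refl this] obtain \<delta> where "\<delta> > 0" and
      \<delta>: "\<And>h. norm h < \<delta> \<Longrightarrow> norm (f (x0 + h) - f x0 - (\<Sum>b\<in>Basis. (h \<bullet> b) *\<^sub>R d b x0)) \<le> \<epsilon> * norm h"
      unfolding PB by blast
    show "\<exists>d'>0. \<forall>y. norm (y - x0) < d' \<longrightarrow>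
        norm (f y - f x0 - (\<Sum>b\<in>Basis. ((y - x0) \<bullet> b) *\<^sub>R d b x0)) \<le> \<epsilon> * norm (y - x0)"
      using \<open>\<delta> > 0\<close> \<delta>[of "_ - x0"] by (intro exI[of _ \<delta>]) simp
  qed
qed

definition cderiv :: "('a::complex_space \<Rightarrow> complex) \<Rightarrow> 'a \<Rightarrow> 'a \<Rightarrow> complex" where
  "cderiv f v x = deriv (\<lambda>\<zeta>. f (x + \<zeta> *\<^sub>C v)) 0"

text \<open>
  The one-variable hypothesis in Osgood's lemma.
\<close>

definition line_holo :: "('a::complex_space \<Rightarrow> complex) \<Rightarrow> 'a set \<Rightarrow> bool" where
  "line_holo f S \<longleftrightarrow> (\<forall>x\<in>S. \<forall>v. (\<lambda>\<zeta>. f (x + \<zeta> *\<^sub>C v)) field_differentiable (at 0))"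

lemma line_holo_has_field_derivative:
  assumes "line_holo f S" "x + \<zeta> *\<^sub>C v \<in> S"
  shows "((\<lambda>\<xi>. f (x + \<xi> *\<^sub>C v)) has_field_derivative cderiv f v (x + \<zeta> *\<^sub>C v)) (at \<zeta>)"
proof -
  have "((\<lambda>\<xi>. f ((x + \<zeta> *\<^sub>C v) + \<xi> *\<^sub>C v)) has_field_derivative cderiv f v (x + \<zeta> *\<^sub>C v)) (at (\<zeta> - \<zeta>))"
    using assms unfolding line_holo_def cderiv_def
    by (auto simp: field_differentiable_derivI)
  then have "((\<lambda>\<xi>. f ((x + \<zeta> *\<^sub>C v) + (\<xi> - \<zeta>) *\<^sub>C v)) has_field_derivative cderiv f v (x + \<zeta> *\<^sub>C v) * 1) (at \<zeta>)"
    by (rule DERIV_chain2) (auto intro!: derivative_eq_intros)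
  then show ?thesis by (simp add: algebra_simps flip: scaleC_add_left)
qed

lemma open_line: "open S \<Longrightarrow> open {\<zeta>. x + \<zeta> *\<^sub>C v \<in> (S :: 'a::complex_space set)}"
  using open_vimage[of S "\<lambda>\<zeta>. x + \<zeta> *\<^sub>C v"]
    continuous_on_add[OF continuous_on_const scaleC.continuous_on[OF continuous_on_id continuous_on_const], of UNIV x v]
  by (simp add: vimage_def)

lemma line_cball:
  assumes "open S" "x \<in> (S :: 'a::complex_space set)"
  obtains r where "r > 0" "\<And>\<zeta>. cmod \<zeta> \<le> r \<Longrightarrow> x + \<zeta> *\<^sub>C v \<in> S"
proof -
  have "0 \<in> {\<zeta>. x + \<zeta> *\<^sub>C v \<in> S}" using assms by simp
  then obtain r where r: "r > 0" "cball 0 r \<subseteq> {\<zeta>. x + \<zeta> *\<^sub>C v \<in> S}"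
    using open_line[OF assms(1), of x v] unfolding open_contains_cball by blast
  then show ?thesis by (intro that[of r]) (auto simp: subset_iff)
qed

lemma line_holo_holomorphic_on:
  assumes "line_holo f S" "\<And>\<zeta>. \<zeta> \<in> A \<Longrightarrow> x + \<zeta> *\<^sub>C v \<in> S"
  shows "(\<lambda>\<xi>. f (x + \<xi> *\<^sub>C v)) holomorphic_on A"
  unfolding holomorphic_on_def field_differentiable_def
  using line_holo_has_field_derivative[OF assms(1) assms(2)] has_field_derivative_at_within by blast

lemma has_derivative_line:
  fixes f :: "'a::complex_space \<Rightarrow> complex"
  assumes "(f has_derivative D) (at x)" "clinear D"
  shows "((\<lambda>\<zeta>. f (x + \<zeta> *\<^sub>C v)) has_field_derivative D v) (at 0)"
proof -
  have "((\<lambda>\<zeta>. x + \<zeta> *\<^sub>C v) has_derivative (\<lambda>\<zeta>. \<zeta> *\<^sub>C v)) (at 0)"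
    by (auto intro!: derivative_eq_intros)
  moreover have "(f has_derivative D) (at (x + 0 *\<^sub>C v))" using assms by simp
  ultimately have "((\<lambda>\<zeta>. f (x + \<zeta> *\<^sub>C v)) has_derivative (\<lambda>\<zeta>. D (\<zeta> *\<^sub>C v))) (at 0)"
    by (rule has_derivative_compose)
  moreover have "(\<lambda>\<zeta>. D (\<zeta> *\<^sub>C v)) = (*) (D v)"
    by (simp add: fun_eq_iff clinearD(2)[OF assms(2)])
  ultimately show ?thesis by (simp add: has_field_derivative_def)
qed

lemma holo_on_imp_line_holo: "holo_on f S \<Longrightarrow> line_holo f S"
  unfolding holo_on_def line_holo_def field_differentiable_def
  using has_derivative_line by blast

lemma has_derivative_cderiv_eq:
  assumes "(f has_derivative D) (at x)" "clinear D"
  shows "cderiv f v x = D v"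
  unfolding cderiv_def by (rule DERIV_imp_deriv[OF has_derivative_line[OF assms]])

lemma exists_uniform_disc:
  fixes x0 :: "'a::complex_space"
  assumes "open S" "x0 \<in> S"
  obtains d r where "d > 0" "r > 0" "ball x0 d \<subseteq> S"
    "\<And>x \<zeta>. x \<in> ball x0 d \<Longrightarrow> cmod \<zeta> \<le> r \<Longrightarrow> x + \<zeta> *\<^sub>C v \<in> S"
proof -
  obtain e where e: "e > 0" "ball x0 e \<subseteq> S" using assms open_contains_ball by blast
  obtain K where K: "K > 0" "\<And>c (w::'a). norm (c *\<^sub>C w) \<le> norm c * norm w * K"
    using scaleC.pos_bounded by blast
  define M where "M = norm v * K + 1"
  define r where "r = e / 2 / M"
  have pos: "M > 0" unfolding M_def using K by (simp add: add_nonneg_pos)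
  have "r > 0" unfolding r_def using e pos by simp
  show ?thesis
  proof (rule that[of "e/2" r])
    show "x + \<zeta> *\<^sub>C v \<in> S" if "x \<in> ball x0 (e/2)" "cmod \<zeta> \<le> r" for x \<zeta>
    proof -
      have "norm (\<zeta> *\<^sub>C v) \<le> cmod \<zeta> * (norm v * K)" using K(2)[of \<zeta> v] by (simp add: mult.assoc)
      also have "\<dots> \<le> r * M" unfolding M_def using that(2) K(1) \<open>r > 0\<close> by (intro mult_mono) auto
      also have "\<dots> = e / 2" unfolding r_def using pos by simp
      finally have "dist x0 (x + \<zeta> *\<^sub>C v) < e"
        using that(1) norm_triangle_ineq4[of "x0 - x" "\<zeta> *\<^sub>C v"] by (simp add: dist_norm algebra_simps)
      then show ?thesis using e by auto
    qed
  qed (use e \<open>r > 0\<close> in auto)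
qed

definition unit_circle :: "real \<Rightarrow> complex" where
  "unit_circle t = exp (2 * of_real pi * \<i> * of_real t)"

lemma norm_unit_circle [simp]: "cmod (unit_circle t) = 1"
  unfolding unit_circle_def by (simp add: norm_exp_eq_Re)

lemma unit_circle_nz [simp]: "unit_circle t \<noteq> 0"
  using norm_unit_circle[of t] by (metis norm_zero zero_neq_one)

lemma continuous_on_unit_circle [continuous_intros]:
  "continuous_on A g \<Longrightarrow> continuous_on A (\<lambda>x. unit_circle (g x))"
  unfolding unit_circle_def by (intro continuous_intros)

lemma contour_integral_circlepath_unit:
  "contour_integral (circlepath z r) g =
     integral {0..1} (\<lambda>t. g (z + of_real r * unit_circle t) * (2 * pi * \<i> * of_real r * unit_circle t))"
  unfolding contour_integral_integral vector_derivative_circlepath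
  by (simp add: circlepath unit_circle_def mult_ac)

lemma mean_value_unit_circle:
  assumes "continuous_on (cball z r) f" "f holomorphic_on ball z r" "r > 0"
  shows "integral {0..1} (\<lambda>t. f (z + of_real r * unit_circle t)) = f z"
proof -
  have "contour_integral (circlepath z r) (\<lambda>u. f u / (u - z)) = 2 * of_real pi * \<i> * f z"
    using Cauchy_integral_circlepath[OF assms(1,2), of z] assms(3) contour_integral_unique by auto
  moreover have "contour_integral (circlepath z r) (\<lambda>u. f u / (u - z)) =
     integral {0..1} (\<lambda>t. (2 * pi * \<i>) * f (z + of_real r * unit_circle t))"
    unfolding contour_integral_circlepath_unit using assms(3)
    by (intro integral_cong) (simp add: field_simps)
  ultimately show ?thesis by simp
qed

text \<open>
  Writing the derivative as an integral over the fixed interval \<open>{0..1}\<close> makes its continuity and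
  holomorphy in \<open>x\<close>, and in parameters, a statement about integrals.
\<close>

lemma cderiv_Cauchy:
  assumes f: "line_holo f S" and r: "r > 0" "\<And>\<zeta>. cmod \<zeta> \<le> r \<Longrightarrow> x + \<zeta> *\<^sub>C v \<in> S"
  shows "cderiv f v x = integral {0..1} (\<lambda>t. f (x + (of_real r * unit_circle t) *\<^sub>C v) / (of_real r * unit_circle t))"
proof -
  let ?g = "\<lambda>\<zeta>. f (x + \<zeta> *\<^sub>C v)"
  have hol: "?g holomorphic_on cball 0 r"
    using r(2) by (intro line_holo_holomorphic_on[OF f]) auto
  have "(?g has_field_derivative (1 / (2 * of_real pi * \<i>) *
       contour_integral (circlepath 0 r) (\<lambda>u. ?g u / (u - 0)^2))) (at 0)"
    using Cauchy_derivative_integral_circlepath(2)[of 0 r ?g 0] hol r(1)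
      holomorphic_on_imp_continuous_on[OF hol] holomorphic_on_subset[OF hol ball_subset_cball]
    by simp
  then have "cderiv f v x = 1 / (2 * of_real pi * \<i>) *
       contour_integral (circlepath 0 r) (\<lambda>u. ?g u / (u - 0)^2)"
    unfolding cderiv_def by (rule DERIV_imp_deriv)
  also have "contour_integral (circlepath 0 r) (\<lambda>u. ?g u / (u - 0)^2) =
     integral {0..1} (\<lambda>t. (2 * of_real pi * \<i>) * (?g (of_real r * unit_circle t) / (of_real r * unit_circle t)))"
    unfolding contour_integral_circlepath_unit using r(1)
    by (intro integral_cong) (simp add: field_simps power2_eq_square)
  also have "\<dots> = (2 * of_real pi * \<i>) * integral {0..1} (\<lambda>t. ?g (of_real r * unit_circle t) / (of_real r * unit_circle t))"
    by (rule integral_mult_right)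
  finally show ?thesis by simp
qed

lemma continuous_on_cderiv_param:
  fixes \<Phi> :: "'a::complex_space \<Rightarrow> 't::t2_space \<Rightarrow> complex"
  assumes S: "open S" and cont: "continuous_on (S \<times> T) (\<lambda>(x,t). \<Phi> x t)"
    and hol: "\<And>t. t \<in> T \<Longrightarrow> line_holo (\<lambda>x. \<Phi> x t) S"
  shows "continuous_on (S \<times> T) (\<lambda>(x,t). cderiv (\<lambda>x. \<Phi> x t) v x)"
  unfolding continuous_on_eq_continuous_within
proof
  fix z assume z: "z \<in> S \<times> T"
  obtain d r where dr: "d > 0" "r > 0" "ball (fst z) d \<subseteq> S"
    "\<And>x \<zeta>. x \<in> ball (fst z) d \<Longrightarrow> cmod \<zeta> \<le> r \<Longrightarrow> x + \<zeta> *\<^sub>C v \<in> S"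
    using exists_uniform_disc[OF S, of "fst z" v] z by (metis mem_Times_iff)
  let ?B = "ball (fst z) d"
  have "continuous_on (?B \<times> T) (\<lambda>u. integral (cbox 0 1)
     (\<lambda>s. \<Phi> (fst u + (of_real r * unit_circle s) *\<^sub>C v) (snd u) / (of_real r * unit_circle s)))"
  proof (rule integral_continuous_on_param)
    show "continuous_on ((?B \<times> T) \<times> cbox 0 1) (\<lambda>(u, s).
       \<Phi> (fst u + (of_real r * unit_circle s) *\<^sub>C v) (snd u) / (of_real r * unit_circle s))"
      unfolding split_def
    proof (rule continuous_on_divide)
      show "continuous_on ((?B \<times> T) \<times> cbox 0 1) (\<lambda>x.
         \<Phi> (fst (fst x) + (of_real r * unit_circle (snd x)) *\<^sub>C v) (snd (fst x)))"
      proof (rule continuous_on_compose_Pair[OF cont])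
        fix c assume c: "c \<in> (?B \<times> T) \<times> cbox 0 (1::real)"
        show "fst (fst c) + (of_real r * unit_circle (snd c)) *\<^sub>C v \<in> S"
          using dr(4)[of "fst (fst c)" "of_real r * unit_circle (snd c)"] dr(2) c
          by (simp add: norm_mult mem_Times_iff)
        show "snd (fst c) \<in> T" using c by (simp add: mem_Times_iff)
      qed (intro continuous_intros)+
    qed (use dr(2) in \<open>auto intro!: continuous_intros\<close>)
  qed
  moreover have "cderiv (\<lambda>x. \<Phi> x (snd u)) v (fst u) = integral (cbox 0 1)
     (\<lambda>s. \<Phi> (fst u + (of_real r * unit_circle s) *\<^sub>C v) (snd u) / (of_real r * unit_circle s))"
    if "u \<in> ?B \<times> T" for u
    using cderiv_Cauchy[OF hol dr(2) dr(4), of "snd u" "fst u"] that by auto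
  ultimately have "continuous_on (?B \<times> T) (\<lambda>u. cderiv (\<lambda>x. \<Phi> x (snd u)) v (fst u))"
    by (rule continuous_on_eq[OF _ sym])
  then have "continuous (at z within ?B \<times> T) (\<lambda>u. cderiv (\<lambda>x. \<Phi> x (snd u)) v (fst u))"
    using z dr(1) by (auto simp: continuous_on_eq_continuous_within)
  moreover have "at z within ?B \<times> T = at z within S \<times> T"
    by (rule at_within_nhd[of _ "?B \<times> UNIV"]) (use z dr in \<open>auto intro: open_Times\<close>)
  ultimately show "continuous (at z within S \<times> T) (\<lambda>(x,t). cderiv (\<lambda>x. \<Phi> x t) v x)"
    by (simp add: split_def)
qed

lemma continuous_on_cderiv_line:
  assumes "open S" "continuous_on S f" "line_holo f S"
  shows "continuous_on S (cderiv f v)"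
proof -
  have "continuous_on (S \<times> {0::real}) (\<lambda>(x,t). f x)"
    unfolding split_def by (rule continuous_on_compose2[OF assms(2)]) (auto intro!: continuous_intros)
  then have "continuous_on (S \<times> {0::real}) (\<lambda>(x,t). cderiv f v x)"
    using continuous_on_cderiv_param[OF assms(1), of "{0::real}" "\<lambda>x t. f x"] assms(3) by auto
  moreover have "continuous_on S (\<lambda>x. (x, 0::real))" by (intro continuous_intros)
  ultimately have "continuous_on S (\<lambda>x. case (x, 0::real) of (x, t) \<Rightarrow> cderiv f v x)"
    by (rule continuous_on_compose2) auto
  then show ?thesis by simp
qed

text \<open>
  By the Cauchy formula the directional derivatives are continuous, and continuous partial
  derivatives give a total derivative, which is then complex linear.
\<close>

theorem Osgood:
  fixes f :: "'a::complex_space \<Rightarrow> complex"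
  assumes S: "open S" and cont: "continuous_on S f" and hol: "line_holo f S"
  shows "holo_on f S"
  unfolding holo_on_def
proof
  fix x assume x: "x \<in> S"
  define D where "D h = (\<Sum>b\<in>Basis. (h \<bullet> b) *\<^sub>R cderiv f b x)" for h
  have D: "(f has_derivative D) (at x)"
    unfolding D_def
  proof (rule has_derivative_continuous_partials[OF S x])
    fix y b assume y: "y \<in> S"
    have "((\<lambda>\<zeta>. f (y + \<zeta> *\<^sub>C b)) has_field_derivative cderiv f b y) (at (of_real 0))"
      using line_holo_has_field_derivative[OF hol, of y 0 b] y by simp
    from has_vector_derivative_real_field[OF this]
    show "((\<lambda>t. f (y + t *\<^sub>R b)) has_vector_derivative cderiv f b y) (at 0)"
      by (simp add: scaleC_of_real)
  qed (rule continuous_on_cderiv_line[OF S cont hol])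
  have "D (\<zeta> *\<^sub>C v) = \<zeta> * cderiv f v x" for \<zeta> v
  proof -
    have "((\<lambda>\<zeta>. x + \<zeta> *\<^sub>C v) has_derivative (\<lambda>\<zeta>. \<zeta> *\<^sub>C v)) (at 0)"
      by (auto intro!: derivative_eq_intros)
    moreover have "(f has_derivative D) (at (x + 0 *\<^sub>C v))" using D by simp
    ultimately have "((\<lambda>\<zeta>. f (x + \<zeta> *\<^sub>C v)) has_derivative (\<lambda>\<zeta>. D (\<zeta> *\<^sub>C v))) (at 0)"
      by (rule has_derivative_compose)
    moreover have "((\<lambda>\<zeta>. f (x + \<zeta> *\<^sub>C v)) has_derivative (*) (cderiv f v x)) (at 0)"
      using line_holo_has_field_derivative[OF hol, of x 0 v] x by (simp add: has_field_derivative_def)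
    ultimately have "(\<lambda>\<zeta>. D (\<zeta> *\<^sub>C v)) = (*) (cderiv f v x)" by (rule has_derivative_unique)
    then show ?thesis by (metis mult.commute)
  qed
  from this this[of 1] have "clinear D"
    using has_derivative_linear[OF D] by (simp add: clinear_def)
  with D show "\<exists>D. (f has_derivative D) (at x) \<and> clinear D" by blast
qed

lemma holo_on_has_derivative_cderiv:
  fixes f :: "'a::complex_space \<Rightarrow> complex"
  assumes "holo_on f S" "x \<in> S"
  shows "(f has_derivative (\<lambda>v. cderiv f v x)) (at x)" "clinear (\<lambda>v. cderiv f v x)"
proof -
  obtain D where D: "(f has_derivative D) (at x)" "clinear D" using holo_onE[OF assms] .
  moreover have "(\<lambda>v. cderiv f v x) = D" using has_derivative_cderiv_eq[OF D] by auto
  ultimately show "(f has_derivative (\<lambda>v. cderiv f v x)) (at x)" "clinear (\<lambda>v. cderiv f v x)" by auto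
qed

lemma continuous_on_cderiv:
  "open S \<Longrightarrow> holo_on f S \<Longrightarrow> continuous_on S (cderiv f v)"
  by (intro continuous_on_cderiv_line holo_on_imp_line_holo holo_on_imp_continuous_on)

lemma holo_on_param_integral:
  fixes \<Phi> :: "'a::complex_space \<Rightarrow> real \<Rightarrow> complex"
  assumes S: "open S" and cont: "continuous_on (S \<times> {a..b}) (\<lambda>(x,t). \<Phi> x t)"
    and hol: "\<And>t. t \<in> {a..b} \<Longrightarrow> holo_on (\<lambda>x. \<Phi> x t) S"
  shows "holo_on (\<lambda>x. integral {a..b} (\<Phi> x)) S"
proof (rule Osgood[OF S])
  show "continuous_on S (\<lambda>x. integral {a..b} (\<Phi> x))"
    using integral_continuous_on_param[of S a b \<Phi>] cont by simp
  have cont': "continuous_on (S \<times> {a..b}) (\<lambda>(x,t). cderiv (\<lambda>x. \<Phi> x t) v x)" for v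
    by (rule continuous_on_cderiv_param[OF S cont holo_on_imp_line_holo[OF hol]])
  show "line_holo (\<lambda>x. integral {a..b} (\<Phi> x)) S"
    unfolding line_holo_def
  proof (intro ballI allI)
    fix x v assume x: "x \<in> S"
    obtain r where r: "r > 0" "\<And>\<zeta>. cmod \<zeta> \<le> r \<Longrightarrow> x + \<zeta> *\<^sub>C v \<in> S"
      using line_cball[OF S x, of v] by blast
    have "(\<lambda>\<zeta>. integral (cbox a b) (\<lambda>t. \<Phi> (x + \<zeta> *\<^sub>C v) t)) holomorphic_on ball 0 r"
    proof (rule leibniz_rule_holomorphic)
      show "((\<lambda>\<zeta>. \<Phi> (x + \<zeta> *\<^sub>C v) t) has_field_derivative cderiv (\<lambda>x. \<Phi> x t) v (x + \<zeta> *\<^sub>C v))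
          (at \<zeta> within ball 0 r)" if "\<zeta> \<in> ball 0 r" "t \<in> cbox a b" for \<zeta> t
        by (rule has_field_derivative_at_within[OF line_holo_has_field_derivative[OF holo_on_imp_line_holo[OF hol]]])
           (use that r in auto)
      show "(\<lambda>t. \<Phi> (x + \<zeta> *\<^sub>C v) t) integrable_on cbox a b" if "\<zeta> \<in> ball 0 r" for \<zeta>
      proof (rule integrable_continuous)
        show "continuous_on (cbox a b) (\<Phi> (x + \<zeta> *\<^sub>C v))"
        proof (rule continuous_on_compose_Pair[OF cont])
          show "x + \<zeta> *\<^sub>C v \<in> S" using that r(2)[of \<zeta>] by simp
        qed (auto intro: continuous_on_const continuous_on_id)
      qed
      show "continuous_on (ball 0 r \<times> cbox a b) (\<lambda>(\<zeta>, t). cderiv (\<lambda>x. \<Phi> x t) v (x + \<zeta> *\<^sub>C v))"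
        unfolding split_def 
      proof (rule continuous_on_compose_Pair[OF cont'])
        fix c assume c: "c \<in> ball (0::complex) r \<times> cbox a b"
        show "x + fst c *\<^sub>C v \<in> S" using r(2)[of "fst c"] c by (simp add: mem_Times_iff)
        show "snd c \<in> {a..b}" using c by (simp add: mem_Times_iff)
      qed (intro continuous_intros)+
    qed simp
    then show "(\<lambda>\<zeta>. integral {a..b} (\<Phi> (x + \<zeta> *\<^sub>C v))) field_differentiable at 0"
      using r(1) holomorphic_on_imp_differentiable_at[of _ "ball 0 r" 0] by auto
  qed
qed

lemma holo_on_cderiv:
  assumes S: "open S" and f: "holo_on f S"
  shows "holo_on (cderiv f v) S"
  unfolding holo_on_def
proof
  fix x0 assume x0: "x0 \<in> S"
  obtain d r where dr: "d > 0" "r > 0" "ball x0 d \<subseteq> S"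
    "\<And>x \<zeta>. x \<in> ball x0 d \<Longrightarrow> cmod \<zeta> \<le> r \<Longrightarrow> x + \<zeta> *\<^sub>C v \<in> S"
    using exists_uniform_disc[OF S x0, of v] by auto
  have "holo_on (\<lambda>x. integral {0..1} (\<lambda>t. f (x + (of_real r * unit_circle t) *\<^sub>C v) / (of_real r * unit_circle t)))
       (ball x0 d)"
  proof (rule holo_on_param_integral)
    show "continuous_on (ball x0 d \<times> {0..1})
        (\<lambda>(x, t). f (x + (of_real r * unit_circle t) *\<^sub>C v) / (of_real r * unit_circle t))"
      unfolding split_def
    proof (rule continuous_on_divide)
      show "continuous_on (ball x0 d \<times> {0..1}) (\<lambda>x. f (fst x + (of_real r * unit_circle (snd x)) *\<^sub>C v))"
        by (rule continuous_on_compose2[OF holo_on_imp_continuous_on[OF f]])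
           (use dr in \<open>auto intro!: continuous_intros simp: norm_mult\<close>)
    qed (use dr(2) in \<open>auto intro!: continuous_intros\<close>)
    show "holo_on (\<lambda>x. f (x + (of_real r * unit_circle t) *\<^sub>C v) / (of_real r * unit_circle t)) (ball x0 d)"
      for t
    proof -
      have "holo_on (\<lambda>x. f (x + (of_real r * unit_circle t) *\<^sub>C v)) (ball x0 d)"
        by (rule holo_on_compose[OF holo_on_add[OF holo_on_id holo_on_const] f])
           (use dr in \<open>auto simp: norm_mult\<close>)
      from holo_on_scaleC[OF this, of "1 / (of_real r * unit_circle t)"] show ?thesis by simp
    qed
  qed auto
  then have "holo_on (cderiv f v) (ball x0 d)"
    by (rule holo_on_cong[rotated -1])
       (use cderiv_Cauchy[OF holo_on_imp_line_holo[OF f] dr(2) dr(4)] in auto)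
  then show "\<exists>D. (cderiv f v has_derivative D) (at x0) \<and> clinear D"
    using dr(1) by (auto simp: holo_on_def)
qed

text \<open>
  Uniform limits preserve continuity and, on complex lines, holomorphy, so that Osgood's lemma applies.
\<close>

lemma holo_on_uniform_limit:
  fixes f :: "'i \<Rightarrow> 'a::complex_space \<Rightarrow> complex"
  assumes S: "open S" and F: "F \<noteq> bot"
    and f: "\<And>i. holo_on (f i) S" and lim: "uniform_limit S f g F"
  shows "holo_on g S"
proof (rule Osgood[OF S])
  show "continuous_on S g"
    by (rule uniform_limit_theorem[OF _ lim F]) (simp add: f holo_on_imp_continuous_on)
  show "line_holo g S"
    unfolding line_holo_def
  proof (intro ballI allI)
    fix x v assume x: "x \<in> S"
    obtain r where r: "r > 0" "\<And>\<zeta>. cmod \<zeta> \<le> r \<Longrightarrow> x + \<zeta> *\<^sub>C v \<in> S"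
      using line_cball[OF S x, of v] by blast
    have hol: "(\<lambda>\<zeta>. f i (x + \<zeta> *\<^sub>C v)) holomorphic_on cball 0 r" for i
      using r by (intro line_holo_holomorphic_on[OF holo_on_imp_line_holo[OF f]]) auto
    have "uniform_limit (cball 0 r) (\<lambda>i \<zeta>. f i (x + \<zeta> *\<^sub>C v)) (\<lambda>\<zeta>. g (x + \<zeta> *\<^sub>C v)) F"
      unfolding uniform_limit_iff
    proof (intro allI impI)
      fix e :: real assume "e > 0"
      with lim have "\<forall>\<^sub>F i in F. \<forall>x\<in>S. dist (f i x) (g x) < e" by (simp add: uniform_limit_iff)
      then show "\<forall>\<^sub>F i in F. \<forall>\<zeta>\<in>cball 0 r. dist (f i (x + \<zeta> *\<^sub>C v)) (g (x + \<zeta> *\<^sub>C v)) < e"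
        by (rule eventually_mono) (use r in auto)
    qed
    then obtain "(\<lambda>\<zeta>. g (x + \<zeta> *\<^sub>C v)) holomorphic_on ball 0 r"
      using holomorphic_uniform_limit[of 0 r "\<lambda>i \<zeta>. f i (x + \<zeta> *\<^sub>C v)" F "\<lambda>\<zeta>. g (x + \<zeta> *\<^sub>C v)"] hol F
      by (metis (no_types, lifting) ball_subset_cball eventuallyI holomorphic_on_imp_continuous_on holomorphic_on_subset)
    then show "(\<lambda>\<zeta>. g (x + \<zeta> *\<^sub>C v)) field_differentiable at 0"
      using r(1) holomorphic_on_imp_differentiable_at[of _ "ball 0 r" 0] by auto
  qed
qed

section \<open>Inverse and implicit functions, identity theorem\<close>

text \<open>
  The complex linear form whose real part is the coordinate along \<open>b\<close>; these forms separate points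
  and reduce vector-valued holomorphic maps to complex-valued functions.
\<close>

definition ccoord :: "'a::complex_space \<Rightarrow> 'a \<Rightarrow> complex" where
  "ccoord b w = Complex (w \<bullet> b) (- ((\<i> *\<^sub>C w) \<bullet> b))"

lemma clinear_ccoord: "clinear (ccoord b)"
proof -
  have "\<i> *\<^sub>C \<i> *\<^sub>C w = - w" for w :: 'a by (simp add: scaleC_scaleC)
  then show ?thesis
    unfolding clinear_i
    by (auto simp: linear_iff ccoord_def complex_eq_iff inner_add_left scaleC_add_right scaleC_scaleR algebra_simps)
qed

lemma ccoord_zero_imp_zero:
  assumes "\<And>b. b \<in> Basis \<Longrightarrow> ccoord b w = 0" shows "w = 0"
  using assms by (intro euclidean_eqI[of w 0]) (auto simp: ccoord_def complex_eq_iff)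

lemma holo_on_ccoord: "holo_on f S \<Longrightarrow> holo_on (\<lambda>x. ccoord b (f x)) S"
  by (rule holo_on_compose[OF _ holo_on_clinear[OF clinear_ccoord, where S = UNIV]]) auto

lemma frechet_derivative_eq: "(f has_derivative D) (at x) \<Longrightarrow> frechet_derivative f (at x) = D"
  using frechet_derivative_at by metis

lemma holo_on_frechet:
  assumes "holo_on f S" "x \<in> S"
  shows "(f has_derivative frechet_derivative f (at x)) (at x)" "clinear (frechet_derivative f (at x))"
proof -
  obtain D where D: "(f has_derivative D) (at x)" "clinear D" using holo_onE[OF assms] .
  then show "(f has_derivative frechet_derivative f (at x)) (at x)" "clinear (frechet_derivative f (at x))"
    using frechet_derivative_eq[OF D(1)] by simp_all
qed

lemma continuous_on_frechet_holo:
  assumes S: "open S" and f: "holo_on f S"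
  shows "continuous_on S (\<lambda>x. frechet_derivative f (at x) v)"
proof (subst continuous_on_componentwise, intro ballI)
  fix b :: 'b assume "b \<in> Basis"
  have "continuous_on S (\<lambda>x. Re (cderiv (\<lambda>x. ccoord b (f x)) v x))"
    by (intro continuous_on_Re continuous_on_cderiv[OF S] holo_on_ccoord f)
  then show "continuous_on S (\<lambda>x. frechet_derivative f (at x) v \<bullet> b)"
  proof (rule continuous_on_eq)
    fix x assume x: "x \<in> S"
    have "((\<lambda>x. ccoord b (f x)) has_derivative (\<lambda>v. ccoord b (frechet_derivative f (at x) v))) (at x)"
      using has_derivative_compose[OF holo_on_frechet(1)[OF f x] linear_imp_has_derivative[OF clinearD(1)[OF clinear_ccoord]]] .
    from has_derivative_cderiv_eq[OF this clinear_compose[OF holo_on_frechet(2)[OF f x] clinear_ccoord]]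
    show "Re (cderiv (\<lambda>x. ccoord b (f x)) v x) = frechet_derivative f (at x) v \<bullet> b"
      by (simp add: ccoord_def)
  qed
qed

lemma holo_on_frechet_vec:
  fixes f :: "'a::complex_space \<Rightarrow> complex ^ 'm"
  assumes S: "open S" and f: "holo_on f S"
  shows "holo_on (\<lambda>x. frechet_derivative f (at x) v) S"
proof (rule holo_on_vecI)
  fix i
  have "holo_on (cderiv (\<lambda>x. f x $ i) v) S"
    by (intro holo_on_cderiv[OF S] holo_on_vec_nth f)
  then show "holo_on (\<lambda>x. frechet_derivative f (at x) v $ i) S"
  proof (rule holo_on_cong[OF S, rotated])
    fix x assume x: "x \<in> S"
    have "((\<lambda>x. f x $ i) has_derivative (\<lambda>v. frechet_derivative f (at x) v $ i)) (at x)"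
      using holo_on_frechet(1)[OF f x] has_derivative_vec_nth_iff by blast
    from has_derivative_cderiv_eq[OF this clinear_compose[OF holo_on_frechet(2)[OF f x] clinear_vec_nth]]
    show "cderiv (\<lambda>x. f x $ i) v x = frechet_derivative f (at x) v $ i" .
  qed
qed

lemma linear_inv_of_inj:
  fixes f :: "'a::euclidean_space \<Rightarrow> 'a"
  assumes "linear f" "inj f"
  shows "bij f" "linear (inv f)"
proof -
  show b: "bij f" using assms linear_injective_imp_surjective by (auto simp: bij_def)
  show "linear (inv f)"
  proof (rule linearI)
    fix x y and r :: real
    have f: "f (inv f z) = z" for z by (rule surj_f_inv_f[OF bij_is_surj[OF b]])
    have "f (inv f x + inv f y) = x + y" by (simp add: linear_add[OF assms(1)] f)
    then show "inv f (x + y) = inv f x + inv f y" using inv_f_eq[OF assms(2)] by blast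
    have "f (r *\<^sub>R inv f x) = r *\<^sub>R x" by (simp add: linear_scale[OF assms(1)] f)
    then show "inv f (r *\<^sub>R x) = r *\<^sub>R inv f x" using inv_f_eq[OF assms(2)] by blast
  qed
qed

text \<open>
  The derivative of the inverse is recorded at every point, so that holomorphy of the inverse can be
  read off.
\<close>

theorem C1_local_inverse:
  fixes f :: "'a::euclidean_space \<Rightarrow> 'a"
  assumes S: "open S" "x0 \<in> S"
    and f': "\<And>x. x \<in> S \<Longrightarrow> (f has_derivative f' x) (at x)"
    and cont: "\<And>v. continuous_on S (\<lambda>x. f' x v)"
    and inj: "\<And>v. f' x0 v = 0 \<Longrightarrow> v = 0"
  obtains U V g where "open U" "x0 \<in> U" "U \<subseteq> S" "open V" "f x0 \<in> V" "homeomorphism U V f g"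
    "\<And>y. y \<in> V \<Longrightarrow> (g has_derivative inv (f' (g y))) (at y)"
    "\<And>y. y \<in> V \<Longrightarrow> bij (f' (g y))"
proof -
  have L: "linear (f' x)" if "x \<in> S" for x using f'[OF that] has_derivative_linear by blast
  define F where "F x = Blinfun (f' x)" for x
  have F: "blinfun_apply (F x) = f' x" if "x \<in> S" for x
    unfolding F_def using L[OF that]
    by (intro bounded_linear_Blinfun_apply) (simp add: linear_conv_bounded_linear)
  have inj0: "inj (f' x0)"
    using inj linear_injective_0[OF L[OF S(2)]] by blast
  note inv0 = linear_inv_of_inj[OF L[OF S(2)] inj0]
  define G where "G = Blinfun (inv (f' x0))"
  have G: "blinfun_apply G = inv (f' x0)"
    unfolding G_def using inv0(2)
    by (intro bounded_linear_Blinfun_apply) (simp add: linear_conv_bounded_linear)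
  have "continuous_on S F"
  proof (rule continuous_on_blinfun_componentwise)
    fix i :: 'a
    show "continuous_on S (\<lambda>x. blinfun_apply (F x) i)"
      by (rule continuous_on_eq[OF cont[of i]]) (simp add: F)
  qed
  note cF = this
  have GF: "G o\<^sub>L F x0 = id_blinfun"
    by (rule blinfun_eqI) (simp add: G F[OF S(2)] inv_f_f[OF inj0])
  have dF: "(f has_derivative blinfun_apply (F x)) (at x)" if "x \<in> S" for x
    using f'[OF that] F[OF that] by simp
  obtain U V g g' where *: "open U" "U \<subseteq> S" "x0 \<in> U" "open V" "f x0 \<in> V" "homeomorphism U V f g"
    "\<And>y. y \<in> V \<Longrightarrow> (g has_derivative (g' y)) (at y)"
    "\<And>y. y \<in> V \<Longrightarrow> g' y = inv (blinfun_apply (F (g y)))"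
    "\<And>y. y \<in> V \<Longrightarrow> bij (blinfun_apply (F (g y)))"
    using inverse_function_theorem[OF S(1) dF cF S(2) GF] by metis
  have gS: "g y \<in> S" if "y \<in> V" for y
    using *(2,6) that unfolding homeomorphism_def by blast
  show ?thesis
  proof (rule that[OF *(1,3,2,4,5,6)])
    fix y assume y: "y \<in> V"
    show "(g has_derivative inv (f' (g y))) (at y)" using *(7,8)[OF y] F[OF gS[OF y]] by simp
    show "bij (f' (g y))" using *(9)[OF y] F[OF gS[OF y]] by simp
  qed
qed

lemma clinear_inv:
  fixes f :: "'a::complex_space \<Rightarrow> 'a"
  assumes f: "clinear f" "bij f"
  shows "clinear (inv f)"
  unfolding clinear_def
proof (intro conjI allI)
  show "linear (inv f)" by (rule linear_inv_of_inj(2)[OF clinearD(1)[OF f(1)] bij_is_inj[OF f(2)]])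
  fix c v
  have "f (c *\<^sub>C inv f v) = c *\<^sub>C v"
    by (simp add: clinearD(2)[OF f(1)] surj_f_inv_f[OF bij_is_surj[OF f(2)]])
  then show "inv f (c *\<^sub>C v) = c *\<^sub>C inv f v"
    using bij_inv_eq_iff[OF f(2)] by metis
qed

theorem holo_local_inverse:
  fixes f :: "'a::complex_space \<Rightarrow> 'a"
  assumes S: "open S" "x0 \<in> S" and f: "holo_on f S"
    and D: "(f has_derivative D) (at x0)" and inj: "\<And>v. D v = 0 \<Longrightarrow> v = 0"
  obtains U V g where "open U" "x0 \<in> U" "U \<subseteq> S" "open V" "f x0 \<in> V" "homeomorphism U V f g"
    "holo_on g V"
proof -
  obtain U V g where *: "open U" "x0 \<in> U" "U \<subseteq> S" "open V" "f x0 \<in> V" "homeomorphism U V f g"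
    "\<And>y. y \<in> V \<Longrightarrow> (g has_derivative inv (frechet_derivative f (at (g y)))) (at y)"
    "\<And>y. y \<in> V \<Longrightarrow> bij (frechet_derivative f (at (g y)))"
  proof (rule C1_local_inverse[OF S holo_on_frechet(1)[OF f] continuous_on_frechet_holo[OF S(1) f]])
    show "frechet_derivative f (at x0) v = 0 \<Longrightarrow> v = 0" for v
      using inj[of v] frechet_derivative_eq[OF D] by simp
  qed auto
  have gS: "g y \<in> S" if "y \<in> V" for y
    using *(3,6) that unfolding homeomorphism_def by blast
  have "holo_on g V"
    unfolding holo_on_def
  proof
    fix y assume y: "y \<in> V"
    show "\<exists>D. (g has_derivative D) (at y) \<and> clinear D"
      using *(7)[OF y] clinear_inv[OF holo_on_frechet(2)[OF f gS[OF y]] *(8)[OF y]] by blast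
  qed
  with * that show ?thesis by blast
qed

text \<open>
  Invert \<open>(x, y) \<mapsto> (x, F (x, y))\<close>; the solution is the second component of the preimage of
  \<open>(x, 0)\<close>.
\<close>

theorem holo_implicit_function:
  fixes F :: "'a::complex_space \<times> 'b::complex_space \<Rightarrow> 'b"
  assumes S: "open S" "(x0, y0) \<in> S" and F: "holo_on F S" and F0: "F (x0, y0) = 0"
    and D: "(F has_derivative D) (at (x0, y0))" and inj: "\<And>v. D (0, v) = 0 \<Longrightarrow> v = 0"
  obtains A B Y where "open A" "x0 \<in> A" "open B" "y0 \<in> B" "A \<times> B \<subseteq> S" "holo_on Y A" "Y ` A \<subseteq> B"
    "\<And>x y. x \<in> A \<Longrightarrow> y \<in> B \<Longrightarrow> F (x, y) = 0 \<longleftrightarrow> y = Y x"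
proof -
  define G where "G z = (fst z, F z)" for z
  have G: "holo_on G S" unfolding G_def
    by (intro holo_on_Pair F holo_on_fst holo_on_id)
  have GD: "(G has_derivative (\<lambda>h. (fst h, D h))) (at (x0, y0))"
    unfolding G_def by (intro has_derivative_Pair D has_derivative_fst has_derivative_ident)
  have "h = 0" if "(fst h, D h) = 0" for h
    using that inj[of "snd h"] by (cases h) (auto simp: zero_prod_def)
  then obtain U V g where *: "open U" "(x0, y0) \<in> U" "U \<subseteq> S" "open V" "G (x0, y0) \<in> V" "homeomorphism U V G g"
    "holo_on g V"
    using holo_local_inverse[OF S G GD] by blast
  have gG: "g (G z) = z" if "z \<in> U" for z using *(6) that by (auto simp: homeomorphism_def)
  have Gg: "G (g w) = w" if "w \<in> V" for w using *(6) that by (auto simp: homeomorphism_def)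
  obtain A0 B where AB: "open A0" "x0 \<in> A0" "open B" "y0 \<in> B" "A0 \<times> B \<subseteq> U"
    using *(1,2) open_prod_elim by (metis mem_Sigma_iff)
  define A where "A = A0 \<inter> (\<lambda>x. (x, 0)) -` (V \<inter> g -` (A0 \<times> B))"
  have "open (V \<inter> g -` (A0 \<times> B))"
    by (rule continuous_open_preimage[OF holo_on_imp_continuous_on[OF *(7)] *(4)])
       (use AB in \<open>auto intro: open_Times\<close>)
  then have "open ((\<lambda>x. (x, 0)) -` (V \<inter> g -` (A0 \<times> B)))"
    by (rule open_vimage) (intro continuous_intros)
  then have "open A" unfolding A_def by (rule open_Int[OF AB(1)])
  have "x0 \<in> A"
    unfolding A_def using AB gG[OF *(2)] *(5) by (auto simp: G_def F0)
  define Y where "Y x = snd (g (x, 0))" for x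
  show ?thesis
  proof (rule that[OF \<open>open A\<close> \<open>x0 \<in> A\<close> AB(3,4)])
    show "A \<times> B \<subseteq> S" using AB(5) *(3) by (auto simp: A_def)
    have "holo_on (\<lambda>x. g (x, 0)) A"
      by (rule holo_on_compose[OF holo_on_Pair[OF holo_on_id holo_on_const] *(7)]) (auto simp: A_def)
    then show "holo_on Y A" unfolding Y_def by (rule holo_on_snd)
    show "Y ` A \<subseteq> B" by (auto simp: Y_def A_def)
    fix x y assume x: "x \<in> A" and y: "y \<in> B"
    have V: "(x, 0) \<in> V" using x by (simp add: A_def)
    have "fst (g (x, 0)) = x" "F (g (x, 0)) = 0" using Gg[OF V] by (simp_all add: G_def)
    then have 1: "F (x, Y x) = 0" by (metis Y_def prod.collapse)
    have "y = Y x" if "F (x, y) = 0"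
    proof -
      have "(x, y) \<in> U" using x y AB(5) by (auto simp: A_def)
      from gG[OF this] that show ?thesis by (simp add: G_def Y_def)
    qed
    with 1 show "F (x, y) = 0 \<longleftrightarrow> y = Y x" by blast
  qed
qed

lemma holo_identity_convex:
  fixes f :: "'a::complex_space \<Rightarrow> complex"
  assumes S: "open S" "convex S" and f: "holo_on f S"
    and T: "open T" "T \<subseteq> S" "z0 \<in> T" "\<And>x. x \<in> T \<Longrightarrow> f x = 0" and y: "y \<in> S"
  shows "f y = 0"
proof -
  define A where "A = {\<zeta>. z0 + \<zeta> *\<^sub>C (y - z0) \<in> S}"
  have "open A" unfolding A_def by (rule open_line[OF S(1)])
  have "convex A"
  proof (rule convexI)
    fix a b :: complex and s t :: real
    assume ab: "a \<in> A" "b \<in> A" and st: "0 \<le> s" "0 \<le> t" "s + t = 1"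
    have "s *\<^sub>R (z0 + a *\<^sub>C (y - z0)) + t *\<^sub>R (z0 + b *\<^sub>C (y - z0)) \<in> S"
      using ab st S(2) by (auto simp: A_def convex_def)
    also have "s *\<^sub>R (z0 + a *\<^sub>C (y - z0)) + t *\<^sub>R (z0 + b *\<^sub>C (y - z0))
      = (s + t) *\<^sub>R z0 + (s *\<^sub>R a + t *\<^sub>R b) *\<^sub>C (y - z0)"
      by (simp add: scaleC_add_left scaleR_add_right scaleR_add_left scaleC.scaleR_left)
    finally show "s *\<^sub>R a + t *\<^sub>R b \<in> A" using st by (simp add: A_def)
  qed
  define B where "B = {\<zeta>. z0 + \<zeta> *\<^sub>C (y - z0) \<in> T}"
  have B: "open B" "B \<subseteq> A" "0 \<in> B" unfolding A_def B_def using open_line[OF T(1)] T by auto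
  have "f (z0 + 1 *\<^sub>C (y - z0)) = 0"
  proof (rule analytic_continuation_open[where f = "\<lambda>\<zeta>. f (z0 + \<zeta> *\<^sub>C (y - z0))" and g = "\<lambda>_. 0", OF \<open>open B\<close> \<open>open A\<close> _ convex_connected[OF \<open>convex A\<close>] \<open>B \<subseteq> A\<close>])
    show "B \<noteq> {}" using B by blast
    show "(\<lambda>\<zeta>. f (z0 + \<zeta> *\<^sub>C (y - z0))) holomorphic_on A"
      by (rule line_holo_holomorphic_on[OF holo_on_imp_line_holo[OF f]]) (auto simp: A_def)
    show "1 \<in> A" using y by (simp add: A_def)
  qed (use T in \<open>auto simp: B_def\<close>)
  then show ?thesis by simp
qed

text \<open>
  On a convex set the statement is the one-variable identity theorem on complex lines; the set of points
  near which \<open>f\<close> and \<open>g\<close> agree is therefore open and closed in \<open>S\<close>.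
\<close>

theorem holo_identity:
  fixes f g :: "'a::complex_space \<Rightarrow> 'b::complex_space"
  assumes S: "open S" "connected S" and f: "holo_on f S" and g: "holo_on g S"
    and T: "open T" "T \<subseteq> S" "T \<noteq> {}" "\<And>x. x \<in> T \<Longrightarrow> f x = g x" and y: "y \<in> S"
  shows "f y = g y"
proof -
  define Z where "Z = interior {x \<in> S. f x = g x}"
  have ZS: "Z \<subseteq> {x \<in> S. f x = g x}" unfolding Z_def by (rule interior_subset)
  have oZ: "open Z" unfolding Z_def by simp
  have "T \<subseteq> Z" unfolding Z_def using T by (intro interior_maximal) auto
  have "closedin (top_of_set S) Z"
    unfolding closedin_limpt
  proof (intro conjI allI impI)
    show "Z \<subseteq> S" using ZS by blast
    fix x assume x: "x islimpt Z \<and> x \<in> S"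
    obtain e where e: "e > 0" "ball x e \<subseteq> S" using S(1) x open_contains_ball by blast
    obtain z where z: "z \<in> Z" "z \<in> ball x e"
      using x e(1) by (meson Int_iff centre_in_ball islimpt_def open_ball)
    have "f w = g w" if w: "w \<in> ball x e" for w
    proof -
      have "ccoord b (f w - g w) = 0" for b
      proof (rule holo_identity_convex[where f = "\<lambda>w. ccoord b (f w - g w)" and S = "ball x e" and T = "Z \<inter> ball x e"])
        show "holo_on (\<lambda>w. ccoord b (f w - g w)) (ball x e)"
          by (intro holo_on_ccoord holo_on_diff holo_on_subset[OF f] holo_on_subset[OF g] e)
        show "\<And>x'. x' \<in> Z \<inter> ball x e \<Longrightarrow> ccoord b (f x' - g x') = 0"
          using ZS linear_0[OF clinearD(1)[OF clinear_ccoord[of b]]] by auto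
        show "z \<in> Z \<inter> ball x e" using z by simp
      qed (use oZ w in auto)
      then show ?thesis using ccoord_zero_imp_zero[of "f w - g w"] by simp
    qed
    then have "ball x e \<subseteq> Z" unfolding Z_def using e(2) by (intro interior_maximal) auto
    then show "x \<in> Z" using e(1) by auto
  qed
  moreover have "openin (top_of_set S) Z" using oZ ZS by (auto simp: openin_open)
  ultimately have "Z = S"
    using S(2) T(3) \<open>T \<subseteq> Z\<close> by (metis connected_clopen subset_empty)
  then show ?thesis using ZS y by blast
qed

section \<open>Polarization of real-analytic functions\<close>

definition cnjv :: "complex ^ 'n \<Rightarrow> complex ^ 'n" where
  "cnjv x = (\<chi> j. cnj (x $ j))"

lemma cnjv_nth [simp]: "cnjv x $ j = cnj (x $ j)"
  by (simp add: cnjv_def)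

lemma cnjv_cnjv [simp]: "cnjv (cnjv x) = x"
  by (simp add: vec_eq_iff)

lemma linear_cnjv: "linear cnjv"
  by (rule linearI) (simp_all add: vec_eq_iff)

lemma bounded_linear_cnjv: "bounded_linear cnjv"
  using linear_cnjv linear_conv_bounded_linear by blast

lemmas cnjv_simps = linear_add[OF linear_cnjv] linear_diff[OF linear_cnjv] linear_0[OF linear_cnjv]
  linear_neg[OF linear_cnjv] linear_scale[OF linear_cnjv]

lemma cnjv_scaleC [simp]: "cnjv (c *\<^sub>C x) = cnj c *\<^sub>C cnjv x"
  by (simp add: vec_eq_iff)

lemma continuous_on_cnjv [continuous_intros]:
  "continuous_on S f \<Longrightarrow> continuous_on S (\<lambda>x. cnjv (f x))"
  using bounded_linear.continuous_on[OF bounded_linear_cnjv] .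

text \<open>
  The real coordinate of \<open>x\<close> along \<open>b\<close> with the conjugate of \<open>x\<close> treated as an independent
  variable.
\<close>

definition polar_coord :: "complex ^ 'n \<Rightarrow> (complex ^ 'n) \<times> (complex ^ 'n) \<Rightarrow> complex" where
  "polar_coord b p = (\<Sum>j\<in>UNIV. cnj (b $ j) * fst p $ j + b $ j * snd p $ j) / 2"

lemma clinear_polar_coord: "clinear (polar_coord b)"
  unfolding clinear_def linear_iff polar_coord_def
  by (auto simp: algebra_simps sum.distrib sum_distrib_left sum_divide_distrib
      scaleR_conv_of_real[where 'a = complex] add_divide_distrib)

lemma polar_coord_cnjv: "polar_coord b (x, cnjv x) = of_real (x \<bullet> b)"
proof -
  have "cnj (b $ j) * x $ j + b $ j * cnj (x $ j) = of_real (2 * (x $ j \<bullet> b $ j))" for j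
    by (auto simp: complex_eq_iff inner_complex_def)
  then have "(\<Sum>j\<in>UNIV. cnj (b $ j) * x $ j + b $ j * cnj (x $ j)) = of_real (2 * (x \<bullet> b))"
    by (simp add: inner_vec_def sum_distrib_left)
  then show ?thesis by (simp add: polar_coord_def)
qed

text \<open>
  Substitute complex values for the real coordinates in the power series of \<open>u\<close>.  Convergence at the
  single real point \<open>a + s (1, \<dots>, 1)\<close> bounds the terms of the complexified series on a polydisc of radius
  \<open>s\<close>, so that its partial sums, which are polynomials, converge uniformly there.
\<close>

theorem real_analytic_polarization:
  fixes u :: "complex ^ 'n \<Rightarrow> real"
  assumes "real_analytic_on u S" "a \<in> S"
  obtains N and R :: "(complex ^ 'n) \<times> (complex ^ 'n) \<Rightarrow> complex"
  where "open N" "(a, cnjv a) \<in> N" "holo_on R N"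
    "\<And>x. (x, cnjv x) \<in> N \<Longrightarrow> R (x, cnjv x) = of_real (u x)"
proof -
  define I where "I = {\<alpha> :: complex ^ 'n \<Rightarrow> nat. \<forall>b. b \<notin> Basis \<longrightarrow> \<alpha> b = 0}"
  obtain c r where r: "r > 0" and hs: "\<And>x. x \<in> ball a r \<Longrightarrow>
      ((\<lambda>\<alpha>. (\<Prod>b\<in>Basis. ((x - a) \<bullet> b) ^ \<alpha> b) *\<^sub>R c \<alpha>) has_sum u x) I"
    using assms unfolding real_analytic_on_def I_def by blast
  define s where "s = r / (2 * real DIM(complex ^ 'n))"
  have s: "s > 0" unfolding s_def using r by simp
  define x1 where "x1 = a + s *\<^sub>R (\<Sum>b\<in>Basis. b)"
  have "norm (x1 - a) = s * norm (\<Sum>b\<in>Basis. b :: complex ^ 'n)"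
    unfolding x1_def using s by simp
  also have "\<dots> \<le> s * real DIM(complex ^ 'n)"
  proof (rule mult_left_mono)
    have "norm (\<Sum>b\<in>Basis. b :: complex ^ 'n) \<le> (\<Sum>b\<in>(Basis::(complex^'n) set). 1)"
      by (rule sum_norm_le) simp
    then show "norm (\<Sum>b\<in>Basis. b :: complex ^ 'n) \<le> real DIM(complex ^ 'n)" by simp
  qed (use s in simp)
  also have "\<dots> = r / 2" unfolding s_def by simp
  finally have "x1 \<in> ball a r" using r by (simp add: dist_norm norm_minus_commute)
  have x1b: "(x1 - a) \<bullet> b = s" if "b \<in> Basis" for b
    using inner_sum_left_Basis[OF that, of "\<lambda>_. s"] unfolding x1_def scaleR_sum_right by simp
  define M where "M \<alpha> = (\<Prod>b\<in>(Basis::(complex^'n) set). s ^ \<alpha> b) * \<bar>c \<alpha>\<bar>" for \<alpha>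
  have "(\<lambda>\<alpha>. (\<Prod>b\<in>Basis. ((x1 - a) \<bullet> b) ^ \<alpha> b) *\<^sub>R c \<alpha>) summable_on I"
    using hs[OF \<open>x1 \<in> ball a r\<close>] by (auto simp: summable_on_def)
  then have "(\<lambda>\<alpha>. norm ((\<Prod>b\<in>Basis. ((x1 - a) \<bullet> b) ^ \<alpha> b) *\<^sub>R c \<alpha>)) summable_on I"
    by (rule summable_on_iff_abs_summable_on_real[THEN iffD1])
  moreover have "norm ((\<Prod>b\<in>Basis. ((x1 - a) \<bullet> b) ^ \<alpha> b) *\<^sub>R c \<alpha>) = M \<alpha>" for \<alpha>
  proof -
    have "(\<Prod>b\<in>Basis. ((x1 - a) \<bullet> b) ^ \<alpha> b) = (\<Prod>b\<in>(Basis::(complex^'n) set). s ^ \<alpha> b)"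
      by (rule prod.cong[OF refl]) (simp only: x1b)
    moreover have "(\<Prod>b\<in>(Basis::(complex^'n) set). s ^ \<alpha> b) \<ge> 0"
      by (rule prod_nonneg) (use s in simp)
    ultimately show ?thesis unfolding M_def by (simp only: real_norm_def real_scaleR_def abs_mult abs_of_nonneg)
  qed
  ultimately have M: "M summable_on I" by (simp only:)
  let ?a = "(a, cnjv a)"
  define N where "N = {p. fst p \<in> ball a r} \<inter> (\<Inter>b\<in>Basis. {p. cmod (polar_coord b (p - ?a)) < s})"
  have contl: "continuous_on UNIV (\<lambda>p. polar_coord b (p - ?a))" for b :: "complex ^ 'n"
    by (intro holo_on_imp_continuous_on
        holo_on_compose[OF holo_on_diff[OF holo_on_id holo_on_const] holo_on_clinear[OF clinear_polar_coord, where S=UNIV]]) auto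
  have "open {p::(complex ^ 'n) \<times> (complex ^ 'n). fst p \<in> ball a r}"
    unfolding mem_ball by (intro open_Collect_less continuous_intros)
  moreover have "open {p. cmod (polar_coord b (p - ?a)) < s}" for b
    by (intro open_Collect_less continuous_on_norm contl continuous_on_const)
  ultimately have N: "open N" unfolding N_def by (intro open_Int open_INT) auto
  have pc0: "polar_coord b 0 = 0" for b :: "complex ^ 'n"
    using linear_0[OF clinearD(1)[OF clinear_polar_coord]] .
  have aN: "?a \<in> N" 
  proof -
    have "cmod (polar_coord b (?a - ?a)) < s" for b :: "complex ^ 'n"
      using s by (simp only: diff_self pc0 norm_zero)
    with r show ?thesis unfolding N_def by (simp only: Int_iff INT_iff mem_Collect_eq fst_conv centre_in_ball) blast
  qed
  define t where "t \<alpha> p = of_real (c \<alpha>) * (\<Prod>b\<in>Basis. polar_coord b (p - ?a) ^ \<alpha> b)" for \<alpha> p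
  define R where "R p = (\<Sum>\<^sub>\<infinity>\<alpha>\<in>I. t \<alpha> p)" for p
  have "norm (t \<alpha> p) \<le> M \<alpha>" if "p \<in> N" for \<alpha> p
  proof -
    have "(\<Prod>b\<in>(Basis::(complex^'n) set). cmod (polar_coord b (p - ?a)) ^ \<alpha> b) \<le> (\<Prod>b\<in>(Basis::(complex^'n) set). s ^ \<alpha> b)"
      using that by (intro prod_mono conjI power_mono) (auto simp: N_def less_imp_le)
    then have "\<bar>c \<alpha>\<bar> * (\<Prod>b\<in>Basis. cmod (polar_coord b (p - ?a)) ^ \<alpha> b) \<le> \<bar>c \<alpha>\<bar> * (\<Prod>b\<in>(Basis::(complex^'n) set). s ^ \<alpha> b)"
      by (rule mult_left_mono) simp
    moreover have "norm (t \<alpha> p) = \<bar>c \<alpha>\<bar> * (\<Prod>b\<in>Basis. cmod (polar_coord b (p - ?a)) ^ \<alpha> b)"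
      unfolding t_def norm_mult prod_norm[symmetric] norm_power norm_of_real real_norm_def ..
    ultimately show ?thesis by (simp only: M_def mult.commute)
  qed
  then have lim: "uniform_limit N (\<lambda>X p. \<Sum>\<alpha>\<in>X. t \<alpha> p) R (finite_subsets_at_top I)"
    unfolding R_def using M by (intro Weierstrass_m_test_general)
  have "holo_on (\<lambda>p. \<Sum>\<alpha>\<in>X. t \<alpha> p) N" for X
  proof (rule holo_on_sum)
    fix \<alpha>
    have "holo_on (\<lambda>p. \<Prod>b\<in>Basis. polar_coord b (p - ?a) ^ \<alpha> b) N"
      by (intro holo_on_prod holo_on_power
        holo_on_compose[OF holo_on_diff[OF holo_on_id holo_on_const] holo_on_clinear[OF clinear_polar_coord, where S=UNIV]]) auto
    from holo_on_scaleC[OF this, of "of_real (c \<alpha>)"] show "holo_on (t \<alpha>) N"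
      by (simp add: t_def[abs_def])
  qed
  from holo_on_uniform_limit[OF N finite_subsets_at_top_neq_bot this lim] have RN: "holo_on R N" .
  have Rv: "R (x, cnjv x) = of_real (u x)" if "(x, cnjv x) \<in> N" for x
  proof -
    have "t \<alpha> (x, cnjv x) = of_real ((\<Prod>b\<in>Basis. ((x - a) \<bullet> b) ^ \<alpha> b) *\<^sub>R c \<alpha>)" for \<alpha>
    proof -
      have "(x, cnjv x) - ?a = (x - a, cnjv (x - a))" by (simp add: linear_diff[OF linear_cnjv])
      then show ?thesis
        unfolding t_def by (simp only: polar_coord_cnjv of_real_mult of_real_prod of_real_power real_scaleR_def mult.commute)
    qed
    moreover have "((\<lambda>\<alpha>. of_real ((\<Prod>b\<in>Basis. ((x - a) \<bullet> b) ^ \<alpha> b) *\<^sub>R c \<alpha>) :: complex) has_sum of_real (u x)) I"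
    proof (rule has_sum_of_real[OF hs])
      show "x \<in> ball a r" using that unfolding N_def by (simp only: Int_iff mem_Collect_eq fst_conv)
    qed
    ultimately show ?thesis unfolding R_def by (simp only: infsumI)
  qed
  show ?thesis by (rule that[OF N aN RN Rv])
qed

lemma real_analytic_on_bounded_linear:
  assumes "real_analytic_on f S" "bounded_linear L"
  shows "real_analytic_on (\<lambda>x. L (f x)) S"
  unfolding real_analytic_on_def
proof
  interpret bounded_linear L by fact
  fix a assume "a \<in> S"
  then obtain c r where "r > 0" and hs: "\<And>x. x \<in> ball a r \<Longrightarrow>
      ((\<lambda>\<alpha>. (\<Prod>b\<in>Basis. ((x - a) \<bullet> b) ^ \<alpha> b) *\<^sub>R c \<alpha>) has_sum f x) {\<alpha>. \<forall>b. b \<notin> Basis \<longrightarrow> \<alpha> b = 0}"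
    using assms(1) unfolding real_analytic_on_def by blast
  have "((\<lambda>\<alpha>. (\<Prod>b\<in>Basis. ((x - a) \<bullet> b) ^ \<alpha> b) *\<^sub>R L (c \<alpha>)) has_sum L (f x)) {\<alpha>. \<forall>b. b \<notin> Basis \<longrightarrow> \<alpha> b = 0}"
    if "x \<in> ball a r" for x
    using has_sum_bounded_linear[OF assms(2) hs[OF that]] by (simp only: scaleR o_def)
  with \<open>r > 0\<close> show "\<exists>c r. r > 0 \<and> (\<forall>x\<in>ball a r. ((\<lambda>\<alpha>. (\<Prod>b\<in>Basis. ((x - a) \<bullet> b) ^ \<alpha> b) *\<^sub>R c \<alpha>)
       has_sum L (f x)) {\<alpha>. \<forall>b. b \<notin> Basis \<longrightarrow> \<alpha> b = 0})"
    by (intro exI[of _ "\<lambda>\<alpha>. L (c \<alpha>)"] exI[of _ r]) auto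
qed

section \<open>Holomorphic maps are real analytic\<close>

definition multi_indices :: "'i set \<Rightarrow> ('i \<Rightarrow> nat) set" where
  "multi_indices I = {\<alpha>. \<forall>i. i \<notin> I \<longrightarrow> \<alpha> i = 0}"

lemma multi_indices_empty: "multi_indices {} = {\<lambda>_. 0}"
  by (auto simp: multi_indices_def)

lemma has_sum_multi_indices_insert:
  assumes "i \<notin> I"
  shows "(f has_sum s) (multi_indices (insert i I)) \<longleftrightarrow>
     ((\<lambda>(k, \<beta>). f (\<beta>(i := k))) has_sum s) (UNIV \<times> multi_indices I)"
proof (rule has_sum_reindex_bij_witness[where i = "\<lambda>(k, \<beta>). \<beta>(i := k)" and j = "\<lambda>\<alpha>. (\<alpha> i, \<alpha>(i := 0))"])
  fix b :: "nat \<times> ('a \<Rightarrow> nat)" assume "b \<in> UNIV \<times> multi_indices I"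
  then show "(\<lambda>\<alpha>. (\<alpha> i, \<alpha>(i := 0))) ((\<lambda>(k, \<beta>). \<beta>(i := k)) b) = b"
    using assms by (cases b) (auto simp: multi_indices_def)
qed (auto simp: multi_indices_def)

lemma prod_insert_update:
  assumes "i \<notin> I" "finite I"
  shows "(\<Prod>j\<in>insert i I. g j ((\<beta>(i := k)) j)) = g i k * (\<Prod>j\<in>I. g j (\<beta> j))"
proof -
  have "(\<Prod>j\<in>I. g j ((\<beta>(i := k)) j)) = (\<Prod>j\<in>I. g j (\<beta> j))"
    using assms(1) by (intro prod.cong) auto
  then show ?thesis using assms by simp
qed

lemma has_sum_multi_geometric:
  fixes q :: "'i \<Rightarrow> real"
  assumes "finite I" "\<And>i. i \<in> I \<Longrightarrow> 0 \<le> q i \<and> q i < 1"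
  shows "((\<lambda>\<alpha>. \<Prod>i\<in>I. q i ^ \<alpha> i) has_sum (\<Prod>i\<in>I. 1 / (1 - q i))) (multi_indices I)"
  using assms
proof (induction I rule: finite_induct)
  case empty
  show ?case by (rule has_sum_finiteI) (simp_all add: multi_indices_empty)
next
  case (insert i I)
  let ?P = "\<lambda>\<beta>. \<Prod>j\<in>I. q j ^ \<beta> j" and ?S = "\<Prod>j\<in>I. 1 / (1 - q j)"
  have IH: "(?P has_sum ?S) (multi_indices I)" using insert by simp
  have qi: "0 \<le> q i" "q i < 1" using insert.prems by auto
  have "((\<lambda>k. q i ^ k) has_sum (1 / (1 - q i))) UNIV"
    by (rule norm_summable_imp_has_sum) (use qi in \<open>auto intro!: geometric_sums summable_geometric simp: norm_power\<close>)
  then have g: "((\<lambda>k. q i ^ k * ?S) has_sum (1 / (1 - q i) * ?S)) UNIV"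
    by (rule has_sum_cmult_left)
  have f: "((\<lambda>\<beta>. case (k, \<beta>) of (k, \<beta>) \<Rightarrow> q i ^ k * ?P \<beta>) has_sum (q i ^ k * ?S)) (multi_indices I)" for k
    unfolding prod.case by (rule has_sum_cmult_right[OF IH])
  have nn: "0 \<le> ?P \<beta>" for \<beta> using insert.prems by (intro prod_nonneg) auto
  have "((\<lambda>(k, \<beta>). q i ^ k * ?P \<beta>) has_sum (1 / (1 - q i) * ?S)) (UNIV \<times> multi_indices I)"
  proof (rule has_sum_SigmaI[OF f g])
    show "(\<lambda>(k, \<beta>). q i ^ k * ?P \<beta>) summable_on UNIV \<times> multi_indices I"
    proof (rule summable_on_SigmaI[OF f])
      show "(\<lambda>k. q i ^ k * ?S) summable_on UNIV" using g summable_on_def by blast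
      show "0 \<le> (case (k, \<beta>) of (k, \<beta>) \<Rightarrow> q i ^ k * ?P \<beta>)" for k \<beta> using nn[of \<beta>] qi by simp
    qed
  qed
  moreover have "(\<Prod>j\<in>insert i I. q j ^ ((\<beta>(i := k)) j)) = q i ^ k * ?P \<beta>" for k \<beta>
    by (rule prod_insert_update[OF insert.hyps(2,1)])
  moreover have "(\<Prod>j\<in>insert i I. 1 / (1 - q j)) = 1 / (1 - q i) * ?S"
    using insert.hyps by simp
  ultimately show ?case
    unfolding has_sum_multi_indices_insert[OF insert.hyps(2)] by (simp only: case_prod_beta)
qed

lemma holomorphic_power_series_coeffs:
  assumes r: "r > 0" and cont: "continuous_on (cball 0 r) g" and hol: "g holomorphic_on ball 0 r"
    and z: "cmod z < r"
  shows "((\<lambda>k. integral {0..1} (\<lambda>t. g (of_real r * unit_circle t) / (of_real r * unit_circle t) ^ k) * z ^ k)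
           has_sum g z) UNIV"
proof -
  let ?c = "\<lambda>k. integral {0..1} (\<lambda>t. g (of_real r * unit_circle t) / (of_real r * unit_circle t) ^ k)"
  have c: "?c k = (deriv ^^ k) g 0 / fact k" for k
  proof -
    have "contour_integral (circlepath 0 r) (\<lambda>u. g u / (u - 0) ^ Suc k) = (2 * pi * \<i>) / fact k * (deriv ^^ k) g 0"
      using Cauchy_has_contour_integral_higher_derivative_circlepath[OF cont hol, of 0 k] r
      by (intro contour_integral_unique) simp
    moreover have "contour_integral (circlepath 0 r) (\<lambda>u. g u / (u - 0) ^ Suc k) =
       integral {0..1} (\<lambda>t. (2 * pi * \<i>) * (g (of_real r * unit_circle t) / (of_real r * unit_circle t) ^ k))"
      unfolding contour_integral_circlepath_unit using r
      by (intro integral_cong) (simp add: field_simps)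
    moreover have "\<dots> = (2 * pi * \<i>) * ?c k" by (rule integral_mult_right)
    ultimately have "(2 * pi * \<i>) * ?c k = (2 * pi * \<i>) * ((deriv ^^ k) g 0 / fact k)" by simp
    then show ?thesis by (subst (asm) mult_cancel_left) simp
  qed
  have S: "(\<lambda>k. ?c k * w ^ k) sums g w" if "cmod w < r" for w
    using holomorphic_power_series[OF hol, of w] that by (simp add: c)
  define w where "w = complex_of_real ((cmod z + r) / 2)"
  have "cmod w = (cmod z + r) / 2"
    unfolding w_def norm_of_real by (rule abs_of_nonneg) (use r in simp)
  then have w: "cmod w < r" "cmod z < cmod w" using z by auto
  have "summable (\<lambda>k. norm (?c k * z ^ k))"
    by (rule powser_insidea[OF sums_summable[OF S[OF w(1)]] w(2)])
  then show ?thesis by (rule norm_summable_imp_has_sum[OF _ S[OF z]])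
qed

text \<open>
  Induction on the number of variables: expand in one variable; the coefficients are Cauchy
  integrals, hence holomorphic in the remaining variables with the bound predicted by Cauchy's
  estimate.  The bound is part of the statement because it gives the absolute convergence that is
  needed to combine the two sums.
\<close>

lemma holo_polydisc_expansion:
  fixes v :: "'i \<Rightarrow> 'a::complex_space"
  assumes "finite I" "\<delta> > 0"
    and "open S" "holo_on h S"
    and "\<And>z. (\<And>i. i \<in> I \<Longrightarrow> cmod (z i) \<le> \<delta>) \<Longrightarrow> a + (\<Sum>i\<in>I. z i *\<^sub>C v i) \<in> S"
    and "\<And>z. (\<And>i. i \<in> I \<Longrightarrow> cmod (z i) \<le> \<delta>) \<Longrightarrow> cmod (h (a + (\<Sum>i\<in>I. z i *\<^sub>C v i))) \<le> M"
  shows "\<exists>c. (\<forall>\<alpha>\<in>multi_indices I. cmod (c \<alpha>) * (\<Prod>i\<in>I. \<delta> ^ \<alpha> i) \<le> M) \<and>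
     (\<forall>z. (\<forall>i\<in>I. cmod (z i) < \<delta>) \<longrightarrow>
       ((\<lambda>\<alpha>. c \<alpha> * (\<Prod>i\<in>I. z i ^ \<alpha> i)) has_sum h (a + (\<Sum>i\<in>I. z i *\<^sub>C v i))) (multi_indices I))"
  using assms
proof (induction I arbitrary: h S M rule: finite_induct)
  case empty
  have "cmod (h a) \<le> M" using empty.prems(5)[of "\<lambda>_. 0"] by simp
  moreover have "((\<lambda>\<alpha>. h a) has_sum h a) (multi_indices ({} :: 'i set))"
    by (rule has_sum_finiteI) (simp_all add: multi_indices_empty)
  ultimately show ?case by (intro exI[of _ "\<lambda>_. h a"]) simp
next
  case (insert i I h S M)
  note \<delta> = insert.prems(1) and S = insert.prems(2) and h = insert.prems(3)
  let ?E = "\<lambda>t. of_real \<delta> * unit_circle t"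
  define S' where "S' = {x. \<forall>\<zeta>. cmod \<zeta> \<le> \<delta> \<longrightarrow> x + \<zeta> *\<^sub>C v i \<in> S}"
  have "open S'"
    unfolding open_contains_ball
  proof
    fix x assume x: "x \<in> S'"
    have "compact ((\<lambda>\<zeta>. x + \<zeta> *\<^sub>C v i) ` cball 0 \<delta>)"
      by (intro compact_continuous_image continuous_intros compact_cball)
    moreover have "(\<lambda>\<zeta>. x + \<zeta> *\<^sub>C v i) ` cball 0 \<delta> \<subseteq> S" using x by (auto simp: S'_def)
    ultimately obtain e where e: "e > 0" "(\<Union>y\<in>(\<lambda>\<zeta>. x + \<zeta> *\<^sub>C v i) ` cball 0 \<delta>. ball y e) \<subseteq> S"
      using compact_subset_open_imp_ball_epsilon_subset[OF _ S] by blast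
    have "y \<in> S'" if "y \<in> ball x e" for y
      unfolding S'_def
    proof (intro CollectI allI impI)
      fix \<zeta> assume "cmod \<zeta> \<le> \<delta>"
      moreover have "y + \<zeta> *\<^sub>C v i \<in> ball (x + \<zeta> *\<^sub>C v i) e" using that by (simp add: dist_norm)
      ultimately show "y + \<zeta> *\<^sub>C v i \<in> S" using e(2) by (meson UN_subset_iff imageI mem_cball_0 subsetD)
    qed
    then show "\<exists>e>0. ball x e \<subseteq> S'" using e(1) by blast
  qed
  define H where "H k x = integral {0..1} (\<lambda>t. h (x + ?E t *\<^sub>C v i) / ?E t ^ k)" for k x
  have E: "cmod (?E t) = \<delta>" for t using \<delta> by (simp add: norm_mult)
  have contH: "continuous_on (S' \<times> {0..1}) (\<lambda>(x, t). h (x + ?E t *\<^sub>C v i) / ?E t ^ k)" for k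
    unfolding split_def
  proof (rule continuous_on_divide)
    show "continuous_on (S' \<times> {0..1}) (\<lambda>x. h (fst x + ?E (snd x) *\<^sub>C v i))"
      by (rule continuous_on_compose2[OF holo_on_imp_continuous_on[OF h]])
         (use E in \<open>auto intro!: continuous_intros simp: S'_def\<close>)
    show "\<forall>x\<in>S' \<times> {0..1}. ?E (snd x) ^ k \<noteq> 0" using \<delta> by simp
  qed (intro continuous_intros)
  have holH: "holo_on (H k) S'" for k
    unfolding H_def
  proof (rule holo_on_param_integral[OF \<open>open S'\<close> contH])
    fix t :: real
    have "holo_on (\<lambda>x. h (x + ?E t *\<^sub>C v i)) S'"
      by (rule holo_on_compose[OF holo_on_add[OF holo_on_id holo_on_const] h])
         (use E in \<open>auto simp: S'_def\<close>)
    from holo_on_scaleC[OF this, of "1 / ?E t ^ k"]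
    show "holo_on (\<lambda>x. h (x + ?E t *\<^sub>C v i) / ?E t ^ k) S'" by simp
  qed
  have split: "a + (\<Sum>j\<in>insert i I. (z(i := \<zeta>)) j *\<^sub>C v j) = (a + (\<Sum>j\<in>I. z j *\<^sub>C v j)) + \<zeta> *\<^sub>C v i" for z \<zeta>
  proof -
    have "(\<Sum>j\<in>I. (z(i := \<zeta>)) j *\<^sub>C v j) = (\<Sum>j\<in>I. z j *\<^sub>C v j)"
      using insert.hyps(2) by (intro sum.cong) auto
    then show ?thesis using insert.hyps by (simp add: algebra_simps)
  qed
  have inS: "(a + (\<Sum>j\<in>I. z j *\<^sub>C v j)) + \<zeta> *\<^sub>C v i \<in> S"
    and bd: "cmod (h ((a + (\<Sum>j\<in>I. z j *\<^sub>C v j)) + \<zeta> *\<^sub>C v i)) \<le> M"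
    if "\<And>j. j \<in> I \<Longrightarrow> cmod (z j) \<le> \<delta>" "cmod \<zeta> \<le> \<delta>" for z \<zeta>
  proof -
    have "cmod ((z(i := \<zeta>)) j) \<le> \<delta>" if "j \<in> insert i I" for j
      using that \<open>\<And>j. j \<in> I \<Longrightarrow> cmod (z j) \<le> \<delta>\<close> \<open>cmod \<zeta> \<le> \<delta>\<close> by auto
    from insert.prems(4,5)[of "z(i := \<zeta>)", OF this]
    show "(a + (\<Sum>j\<in>I. z j *\<^sub>C v j)) + \<zeta> *\<^sub>C v i \<in> S" "cmod (h ((a + (\<Sum>j\<in>I. z j *\<^sub>C v j)) + \<zeta> *\<^sub>C v i)) \<le> M"
      unfolding split by blast+
  qed
  have inS': "a + (\<Sum>j\<in>I. z j *\<^sub>C v j) \<in> S'" if "\<And>j. j \<in> I \<Longrightarrow> cmod (z j) \<le> \<delta>" for z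
    unfolding S'_def using inS[of z, OF that] by blast
  have Hbd: "cmod (H k (a + (\<Sum>j\<in>I. z j *\<^sub>C v j))) \<le> M / \<delta> ^ k" if z: "\<And>j. j \<in> I \<Longrightarrow> cmod (z j) \<le> \<delta>" for z k
  proof -
    let ?x = "a + (\<Sum>j\<in>I. z j *\<^sub>C v j)"
    have "cmod (H k ?x) \<le> M / \<delta> ^ k * (1 - 0)"
      unfolding H_def
    proof (rule integral_bound)
      show "continuous_on {0..1} (\<lambda>t. h (?x + ?E t *\<^sub>C v i) / ?E t ^ k)"
        by (rule continuous_on_compose_Pair[OF contH continuous_on_const continuous_on_id])
           (use inS'[of z, OF z] in auto)
      show "cmod (h (?x + ?E t *\<^sub>C v i) / ?E t ^ k) \<le> M / \<delta> ^ k" for t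
        using bd[of z, OF z, of "?E t"] E[of t] \<delta> by (simp add: norm_divide norm_power divide_right_mono)
    qed simp
    then show ?thesis by simp
  qed
  define Q where "Q k c \<longleftrightarrow> (\<forall>\<alpha>\<in>multi_indices I. cmod (c \<alpha>) * (\<Prod>i\<in>I. \<delta> ^ \<alpha> i) \<le> M / \<delta> ^ k) \<and>
     (\<forall>z. (\<forall>i\<in>I. cmod (z i) < \<delta>) \<longrightarrow>
       ((\<lambda>\<alpha>. c \<alpha> * (\<Prod>i\<in>I. z i ^ \<alpha> i)) has_sum H k (a + (\<Sum>i\<in>I. z i *\<^sub>C v i))) (multi_indices I))" for k c
  have "\<exists>c. (\<forall>\<alpha>\<in>multi_indices I. cmod (c \<alpha>) * (\<Prod>i\<in>I. \<delta> ^ \<alpha> i) \<le> M / \<delta> ^ k) \<and>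
     (\<forall>z. (\<forall>i\<in>I. cmod (z i) < \<delta>) \<longrightarrow>
       ((\<lambda>\<alpha>. c \<alpha> * (\<Prod>i\<in>I. z i ^ \<alpha> i)) has_sum H k (a + (\<Sum>i\<in>I. z i *\<^sub>C v i))) (multi_indices I))" for k
  proof (rule insert.IH[OF \<delta> \<open>open S'\<close> holH])
    fix z :: "'i \<Rightarrow> complex" assume z: "\<And>j. j \<in> I \<Longrightarrow> cmod (z j) \<le> \<delta>"
    show "a + (\<Sum>j\<in>I. z j *\<^sub>C v j) \<in> S'" by (rule inS'[of z, OF z])
    show "cmod (H k (a + (\<Sum>j\<in>I. z j *\<^sub>C v j))) \<le> M / \<delta> ^ k" by (rule Hbd[of z, OF z])
  qed
  then have "\<forall>k. \<exists>c. Q k c" unfolding Q_def by (rule allI)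
  then obtain c where "\<forall>k. Q k (c k)" using choice[of Q] by blast
  then have c: "(\<forall>\<alpha>\<in>multi_indices I. cmod (c k \<alpha>) * (\<Prod>i\<in>I. \<delta> ^ \<alpha> i) \<le> M / \<delta> ^ k) \<and>
     (\<forall>z. (\<forall>i\<in>I. cmod (z i) < \<delta>) \<longrightarrow>
       ((\<lambda>\<alpha>. c k \<alpha> * (\<Prod>i\<in>I. z i ^ \<alpha> i)) has_sum H k (a + (\<Sum>i\<in>I. z i *\<^sub>C v i))) (multi_indices I))" for k
    unfolding Q_def by blast
  have c1: "cmod (c k \<alpha>) * (\<Prod>i\<in>I. \<delta> ^ \<alpha> i) \<le> M / \<delta> ^ k" if "\<alpha> \<in> multi_indices I" for k \<alpha>
    using c[of k] that by blast
  have c2: "((\<lambda>\<alpha>. c k \<alpha> * (\<Prod>i\<in>I. z i ^ \<alpha> i)) has_sum H k (a + (\<Sum>i\<in>I. z i *\<^sub>C v i))) (multi_indices I)"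
    if "\<And>i. i \<in> I \<Longrightarrow> cmod (z i) < \<delta>" for k z
    using c[of k] that by blast
  define C where "C \<alpha> = c (\<alpha> i) (\<alpha>(i := 0))" for \<alpha>
  have Cupd: "C (\<beta>(i := k)) = c k \<beta>" if "\<beta> \<in> multi_indices I" for \<beta> k
    using that insert.hyps(2) unfolding C_def by (simp add: multi_indices_def fun_upd_idem)
  have Cbd: "cmod (C \<alpha>) * (\<Prod>j\<in>insert i I. \<delta> ^ \<alpha> j) \<le> M" if "\<alpha> \<in> multi_indices (insert i I)" for \<alpha>
  proof -
    define \<beta> where "\<beta> = \<alpha>(i := 0)"
    have \<beta>: "\<beta> \<in> multi_indices I" and \<alpha>: "\<alpha> = \<beta>(i := \<alpha> i)"
      using that by (auto simp: \<beta>_def multi_indices_def)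
    have "(\<Prod>j\<in>insert i I. \<delta> ^ \<alpha> j) = \<delta> ^ \<alpha> i * (\<Prod>j\<in>I. \<delta> ^ \<beta> j)"
      by (subst \<alpha>) (rule prod_insert_update[OF insert.hyps(2,1)])
    moreover have "C \<alpha> = c (\<alpha> i) \<beta>" by (subst \<alpha>) (rule Cupd[OF \<beta>])
    moreover have "\<delta> ^ \<alpha> i * (cmod (c (\<alpha> i) \<beta>) * (\<Prod>j\<in>I. \<delta> ^ \<beta> j)) \<le> \<delta> ^ \<alpha> i * (M / \<delta> ^ \<alpha> i)"
      using c1[OF \<beta>, of "\<alpha> i"] \<delta> by (intro mult_left_mono) auto
    ultimately show ?thesis using \<delta> by (simp add: mult_ac)
  qed
  have sum: "((\<lambda>\<alpha>. C \<alpha> * (\<Prod>j\<in>insert i I. z j ^ \<alpha> j)) has_sum h (a + (\<Sum>j\<in>insert i I. z j *\<^sub>C v j)))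
      (multi_indices (insert i I))" if z: "\<And>j. j \<in> insert i I \<Longrightarrow> cmod (z j) < \<delta>" for z
  proof -
    let ?x = "a + (\<Sum>j\<in>I. z j *\<^sub>C v j)"
    let ?F = "\<lambda>(k, \<beta>). C (\<beta>(i := k)) * (\<Prod>j\<in>insert i I. z j ^ (\<beta>(i := k)) j)"
    have zI: "\<And>j. j \<in> I \<Longrightarrow> cmod (z j) < \<delta>" using z by blast
    have zI': "\<And>j. j \<in> I \<Longrightarrow> cmod (z j) \<le> \<delta>" using zI less_imp_le by blast
    have M0: "0 \<le> M"
    proof -
      have "cmod (h (?x + 0 *\<^sub>C v i)) \<le> M" by (rule bd[of z 0, OF zI']) (use \<delta> in auto)
      then show ?thesis using norm_ge_zero order_trans by blast
    qed
    have "((\<lambda>\<alpha>. \<Prod>j\<in>insert i I. (cmod (z j) / \<delta>) ^ \<alpha> j) has_sum (\<Prod>j\<in>insert i I. 1 / (1 - cmod (z j) / \<delta>)))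
        (multi_indices (insert i I))"
      using insert.hyps(1) z \<delta> by (intro has_sum_multi_geometric) auto
    then have "(\<lambda>\<alpha>. M * (\<Prod>j\<in>insert i I. (cmod (z j) / \<delta>) ^ \<alpha> j)) summable_on multi_indices (insert i I)"
      using summable_on_cmult_right summable_on_def by blast
    then have "(\<lambda>\<alpha>. norm (C \<alpha> * (\<Prod>j\<in>insert i I. z j ^ \<alpha> j))) summable_on multi_indices (insert i I)"
    proof (rule Infinite_Sum.abs_summable_on_comparison_test')
      fix \<alpha> assume \<alpha>: "\<alpha> \<in> multi_indices (insert i I)"
      define P where "P = (\<Prod>j\<in>insert i I. \<delta> ^ \<alpha> j)"
      have P: "P > 0" unfolding P_def using \<delta> by (intro prod_pos) simp
      have "(\<Prod>j\<in>insert i I. (cmod (z j) / \<delta>) ^ \<alpha> j) = (\<Prod>j\<in>insert i I. cmod (z j) ^ \<alpha> j) / P"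
        unfolding P_def power_divide by (rule prod_dividef)
      moreover have "norm (C \<alpha> * (\<Prod>j\<in>insert i I. z j ^ \<alpha> j)) = cmod (C \<alpha>) * (\<Prod>j\<in>insert i I. cmod (z j) ^ \<alpha> j)"
        unfolding norm_mult prod_norm[symmetric] norm_power ..
      moreover have "cmod (C \<alpha>) \<le> M / P" using Cbd[OF \<alpha>] P unfolding P_def[symmetric] by (simp add: pos_le_divide_eq)
      then have "cmod (C \<alpha>) * (\<Prod>j\<in>insert i I. cmod (z j) ^ \<alpha> j) \<le> M / P * (\<Prod>j\<in>insert i I. cmod (z j) ^ \<alpha> j)"
        by (rule mult_right_mono) (intro prod_nonneg, simp)
      ultimately show "norm (C \<alpha> * (\<Prod>j\<in>insert i I. z j ^ \<alpha> j)) \<le> M * (\<Prod>j\<in>insert i I. (cmod (z j) / \<delta>) ^ \<alpha> j)"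
        by simp
    qed
    then have "(\<lambda>\<alpha>. C \<alpha> * (\<Prod>j\<in>insert i I. z j ^ \<alpha> j)) summable_on multi_indices (insert i I)"
      by (rule abs_summable_summable)
    then have Fsum: "?F summable_on UNIV \<times> multi_indices I"
      unfolding summable_on_def has_sum_multi_indices_insert[OF insert.hyps(2)] .
    have inner: "((\<lambda>\<beta>. ?F (k, \<beta>)) has_sum H k ?x * z i ^ k) (multi_indices I)" for k
    proof -
      have "((\<lambda>\<beta>. c k \<beta> * (\<Prod>j\<in>I. z j ^ \<beta> j) * z i ^ k) has_sum H k ?x * z i ^ k) (multi_indices I)"
        by (rule has_sum_cmult_left[OF c2[of z, OF zI]])
      then show ?thesis
      proof (rule iffD1[OF has_sum_cong, rotated])
        fix \<beta> assume \<beta>: "\<beta> \<in> multi_indices I"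
        have "(\<Prod>j\<in>insert i I. z j ^ (\<beta>(i := k)) j) = z i ^ k * (\<Prod>j\<in>I. z j ^ \<beta> j)"
          by (rule prod_insert_update[OF insert.hyps(2,1)])
        then show "c k \<beta> * (\<Prod>j\<in>I. z j ^ \<beta> j) * z i ^ k = ?F (k, \<beta>)"
          unfolding prod.case Cupd[OF \<beta>] by (simp only: mult_ac)
      qed
    qed
    have hol: "(\<lambda>\<zeta>. h (?x + \<zeta> *\<^sub>C v i)) holomorphic_on cball 0 \<delta>"
      by (rule line_holo_holomorphic_on[OF holo_on_imp_line_holo[OF h]]) (use inS[of z, OF zI'] in auto)
    have outer: "((\<lambda>k. H k ?x * z i ^ k) has_sum h (?x + z i *\<^sub>C v i)) UNIV"
      unfolding H_def
      by (rule holomorphic_power_series_coeffs[OF \<delta> holomorphic_on_imp_continuous_on[OF hol]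
            holomorphic_on_subset[OF hol ball_subset_cball]]) (use z in simp)
    have "(?F has_sum h (?x + z i *\<^sub>C v i)) (UNIV \<times> multi_indices I)"
      by (rule has_sum_SigmaI[OF inner outer Fsum])
    then have "((\<lambda>\<alpha>. C \<alpha> * (\<Prod>j\<in>insert i I. z j ^ \<alpha> j)) has_sum h (?x + z i *\<^sub>C v i)) (multi_indices (insert i I))"
      unfolding has_sum_multi_indices_insert[OF insert.hyps(2)] .
    then show ?thesis using split[of z "z i"] by (simp only: fun_upd_triv)
  qed
  show ?case
  proof (intro exI[of _ C] conjI ballI allI impI)
    show "cmod (C \<alpha>) * (\<Prod>j\<in>insert i I. \<delta> ^ \<alpha> j) \<le> M" if "\<alpha> \<in> multi_indices (insert i I)" for \<alpha>
      by (rule Cbd[OF that])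
    fix z assume "\<forall>j\<in>insert i I. cmod (z j) < \<delta>"
    then show "((\<lambda>\<alpha>. C \<alpha> * (\<Prod>j\<in>insert i I. z j ^ \<alpha> j)) has_sum h (a + (\<Sum>j\<in>insert i I. z j *\<^sub>C v j)))
      (multi_indices (insert i I))"
      by (intro sum) blast
  qed
qed

lemma has_sum_finite_sum:
  fixes f :: "'i \<Rightarrow> 'j \<Rightarrow> 'b::topological_comm_monoid_add"
  assumes "finite B" "\<And>b. b \<in> B \<Longrightarrow> (f b has_sum s b) A"
  shows "((\<lambda>x. \<Sum>b\<in>B. f b x) has_sum (\<Sum>b\<in>B. s b)) A"
  using assms by (induction B rule: finite_induct) (auto intro: has_sum_add)

text \<open>
  The polydisc expansion is used with the real basis vectors as directions and then restricted to
  real values of its complex variables.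
\<close>

theorem holo_on_imp_real_analytic_on:
  fixes f :: "'a::complex_space \<Rightarrow> 'b::complex_space"
  assumes S: "open S" and f: "holo_on f S"
  shows "real_analytic_on f S"
  unfolding real_analytic_on_def
proof
  fix a assume a: "a \<in> S"
  obtain e where e: "e > 0" "cball a e \<subseteq> S" using S a open_contains_cball by blast
  obtain K where K: "K > 0" "\<And>c (w::'a). norm (c *\<^sub>C w) \<le> norm c * norm w * K"
    using scaleC.pos_bounded by blast
  define \<delta> where "\<delta> = e / (K * real DIM('a))"
  have \<delta>: "\<delta> > 0" unfolding \<delta>_def using e K by simp
  have inB: "a + (\<Sum>b\<in>Basis. z b *\<^sub>C b) \<in> cball a e" if "\<And>b. b \<in> Basis \<Longrightarrow> cmod (z b) \<le> \<delta>" for z :: "'a \<Rightarrow> complex"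
  proof -
    have "norm (\<Sum>b\<in>Basis. z b *\<^sub>C b) \<le> (\<Sum>b\<in>(Basis::'a set). \<delta> * K)"
    proof (rule sum_norm_le)
      fix b :: 'a assume b: "b \<in> Basis"
      have "norm (z b *\<^sub>C b) \<le> cmod (z b) * 1 * K" using K(2)[of "z b" b] b by simp
      also have "\<dots> \<le> \<delta> * K" using that[OF b] K(1) by (simp add: mult_right_mono)
      finally show "norm (z b *\<^sub>C b) \<le> \<delta> * K" .
    qed
    also have "\<dots> = e" unfolding \<delta>_def using K(1) by simp
    finally show ?thesis by (simp add: dist_norm)
  qed
  have "compact (f ` cball a e)"
    by (intro compact_continuous_image continuous_on_subset[OF holo_on_imp_continuous_on[OF f] e(2)] compact_cball)
  have ex: "\<exists>c. \<forall>x\<in>ball a \<delta>. ((\<lambda>\<alpha>. (\<Prod>b\<in>Basis. ((x - a) \<bullet> b) ^ \<alpha> b) *\<^sub>R c \<alpha>) has_sum f x \<bullet> b') (multi_indices Basis)"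
    for b' :: 'b
  proof -
    let ?h = "\<lambda>x. ccoord b' (f x)"
    have h: "holo_on ?h S" by (rule holo_on_ccoord[OF f])
    have "compact (?h ` cball a e)"
      by (intro compact_continuous_image continuous_on_subset[OF holo_on_imp_continuous_on[OF h] e(2)] compact_cball)
    then obtain M where M: "\<And>x. x \<in> cball a e \<Longrightarrow> cmod (?h x) \<le> M"
      using compact_imp_bounded[of "?h ` cball a e"] unfolding bounded_iff by blast
    have "\<exists>c. (\<forall>\<alpha>\<in>multi_indices Basis. cmod (c \<alpha>) * (\<Prod>i\<in>(Basis::'a set). \<delta> ^ \<alpha> i) \<le> M) \<and>
     (\<forall>z. (\<forall>i\<in>(Basis::'a set). cmod (z i) < \<delta>) \<longrightarrow>
       ((\<lambda>\<alpha>. c \<alpha> * (\<Prod>i\<in>Basis. z i ^ \<alpha> i)) has_sum ?h (a + (\<Sum>i\<in>Basis. z i *\<^sub>C i))) (multi_indices Basis))"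
    proof (rule holo_polydisc_expansion[where v = "\<lambda>b. b", OF finite_Basis \<delta> S h])
      fix z :: "'a \<Rightarrow> complex" assume z: "\<And>b. b \<in> Basis \<Longrightarrow> cmod (z b) \<le> \<delta>"
      show "a + (\<Sum>b\<in>Basis. z b *\<^sub>C b) \<in> S" using inB[of z, OF z] e(2) by blast
      show "cmod (?h (a + (\<Sum>b\<in>Basis. z b *\<^sub>C b))) \<le> M" by (rule M[OF inB[of z, OF z]])
    qed
    then obtain c where c0: "(\<forall>\<alpha>\<in>multi_indices Basis. cmod (c \<alpha>) * (\<Prod>i\<in>(Basis::'a set). \<delta> ^ \<alpha> i) \<le> M) \<and>
     (\<forall>z. (\<forall>i\<in>(Basis::'a set). cmod (z i) < \<delta>) \<longrightarrow>
       ((\<lambda>\<alpha>. c \<alpha> * (\<Prod>i\<in>Basis. z i ^ \<alpha> i)) has_sum ?h (a + (\<Sum>i\<in>Basis. z i *\<^sub>C i))) (multi_indices Basis))"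
      by (rule exE)
    note c = conjunct2[OF c0, THEN spec, THEN mp]
    have "((\<lambda>\<alpha>. (\<Prod>b\<in>Basis. ((x - a) \<bullet> b) ^ \<alpha> b) *\<^sub>R Re (c \<alpha>)) has_sum f x \<bullet> b') (multi_indices Basis)"
      if x: "x \<in> ball a \<delta>" for x
    proof -
      let ?z = "\<lambda>b. complex_of_real ((x - a) \<bullet> b)"
      have "cmod (?z b) < \<delta>" if "b \<in> Basis" for b
        using Basis_le_norm[OF that, of "x - a"] x by (simp add: dist_norm norm_minus_commute)
      then have "\<forall>b\<in>(Basis::'a set). cmod (?z b) < \<delta>" by (rule ballI)
      from c[OF this] have "((\<lambda>\<alpha>. c \<alpha> * (\<Prod>i\<in>Basis. ?z i ^ \<alpha> i)) has_sum ?h (a + (\<Sum>i\<in>Basis. ?z i *\<^sub>C i))) (multi_indices Basis)" .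
      moreover have "(\<Sum>i\<in>Basis. ?z i *\<^sub>C i) = x - a"
        by (simp only: scaleC_of_real euclidean_representation)
      moreover have "a + (x - a) = x" by simp
      ultimately have "((\<lambda>\<alpha>. c \<alpha> * (\<Prod>i\<in>Basis. ?z i ^ \<alpha> i)) has_sum ?h x) (multi_indices Basis)" by (simp only:)
      from has_sum_bounded_linear[OF bounded_linear_Re this]
      have "((\<lambda>\<alpha>. Re (c \<alpha> * (\<Prod>i\<in>Basis. ?z i ^ \<alpha> i))) has_sum Re (?h x)) (multi_indices Basis)"
        by (simp only: o_def)
      moreover have "Re (?h x) = f x \<bullet> b'" by (simp add: ccoord_def)
      moreover have "Re (c \<alpha> * (\<Prod>i\<in>Basis. ?z i ^ \<alpha> i)) = (\<Prod>b\<in>Basis. ((x - a) \<bullet> b) ^ \<alpha> b) *\<^sub>R Re (c \<alpha>)" for \<alpha>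
      proof -
        have "(\<Prod>i\<in>Basis. ?z i ^ \<alpha> i) = of_real (\<Prod>b\<in>Basis. ((x - a) \<bullet> b) ^ \<alpha> b)"
          unfolding of_real_prod of_real_power ..
        then show ?thesis by (simp del: of_real_prod)
      qed
      ultimately show ?thesis by (simp only:)
    qed
    then show ?thesis by (intro exI[of _ "\<lambda>\<alpha>. Re (c \<alpha>)"] ballI)
  qed
  define c where "c b' = (SOME c. \<forall>x\<in>ball a \<delta>.
     ((\<lambda>\<alpha>. (\<Prod>b\<in>Basis. ((x - a) \<bullet> b) ^ \<alpha> b) *\<^sub>R c \<alpha>) has_sum f x \<bullet> b') (multi_indices Basis))" for b' :: 'b
  have c: "((\<lambda>\<alpha>. (\<Prod>b\<in>Basis. ((x - a) \<bullet> b) ^ \<alpha> b) *\<^sub>R c b' \<alpha>) has_sum f x \<bullet> b') (multi_indices Basis)"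
    if "x \<in> ball a \<delta>" for x b'
    using bspec[OF someI_ex[OF ex[of b'], folded c_def] that] .
  have "((\<lambda>\<alpha>. (\<Prod>b\<in>Basis. ((x - a) \<bullet> b) ^ \<alpha> b) *\<^sub>R (\<Sum>b'\<in>Basis. c b' \<alpha> *\<^sub>R b')) has_sum f x) (multi_indices Basis)"
    if x: "x \<in> ball a \<delta>" for x
  proof -
    have "((\<lambda>\<alpha>. \<Sum>b'\<in>Basis. ((\<Prod>b\<in>Basis. ((x - a) \<bullet> b) ^ \<alpha> b) *\<^sub>R c b' \<alpha>) *\<^sub>R b') has_sum (\<Sum>b'\<in>Basis. (f x \<bullet> b') *\<^sub>R b'))
       (multi_indices Basis)"
      by (rule has_sum_finite_sum[OF finite_Basis])
         (rule has_sum_bounded_linear[OF bounded_linear_scaleR_left c[OF x], unfolded o_def])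
    then show ?thesis by (simp only: euclidean_representation scaleR_sum_right scaleR_scaleR real_scaleR_def)
  qed
  then show "\<exists>c r. 0 < r \<and> (\<forall>x\<in>ball a r. ((\<lambda>\<alpha>. (\<Prod>b\<in>Basis. ((x - a) \<bullet> b) ^ \<alpha> b) *\<^sub>R c \<alpha>) has_sum f x)
       {\<alpha>. \<forall>b. b \<notin> Basis \<longrightarrow> \<alpha> b = (0::nat)})"
    unfolding multi_indices_def[symmetric]
    by (intro exI[of _ "\<lambda>\<alpha>. \<Sum>b'\<in>Basis. c b' \<alpha> *\<^sub>R b'"] exI[of _ \<delta>] conjI ballI \<delta>)
qed

section \<open>The edge-of-the-wedge theorem\<close>

definition real_points :: "(complex ^ 'n) set" where
  "real_points = {w. \<forall>j. Im (w $ j) = 0}"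

definition polydisc :: "real \<Rightarrow> (complex ^ 'n) set" where
  "polydisc \<rho> = {w. \<forall>j. cmod (w $ j) < \<rho>}"

definition upper_wedge :: "real \<Rightarrow> (complex ^ 'n) set" where
  "upper_wedge \<rho> = polydisc \<rho> \<inter> {w. \<forall>j. 0 < Im (w $ j)}"

lemma open_polydisc: "open (polydisc \<rho> :: (complex ^ 'n) set)"
proof -
  have "polydisc \<rho> = (\<Inter>j. {w :: complex ^ 'n. cmod (w $ j) < \<rho>})" by (auto simp: polydisc_def)
  moreover have "open (\<Inter>j. {w :: complex ^ 'n. cmod (w $ j) < \<rho>})"
    by (intro open_INT finite ballI open_Collect_less continuous_intros)
  ultimately show ?thesis by simp
qed

lemma open_upper_wedge: "open (upper_wedge \<rho> :: (complex ^ 'n) set)"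
proof -
  have "open (\<Inter>j. {w :: complex ^ 'n. 0 < Im (w $ j)})"
    by (intro open_INT finite ballI open_Collect_less continuous_intros)
  moreover have "upper_wedge \<rho> = polydisc \<rho> \<inter> (\<Inter>j. {w :: complex ^ 'n. 0 < Im (w $ j)})"
    by (auto simp: upper_wedge_def)
  ultimately show ?thesis using open_Int[OF open_polydisc] by simp
qed

lemma cnjv_real_points: "w \<in> real_points \<Longrightarrow> cnjv w = w"
  by (auto simp: real_points_def vec_eq_iff complex_eq_iff)

lemma holo_on_cnj_cnjv:
  fixes k :: "complex ^ 'n \<Rightarrow> complex"
  assumes "holo_on k S" "\<And>w. w \<in> T \<Longrightarrow> cnjv w \<in> S"
  shows "holo_on (\<lambda>w. cnj (k (cnjv w))) T"
  unfolding holo_on_def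
proof
  fix w assume "w \<in> T"
  then obtain D where D: "(k has_derivative D) (at (cnjv w))" "clinear D"
    using holo_onE[OF assms(1)] assms(2) by blast
  have "((\<lambda>w. cnj (k (cnjv w))) has_derivative (\<lambda>v. cnj (D (cnjv v)))) (at w)"
    by (rule has_derivative_cnj, rule has_derivative_compose[of cnjv cnjv w UNIV k D, OF _ D(1)])
      (rule linear_imp_has_derivative[OF linear_cnjv])
  moreover have "clinear (\<lambda>v. cnj (D (cnjv v)))"
    unfolding clinear_def linear_iff
    using linear_add[OF clinearD(1)[OF D(2)]] linear_scale[OF clinearD(1)[OF D(2)]] clinearD(2)[OF D(2)]
    by (auto simp: cnjv_simps)
  ultimately show "\<exists>D. ((\<lambda>w. cnj (k (cnjv w))) has_derivative D) (at w) \<and> clinear D" by blast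
qed

lemma holomorphic_on_imp_holo_on:
  assumes "open S" "f holomorphic_on S" shows "holo_on f S"
  unfolding holo_on_def
proof
  fix x assume "x \<in> S"
  with assms obtain f' where "(f has_field_derivative f') (at x)"
    by (auto simp: holomorphic_on_open)
  then show "\<exists>D. (f has_derivative D) (at x) \<and> clinear D"
    using clinear_mult by (auto simp: has_field_derivative_def)
qed

text \<open>
  Rudin's family of Moebius maps.  At \<open>z = 0\<close> the value is \<open>w\<close>; for \<open>w\<close> in the small polydisc
  the upper and the lower half of the unit circle go to the wedges \<open>Im > 0\<close> and \<open>Im < 0\<close>, and for real \<open>w\<close>
  this holds for the two halves of the closed unit disc.
\<close>

definition eow_map :: "real \<Rightarrow> complex ^ 'n \<Rightarrow> complex \<Rightarrow> complex ^ 'n" where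
  "eow_map \<epsilon> w z = (\<chi> j. (w $ j + of_real \<epsilon> * z) / (1 + z * w $ j / of_real \<epsilon>))"

lemma eow_denominator:
  assumes "\<epsilon> > 0" "cmod a < \<epsilon> / 2" "cmod z \<le> 1"
  shows "cmod (1 + z * a / of_real \<epsilon>) > 1 / 2" "1 + z * a / of_real \<epsilon> \<noteq> 0"
proof -
  have "cmod z * cmod a \<le> 1 * cmod a" using assms(3) by (rule mult_right_mono) simp
  then have "cmod (z * a / of_real \<epsilon>) < 1 / 2"
    using assms(1,2) by (simp add: norm_mult norm_divide pos_divide_less_eq)
  moreover have "1 \<le> cmod (1 + z * a / of_real \<epsilon>) + cmod (z * a / of_real \<epsilon>)"
    using norm_triangle_ineq4[of "1 + z * a / of_real \<epsilon>" "z * a / of_real \<epsilon>"] by simp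
  ultimately show "cmod (1 + z * a / of_real \<epsilon>) > 1 / 2" by linarith
  then show "1 + z * a / of_real \<epsilon> \<noteq> 0" by auto
qed

lemma eow_map_polydisc:
  assumes "\<epsilon> > 0" "w \<in> polydisc (\<epsilon> / 2)" "cmod z \<le> 1"
  shows "eow_map \<epsilon> w z \<in> polydisc (4 * \<epsilon>)"
  unfolding polydisc_def
proof (intro CollectI allI)
  fix j
  have w: "cmod (w $ j) < \<epsilon> / 2" using assms(2) by (simp add: polydisc_def)
  have "cmod (of_real \<epsilon> * z) \<le> \<epsilon> * 1" unfolding norm_mult norm_of_real
    using assms(1,3) by (intro mult_mono) auto
  then have "cmod (w $ j + of_real \<epsilon> * z) < 2 * \<epsilon>"
    using norm_triangle_ineq[of "w $ j" "of_real \<epsilon> * z"] w assms(1) by linarith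
  also have "2 * \<epsilon> = 4 * \<epsilon> * (1 / 2)" by simp
  also have "\<dots> < 4 * \<epsilon> * cmod (1 + z * w $ j / of_real \<epsilon>)"
    by (rule mult_strict_left_mono[OF eow_denominator(1)[OF assms(1) w assms(3)]]) (use assms(1) in simp)
  finally show "cmod (eow_map \<epsilon> w z $ j) < 4 * \<epsilon>"
    using eow_denominator(2)[OF assms(1) w assms(3)]
    by (simp add: eow_map_def norm_divide pos_divide_less_eq)
qed

lemma Im_divide_pos_iff:
  assumes "b \<noteq> 0"
  shows "Im (a / b) > 0 \<longleftrightarrow> Im (a * cnj b) > 0" "Im (a / b) < 0 \<longleftrightarrow> Im (a * cnj b) < 0"
    "Im (a / b) = 0 \<longleftrightarrow> Im (a * cnj b) = 0"
proof -
  have p: "(cmod b)\<^sup>2 > 0" using assms by simp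
  have "Im (a / b) = Im (a * cnj b / of_real ((cmod b)\<^sup>2))"
    using complex_div_cnj[of a b] by simp
  also have "\<dots> = Im (a * cnj b) / (cmod b)\<^sup>2" by (rule Im_divide_of_real)
  finally have eq: "Im (a / b) = Im (a * cnj b) / (cmod b)\<^sup>2" .
  show "Im (a / b) > 0 \<longleftrightarrow> Im (a * cnj b) > 0" "Im (a / b) < 0 \<longleftrightarrow> Im (a * cnj b) < 0"
    "Im (a / b) = 0 \<longleftrightarrow> Im (a * cnj b) = 0"
    unfolding eq using p assms by (simp_all add: zero_less_divide_iff divide_less_0_iff)
qed

text \<open>
  The sign of the imaginary part of the Moebius map is that of \<open>Im z\<close>: after multiplication with
  the conjugate denominator a positive factor splits off.
\<close>

lemma eow_Im_key:
  assumes "\<epsilon> > 0" "cmod a < \<epsilon> / 2" "cmod z = 1 \<or> (Im a = 0 \<and> cmod z \<le> 1)"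
  obtains p where "p > 0" "Im ((a + of_real \<epsilon> * z) * cnj (1 + z * a / of_real \<epsilon>)) = Im z * p"
proof -
  have "(cmod a)\<^sup>2 < (\<epsilon> / 2)\<^sup>2" using assms(2) by (intro power_strict_mono) auto
  also have "(\<epsilon> / 2)\<^sup>2 \<le> \<epsilon> * \<epsilon>" using assms(1) by (simp add: power2_eq_square)
  finally have "(cmod a)\<^sup>2 < \<epsilon> * \<epsilon>" .
  then have p: "\<epsilon> - (cmod a)\<^sup>2 / \<epsilon> > 0" using assms(1) by (simp add: pos_divide_less_eq)
  have "Im ((a + of_real \<epsilon> * z) * cnj (1 + z * a / of_real \<epsilon>)) =
     Im a - (cmod z)\<^sup>2 * Im a + Im z * (\<epsilon> - (cmod a)\<^sup>2 / \<epsilon>)"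
    using assms(1) unfolding cmod_power2
    by (simp add: field_simps power2_eq_square)
  also have "Im a - (cmod z)\<^sup>2 * Im a = 0" using assms(3) by auto
  finally show ?thesis using that[OF p] by simp
qed

lemma eow_map_Im:
  assumes "\<epsilon> > 0" "w \<in> polydisc (\<epsilon> / 2)" "cmod z = 1 \<or> (w \<in> real_points \<and> cmod z \<le> 1)"
  shows "Im z > 0 \<Longrightarrow> Im (eow_map \<epsilon> w z $ j) > 0" "Im z < 0 \<Longrightarrow> Im (eow_map \<epsilon> w z $ j) < 0"
    "Im z = 0 \<Longrightarrow> Im (eow_map \<epsilon> w z $ j) = 0"
proof -
  have w: "cmod (w $ j) < \<epsilon> / 2" using assms(2) by (simp add: polydisc_def)
  have z: "cmod z = 1 \<or> (Im (w $ j) = 0 \<and> cmod z \<le> 1)" "cmod z \<le> 1" using assms(3) by (auto simp: real_points_def)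
  obtain p where p: "p > 0" "Im ((w $ j + of_real \<epsilon> * z) * cnj (1 + z * w $ j / of_real \<epsilon>)) = Im z * p"
    using eow_Im_key[OF assms(1) w z(1)] .
  note d = eow_denominator(2)[OF assms(1) w z(2)]
  show "Im z > 0 \<Longrightarrow> Im (eow_map \<epsilon> w z $ j) > 0" "Im z < 0 \<Longrightarrow> Im (eow_map \<epsilon> w z $ j) < 0"
    "Im z = 0 \<Longrightarrow> Im (eow_map \<epsilon> w z $ j) = 0"
    unfolding eow_map_def vec_lambda_beta Im_divide_pos_iff[OF d] p(2) using p(1)
    by (simp_all add: mult_neg_pos)
qed

text \<open>
  The complex line through \<open>w\<close> in the direction of its imaginary part meets the edge in a real
  segment and reduces the claim to one variable.
\<close>

lemma zero_of_edge:
  fixes d :: "complex ^ 'n \<Rightarrow> complex"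
  assumes cont: "continuous_on (upper_wedge \<rho> \<union> polydisc \<rho> \<inter> real_points) d"
    and hol: "holo_on d (upper_wedge \<rho>)"
    and edge: "\<And>w. w \<in> polydisc \<rho> \<inter> real_points \<Longrightarrow> d w = 0"
    and w: "w \<in> upper_wedge \<rho>"
  shows "d w = 0"
proof -
  define u v :: "complex ^ 'n" where "u = (\<chi> j. of_real (Re (w $ j)))" and "v = (\<chi> j. of_real (Im (w $ j)))"
  have uv: "w = u + \<i> *\<^sub>C v" by (auto simp: u_def v_def vec_eq_iff complex_eq_iff)
  have vpos: "Im (w $ j) > 0" for j using w by (simp add: upper_wedge_def)
  define A where "A = {\<zeta>. u + \<zeta> *\<^sub>C v \<in> polydisc \<rho>}"
  have oA: "open A" unfolding A_def by (rule open_line[OF open_polydisc])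
  have cA: "convex A"
  proof (rule convexI)
    fix a b :: complex and s t :: real
    assume ab: "a \<in> A" "b \<in> A" and st: "0 \<le> s" "0 \<le> t" "s + t = 1"
    show "s *\<^sub>R a + t *\<^sub>R b \<in> A"
      unfolding A_def polydisc_def
    proof (intro CollectI allI)
      fix j
      have "u $ j + a * v $ j \<in> ball 0 \<rho>" "u $ j + b * v $ j \<in> ball 0 \<rho>"
        using ab by (auto simp: A_def polydisc_def)
      then have "s *\<^sub>R (u $ j + a * v $ j) + t *\<^sub>R (u $ j + b * v $ j) \<in> ball 0 \<rho>"
        by (rule convexD[OF convex_ball]) (use st in auto)
      also have "s *\<^sub>R (u $ j + a * v $ j) + t *\<^sub>R (u $ j + b * v $ j) = (s + t) *\<^sub>R u $ j + (s *\<^sub>R a + t *\<^sub>R b) * v $ j"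
        by (simp add: scaleR_conv_of_real algebra_simps)
      finally show "cmod ((u + (s *\<^sub>R a + t *\<^sub>R b) *\<^sub>C v) $ j) < \<rho>" using st by simp
    qed
  qed
  have Im_line: "Im ((u + \<zeta> *\<^sub>C v) $ j) = Im \<zeta> * Im (w $ j)" for \<zeta> j
    by (simp add: u_def v_def)
  have up: "u + \<zeta> *\<^sub>C v \<in> upper_wedge \<rho>" if "\<zeta> \<in> A" "Im \<zeta> > 0" for \<zeta>
    using that vpos unfolding upper_wedge_def A_def by (auto simp: Im_line simp del: vector_add_component)
  have re: "u + \<zeta> *\<^sub>C v \<in> polydisc \<rho> \<inter> real_points" if "\<zeta> \<in> A" "Im \<zeta> = 0" for \<zeta>
    using that unfolding real_points_def A_def by (auto simp: Im_line simp del: vector_add_component)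
  define D where "D \<zeta> = (if 0 \<le> Im \<zeta> then d (u + \<zeta> *\<^sub>C v) else 0)" for \<zeta>
  have "continuous_on ((A \<inter> {\<zeta>. 0 \<le> Im \<zeta>}) \<union> (A \<inter> {\<zeta>. Im \<zeta> \<le> 0})) D"
    unfolding D_def
  proof (rule continuous_on_cases_local)
    have U: "(A \<inter> {\<zeta>. 0 \<le> Im \<zeta>}) \<union> (A \<inter> {\<zeta>. Im \<zeta> \<le> 0}) = A" by auto
    have "closed {\<zeta>. 0 \<le> Im \<zeta>}" "closed {\<zeta>. Im \<zeta> \<le> 0}"
      by (intro closed_Collect_le continuous_intros)+
    then show "closedin (top_of_set ((A \<inter> {\<zeta>. 0 \<le> Im \<zeta>}) \<union> (A \<inter> {\<zeta>. Im \<zeta> \<le> 0}))) (A \<inter> {\<zeta>. 0 \<le> Im \<zeta>})"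
       "closedin (top_of_set ((A \<inter> {\<zeta>. 0 \<le> Im \<zeta>}) \<union> (A \<inter> {\<zeta>. Im \<zeta> \<le> 0}))) (A \<inter> {\<zeta>. Im \<zeta> \<le> 0})"
      unfolding U by (auto simp: closedin_closed)
    show "continuous_on (A \<inter> {\<zeta>. 0 \<le> Im \<zeta>}) (\<lambda>\<zeta>. d (u + \<zeta> *\<^sub>C v))"
    proof (rule continuous_on_compose2[OF cont])
      show "(\<lambda>\<zeta>. u + \<zeta> *\<^sub>C v) ` (A \<inter> {\<zeta>. 0 \<le> Im \<zeta>}) \<subseteq> upper_wedge \<rho> \<union> polydisc \<rho> \<inter> real_points"
        using up re by (metis (mono_tags, lifting) Int_iff UnCI image_subsetI mem_Collect_eq order_le_less)
    qed (intro continuous_intros)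
    show "continuous_on (A \<inter> {\<zeta>. Im \<zeta> \<le> 0}) (\<lambda>\<zeta>. 0)" by simp
    show "\<And>\<zeta>. \<zeta> \<in> A \<inter> {\<zeta>. 0 \<le> Im \<zeta>} \<and> \<not> 0 \<le> Im \<zeta> \<or> \<zeta> \<in> A \<inter> {\<zeta>. Im \<zeta> \<le> 0} \<and> 0 \<le> Im \<zeta> \<Longrightarrow> d (u + \<zeta> *\<^sub>C v) = 0"
      using edge[OF re] by auto
  qed
  moreover have "(A \<inter> {\<zeta>. 0 \<le> Im \<zeta>}) \<union> (A \<inter> {\<zeta>. Im \<zeta> \<le> 0}) = A" by auto
  ultimately have contD: "continuous_on A D" by simp
  have inner_i: "\<i> \<bullet> z = Im z" for z :: complex by (simp add: inner_complex_def)
  have "D holomorphic_on A"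
  proof (rule holomorphic_on_paste_across_line[OF oA, of \<i> _ 0])
    show "D holomorphic_on (A \<inter> {z. \<i> \<bullet> z < 0})"
      by (rule holomorphic_transform[of "\<lambda>_. 0"]) (auto simp: D_def inner_i)
    have "(\<lambda>\<zeta>. d (u + \<zeta> *\<^sub>C v)) holomorphic_on (A \<inter> {z. 0 < \<i> \<bullet> z})"
      by (rule line_holo_holomorphic_on[OF holo_on_imp_line_holo[OF hol]]) (auto simp: inner_i intro: up)
    then show "D holomorphic_on (A \<inter> {z. 0 < \<i> \<bullet> z})"
      by (rule holomorphic_transform) (auto simp: D_def inner_i)
  qed (use contD in auto)
  have "0 \<in> A"
  proof -
    have "cmod (u $ j) < \<rho>" for j
      using w abs_Re_le_cmod[of "w $ j"] le_less_trans unfolding u_def upper_wedge_def polydisc_def by auto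
    then show ?thesis by (simp add: A_def polydisc_def)
  qed
  obtain r where r: "r > 0" "ball 0 r \<subseteq> A" using oA \<open>0 \<in> A\<close> open_contains_ball by blast
  have "- (of_real (r/2)) * \<i> \<in> A \<inter> {\<zeta>. Im \<zeta> < 0}" using r by (auto simp: subset_iff norm_mult)
  then have ne: "A \<inter> {\<zeta>. Im \<zeta> < 0} \<noteq> {}" by blast
  have "D \<i> = 0"
  proof (rule analytic_continuation_open[where f = D and g = "\<lambda>_. 0"])
    show "open (A \<inter> {\<zeta>. Im \<zeta> < 0})" by (intro open_Int oA open_Collect_less continuous_intros)
    show "\<i> \<in> A" using w by (simp add: A_def uv[symmetric] upper_wedge_def)
    show "D holomorphic_on A" by fact
  qed (use ne oA cA in \<open>auto simp: D_def convex_connected\<close>)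
  then show ?thesis by (simp add: D_def uv[symmetric])
qed

text \<open>
  Reflection extends \<open>k\<close> continuously to a function \<open>F\<close> on both wedges and the edge.  The mean of
  \<open>F (eow_map \<epsilon> w z)\<close> over the unit circle in \<open>z\<close> is holomorphic in \<open>w\<close> by Osgood's lemma.
  For real \<open>w\<close> the integrand is holomorphic in the two half discs and continuous across the diameter, so
  that the mean is its value \<open>F w = k w\<close> at \<open>z = 0\<close>; in the wedge the two functions then agree by
  \<open>zero_of_edge\<close>.
\<close>

theorem edge_of_the_wedge:
  fixes k :: "complex ^ 'n \<Rightarrow> complex"
  assumes \<epsilon>: "\<epsilon> > 0"
    and cont: "continuous_on (upper_wedge (4 * \<epsilon>) \<union> polydisc (4 * \<epsilon>) \<inter> real_points) k"
    and hol: "holo_on k (upper_wedge (4 * \<epsilon>))"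
    and real: "\<And>w. w \<in> polydisc (4 * \<epsilon>) \<inter> real_points \<Longrightarrow> Im (k w) = 0"
  obtains g where "holo_on g (polydisc (\<epsilon> / 2))"
    "\<And>w. w \<in> upper_wedge (\<epsilon> / 2) \<union> polydisc (\<epsilon> / 2) \<inter> real_points \<Longrightarrow> g w = k w"
proof -
  let ?P = "polydisc (4 * \<epsilon>) :: (complex ^ 'n) set" and ?W = "upper_wedge (4 * \<epsilon>) :: (complex ^ 'n) set"
  let ?D = "polydisc (\<epsilon> / 2) :: (complex ^ 'n) set"
  define Wm where "Wm = ?P \<inter> {w. \<forall>j. Im (w $ j) < 0}"
  define Q where "Q = (?W \<union> ?P \<inter> real_points) \<union> (Wm \<union> ?P \<inter> real_points)"
  define F where "F w = (if w \<in> ?W \<union> ?P \<inter> real_points then k w else cnj (k (cnjv w)))" for w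
  have sub: "?D \<subseteq> ?P"
  proof
    fix w :: "complex ^ 'n" assume w: "w \<in> ?D"
    have "cmod (w $ j) < 4 * \<epsilon>" for j
    proof -
      have "cmod (w $ j) < \<epsilon> / 2" using w by (simp add: polydisc_def)
      then show ?thesis using \<epsilon> by linarith
    qed
    then show "w \<in> ?P" by (simp add: polydisc_def)
  qed
  have cP: "cnjv w \<in> ?P" if "w \<in> ?P" for w using that by (simp add: polydisc_def)
  have cWm: "cnjv w \<in> ?W" if "w \<in> Wm" for w using that cP by (simp add: Wm_def upper_wedge_def)
  have disj: "w \<notin> ?W \<union> ?P \<inter> real_points" if "w \<in> Wm" for w
  proof -
    have "Im (w $ j) < 0" for j using that by (simp add: Wm_def)
    from this[of undefined] have "\<not> 0 < Im (w $ undefined)" "Im (w $ undefined) \<noteq> 0" by linarith+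
    then show ?thesis unfolding upper_wedge_def real_points_def by blast
  qed
  have contF: "continuous_on Q F"
    unfolding Q_def F_def
  proof (rule continuous_on_cases_local)
    let ?A = "?W \<union> ?P \<inter> real_points" and ?B = "Wm \<union> ?P \<inter> real_points"
    have cA: "closed {w :: complex ^ 'n. \<forall>j. 0 \<le> Im (w $ j)}" and cB: "closed {w :: complex ^ 'n. \<forall>j. Im (w $ j) \<le> 0}"
      by (intro closed_Collect_all closed_Collect_le continuous_intros)+
    have pos: "(\<forall>j. 0 < Im (w $ j)) \<Longrightarrow> \<not> (\<forall>j. Im (w $ j) \<le> 0)"
      "(\<forall>j. Im (w $ j) < 0) \<Longrightarrow> \<not> (\<forall>j. 0 \<le> Im (w $ j))" for w :: "complex ^ 'n"
      by (auto simp: not_le)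
    have A: "?A = (?A \<union> ?B) \<inter> {w. \<forall>j. 0 \<le> Im (w $ j)}"
      using pos(2) unfolding Wm_def upper_wedge_def real_points_def by (auto intro: less_imp_le)
    have B: "?B = (?A \<union> ?B) \<inter> {w. \<forall>j. Im (w $ j) \<le> 0}"
      using pos(1) unfolding Wm_def upper_wedge_def real_points_def by (auto intro: less_imp_le)
    show "closedin (top_of_set (?A \<union> ?B)) ?A"
      by (rule iffD2[OF closedin_closed], rule exI, rule conjI[OF cA A])
    show "closedin (top_of_set (?A \<union> ?B)) ?B"
      by (rule iffD2[OF closedin_closed], rule exI, rule conjI[OF cB B])
    show "continuous_on ?A k" by (rule cont)
    show "continuous_on ?B (\<lambda>w. cnj (k (cnjv w)))"
    proof (intro continuous_on_cnj continuous_on_compose2[OF cont])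
      show "continuous_on ?B cnjv" using continuous_on_cnjv[OF continuous_on_id] .
      show "cnjv ` ?B \<subseteq> ?A"
      proof (rule image_subsetI)
        fix w assume "w \<in> ?B"
        then show "cnjv w \<in> ?A" using cWm[of w] cnjv_real_points[of w] by (elim UnE IntE) simp_all
      qed
    qed
    fix w assume "w \<in> ?A \<and> \<not> w \<in> ?A \<or> w \<in> ?B \<and> w \<in> ?A"
    then have "w \<in> ?P \<inter> real_points" using disj by blast
    then show "k w = cnj (k (cnjv w))" using real[of w] cnjv_real_points[of w] by (simp add: complex_eq_iff)
  qed
  have holF: "holo_on F ?W"
    by (rule holo_on_cong[OF open_upper_wedge _ hol]) (simp add: F_def)
  have "open Wm"
  proof -
    have "open (\<Inter>j. {w :: complex ^ 'n. Im (w $ j) < 0})"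
      by (intro open_INT finite ballI open_Collect_less continuous_intros)
    moreover have "Wm = ?P \<inter> (\<Inter>j. {w :: complex ^ 'n. Im (w $ j) < 0})" by (auto simp: Wm_def)
    ultimately show ?thesis using open_Int[OF open_polydisc] by simp
  qed
  have holFm: "holo_on F Wm"
    by (rule holo_on_cong[OF \<open>open Wm\<close> _ holo_on_cnj_cnjv[OF hol cWm]]) (use disj in \<open>auto simp: F_def\<close>)
  have Qcases: "z \<in> Q" if "z \<in> ?P" "(\<forall>j. Im (z $ j) > 0) \<or> (\<forall>j. Im (z $ j) < 0) \<or> (\<forall>j. Im (z $ j) = 0)" for z
    using that by (auto simp: Q_def Wm_def upper_wedge_def real_points_def)
  have eP: "eow_map \<epsilon> w z \<in> ?P" if "w \<in> ?D" "cmod z \<le> 1" for w z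
    by (rule eow_map_polydisc[OF \<epsilon> that])
  have eQ: "eow_map \<epsilon> w z \<in> Q" if "w \<in> ?D" "cmod z = 1 \<or> (w \<in> real_points \<and> cmod z \<le> 1)" for w z
  proof (rule Qcases)
    show "eow_map \<epsilon> w z \<in> ?P" using eP[OF that(1)] that(2) by auto
    show "(\<forall>j. Im (eow_map \<epsilon> w z $ j) > 0) \<or> (\<forall>j. Im (eow_map \<epsilon> w z $ j) < 0) \<or> (\<forall>j. Im (eow_map \<epsilon> w z $ j) = 0)"
      using eow_map_Im[OF \<epsilon> that] by (cases "Im z" "0::real" rule: linorder_cases) auto
  qed
  have eW: "eow_map \<epsilon> w z \<in> ?W" if "w \<in> ?D" "cmod z = 1 \<or> (w \<in> real_points \<and> cmod z \<le> 1)" "Im z > 0" for w z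
    using eP[OF that(1), of z] that(2) eow_map_Im(1)[OF \<epsilon> that] by (auto simp: upper_wedge_def)
  have eWm: "eow_map \<epsilon> w z \<in> Wm" if "w \<in> ?D" "cmod z = 1 \<or> (w \<in> real_points \<and> cmod z \<le> 1)" "Im z < 0" for w z
    using eP[OF that(1), of z] that(2) eow_map_Im(2)[OF \<epsilon> that] by (auto simp: Wm_def)
  have conte: "continuous_on (?D \<times> cball 0 1) (\<lambda>(w, z). eow_map \<epsilon> w z)"
    unfolding eow_map_def split_def
  proof (rule continuous_on_vec_lambda)
    fix j
    have "\<forall>p \<in> ?D \<times> cball 0 1. 1 + snd p * fst p $ j / of_real \<epsilon> \<noteq> 0"
      by (intro ballI eow_denominator(2)[OF \<epsilon>]) (auto simp: polydisc_def)
    then show "continuous_on (?D \<times> cball 0 1)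
        (\<lambda>p. (fst p $ j + of_real \<epsilon> * snd p) / (1 + snd p * fst p $ j / of_real \<epsilon>))"
      by (intro continuous_on_divide continuous_intros) (use \<epsilon> in auto)
  qed
  have hole: "holo_on (\<lambda>w. eow_map \<epsilon> w z) ?D" if "cmod z \<le> 1" for z
  proof (rule holo_on_vecI)
    fix j
    define m where "m a = (a + of_real \<epsilon> * z) / (1 + z * a / of_real \<epsilon>)" for a
    have "m holomorphic_on {a. cmod a < \<epsilon> / 2}"
      unfolding m_def using eow_denominator(2)[OF \<epsilon> _ that] \<epsilon> by (intro holomorphic_intros) auto
    moreover have "open {a::complex. cmod a < \<epsilon> / 2}" by (intro open_Collect_less continuous_intros)
    ultimately have "holo_on m {a. cmod a < \<epsilon> / 2}" by (intro holomorphic_on_imp_holo_on)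
    then have "holo_on (\<lambda>w. m (w $ j)) ?D"
      by (rule holo_on_compose[OF holo_on_vec_nth[OF holo_on_id]]) (auto simp: polydisc_def)
    then show "holo_on (\<lambda>w. eow_map \<epsilon> w z $ j) ?D"
      by (simp add: eow_map_def m_def)
  qed
  define g where "g w = integral {0..1} (\<lambda>t. F (eow_map \<epsilon> w (unit_circle t)))" for w
  have holg: "holo_on g ?D"
    unfolding g_def
  proof (rule holo_on_param_integral[OF open_polydisc])
    have "continuous_on (?D \<times> {0..1}) (\<lambda>p. eow_map \<epsilon> (fst p) (unit_circle (snd p)))"
      by (rule continuous_on_compose_Pair[OF conte]) (auto intro!: continuous_intros)
    then show "continuous_on (?D \<times> {0..1}) (\<lambda>(w, t). F (eow_map \<epsilon> w (unit_circle t)))"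
      unfolding split_def by (rule continuous_on_compose2[OF contF]) (auto intro!: eQ)
    fix t :: real
    let ?z = "unit_circle t"
    have z1: "cmod ?z = 1" "cmod ?z \<le> 1" by auto
    consider "Im ?z > 0" | "Im ?z < 0" | "Im ?z = 0" by linarith
    then show "holo_on (\<lambda>w. F (eow_map \<epsilon> w ?z)) ?D"
    proof cases
      case 1
      show ?thesis
        by (rule holo_on_compose[OF hole[OF z1(2)] holF]) (use eW[OF _ _ 1] in auto)
    next
      case 2
      show ?thesis
        by (rule holo_on_compose[OF hole[OF z1(2)] holFm]) (use eWm[OF _ _ 2] in auto)
    next
      case 3
      have zz: "?z * ?z = 1"
      proof -
        have "(Re ?z)\<^sup>2 = 1" using z1(1) 3 cmod_power2[of ?z] by simp
        then show ?thesis using 3 by (simp add: complex_eq_iff power2_eq_square)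
      qed
      have "eow_map \<epsilon> w ?z = (\<chi> j. of_real \<epsilon> * ?z)" if "w \<in> ?D" for w
      proof -
        have "(w $ j + of_real \<epsilon> * ?z) / (1 + ?z * w $ j / of_real \<epsilon>) = of_real \<epsilon> * ?z" for j
        proof -
          have "1 + ?z * w $ j / of_real \<epsilon> \<noteq> 0"
            by (rule eow_denominator(2)[OF \<epsilon> _ z1(2)]) (use that in \<open>simp add: polydisc_def\<close>)
          moreover have "of_real \<epsilon> * ?z * (1 + ?z * w $ j / of_real \<epsilon>) = of_real \<epsilon> * ?z + (?z * ?z) * w $ j"
            using \<epsilon> by (simp add: field_simps)
          ultimately show ?thesis unfolding zz by (simp add: divide_eq_eq)
        qed
        then show ?thesis by (simp add: eow_map_def)
      qed
      then show ?thesis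
        by (intro holo_on_cong[OF open_polydisc _ holo_on_const[of "F (\<chi> j. of_real \<epsilon> * ?z)"]]) auto
    qed
  qed
  have g_edge: "g w = k w" if w: "w \<in> ?D \<inter> real_points" for w
  proof -
    define G where "G z = F (eow_map \<epsilon> w z)" for z
    have wD: "w \<in> ?D" "w \<in> real_points" using w by auto
    have contG: "continuous_on (cball 0 1) G"
      unfolding G_def
    proof (rule continuous_on_compose2[OF contF])
      show "continuous_on (cball 0 1) (eow_map \<epsilon> w)"
        by (rule continuous_on_compose_Pair[OF conte continuous_on_const continuous_on_id]) (use wD in auto)
    qed (use eQ wD in auto)
    have inner_i: "\<i> \<bullet> z = Im z" for z :: complex by (simp add: inner_complex_def)
    have line: "(\<lambda>z. F (eow_map \<epsilon> w z)) holomorphic_on T"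
      if T: "open T" "T \<subseteq> ball 0 1" "holo_on F R" "(\<lambda>z. eow_map \<epsilon> w z) ` T \<subseteq> R" for T R
    proof -
      have "holo_on (\<lambda>z. eow_map \<epsilon> w z) T"
      proof (rule holo_on_vecI)
        fix j
        have "(\<lambda>z. (w $ j + of_real \<epsilon> * z) / (1 + z * w $ j / of_real \<epsilon>)) holomorphic_on T"
          using eow_denominator(2)[OF \<epsilon>, of "w $ j"] wD(1) T(2)
          by (intro holomorphic_intros) (use \<epsilon> in \<open>force simp: polydisc_def\<close>)+
        with T(1) show "holo_on (\<lambda>z. eow_map \<epsilon> w z $ j) T"
          unfolding eow_map_def vec_lambda_beta by (intro holomorphic_on_imp_holo_on)
      qed
      from holo_on_compose[OF this T(3,4)]
      have "holo_on (\<lambda>z. F (eow_map \<epsilon> w z)) T" .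
      from line_holo_holomorphic_on[OF holo_on_imp_line_holo[OF this], of T 0 1] show ?thesis by simp
    qed
    have "G holomorphic_on ball 0 1"
    proof (rule holomorphic_on_paste_across_line[where d = "\<i>" and k = 0, OF open_ball])
      show "G holomorphic_on (ball 0 1 \<inter> {z. \<i> \<bullet> z < 0})"
        unfolding G_def inner_i
        by (rule line[OF _ _ holFm])
           (use eWm[OF wD(1)] wD(2) in \<open>auto intro!: open_Int open_Collect_less continuous_intros\<close>)
      show "G holomorphic_on (ball 0 1 \<inter> {z. 0 < \<i> \<bullet> z})"
        unfolding G_def inner_i
        by (rule line[OF _ _ holF])
           (use eW[OF wD(1)] wD(2) in \<open>auto intro!: open_Int open_Collect_less continuous_intros\<close>)
    qed (use continuous_on_subset[OF contG ball_subset_cball] in auto)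
    from mean_value_unit_circle[OF contG this]
    have "g w = G 0" by (simp add: g_def G_def)
    also have "G 0 = F w" by (simp add: G_def eow_map_def)
    also have "F w = k w"
    proof -
      have "w \<in> ?P" using wD(1) sub by blast
      then show ?thesis using wD(2) by (simp add: F_def)
    qed
    finally show ?thesis .
  qed
  from sub have subW: "upper_wedge (\<epsilon> / 2) \<subseteq> ?W" by (auto simp: upper_wedge_def)
  have WD: "upper_wedge (\<epsilon> / 2) \<subseteq> ?D" by (auto simp: upper_wedge_def)
  have g_wedge: "k w - g w = 0" if "w \<in> upper_wedge (\<epsilon> / 2)" for w
  proof (rule zero_of_edge[where d = "\<lambda>w. k w - g w", OF _ _ _ that])
    show "continuous_on (upper_wedge (\<epsilon> / 2) \<union> ?D \<inter> real_points) (\<lambda>w. k w - g w)"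
      by (intro continuous_on_diff continuous_on_subset[OF cont] continuous_on_subset[OF holo_on_imp_continuous_on[OF holg]])
         (use sub subW WD in blast)+
    show "holo_on (\<lambda>w. k w - g w) (upper_wedge (\<epsilon> / 2))"
      by (intro holo_on_diff holo_on_subset[OF hol] holo_on_subset[OF holg] subW WD)
  qed (use g_edge in simp)
  show ?thesis
    by (rule that[OF holg]) (use g_edge g_wedge in auto)
qed

section \<open>Strict differentiability and a Hopf lemma\<close>

lemma linear_tendsto_imp_uniform:
  fixes f' :: "'x \<Rightarrow> 'a::euclidean_space \<Rightarrow> 'b::real_normed_vector"
  assumes lin: "eventually (\<lambda>x. linear (f' x)) F" and D: "linear D"
    and lim: "\<And>v. ((\<lambda>x. f' x v) \<longlongrightarrow> D v) F" and \<eta>: "\<eta> > 0"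
  shows "eventually (\<lambda>x. \<forall>v. norm (f' x v - D v) \<le> \<eta> * norm v) F"
proof -
  let ?e = "\<eta> / real DIM('a)"
  have e: "?e > 0" using \<eta> by simp
  have "eventually (\<lambda>x. \<forall>b\<in>Basis. dist (f' x b) (D b) < ?e) F"
    by (rule eventually_ball_finite) (use tendstoD[OF lim e] in auto)
  then show ?thesis using lin
  proof eventually_elim
    case (elim x)
    show ?case
    proof
      fix v :: 'a
      have "f' x v - D v = f' x (\<Sum>b\<in>Basis. (v \<bullet> b) *\<^sub>R b) - D (\<Sum>b\<in>Basis. (v \<bullet> b) *\<^sub>R b)"
        by (simp only: euclidean_representation)
      also have "\<dots> = (\<Sum>b\<in>Basis. (v \<bullet> b) *\<^sub>R (f' x b - D b))"
        by (simp add: linear_sum[OF elim(2)] linear_sum[OF D] linear_scale[OF elim(2)] linear_scale[OF D]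
            sum_subtractf scaleR_diff_right)
      also have "norm \<dots> \<le> (\<Sum>b\<in>(Basis::'a set). norm v * ?e)"
      proof (rule sum_norm_le)
        fix b :: 'a assume b: "b \<in> Basis"
        have "\<bar>v \<bullet> b\<bar> * norm (f' x b - D b) \<le> norm v * ?e"
          using elim(1) b Basis_le_norm[OF b, of v] by (intro mult_mono) (auto simp: dist_norm less_imp_le)
        then show "norm ((v \<bullet> b) *\<^sub>R (f' x b - D b)) \<le> norm v * ?e" by simp
      qed
      also have "\<dots> = \<eta> * norm v" by simp
      finally show "norm (f' x v - D v) \<le> \<eta> * norm v" .
    qed
  qed
qed

lemma C1_strictly_differentiable:
  fixes f :: "'a::euclidean_space \<Rightarrow> 'b::real_normed_vector"
  assumes S: "open S" "p \<in> S"
    and f': "\<And>x. x \<in> S \<Longrightarrow> (f has_derivative f' x) (at x)"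
    and cont: "\<And>v. continuous_on S (\<lambda>x. f' x v)" and \<eta>: "\<eta> > 0"
  obtains \<delta> where "\<delta> > 0" "ball p \<delta> \<subseteq> S"
    "\<And>x y. x \<in> ball p \<delta> \<Longrightarrow> y \<in> ball p \<delta> \<Longrightarrow> norm (f y - f x - f' p (y - x)) \<le> \<eta> * norm (y - x)"
proof -
  have lin: "linear (f' x)" if "x \<in> S" for x using f'[OF that] has_derivative_linear by blast
  have "eventually (\<lambda>x. \<forall>v. norm (f' x v - f' p v) \<le> \<eta> * norm v) (at p)"
  proof (rule linear_tendsto_imp_uniform[OF _ lin[OF S(2)] _ \<eta>])
    show "eventually (\<lambda>x. linear (f' x)) (at p)"
      using eventually_at_in_open'[OF S] by eventually_elim (rule lin)
    fix v show "((\<lambda>x. f' x v) \<longlongrightarrow> f' p v) (at p)"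
      using cont[of v] S continuous_on_eq_continuous_at[OF S(1)] isCont_def by blast
  qed
  then obtain \<delta>1 where \<delta>1: "\<delta>1 > 0" "\<And>x. x \<noteq> p \<Longrightarrow> dist x p < \<delta>1 \<Longrightarrow> \<forall>v. norm (f' x v - f' p v) \<le> \<eta> * norm v"
    unfolding eventually_at by blast
  obtain \<delta>2 where \<delta>2: "\<delta>2 > 0" "ball p \<delta>2 \<subseteq> S" using S open_contains_ball by blast
  define \<delta> where "\<delta> = min \<delta>1 \<delta>2"
  show ?thesis
  proof (rule that[of \<delta>])
    show "\<delta> > 0" "ball p \<delta> \<subseteq> S" using \<delta>1 \<delta>2 by (auto simp: \<delta>_def)
    fix x y assume xy: "x \<in> ball p \<delta>" "y \<in> ball p \<delta>"
    have "norm ((\<lambda>z. f z - f' p z) y - (\<lambda>z. f z - f' p z) x) \<le> \<eta> * norm (y - x)"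
    proof (rule differentiable_bound[OF convex_ball _ _ xy(2,1)])
      fix z assume z: "z \<in> ball p \<delta>"
      then have zS: "z \<in> S" using \<open>ball p \<delta> \<subseteq> S\<close> by blast
      show "((\<lambda>z. f z - f' p z) has_derivative (\<lambda>v. f' z v - f' p v)) (at z within ball p \<delta>)"
        by (intro has_derivative_diff has_derivative_at_withinI[OF f'[OF zS]]
            linear_imp_has_derivative lin S)
      show "onorm (\<lambda>v. f' z v - f' p v) \<le> \<eta>"
      proof (rule onorm_le)
        fix v show "norm (f' z v - f' p v) \<le> \<eta> * norm v"
          using \<delta>1(2)[of z] z \<eta> by (cases "z = p") (auto simp: \<delta>_def dist_commute)
      qed
    qed
    then show "norm (f y - f x - f' p (y - x)) \<le> \<eta> * norm (y - x)"
      by (simp add: linear_diff[OF lin[OF S(2)]] algebra_simps)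
  qed
qed

lemma holo_second_order_bound:
  fixes q :: "complex \<Rightarrow> complex ^ 'm"
  assumes S: "open S" "\<zeta> \<in> S" and q: "holo_on q S"
  obtains C r b where "C > 0" "r > 0" "(q has_derivative (\<lambda>h. h *\<^sub>C b)) (at \<zeta>)"
    "\<And>z. cmod z < r \<Longrightarrow> \<zeta> + z \<in> S \<and> norm (q (\<zeta> + z) - q \<zeta> - z *\<^sub>C b) \<le> C * (cmod z)\<^sup>2"
proof -
  let ?q1 = "\<lambda>x. frechet_derivative q (at x) 1"
  define b where "b = ?q1 \<zeta>"
  have dq: "frechet_derivative q (at x) h = h *\<^sub>C ?q1 x" if "x \<in> S" for x h
    using clinearD(2)[OF holo_on_frechet(2)[OF q that], of h 1] by simp
  obtain K where K: "K > 0" "\<And>c (w::complex^'m). norm (c *\<^sub>C w) \<le> norm c * norm w * K"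
    using scaleC.pos_bounded by blast
  have "holo_on ?q1 S" by (rule holo_on_frechet_vec[OF S(1) q])
  then obtain D where D: "(?q1 has_derivative D) (at \<zeta>)" using S(2) holo_onE by blast
  obtain B where B: "B > 0" "\<And>h. norm (D h) \<le> norm h * B"
    using bounded_linear.pos_bounded[OF has_derivative_bounded_linear[OF D]] by blast
  obtain d where d: "d > 0" "\<And>y. norm (y - \<zeta>) < d \<Longrightarrow> norm (?q1 y - ?q1 \<zeta> - D (y - \<zeta>)) \<le> 1 * norm (y - \<zeta>)"
    using D unfolding has_derivative_at_alt by (metis zero_less_one)
  obtain d' where d': "d' > 0" "ball \<zeta> d' \<subseteq> S" using S open_contains_ball by blast
  define r where "r = min d d'"
  have q1: "norm (?q1 y - b) \<le> (B + 1) * norm (y - \<zeta>)" if "norm (y - \<zeta>) < r" for y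
  proof -
    have "norm (?q1 y - b) \<le> norm (?q1 y - ?q1 \<zeta> - D (y - \<zeta>)) + norm (D (y - \<zeta>))"
      unfolding b_def using norm_triangle_ineq[of "?q1 y - ?q1 \<zeta> - D (y - \<zeta>)" "D (y - \<zeta>)"] by simp
    also have "\<dots> \<le> norm (y - \<zeta>) + norm (y - \<zeta>) * B"
      using d(2)[of y] B(2)[of "y - \<zeta>"] that by (simp add: r_def)
    finally show ?thesis by (simp add: algebra_simps)
  qed
  show ?thesis
  proof (rule that[of "(B + 1) * K" r b])
    show "(B + 1) * K > 0" "r > 0" using B K d d' by (auto simp: r_def)
    show "(q has_derivative (\<lambda>h. h *\<^sub>C b)) (at \<zeta>)"
    proof -
      have "frechet_derivative q (at \<zeta>) = (\<lambda>h. h *\<^sub>C b)" unfolding b_def by (rule ext) (rule dq[OF S(2)])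
      then show ?thesis using holo_on_frechet(1)[OF q S(2)] by simp
    qed
    fix z assume z: "cmod z < r"
    define R where "R = ball \<zeta> r \<inter> cball \<zeta> (cmod z)"
    have RS: "R \<subseteq> S" using d' by (auto simp: R_def r_def)
    have mem: "\<zeta> \<in> R" "\<zeta> + z \<in> R" using z d(1) d'(1) by (auto simp: R_def r_def dist_norm)
    have "norm ((\<lambda>x. q x - (x - \<zeta>) *\<^sub>C b) (\<zeta> + z) - (\<lambda>x. q x - (x - \<zeta>) *\<^sub>C b) \<zeta>)
       \<le> ((B + 1) * cmod z * K) * norm (\<zeta> + z - \<zeta>)"
    proof (rule differentiable_bound[where S = R])
      show "convex R" unfolding R_def by (intro convex_Int convex_ball convex_cball)
      fix x assume x: "x \<in> R"
      have dx: "(q has_derivative (\<lambda>h. h *\<^sub>C ?q1 x)) (at x within R)"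
      proof -
        have "frechet_derivative q (at x) = (\<lambda>h. h *\<^sub>C ?q1 x)" using dq x RS by blast
        then show ?thesis using has_derivative_at_withinI[OF holo_on_frechet(1)[OF q]] x RS by (metis subsetD)
      qed
      have "((\<lambda>x. (x - \<zeta>) *\<^sub>C b) has_derivative (\<lambda>h. h *\<^sub>C b)) (at x within R)"
        by (auto intro!: derivative_eq_intros)
      from has_derivative_diff[OF dx this]
      show "((\<lambda>x. q x - (x - \<zeta>) *\<^sub>C b) has_derivative (\<lambda>h. h *\<^sub>C (?q1 x - b))) (at x within R)"
        by (simp add: scaleC_diff_right)
      show "onorm (\<lambda>h. h *\<^sub>C (?q1 x - b)) \<le> (B + 1) * cmod z * K"
      proof (rule onorm_le)
        fix h :: complex
        have "norm (x - \<zeta>) < r" "norm (x - \<zeta>) \<le> cmod z" using x by (auto simp: R_def dist_norm norm_minus_commute)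
        then have "norm (?q1 x - b) \<le> (B + 1) * cmod z"
          using q1[of x] B(1) mult_left_mono[of "norm (x - \<zeta>)" "cmod z" "B + 1"] by linarith
        then have "cmod h * norm (?q1 x - b) * K \<le> cmod h * ((B + 1) * cmod z) * K"
          using K(1) by (intro mult_right_mono mult_left_mono) auto
        then show "norm (h *\<^sub>C (?q1 x - b)) \<le> (B + 1) * cmod z * K * norm h"
          using K(2)[of h "?q1 x - b"] by (simp add: mult_ac)
      qed
    qed (use mem in auto)
    then show "\<zeta> + z \<in> S \<and> norm (q (\<zeta> + z) - q \<zeta> - z *\<^sub>C b) \<le> (B + 1) * K * (cmod z)\<^sup>2"
      using mem RS by (auto simp: power2_eq_square mult_ac algebra_simps)
  qed
qed

lemma plurisubharmonic_unit_circle: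
  assumes psh: "plurisubharmonic_on \<rho> V" and r: "r > 0"
    and V: "\<And>\<zeta>. cmod \<zeta> \<le> r \<Longrightarrow> a + \<zeta> *\<^sub>C b \<in> V"
  shows "(\<lambda>t. \<rho> (a + (of_real r * unit_circle t) *\<^sub>C b)) integrable_on {0..1}"
    "\<rho> a \<le> integral {0..1} (\<lambda>t. \<rho> (a + (of_real r * unit_circle t) *\<^sub>C b))"
proof -
  let ?w = "of_real r *\<^sub>C b" and ?f = "\<lambda>t. \<rho> (a + cis t *s (of_real r *\<^sub>C b))"
  have "a + \<zeta> *s ?w \<in> V" if "cmod \<zeta> \<le> 1" for \<zeta>
    using V[of "\<zeta> * of_real r"] that r by (simp add: scaleC_scaleC norm_mult mult_le_cancel_right1 flip: scaleC_vector_eq)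
  then have f: "?f integrable_on {0..2 * pi}" and le: "\<rho> a \<le> integral {0..2 * pi} ?f / (2 * pi)"
    using psh unfolding plurisubharmonic_on_def by blast+
  have "((\<lambda>t. ?f (2 * pi * t)) has_integral (1 / \<bar>2 * pi\<bar>) *\<^sub>R integral {0..2 * pi} ?f) ((\<lambda>x. x / (2 * pi)) ` {0..2 * pi})"
    by (rule has_integral_stretch_real[OF integrable_integral[OF f]]) simp
  moreover have "(\<lambda>x. x / (2 * pi)) ` {0..2 * pi} = {0..1}"
    using image_affinity_atLeastAtMost_div[of "2 * pi" 0 0 "2 * pi"] by simp
  moreover have "?f (2 * pi * t) = \<rho> (a + (of_real r * unit_circle t) *\<^sub>C b)" for t
    by (simp add: unit_circle_def cis_conv_exp scaleC_scaleC mult_ac flip: scaleC_vector_eq)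
  ultimately have "((\<lambda>t. \<rho> (a + (of_real r * unit_circle t) *\<^sub>C b)) has_integral (1 / (2 * pi)) * integral {0..2 * pi} ?f) {0..1}"
    by simp
  with le show "(\<lambda>t. \<rho> (a + (of_real r * unit_circle t) *\<^sub>C b)) integrable_on {0..1}"
    "\<rho> a \<le> integral {0..1} (\<lambda>t. \<rho> (a + (of_real r * unit_circle t) *\<^sub>C b))"
    by (auto simp: integral_unique has_integral_integrable)
qed

lemma inverse_square_expansion:
  fixes z0 z :: complex
  assumes "z0 \<noteq> 0" "cmod z \<le> cmod z0 / 2"
  shows "1 / (cmod (z0 + z))\<^sup>2 \<ge> 1 / (cmod z0)\<^sup>2 + 2 * Re (cnj (1 / z0) * (1 / (z0 + z) - 1 / z0))
           + (cmod z)\<^sup>2 / (4 * (cmod z0) ^ 4)"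
proof -
  have nz: "z0 + z \<noteq> 0"
  proof
    assume "z0 + z = 0"
    then have "cmod z = cmod z0" by (metis add_eq_0_iff norm_minus_cancel)
    then show False using assms by simp
  qed
  let ?u = "1 / z0" and ?v = "1 / (z0 + z)"
  have "?v - ?u = - z / (z0 * (z0 + z))" using assms(1) nz by (simp add: field_simps)
  then have d: "(cmod (?v - ?u))\<^sup>2 = (cmod z)\<^sup>2 / ((cmod z0)\<^sup>2 * (cmod (z0 + z))\<^sup>2)"
    by (simp add: norm_divide norm_mult power_divide power_mult_distrib)
  have "cmod (z0 + z) \<le> cmod z0 + cmod z" by (rule norm_triangle_ineq)
  also have "\<dots> \<le> 2 * cmod z0" using assms(2) norm_ge_zero[of z0] by linarith
  finally have "(cmod (z0 + z))\<^sup>2 \<le> (2 * cmod z0)\<^sup>2" by (intro power_mono) auto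
  then have "(cmod z0)\<^sup>2 * (cmod (z0 + z))\<^sup>2 \<le> 4 * (cmod z0) ^ 4"
    using mult_left_mono[of "(cmod (z0 + z))\<^sup>2" "(2 * cmod z0)\<^sup>2" "(cmod z0)\<^sup>2"] by (simp add: power_mult_distrib power2_eq_square power4_eq_xxxx)
  then have "(cmod z)\<^sup>2 / (4 * (cmod z0) ^ 4) \<le> (cmod (?v - ?u))\<^sup>2"
    unfolding d using assms(1) nz by (intro divide_left_mono) auto
  moreover have "(cmod v)\<^sup>2 = (cmod u)\<^sup>2 + 2 * Re (cnj u * (v - u)) + (cmod (v - u))\<^sup>2" for u v
    unfolding cmod_power2 by (simp add: power2_eq_square algebra_simps)
  from this[of ?v ?u] have "(cmod ?v)\<^sup>2 = (cmod ?u)\<^sup>2 + 2 * Re (cnj ?u * (?v - ?u)) + (cmod (?v - ?u))\<^sup>2" .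
  ultimately show ?thesis by (simp add: norm_divide power_divide)
qed

lemma Re_of_real_mult: "Re (of_real c * z) = c * Re z"
  by simp

text \<open>
  Plurisubharmonicity controls \<open>\<rho>\<close> only on affine discs.  Replacing \<open>q\<close> by its tangent disc
  \<open>z \<mapsto> a + z b\<close> costs a term whose linear part is harmonic and whose remainder is an arbitrarily small
  multiple of \<open>r^2\<close>, by strict differentiability of \<open>\<rho>\<close>.  The strict subharmonicity of \<open>1 / |x - c|^2\<close>
  dominates this remainder.
\<close>

lemma psh_barrier_no_interior_max:
  fixes q :: "complex \<Rightarrow> complex ^ 'm" and \<rho> :: "complex ^ 'm \<Rightarrow> real"
  assumes S: "open S" "\<zeta> \<in> S" and q: "holo_on q S" "q ` S \<subseteq> V" and V: "open V"
    and \<rho>: "\<And>x. x \<in> V \<Longrightarrow> (\<rho> has_derivative \<rho>' x) (at x)" "\<And>v. continuous_on V (\<lambda>x. \<rho>' x v)"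
    and psh: "plurisubharmonic_on \<rho> V"
    and c: "c \<noteq> \<zeta>" and \<epsilon>: "\<epsilon> > 0"
    and max: "\<And>x. x \<in> S \<Longrightarrow> \<rho> (q x) + \<epsilon> / (cmod (x - c))\<^sup>2 \<le> \<rho> (q \<zeta>) + \<epsilon> / (cmod (\<zeta> - c))\<^sup>2"
  shows False
proof -
  define a where "a = q \<zeta>"
  define z0 where "z0 = \<zeta> - c"
  have z0: "z0 \<noteq> 0" using c by (simp add: z0_def)
  have aV: "a \<in> V" using q(2) S(2) by (auto simp: a_def)
  obtain C r1 b where C: "C > 0" "r1 > 0" and
    qC: "\<And>z. cmod z < r1 \<Longrightarrow> \<zeta> + z \<in> S \<and> norm (q (\<zeta> + z) - q \<zeta> - z *\<^sub>C b) \<le> C * (cmod z)\<^sup>2"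
    using holo_second_order_bound[OF S q(1)] by metis
  \<comment> \<open>half of the quadratic gain \<open>\<epsilon> |z|^2 / (4 |z0|^4)\<close> of the barrier, divided by the constant \<open>C\<close> of the tangent disc\<close>
  define \<eta> where "\<eta> = \<epsilon> / (8 * cmod z0 ^ 4 * C)"
  have \<eta>: "\<eta> > 0" unfolding \<eta>_def using \<epsilon> C z0 by simp
  obtain \<delta> where \<delta>: "\<delta> > 0" "ball a \<delta> \<subseteq> V" "\<And>x y. x \<in> ball a \<delta> \<Longrightarrow> y \<in> ball a \<delta> \<Longrightarrow>
      norm (\<rho> y - \<rho> x - \<rho>' a (y - x)) \<le> \<eta> * norm (y - x)"
    using C1_strictly_differentiable[OF V aV \<rho> \<eta>] by blast
  have lin: "linear (\<rho>' a)" using \<rho>(1)[OF aV] has_derivative_linear by blast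
  have "continuous_on UNIV (\<lambda>z::complex. a + z *\<^sub>C b)" by (intro continuous_intros)
  then have "open ((\<lambda>z. a + z *\<^sub>C b) -` ball a \<delta>)" by (rule open_vimage[OF open_ball])
  moreover have "0 \<in> (\<lambda>z. a + z *\<^sub>C b) -` ball a \<delta>" using \<delta>(1) by simp
  ultimately obtain r2 where r2: "r2 > 0" "ball 0 r2 \<subseteq> (\<lambda>z. a + z *\<^sub>C b) -` ball a \<delta>"
    using open_contains_ball by blast
  have "continuous_on S q" by (rule holo_on_imp_continuous_on[OF q(1)])
  then have "open (S \<inter> q -` ball a \<delta>)" by (intro continuous_open_preimage S open_ball)
  moreover have "\<zeta> \<in> S \<inter> q -` ball a \<delta>" using S(2) \<delta>(1) by (simp add: a_def)
  ultimately obtain r3 where r3: "r3 > 0" "ball \<zeta> r3 \<subseteq> S \<inter> q -` ball a \<delta>"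
    using open_contains_ball by blast
  define r where "r = min (min r1 r2) (min r3 (cmod z0)) / 2"
  have r: "r > 0" "r < r1" "r < r2" "r < r3" "r \<le> cmod z0 / 2" unfolding r_def using C(2) r2(1) r3(1) z0 by auto
  define lam where "lam v = Complex (\<rho>' a v) (- \<rho>' a (\<i> *\<^sub>C v))" for v
  have cl: "clinear lam"
  proof -
    have "\<i> *\<^sub>C \<i> *\<^sub>C v = - v" for v :: "complex ^ 'm" by (simp only: scaleC_scaleC) simp
    then show ?thesis unfolding clinear_i linear_iff lam_def
      using linear_add[OF lin] linear_scale[OF lin] linear_neg[OF lin]
      by (auto simp: complex_eq_iff scaleC_add_right scaleC_scaleR simp del: scaleC_vec_nth)
  qed
  define \<Psi> where "\<Psi> z = lam (q (\<zeta> + z) - a - z *\<^sub>C b) + of_real (2 * \<epsilon>) * (cnj (1 / z0) * (1 / (z0 + z) - 1 / z0))" for z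
  have hol1: "holo_on (\<lambda>z. lam (q (\<zeta> + z) - a - z *\<^sub>C b)) (ball 0 r1)"
  proof (rule holo_on_compose[OF _ holo_on_clinear[OF cl, of UNIV]])
    have "clinear (\<lambda>z. z *\<^sub>C b)"
      unfolding clinear_def linear_iff by (simp add: scaleC_add_left scaleC.scaleR_left scaleC_scaleC)
    then have "holo_on (\<lambda>z. z *\<^sub>C b) (ball 0 r1)" by (rule holo_on_clinear)
    moreover have "holo_on (\<lambda>z. q (\<zeta> + z)) (ball 0 r1)"
      by (rule holo_on_compose[OF holo_on_add[OF holo_on_const holo_on_id] q(1)])
         (rule image_subsetI, use qC in simp)
    ultimately show "holo_on (\<lambda>z. q (\<zeta> + z) - a - z *\<^sub>C b) (ball 0 r1)"
      by (intro holo_on_diff holo_on_const)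
  qed auto
  have nz: "z0 + z \<noteq> 0" if "cmod z < cmod z0" for z
  proof
    assume "z0 + z = 0"
    then have "cmod z = cmod z0" by (metis add_eq_0_iff norm_minus_cancel)
    then show False using that by simp
  qed
  have sub: "cball 0 r \<subseteq> ball 0 r1" using r by auto
  have hol\<Psi>: "\<Psi> holomorphic_on cball 0 r"
    unfolding \<Psi>_def
  proof (intro holomorphic_intros)
    show "(\<lambda>z. lam (q (\<zeta> + z) - a - z *\<^sub>C b)) holomorphic_on cball 0 r"
    proof -
      have "0 + z *\<^sub>C (1::complex) \<in> ball 0 r1" if "z \<in> cball 0 r" for z using that r(2) by simp
      from line_holo_holomorphic_on[OF holo_on_imp_line_holo[OF hol1], where A = "cball 0 r", OF this]
      show ?thesis by simp
    qed
    show "z0 + z \<noteq> 0" if "z \<in> cball 0 r" for z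
      using that r z0 by (intro nz) auto
  qed
  have \<Psi>0: "\<Psi> 0 = 0" using linear_0[OF clinearD(1)[OF cl]] by (simp add: \<Psi>_def a_def)
  let ?z = "\<lambda>t. of_real r * unit_circle t"
  have nz': "cmod (?z t) = r" for t using r(1) by (simp add: norm_mult)
  have cont\<Psi>: "continuous_on {0..1} (\<lambda>t. \<Psi> (?z t))"
    by (rule continuous_on_compose2[OF holomorphic_on_imp_continuous_on[OF hol\<Psi>]])
       (use nz' in \<open>auto intro!: continuous_intros\<close>)
  have "integral {0..1} (\<lambda>t. \<Psi> (0 + ?z t)) = \<Psi> 0"
    by (rule mean_value_unit_circle[OF holomorphic_on_imp_continuous_on[OF hol\<Psi>]
          holomorphic_on_subset[OF hol\<Psi> ball_subset_cball] r(1)])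
  then have int\<Psi>: "((\<lambda>t. \<Psi> (?z t)) has_integral 0) {0..1}"
    using integrable_integral[OF integrable_continuous_interval[OF cont\<Psi>]] \<Psi>0 by simp
  have intRe: "((\<lambda>t. Re (\<Psi> (?z t))) has_integral 0) {0..1}"
    using has_integral_linear[OF int\<Psi> bounded_linear_Re] by (simp add: o_def)
  define g where "g = \<epsilon> / (8 * cmod z0 ^ 4) * r\<^sup>2"
  have g: "g > 0" unfolding g_def using \<epsilon> z0 r by simp
  have pt: "\<rho> (a + ?z t *\<^sub>C b) \<le> \<rho> a - g - Re (\<Psi> (?z t))" for t
  proof -
    define z where "z = ?z t"
    have zr: "cmod z = r" using nz' by (simp add: z_def)
    define y where "y = a + z *\<^sub>C b"
    define y' where "y' = q (\<zeta> + z)"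
    have yb: "y \<in> ball a \<delta>" using r2(2) zr r by (auto simp: y_def)
    have y'b: "y' \<in> ball a \<delta>" using r3(2) zr r by (auto simp: y'_def dist_norm subset_iff)
    have zS: "\<zeta> + z \<in> S" and dy: "norm (y' - y) \<le> C * r\<^sup>2"
      using qC[of z] zr r by (auto simp: y'_def y_def a_def algebra_simps)
    have "\<eta> * norm (y' - y) \<le> \<eta> * (C * r\<^sup>2)" using dy \<eta> by (intro mult_left_mono) auto
    also have "\<dots> = g" unfolding \<eta>_def g_def using C by simp
    finally have 1: "\<rho> y \<le> \<rho> y' - \<rho>' a (y' - y) + g"
      using \<delta>(3)[OF yb y'b] by (simp add: abs_le_iff)
    have 2: "\<rho> y' + \<epsilon> / (cmod (z0 + z))\<^sup>2 \<le> \<rho> a + \<epsilon> / (cmod z0)\<^sup>2"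
      using max[OF zS] by (simp add: y'_def a_def z0_def algebra_simps)
    have "\<epsilon> * (1 / (cmod (z0 + z))\<^sup>2) \<ge> \<epsilon> * (1 / (cmod z0)\<^sup>2 + 2 * Re (cnj (1 / z0) * (1 / (z0 + z) - 1 / z0))
           + r\<^sup>2 / (4 * (cmod z0) ^ 4))"
      using inverse_square_expansion[OF z0, of z] zr r(5) \<epsilon> by (intro mult_left_mono) auto
    also have "\<epsilon> * (1 / (cmod z0)\<^sup>2 + 2 * Re (cnj (1 / z0) * (1 / (z0 + z) - 1 / z0)) + r\<^sup>2 / (4 * (cmod z0) ^ 4))
      = \<epsilon> / (cmod z0)\<^sup>2 + 2 * \<epsilon> * Re (cnj (1 / z0) * (1 / (z0 + z) - 1 / z0)) + 2 * g"
      unfolding g_def by (simp add: algebra_simps)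
    finally have 3: "\<epsilon> / (cmod z0)\<^sup>2 + 2 * \<epsilon> * Re (cnj (1 / z0) * (1 / (z0 + z) - 1 / z0)) + 2 * g \<le> \<epsilon> / (cmod (z0 + z))\<^sup>2"
      by simp
    have "y' - y = q (\<zeta> + z) - a - z *\<^sub>C b" by (simp add: y'_def y_def)
    then have "Re (\<Psi> z) = \<rho>' a (y' - y) + 2 * \<epsilon> * Re (cnj (1 / z0) * (1 / (z0 + z) - 1 / z0))"
      unfolding \<Psi>_def lam_def by (simp only: plus_complex.sel complex.sel Re_of_real_mult)
    then show ?thesis using 1 2 3 unfolding y_def z_def by linarith
  qed
  have disc: "a + \<zeta>' *\<^sub>C b \<in> V" if "cmod \<zeta>' \<le> r" for \<zeta>'
    using r2(2) that r \<delta>(2) by (auto simp: subset_iff)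
  have mean: "(\<lambda>t. \<rho> (a + ?z t *\<^sub>C b)) integrable_on {0..1}" "\<rho> a \<le> integral {0..1} (\<lambda>t. \<rho> (a + ?z t *\<^sub>C b))"
    by (rule plurisubharmonic_unit_circle[OF psh r(1)], erule disc)+
  have "integral {0..1} (\<lambda>t. \<rho> (a + ?z t *\<^sub>C b)) \<le> integral {0..1} (\<lambda>t. \<rho> a - g - Re (\<Psi> (?z t)))"
    by (rule integral_le[OF mean(1) _ pt])
       (intro integrable_diff integrable_const_ivl, rule has_integral_integrable[OF intRe])
  also have "\<dots> = \<rho> a - g - 0"
  proof (rule integral_unique[OF has_integral_diff[OF _ intRe]])
    show "((\<lambda>t. \<rho> a - g) has_integral \<rho> a - g) {0..1::real}"
      using has_integral_const_real[of "\<rho> a - g" 0 1] by simp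
  qed
  finally show False using mean(2) g by linarith
qed

text \<open>
  Compare \<open>\<rho> \<circ> q\<close> on the annulus \<open>s/2 \<le> |z - s| \<le> s\<close> with \<open>\<epsilon> (1/s^2 - 1/|z - s|^2)\<close>, which vanishes on the
  outer circle and decreases linearly from \<open>0\<close> along the inner normal.  The sum of \<open>\<rho> \<circ> q\<close> and the barrier has no interior
  maximum, so its maximum lies on the two circles.
\<close>

theorem Hopf_psh:
  fixes q :: "complex \<Rightarrow> complex ^ 'm" and \<rho> :: "complex ^ 'm \<Rightarrow> real"
  assumes s: "s > 0"
    and q: "holo_on q (ball (of_real s) s)" and contq: "continuous_on (cball (of_real s) s) q"
    and qV: "q ` cball (of_real s) s \<subseteq> V" and V: "open V"
    and \<rho>: "\<And>x. x \<in> V \<Longrightarrow> (\<rho> has_derivative \<rho>' x) (at x)" "\<And>v. continuous_on V (\<lambda>x. \<rho>' x v)"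
    and psh: "plurisubharmonic_on \<rho> V"
    and neg: "\<And>z. z \<in> cball (of_real s) s \<Longrightarrow> z \<noteq> 0 \<Longrightarrow> \<rho> (q z) < 0" and zero: "\<rho> (q 0) = 0"
  obtains \<kappa> where "\<kappa> > 0" "\<And>t. 0 \<le> t \<Longrightarrow> t \<le> s / 2 \<Longrightarrow> \<rho> (q (of_real t)) \<le> - \<kappa> * t"
proof -
  let ?c = "complex_of_real s"
  have cont\<rho>: "continuous_on V \<rho>"
    using \<rho>(1) has_derivative_continuous continuous_at_imp_continuous_on by blast
  have contu: "continuous_on (cball ?c s) (\<lambda>z. \<rho> (q z))"
    by (rule continuous_on_compose2[OF cont\<rho> contq qV])
  have s0: "z \<noteq> 0" if "dist ?c z < s" for z using that s by auto
  have "\<exists>x\<in>sphere ?c (s/2). \<forall>y\<in>sphere ?c (s/2). \<rho> (q y) \<le> \<rho> (q x)"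
    by (rule continuous_attains_sup[OF compact_sphere])
       (use s in \<open>auto intro!: continuous_on_subset[OF contu]\<close>)
  then obtain x0 where x0: "x0 \<in> sphere ?c (s/2)" "\<And>y. y \<in> sphere ?c (s/2) \<Longrightarrow> \<rho> (q y) \<le> \<rho> (q x0)" by blast
  define m where "m = - \<rho> (q x0)"
  have m: "m > 0" unfolding m_def using neg[of x0] s0[of x0] x0(1) s by simp
  have inner: "\<rho> (q y) \<le> - m" if "dist ?c y = s / 2" for y using x0(2)[of y] that by (simp add: m_def)
  \<comment> \<open>chosen so that \<open>- m + \<epsilon> / (s/2)^2 = \<epsilon> / s^2\<close>: the maximum of the comparison function has the same bound on both circles\<close>
  define \<epsilon> where "\<epsilon> = m * s\<^sup>2 / 3"
  have \<epsilon>: "\<epsilon> > 0" unfolding \<epsilon>_def using m s by simp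
  define A where "A = {z. s / 2 \<le> dist ?c z \<and> dist ?c z \<le> s}"
  define w where "w z = \<rho> (q z) + \<epsilon> / (cmod (z - ?c))\<^sup>2" for z
  have "closed {z. s / 2 \<le> dist ?c z}" by (intro closed_Collect_le continuous_intros)
  then have "compact (cball ?c s \<inter> {z. s / 2 \<le> dist ?c z})" by (rule compact_Int_closed[OF compact_cball])
  moreover have "cball ?c s \<inter> {z. s / 2 \<le> dist ?c z} = A" by (auto simp: A_def)
  ultimately have cA: "compact A" by simp
  have nzA: "cmod (z - ?c) \<noteq> 0" if "z \<in> A" for z using that s by (auto simp: A_def)
  have AB: "A \<subseteq> cball ?c s" by (auto simp: A_def)
  have "continuous_on A w" unfolding w_def
    by (intro continuous_intros continuous_on_subset[OF contu AB]) (use nzA in auto)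
  moreover have "0 \<in> A" using s by (simp add: A_def dist_norm)
  ultimately obtain x1 where x1: "x1 \<in> A" "\<And>y. y \<in> A \<Longrightarrow> w y \<le> w x1"
    using continuous_attains_sup[OF cA] by blast
  have "w x1 \<le> \<epsilon> / s\<^sup>2"
  proof (rule ccontr)
    assume big: "\<not> w x1 \<le> \<epsilon> / s\<^sup>2"
    have "dist ?c x1 \<noteq> s / 2"
    proof
      assume d: "dist ?c x1 = s / 2"
      then have c: "cmod (x1 - ?c) = s / 2" by (simp add: dist_norm norm_minus_commute)
      have "w x1 \<le> - m + \<epsilon> / (s/2)\<^sup>2" unfolding w_def c using inner[OF d] by simp
      also have "\<dots> = \<epsilon> / s\<^sup>2" unfolding \<epsilon>_def using s by (simp add: field_simps power2_eq_square)
      finally show False using big by simp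
    qed
    moreover have "dist ?c x1 \<noteq> s"
    proof
      assume d: "dist ?c x1 = s"
      have "\<rho> (q x1) \<le> 0" using neg[of x1] zero d by (cases "x1 = 0") (auto simp: less_imp_le)
      then show False using big d by (simp add: w_def dist_norm norm_minus_commute)
    qed
    ultimately have d: "s / 2 < dist ?c x1" "dist ?c x1 < s" using x1(1) by (auto simp: A_def)
    define S where "S = ball ?c s \<inter> {z. s / 2 < dist ?c z}"
    have S: "open S" unfolding S_def by (intro open_Int open_ball open_Collect_less continuous_intros)
    have SA: "S \<subseteq> A" by (auto simp: S_def A_def)
    show False
    proof (rule psh_barrier_no_interior_max[OF S _ _ _ V \<rho> psh _ \<epsilon>, of x1 q ?c])
      show "x1 \<in> S" using d by (simp add: S_def)
      show "holo_on q S" by (rule holo_on_subset[OF q]) (auto simp: S_def)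
      show "q ` S \<subseteq> V" using qV SA AB by blast
      show "?c \<noteq> x1" using d s by auto
      fix x assume "x \<in> S"
      then show "\<rho> (q x) + \<epsilon> / (cmod (x - ?c))\<^sup>2 \<le> \<rho> (q x1) + \<epsilon> / (cmod (x1 - ?c))\<^sup>2"
        using x1(2)[of x] SA by (auto simp: w_def)
    qed
  qed
  then have wA: "w z \<le> \<epsilon> / s\<^sup>2" if "z \<in> A" for z using x1(2)[OF that] by simp
  define \<kappa> where "\<kappa> = \<epsilon> / s ^ 3"
  show ?thesis
  proof (rule that[of \<kappa>])
    show "\<kappa> > 0" using \<epsilon> s by (simp add: \<kappa>_def)
    fix t assume t: "0 \<le> t" "t \<le> s / 2"
    have d: "dist ?c (of_real t) = s - t" unfolding dist_norm using t by (simp flip: of_real_diff)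
    then have "of_real t \<in> A" using t by (simp add: A_def)
    from wA[OF this] have "\<rho> (q (of_real t)) \<le> \<epsilon> / s\<^sup>2 - \<epsilon> / (s - t)\<^sup>2"
      using d by (simp add: w_def dist_norm norm_minus_commute)
    also have "\<dots> \<le> - \<kappa> * t"
    proof -
      have st: "s - t > 0" "s - t \<le> s" using t s by auto
      have "(s - t)\<^sup>2 * (s + t) \<le> s ^ 3"
      proof -
        have "(s - t)\<^sup>2 * (s + t) = (s - t) * (s\<^sup>2 - t\<^sup>2)" by (simp add: power2_eq_square algebra_simps)
        also have "\<dots> \<le> s * s\<^sup>2" using st s t by (intro mult_mono) (auto simp: power2_eq_square mult_mono)
        finally show ?thesis by (simp add: power3_eq_cube power2_eq_square)
      qed
      then have "s + t \<le> s ^ 3 / (s - t)\<^sup>2"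
        using pos_le_divide_eq[of "(s - t)\<^sup>2" "s + t" "s ^ 3"] st by (simp add: mult.commute)
      then have "(s + t) / s ^ 3 \<le> 1 / (s - t)\<^sup>2"
        using pos_divide_le_eq[of "s ^ 3" "s + t" "1 / (s - t)\<^sup>2"] s by simp
      moreover have "(s + t) / s ^ 3 = 1 / s\<^sup>2 + t / s ^ 3"
        using s by (simp add: add_divide_distrib power3_eq_cube power2_eq_square)
      ultimately have "1 / s\<^sup>2 + t / s ^ 3 \<le> 1 / (s - t)\<^sup>2" by simp
      from mult_left_mono[OF this, of \<epsilon>] \<epsilon> show ?thesis by (simp add: \<kappa>_def algebra_simps)
    qed
    finally show "\<rho> (q (of_real t)) \<le> - \<kappa> * t" .
  qed
qed

section \<open>One-sided differentiability along a hypersurface\<close>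

text \<open>
  \<open>\<Omega>\<close> is near \<open>p\<close> the side \<open>r < 0\<close> of a \<open>C^1\<close> hypersurface.
\<close>

locale C1_side =
  fixes \<Omega> N :: "'a::euclidean_space set" and r :: "'a \<Rightarrow> real" and r' :: "'a \<Rightarrow> 'a \<Rightarrow> real" and p :: 'a
  assumes open_\<Omega>: "open \<Omega>" and open_N: "open N"
    and deriv: "\<And>x. x \<in> N \<Longrightarrow> (r has_derivative r' x) (at x)"
    and cont_deriv: "\<And>v. continuous_on N (\<lambda>x. r' x v)"
    and side: "\<Omega> \<inter> N = {x \<in> N. r x < 0}"
    and p: "p \<in> N" "r p = 0" and nondegenerate: "\<exists>v. r' p v \<noteq> 0"
begin

lemma linear_r': "linear (r' p)"
  using deriv[OF p(1)] has_derivative_linear by blast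

lemma mem_\<Omega>_iff: "x \<in> N \<Longrightarrow> x \<in> \<Omega> \<longleftrightarrow> r x < 0"
  using side by blast

lemma p_notin: "p \<notin> \<Omega>"
  using mem_\<Omega>_iff[OF p(1)] p(2) by simp

lemma closure_le: assumes "x \<in> closure \<Omega>" "x \<in> N" shows "r x \<le> 0"
proof (rule ccontr)
  assume "\<not> r x \<le> 0"
  have "continuous_on N r" using deriv has_derivative_continuous continuous_at_imp_continuous_on by blast
  then have "open (N \<inter> r -` {0<..})" by (intro continuous_open_preimage open_N) auto
  moreover have "x \<in> N \<inter> r -` {0<..}" using assms \<open>\<not> r x \<le> 0\<close> by simp
  ultimately have "\<Omega> \<inter> (N \<inter> r -` {0<..}) \<noteq> {}"
    using assms(1) open_Int_closure_eq_empty[of "N \<inter> r -` {0<..}" \<Omega>] by blast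
  then show False using mem_\<Omega>_iff by fastforce
qed

text \<open>
  The direction \<open>\<nu>\<close> is transversal.  Since the boundary is a \<open>C^1\<close> graph, a segment between two points
  of the closure lies in \<open>\<Omega>\<close> after a push along \<open>\<nu>\<close> by its own length.
\<close>

lemma inward:
  obtains \<nu> \<delta> where "r' p \<nu> = -1" "\<delta> > 0" "ball p \<delta> \<subseteq> N"
    "\<And>x1 x2 \<theta>. x1 \<in> closure \<Omega> \<inter> ball p \<delta> \<Longrightarrow> x2 \<in> closure \<Omega> \<inter> ball p \<delta> \<Longrightarrow> x1 \<noteq> x2 \<Longrightarrow> 0 \<le> \<theta> \<Longrightarrow> \<theta> \<le> 1 \<Longrightarrow>
       x1 + \<theta> *\<^sub>R (x2 - x1) + norm (x2 - x1) *\<^sub>R \<nu> \<in> \<Omega>"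
    "\<And>x t. x \<in> closure \<Omega> \<inter> ball p \<delta> \<Longrightarrow> 0 < t \<Longrightarrow> t < 2 * \<delta> \<Longrightarrow> x + t *\<^sub>R \<nu> \<in> \<Omega>"
proof -
  note lin = linear_r'
  obtain v where v: "r' p v \<noteq> 0" using nondegenerate by blast
  define \<nu> where "\<nu> = (- 1 / r' p v) *\<^sub>R v"
  have \<nu>: "r' p \<nu> = -1" unfolding \<nu>_def linear_scale[OF lin] using v by simp
  let ?\<eta> = "1 / (4 * (1 + norm \<nu>))"
  have pos: "1 + norm \<nu> > 0" by (simp add: add_pos_nonneg)
  then have \<eta>: "?\<eta> > 0" by simp
  have \<eta>\<nu>: "?\<eta> * (1 + norm \<nu>) = 1 / 4" using pos by (simp add: field_simps)
  obtain \<delta>0 where \<delta>0: "\<delta>0 > 0" "ball p \<delta>0 \<subseteq> N" and sd: "\<And>x y. x \<in> ball p \<delta>0 \<Longrightarrow> y \<in> ball p \<delta>0 \<Longrightarrow>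
      norm (r y - r x - r' p (y - x)) \<le> ?\<eta> * norm (y - x)"
    using C1_strictly_differentiable[OF open_N p(1) deriv cont_deriv \<eta>] by blast
  define \<delta> where "\<delta> = \<delta>0 / (2 * (1 + norm \<nu>))"
  have \<delta>: "\<delta> > 0" unfolding \<delta>_def using \<delta>0(1) pos by simp
  have "2 * (\<delta>0 / (2 * M)) * M = \<delta>0" if "M > 0" for M :: real using that by simp
  from this[OF pos] have \<delta>\<delta>0: "2 * \<delta> * (1 + norm \<nu>) = \<delta>0" unfolding \<delta>_def .
  then have "2 * \<delta> + 2 * \<delta> * norm \<nu> = \<delta>0" by (simp add: algebra_simps)
  then have le: "\<delta> \<le> \<delta>0" using \<delta> mult_nonneg_nonneg[of "2 * \<delta>" "norm \<nu>"] norm_ge_zero[of \<nu>] by linarith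
  have far: "x + t *\<^sub>R \<nu> \<in> ball p \<delta>0" if "x \<in> ball p \<delta>" "0 \<le> t" "t < 2 * \<delta>" for x t
  proof -
    have "dist p (x + t *\<^sub>R \<nu>) \<le> dist p x + t * norm \<nu>"
      using norm_triangle_ineq4[of "p - x" "t *\<^sub>R \<nu>"] that by (simp add: dist_norm diff_diff_eq)
    also have "\<dots> < \<delta> + 2 * \<delta> * norm \<nu>"
      using that mult_right_mono[of t "2 * \<delta>" "norm \<nu>"] by simp
    also have "\<dots> \<le> \<delta>0" using \<open>2 * \<delta> + 2 * \<delta> * norm \<nu> = \<delta>0\<close> \<delta> by linarith
    finally show ?thesis by simp
  qed
  have push: "x + t *\<^sub>R \<nu> \<in> \<Omega>" if x: "x \<in> ball p \<delta>" "0 < t" "t < 2 * \<delta>" and rx: "r x \<le> t / 2" for x t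
  proof -
    have xb: "x \<in> ball p \<delta>0" using x(1) le by auto
    have yb: "x + t *\<^sub>R \<nu> \<in> ball p \<delta>0" by (rule far) (use x in auto)
    have "r (x + t *\<^sub>R \<nu>) - r x + t \<le> ?\<eta> * (t * norm \<nu>)"
      using sd[OF xb yb] x(2) \<nu> by (simp add: linear_scale[OF lin] abs_le_iff del: divide_divide_eq_left)
    also have "\<dots> = t * (?\<eta> * norm \<nu>)" by simp
    also have "\<dots> \<le> t * (1 / 4)" using \<eta>\<nu> \<eta> x(2) by (intro mult_left_mono) (auto simp: algebra_simps)
    finally have "r (x + t *\<^sub>R \<nu>) < 0" using rx x(2) by linarith
    then show ?thesis using yb \<delta>0(2) side by auto
  qed
  show ?thesis
  proof (rule that[OF \<nu> \<delta>])
    show bN: "ball p \<delta> \<subseteq> N" using \<delta>0(2) le by auto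
    show "x + t *\<^sub>R \<nu> \<in> \<Omega>" if "x \<in> closure \<Omega> \<inter> ball p \<delta>" "0 < t" "t < 2 * \<delta>" for x t
      by (rule push) (use that closure_le[of x] bN in auto)
    fix x1 x2 \<theta> assume x1: "x1 \<in> closure \<Omega> \<inter> ball p \<delta>" and x2: "x2 \<in> closure \<Omega> \<inter> ball p \<delta>"
      and ne: "x1 \<noteq> x2" and \<theta>: "0 \<le> \<theta>" "\<theta> \<le> (1::real)"
    define d where "d = norm (x2 - x1)"
    have d: "d > 0" using ne by (simp add: d_def)
    have "d \<le> dist p x1 + dist p x2" unfolding d_def dist_norm
      using norm_triangle_ineq4[of "p - x1" "p - x2"] by (simp add: algebra_simps)
    then have d2: "d < 2 * \<delta>" using x1 x2 by auto
    define z where "z = x1 + \<theta> *\<^sub>R (x2 - x1)"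
    have "z = (1 - \<theta>) *\<^sub>R x1 + \<theta> *\<^sub>R x2" by (simp add: z_def algebra_simps)
    then have zb: "z \<in> ball p \<delta>"
      using convexD[OF convex_ball, of x1 p \<delta> x2 "1 - \<theta>" \<theta>] x1 x2 \<theta> by auto
    have r12: "r x1 \<le> 0" "r x2 \<le> 0" using closure_le x1 x2 bN by auto
    have zx1: "z - x1 = \<theta> *\<^sub>R (x2 - x1)" and zx2: "z - x2 = (- (1 - \<theta>)) *\<^sub>R (x2 - x1)"
      by (simp_all add: z_def algebra_simps)
    define m where "m = r' p (x2 - x1)"
    have "r z - r x1 - \<theta> * m \<le> ?\<eta> * (\<theta> * d)"
      using sd[of x1 z] x1 zb le \<theta> unfolding zx1 linear_scale[OF lin] m_def[symmetric]
      by (auto simp: d_def abs_le_iff)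
    then have 1: "r z \<le> \<theta> * m + ?\<eta> * (\<theta> * d)" using r12 by linarith
    have "r z - r x2 - (\<theta> - 1) * m \<le> ?\<eta> * ((1 - \<theta>) * d)"
      using sd[of x2 z] x2 zb le \<theta> unfolding zx2 linear_scale[OF lin] m_def[symmetric]
      by (auto simp: d_def abs_le_iff)
    then have 2: "r z \<le> - (1 - \<theta>) * m + ?\<eta> * ((1 - \<theta>) * d)" using r12 by (simp add: algebra_simps)
    have "r z = (1 - \<theta>) * r z + \<theta> * r z" by (simp add: algebra_simps)
    also have "\<dots> \<le> (1 - \<theta>) * (\<theta> * m + ?\<eta> * (\<theta> * d)) + \<theta> * (- (1 - \<theta>) * m + ?\<eta> * ((1 - \<theta>) * d))"
      using 1 2 \<theta> by (intro add_mono mult_left_mono) auto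
    also have "\<dots> = (2 * \<theta> * (1 - \<theta>)) * (?\<eta> * d)" by (simp add: algebra_simps)
    also have "\<dots> \<le> 1 * (?\<eta> * d)"
    proof (rule mult_right_mono)
      have "0 \<le> (\<theta> - (1 - \<theta>))\<^sup>2" by simp
      then show "2 * \<theta> * (1 - \<theta>) \<le> 1" using \<theta> by (simp add: power2_eq_square algebra_simps)
    qed (use \<eta> d in auto)
    also have "\<dots> \<le> 1 / 4 * d"
    proof -
      have "?\<eta> \<le> 1 / 4" using pos by (simp add: field_simps)
      from mult_right_mono[OF this, of d] show ?thesis using d by (simp only: less_imp_le mult_1_left)
    qed
    finally have "r z \<le> d / 2" using d by simp
    from push[OF zb d d2 this] show "x1 + \<theta> *\<^sub>R (x2 - x1) + norm (x2 - x1) *\<^sub>R \<nu> \<in> \<Omega>"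
      by (simp add: z_def d_def)
  qed
qed

text \<open>
  Two points of the closure are joined inside \<open>\<Omega>\<close> by two legs along \<open>\<nu>\<close> and the pushed segment; the
  length of this path is bounded by a multiple of their distance, and along it the derivative is uniformly close to \<open>D\<close>.
  The mean value inequality on the three pieces gives the estimate.
\<close>

lemma one_sided_strictly_differentiable:
  fixes h :: "'a \<Rightarrow> 'b::euclidean_space"
  assumes \<beta>: "\<beta> > 0" and cont: "continuous_on (closure \<Omega> \<inter> ball p \<beta>) h"
    and h': "\<And>x. x \<in> \<Omega> \<inter> ball p \<beta> \<Longrightarrow> (h has_derivative h' x) (at x)"
    and lim: "\<And>v. ((\<lambda>x. h' x v) \<longlongrightarrow> D v) (at p within \<Omega>)" and D: "linear D" and \<eta>: "\<eta> > 0"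
  obtains \<delta> where "\<delta> > 0"
    "\<And>x1 x2. x1 \<in> closure \<Omega> \<inter> ball p \<delta> \<Longrightarrow> x2 \<in> closure \<Omega> \<inter> ball p \<delta> \<Longrightarrow>
       norm (h x2 - h x1 - D (x2 - x1)) \<le> \<eta> * norm (x2 - x1)"
    "\<And>x v. x \<in> \<Omega> \<inter> ball p \<delta> \<Longrightarrow> norm (h' x v - D v) \<le> \<eta> * norm v"
proof -
  obtain \<nu> \<delta>0 where \<nu>: "r' p \<nu> = -1" and \<delta>0: "\<delta>0 > 0" "ball p \<delta>0 \<subseteq> N"
    and mid: "\<And>x1 x2 \<theta>. x1 \<in> closure \<Omega> \<inter> ball p \<delta>0 \<Longrightarrow> x2 \<in> closure \<Omega> \<inter> ball p \<delta>0 \<Longrightarrow> x1 \<noteq> x2 \<Longrightarrow> 0 \<le> \<theta> \<Longrightarrow> \<theta> \<le> 1 \<Longrightarrow>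
       x1 + \<theta> *\<^sub>R (x2 - x1) + norm (x2 - x1) *\<^sub>R \<nu> \<in> \<Omega>"
    and leg: "\<And>x t. x \<in> closure \<Omega> \<inter> ball p \<delta>0 \<Longrightarrow> 0 < t \<Longrightarrow> t < 2 * \<delta>0 \<Longrightarrow> x + t *\<^sub>R \<nu> \<in> \<Omega>"
    using inward by blast
  have pos: "1 + norm \<nu> > 0" by (simp add: add_pos_nonneg)
  define \<eta>1 where "\<eta>1 = \<eta> / (1 + 2 * norm \<nu>)"
  have pos2: "1 + 2 * norm \<nu> > 0" by (simp add: add_pos_nonneg)
  have \<eta>1: "\<eta>1 > 0" unfolding \<eta>1_def using \<eta> pos2 by simp
  have \<eta>1\<eta>: "\<eta>1 \<le> \<eta>" unfolding \<eta>1_def using \<eta> pos2 by (simp add: divide_le_eq)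
  have "eventually (\<lambda>x. \<forall>v. norm (h' x v - D v) \<le> \<eta>1 * norm v) (at p within \<Omega>)"
  proof (rule linear_tendsto_imp_uniform[OF _ D lim \<eta>1])
    show "eventually (\<lambda>x. linear (h' x)) (at p within \<Omega>)"
      unfolding eventually_at
    proof (intro exI[of _ \<beta>] conjI \<beta> ballI impI)
      fix x assume "x \<in> \<Omega>" "x \<noteq> p \<and> dist x p < \<beta>"
      then show "linear (h' x)" using h'[of x] has_derivative_linear by (auto simp: dist_commute)
    qed
  qed
  then obtain \<delta>1 where \<delta>1: "\<delta>1 > 0" "\<And>x. x \<in> \<Omega> \<Longrightarrow> x \<noteq> p \<Longrightarrow> dist x p < \<delta>1 \<Longrightarrow> \<forall>v. norm (h' x v - D v) \<le> \<eta>1 * norm v"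
    unfolding eventually_at by blast
  define \<delta>2 where "\<delta>2 = min \<beta> \<delta>1"
  have \<delta>2: "\<delta>2 > 0" using \<beta> \<delta>1 by (simp add: \<delta>2_def)
  define \<delta> where "\<delta> = min \<delta>0 (\<delta>2 / (2 * (1 + norm \<nu>)))"
  have \<delta>: "\<delta> > 0" "\<delta> \<le> \<delta>0" unfolding \<delta>_def using \<delta>0 \<delta>2 pos by auto
  have "\<delta> * (2 * (1 + norm \<nu>)) \<le> \<delta>2"
    using pos by (simp add: \<delta>_def flip: pos_le_divide_eq)
  then have \<delta>\<nu>: "2 * \<delta> + 2 * \<delta> * norm \<nu> \<le> \<delta>2" by (simp add: algebra_simps)
  have \<delta>\<delta>2: "\<delta> \<le> \<delta>2" using \<delta>\<nu> \<delta>(1) mult_nonneg_nonneg[of "2 * \<delta>" "norm \<nu>"] norm_ge_zero[of \<nu>] by linarith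
  have far: "x + t *\<^sub>R \<nu> \<in> ball p \<delta>2" if "x \<in> ball p \<delta>" "0 \<le> t" "t < 2 * \<delta>" for x t
  proof -
    have "dist p (x + t *\<^sub>R \<nu>) \<le> dist p x + t * norm \<nu>"
      using norm_triangle_ineq4[of "p - x" "t *\<^sub>R \<nu>"] that by (simp add: dist_norm diff_diff_eq)
    also have "\<dots> < \<delta> + 2 * \<delta> * norm \<nu>"
      using that mult_right_mono[of t "2 * \<delta>" "norm \<nu>"] by simp
    also have "\<dots> \<le> \<delta>2" using \<delta>\<nu> \<delta> by linarith
    finally show ?thesis by simp
  qed
  have bound: "norm (h' x v - D v) \<le> \<eta>1 * norm v" if "x \<in> \<Omega> \<inter> ball p \<delta>2" for x v
    using \<delta>1(2)[of x] that p_notin by (auto simp: \<delta>2_def dist_commute)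
  define k where "k x = h x - D x" for x
  have path: "norm (k (x + w) - k x) \<le> \<eta>1 * norm w"
    if seg: "\<And>t. 0 \<le> t \<Longrightarrow> t \<le> 1 \<Longrightarrow> x + t *\<^sub>R w \<in> closure \<Omega> \<inter> ball p \<delta>2"
      and seg': "\<And>t. 0 < t \<Longrightarrow> t < 1 \<Longrightarrow> x + t *\<^sub>R w \<in> \<Omega>" for x w
  proof -
    let ?f = "\<lambda>t. k (x + t *\<^sub>R w)"
    have "\<exists>t\<in>{0<..<1}. norm (?f 1 - ?f 0) \<le> norm ((\<lambda>s. h' (x + t *\<^sub>R w) (s *\<^sub>R w) - D (s *\<^sub>R w)) (1 - 0))"
    proof (rule mvt_general)
      have "continuous_on {0..1} (\<lambda>t. h (x + t *\<^sub>R w))"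
        by (rule continuous_on_compose2[OF cont])
           (use seg in \<open>auto intro!: continuous_intros simp: \<delta>2_def\<close>)
      moreover have "continuous_on {0..1} (\<lambda>t. D (x + t *\<^sub>R w))"
        by (intro linear_continuous_on_compose[OF _ D] continuous_intros)
      ultimately show "continuous_on {0..1} ?f" unfolding k_def by (rule continuous_on_diff)
      fix t :: real assume t: "0 < t" "t < 1"
      have xt: "x + t *\<^sub>R w \<in> \<Omega> \<inter> ball p \<beta>" using seg[of t] seg'[of t] t by (auto simp: \<delta>2_def)
      have l: "((\<lambda>t. x + t *\<^sub>R w) has_derivative (\<lambda>s. s *\<^sub>R w)) (at t)"
        by (auto intro!: derivative_eq_intros)
      show "(?f has_derivative (\<lambda>s. h' (x + t *\<^sub>R w) (s *\<^sub>R w) - D (s *\<^sub>R w))) (at t)"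
        unfolding k_def
        by (intro has_derivative_diff has_derivative_compose[OF l h'[OF xt]]
            has_derivative_compose[OF l linear_imp_has_derivative[OF D]])
    qed simp
    then obtain t where t: "0 < t" "t < 1" "norm (k (x + w) - k x) \<le> norm (h' (x + t *\<^sub>R w) w - D w)" by auto
    have "x + t *\<^sub>R w \<in> \<Omega> \<inter> ball p \<delta>2" using seg[of t] seg'[of t] t by auto
    from t(3) bound[OF this, of w] show ?thesis by linarith
  qed
  have clo: "\<Omega> \<subseteq> closure \<Omega>" by (rule closure_subset)
  have legpath: "norm (k (x + t *\<^sub>R \<nu>) - k x) \<le> \<eta>1 * (t * norm \<nu>)"
    if x: "x \<in> closure \<Omega> \<inter> ball p \<delta>" and t: "0 < t" "t < 2 * \<delta>" for x t
  proof -
    have "norm (k (x + t *\<^sub>R \<nu>) - k x) \<le> \<eta>1 * norm (t *\<^sub>R \<nu>)"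
    proof (rule path)
      fix s :: real assume s: "0 \<le> s" "s \<le> 1"
      have "s * t \<le> t" using s t by (intro mult_left_le_one_le) auto
      moreover have "0 \<le> s * t" using s t by simp
      ultimately have st: "0 \<le> s * t" "s * t < 2 * \<delta>" using t by linarith+
      have "x + (s * t) *\<^sub>R \<nu> \<in> closure \<Omega>"
      proof (cases "s * t = 0")
        case True show ?thesis unfolding True using x by simp
      next
        case False
        then have "0 < s * t" using st(1) by linarith
        then show ?thesis using leg[of x "s * t"] x st(2) \<delta>(2) clo by auto
      qed
      then show "x + s *\<^sub>R (t *\<^sub>R \<nu>) \<in> closure \<Omega> \<inter> ball p \<delta>2" using far[of x "s * t"] x st by auto
    next
      fix s :: real assume s: "0 < s" "s < 1"
      have "s * t \<le> t" using s t by (intro mult_left_le_one_le) auto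
      moreover have "0 < s * t" using s t by simp
      ultimately have st: "0 < s * t" "s * t < 2 * \<delta>" using t by linarith+
      show "x + s *\<^sub>R (t *\<^sub>R \<nu>) \<in> \<Omega>" using leg[of x "s * t"] x st \<delta>(2) by auto
    qed
    then show ?thesis using t by simp
  qed
  show ?thesis
  proof (rule that[OF \<delta>(1)])
    show "norm (h' x v - D v) \<le> \<eta> * norm v" if "x \<in> \<Omega> \<inter> ball p \<delta>" for x v
      using bound[of x v] that \<delta>\<delta>2 mult_right_mono[OF \<eta>1\<eta>, of "norm v"] by (auto intro: order_trans)
    fix x1 x2 assume x1: "x1 \<in> closure \<Omega> \<inter> ball p \<delta>" and x2: "x2 \<in> closure \<Omega> \<inter> ball p \<delta>"
    show "norm (h x2 - h x1 - D (x2 - x1)) \<le> \<eta> * norm (x2 - x1)"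
    proof (cases "x1 = x2")
      case True then show ?thesis using linear_0[OF D] by simp
    next
      case False
      define d where "d = norm (x2 - x1)"
      have d: "d > 0" using False by (simp add: d_def)
      have "d \<le> dist p x1 + dist p x2" unfolding d_def dist_norm
        using norm_triangle_ineq4[of "p - x1" "p - x2"] by (simp add: algebra_simps)
      then have d2: "d < 2 * \<delta>" using x1 x2 by auto
      let ?a1 = "x1 + d *\<^sub>R \<nu>" and ?a2 = "x2 + d *\<^sub>R \<nu>"
      have midpath: "norm (k (?a1 + (x2 - x1)) - k ?a1) \<le> \<eta>1 * norm (x2 - x1)"
      proof (rule path)
        have in\<Omega>: "?a1 + t *\<^sub>R (x2 - x1) \<in> \<Omega>" if "0 \<le> t" "t \<le> 1" for t
          using mid[of x1 x2 t] x1 x2 False that \<delta>(2) by (auto simp: d_def algebra_simps)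
        then show "?a1 + t *\<^sub>R (x2 - x1) \<in> \<Omega>" if "0 < t" "t < 1" for t using that by simp
        fix t :: real assume t: "0 \<le> t" "t \<le> 1"
        have "x1 + t *\<^sub>R (x2 - x1) = (1 - t) *\<^sub>R x1 + t *\<^sub>R x2" by (simp add: algebra_simps)
        then have "x1 + t *\<^sub>R (x2 - x1) \<in> ball p \<delta>"
          using convexD[OF convex_ball, of x1 p \<delta> x2 "1 - t" t] x1 x2 t by auto
        from far[OF this, of d] d d2 have "?a1 + t *\<^sub>R (x2 - x1) \<in> ball p \<delta>2" by (simp add: algebra_simps)
        then show "?a1 + t *\<^sub>R (x2 - x1) \<in> closure \<Omega> \<inter> ball p \<delta>2" using in\<Omega>[OF t] clo by auto
      qed
      have "?a1 + (x2 - x1) = ?a2" by simp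
      have "k x2 - k x1 = (k ?a1 - k x1) + ((k ?a2 - k ?a1) + (k x2 - k ?a2))" by simp
      also have "norm \<dots> \<le> norm (k ?a1 - k x1) + (norm (k ?a2 - k ?a1) + norm (k x2 - k ?a2))"
        by (intro norm_triangle_mono norm_triangle_ineq order_refl)
      also have "\<dots> \<le> \<eta>1 * (d * norm \<nu>) + (\<eta>1 * d + \<eta>1 * (d * norm \<nu>))"
      proof (intro add_mono)
        show "norm (k ?a1 - k x1) \<le> \<eta>1 * (d * norm \<nu>)" by (rule legpath[OF x1 d d2])
        show "norm (k x2 - k ?a2) \<le> \<eta>1 * (d * norm \<nu>)"
          by (subst norm_minus_commute) (rule legpath[OF x2 d d2])
        show "norm (k ?a2 - k ?a1) \<le> \<eta>1 * d"
          using midpath by (simp only: \<open>?a1 + (x2 - x1) = ?a2\<close> d_def[symmetric])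
      qed
      also have "\<dots> = \<eta>1 * (1 + 2 * norm \<nu>) * d" by (simp add: algebra_simps)
      also have "\<dots> = \<eta> * d" unfolding \<eta>1_def using pos2 by simp
      finally have "norm (k x2 - k x1) \<le> \<eta> * norm (x2 - x1)" by (simp only: d_def)
      moreover have "k x2 - k x1 = h x2 - h x1 - D (x2 - x1)"
        by (simp add: k_def linear_diff[OF D])
      ultimately show ?thesis by (simp only:)
    qed
  qed
qed

end

section \<open>Half-dimensional submanifolds\<close>

lemma subspace_half_dim_equations:
  fixes L :: "(complex ^ 'n) set"
  assumes L: "subspace L" "dim L = CARD('n)"
  obtains \<beta> :: "'n \<Rightarrow> complex ^ 'n" where "\<And>x. x \<in> L \<longleftrightarrow> (\<forall>j. x \<bullet> \<beta> j = 0)"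
proof -
  let ?C = "{y. \<forall>x\<in>L. orthogonal x y}"
  have "dim {y \<in> UNIV. \<forall>x\<in>L. orthogonal x y} + dim L = dim (UNIV :: (complex ^ 'n) set)"
    by (rule dim_subspace_orthogonal_to_vectors) (use L in auto)
  then have dC: "dim ?C = CARD('n)" using L(2) by simp
  obtain B where B: "B \<subseteq> ?C" "independent B" "?C \<subseteq> span B" "card B = dim ?C"
    using basis_exists by blast
  have "finite B" using B(2) by (rule independent_imp_finite)
  then obtain \<beta> where \<beta>: "bij_betw \<beta> (UNIV :: 'n set) B"
    using finite_same_card_bij[of "UNIV :: 'n set" B] B(4) dC by auto
  have "x \<in> L" if x: "\<And>j. x \<bullet> \<beta> j = 0" for x
  proof -
    have xB: "orthogonal x y" if "y \<in> B" for y
      using \<beta> that x unfolding bij_betw_def orthogonal_def by blast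
    have "orthogonal x y" if "y \<in> span B" for y
      using orthogonal_to_span[OF that] xB by blast
    then have "x \<in> orthogonal_comp (orthogonal_comp L)"
      using B(3) unfolding orthogonal_comp_def by (auto simp: orthogonal_commute)
    then show ?thesis using orthogonal_comp_self[OF L(1)] by simp
  qed
  moreover have "x \<bullet> \<beta> j = 0" if "x \<in> L" for x j
  proof -
    have "\<beta> j \<in> ?C" using \<beta> B(1) unfolding bij_betw_def by blast
    then show ?thesis using that by (auto simp: orthogonal_def)
  qed
  ultimately show ?thesis using that by blast
qed

lemma subspace_half_dim_basis:
  fixes L :: "(complex ^ 'n) set"
  assumes L: "subspace L" "dim L = CARD('n)"
  obtains b :: "'n \<Rightarrow> complex ^ 'n" where "\<And>x. x \<in> L \<longleftrightarrow> (\<exists>u. x = (\<Sum>j\<in>UNIV. u j *\<^sub>R b j))"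
    "\<And>u j. (\<Sum>j\<in>UNIV. u j *\<^sub>R b j) = 0 \<Longrightarrow> u j = 0"
proof -
  obtain B where B: "B \<subseteq> L" "independent B" "L \<subseteq> span B" "card B = dim L"
    using basis_exists by blast
  have fin: "finite B" using B(2) by (rule independent_imp_finite)
  then obtain b where b: "bij_betw b (UNIV :: 'n set) B"
    using finite_same_card_bij[of "UNIV :: 'n set" B] B(4) L(2) by auto
  have inj: "inj b" and ran: "range b = B" using b by (auto simp: bij_betw_def)
  have sum: "(\<Sum>v\<in>B. c v *\<^sub>R v) = (\<Sum>j\<in>UNIV. c (b j) *\<^sub>R b j)" for c
    using sum.reindex_bij_betw[OF b, of "\<lambda>v. c v *\<^sub>R v"] by simp
  show ?thesis
  proof (rule that[of b])
    fix x
    show "x \<in> L \<longleftrightarrow> (\<exists>u. x = (\<Sum>j\<in>UNIV. u j *\<^sub>R b j))"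
    proof
      assume "x \<in> L"
      then obtain c where "x = (\<Sum>v\<in>B. c v *\<^sub>R v)" using B(3) span_finite[OF fin] by auto
      then show "\<exists>u. x = (\<Sum>j\<in>UNIV. u j *\<^sub>R b j)" using sum[of c] by (intro exI[of _ "\<lambda>j. c (b j)"]) simp
    next
      assume "\<exists>u. x = (\<Sum>j\<in>UNIV. u j *\<^sub>R b j)"
      then show "x \<in> L" using B(1) ran L(1) by (auto intro!: subspace_sum subspace_scale)
    qed
  next
    fix u :: "'n \<Rightarrow> real" and j assume z: "(\<Sum>j\<in>UNIV. u j *\<^sub>R b j) = 0"
    have "(\<Sum>v\<in>B. u (inv b v) *\<^sub>R v) = 0" unfolding sum using z inv_f_f[OF inj] by simp
    from independentD[OF B(2) fin subset_refl this, of "b j"] ran inv_f_f[OF inj] show "u j = 0" by auto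
  qed
qed

text \<open>
  A submanifold whose dimension is half the real dimension is given by as many real equations as
  it has parameters; both families can be indexed by the coordinates of \<open>\<complex>^n\<close>.
\<close>

lemma submanifold_chart:
  fixes M :: "(complex ^ 'n) set"
  assumes M: "submanifold reg CARD('n) M" "p \<in> M"
    and diff: "\<And>f S x. reg f S \<Longrightarrow> open S \<Longrightarrow> x \<in> S \<Longrightarrow> f differentiable (at x)"
  obtains W \<phi> \<phi>' and \<beta> b :: "'n \<Rightarrow> complex ^ 'n" where "open W" "p \<in> W" "reg \<phi> W"
    "(\<phi> has_derivative \<phi>') (at p)"
    "\<And>x. x \<in> W \<Longrightarrow> x \<in> M \<longleftrightarrow> (\<forall>j. \<phi> x \<bullet> \<beta> j = 0)"
    "\<And>v. (\<forall>j. \<phi>' v \<bullet> \<beta> j = 0) \<Longrightarrow> v \<in> tangent_space M p"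
    "\<And>v. (\<forall>j. \<phi>' v \<bullet> \<beta> j = 0) \<longleftrightarrow> (\<exists>u. v = (\<Sum>j\<in>UNIV. u j *\<^sub>R b j))"
    "\<And>u j. (\<Sum>j\<in>UNIV. u j *\<^sub>R b j) = 0 \<Longrightarrow> u j = 0"
proof -
  from M(1)[unfolded submanifold_def, THEN bspec, OF M(2)]
  obtain W \<phi> \<psi> L where A: "open W \<and> p \<in> W \<and> open (\<phi> ` W) \<and> reg \<phi> W \<and> reg \<psi> (\<phi> ` W) \<and>
      (\<forall>x\<in>W. \<psi> (\<phi> x) = x) \<and> subspace L \<and> dim L = CARD('n) \<and> \<phi> ` (W \<inter> M) = \<phi> ` W \<inter> L"
    by (elim exE)
  then have W: "open W" "p \<in> W" "open (\<phi> ` W)" "reg \<phi> W" "reg \<psi> (\<phi> ` W)"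
    and L: "subspace L" "dim L = CARD('n)" and im: "\<phi> ` (W \<inter> M) = \<phi> ` W \<inter> L"
    by simp_all
  have inv: "\<psi> (\<phi> x) = x" if "x \<in> W" for x using A that by simp
  obtain \<beta> :: "'n \<Rightarrow> complex ^ 'n" where \<beta>: "\<And>x. x \<in> L \<longleftrightarrow> (\<forall>j. x \<bullet> \<beta> j = 0)"
    using subspace_half_dim_equations[OF L] by blast
  obtain l :: "'n \<Rightarrow> complex ^ 'n" where l: "\<And>x. x \<in> L \<longleftrightarrow> (\<exists>u. x = (\<Sum>j\<in>UNIV. u j *\<^sub>R l j))"
    "\<And>u j. (\<Sum>j\<in>UNIV. u j *\<^sub>R l j) = 0 \<Longrightarrow> u j = 0"
    using subspace_half_dim_basis[OF L] by blast
  define \<phi>' where "\<phi>' = frechet_derivative \<phi> (at p)"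
  define \<psi>' where "\<psi>' = frechet_derivative \<psi> (at (\<phi> p))"
  have d\<phi>: "(\<phi> has_derivative \<phi>') (at p)"
    unfolding \<phi>'_def using diff[OF W(4,1,2)] frechet_derivative_works by blast
  have d\<psi>: "(\<psi> has_derivative \<psi>') (at (\<phi> p))"
    unfolding \<psi>'_def using diff[OF W(5,3)] W(2) frechet_derivative_works by blast
  have lin\<phi>: "linear \<phi>'" and lin\<psi>: "linear \<psi>'" using d\<phi> d\<psi> has_derivative_linear by blast+
  have \<psi>\<phi>: "\<psi>' (\<phi>' v) = v" for v
  proof -
    have "((\<lambda>x. \<psi> (\<phi> x)) has_derivative (\<lambda>v. \<psi>' (\<phi>' v))) (at p)" by (rule has_derivative_compose[OF d\<phi> d\<psi>])
    moreover have "((\<lambda>x. \<psi> (\<phi> x)) has_derivative (\<lambda>v. v)) (at p)"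
      by (rule has_derivative_transform_within_open[OF has_derivative_ident W(1,2)]) (simp add: inv)
    ultimately show ?thesis using has_derivative_unique by metis
  qed
  have \<phi>\<psi>: "\<phi>' (\<psi>' v) = v" for v
  proof -
    have "inj \<phi>'" using \<psi>\<phi> by (metis injI)
    then have "surj \<phi>'" using lin\<phi> linear_injective_imp_surjective by blast
    then obtain u where "v = \<phi>' u" by (metis surjD)
    then show ?thesis using \<psi>\<phi> by simp
  qed
  have mem: "x \<in> M \<longleftrightarrow> \<phi> x \<in> L" if "x \<in> W" for x
  proof
    assume "\<phi> x \<in> L"
    then have "\<phi> x \<in> \<phi> ` (W \<inter> M)" unfolding im using that by simp
    then obtain x' where x': "x' \<in> W \<inter> M" "\<phi> x = \<phi> x'" by (elim imageE)
    have "x = x'" using inv[OF that] inv[of x'] x' by simp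
    then show "x \<in> M" using x' by simp
  next
    assume "x \<in> M"
    then have "\<phi> x \<in> \<phi> ` W \<inter> L" unfolding im[symmetric] using that by simp
    then show "\<phi> x \<in> L" by simp
  qed
  define b where "b j = \<psi>' (l j)" for j
  have sumb: "(\<Sum>j\<in>UNIV. u j *\<^sub>R b j) = \<psi>' (\<Sum>j\<in>UNIV. u j *\<^sub>R l j)" for u
    unfolding b_def by (simp add: linear_sum[OF lin\<psi>] linear_scale[OF lin\<psi>])
  show ?thesis
  proof (rule that[OF W(1,2,4) d\<phi>, of \<beta> b])
    show "x \<in> M \<longleftrightarrow> (\<forall>j. \<phi> x \<bullet> \<beta> j = 0)" if "x \<in> W" for x using mem[OF that] \<beta> by simp
    show "v \<in> tangent_space M p" if "\<forall>j. \<phi>' v \<bullet> \<beta> j = 0" for v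
    proof -
      have vL: "\<phi>' v \<in> L" using that \<beta> by simp
      have pL: "\<phi> p \<in> L" using mem[OF W(2)] M(2) by simp
      define \<gamma> where "\<gamma> t = \<psi> (\<phi> p + t *\<^sub>R \<phi>' v)" for t
      have "open ((\<lambda>t. \<phi> p + t *\<^sub>R \<phi>' v) -` (\<phi> ` W))"
        by (rule open_vimage[OF W(3)]) (intro continuous_intros)
      moreover have "0 \<in> (\<lambda>t. \<phi> p + t *\<^sub>R \<phi>' v) -` (\<phi> ` W)" using W(2) by simp
      ultimately obtain \<epsilon> where \<epsilon>: "\<epsilon> > 0" "ball 0 \<epsilon> \<subseteq> (\<lambda>t. \<phi> p + t *\<^sub>R \<phi>' v) -` (\<phi> ` W)"
        using open_contains_ball by blast
      have "\<gamma> t \<in> M" if "\<bar>t\<bar> < \<epsilon>" for t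
      proof -
        have "t \<in> ball 0 \<epsilon>" using that by simp
        then obtain x where x: "x \<in> W" "\<phi> p + t *\<^sub>R \<phi>' v = \<phi> x" using \<epsilon>(2) by blast
        have "\<phi> x \<in> L" unfolding x(2)[symmetric] using pL vL L(1) by (intro subspace_add subspace_scale)
        then show ?thesis unfolding \<gamma>_def x(2) using mem[OF x(1)] inv[OF x(1)] by simp
      qed
      moreover have "\<gamma> 0 = p" using inv[OF W(2)] by (simp add: \<gamma>_def)
      moreover have "(\<gamma> has_vector_derivative v) (at 0)"
      proof -
        have l: "((\<lambda>t. \<phi> p + t *\<^sub>R \<phi>' v) has_derivative (\<lambda>s. s *\<^sub>R \<phi>' v)) (at 0)"
          by (auto intro!: derivative_eq_intros)
        have "(\<psi> has_derivative \<psi>') (at (\<phi> p + 0 *\<^sub>R \<phi>' v))" using d\<psi> by simp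
        from has_derivative_compose[OF l this] show ?thesis
          unfolding \<gamma>_def has_vector_derivative_def by (simp add: linear_scale[OF lin\<psi>] \<psi>\<phi>)
      qed
      ultimately show ?thesis unfolding tangent_space_def using \<epsilon>(1) by blast
    qed
    show "(\<forall>j. \<phi>' v \<bullet> \<beta> j = 0) \<longleftrightarrow> (\<exists>u. v = (\<Sum>j\<in>UNIV. u j *\<^sub>R b j))" for v
    proof -
      have "(\<forall>j. \<phi>' v \<bullet> \<beta> j = 0) \<longleftrightarrow> (\<exists>u. \<phi>' v = (\<Sum>j\<in>UNIV. u j *\<^sub>R l j))"
        by (simp only: \<beta>[symmetric] l(1))
      also have "\<dots> \<longleftrightarrow> (\<exists>u. v = (\<Sum>j\<in>UNIV. u j *\<^sub>R b j))"
      proof (intro iff_exI)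
        fix u
        show "\<phi>' v = (\<Sum>j\<in>UNIV. u j *\<^sub>R l j) \<longleftrightarrow> v = (\<Sum>j\<in>UNIV. u j *\<^sub>R b j)"
          unfolding sumb by (metis \<psi>\<phi> \<phi>\<psi>)
      qed
      finally show ?thesis .
    qed
    show "u j = 0" if "(\<Sum>j\<in>UNIV. u j *\<^sub>R b j) = 0" for u j
    proof -
      have "\<phi>' (\<psi>' (\<Sum>j\<in>UNIV. u j *\<^sub>R l j)) = \<phi>' 0" using that unfolding sumb by simp
      then have "(\<Sum>j\<in>UNIV. u j *\<^sub>R l j) = 0" unfolding \<phi>\<psi> linear_0[OF lin\<phi>] .
      then show ?thesis by (rule l(2))
    qed
  qed
qed

text \<open>
  The vectors \<open>b j\<close> form a complex basis of \<open>\<complex>^n\<close> inside the kernel of \<open>\<rho>'\<close>.  A real change of this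
  basis gives \<open>\<rho>'\<close> the same value on all vectors \<open>\<i> b j\<close>, so that the wedge \<open>Im w > 0\<close> points to the
  side where \<open>\<rho>'\<close> is negative.
\<close>

lemma adapted_basis:
  fixes b :: "'n \<Rightarrow> complex ^ 'n" and \<rho>' :: "complex ^ 'n \<Rightarrow> real"
  assumes lin: "linear \<rho>'" and b0: "\<And>j. \<rho>' (b j) = 0"
    and indep: "\<And>w j. (\<Sum>j\<in>UNIV. w j *\<^sub>C b j) = 0 \<Longrightarrow> w j = 0"
    and nz: "\<rho>' v0 \<noteq> 0"
  obtains M :: "complex ^ 'n \<Rightarrow> complex ^ 'n" where "clinear M" "bij M" "\<And>w. \<rho>' (M w) = - (\<Sum>j\<in>UNIV. Im (w $ j))"
    "\<And>j. inv M (b j) \<in> real_points"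
    "\<And>w. w \<in> real_points \<Longrightarrow> \<exists>u. M w = (\<Sum>j\<in>UNIV. u j *\<^sub>R b j)"
proof -
  define B where "B w = (\<Sum>j\<in>UNIV. w $ j *\<^sub>C b j)" for w :: "complex ^ 'n"
  have clB: "clinear B"
    unfolding clinear_def linear_iff B_def
    by (simp add: scaleC_add_left sum.distrib scaleC.scaleR_left scaleR_sum_right scaleC_sum_right scaleC_scaleC)
  have injB: "inj B"
    unfolding linear_injective_0[OF clinearD(1)[OF clB]] B_def using indep by (auto simp: vec_eq_iff)
  have surjB: "surj B" using linear_injective_imp_surjective[OF clinearD(1)[OF clB] injB] by simp
  define d where "d j = \<rho>' (\<i> *\<^sub>C b j)" for j
  have \<rho>B: "\<rho>' (B w) = (\<Sum>j\<in>UNIV. Im (w $ j) * d j)" for w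
  proof -
    have "\<rho>' (w $ j *\<^sub>C b j) = Im (w $ j) * d j" for j
      unfolding scaleC_eq_Re_Im[of "w $ j"] d_def
      by (simp add: linear_add[OF lin] linear_scale[OF lin] b0)
    then show ?thesis by (simp add: B_def linear_sum[OF lin])
  qed
  obtain j0 where j0: "d j0 \<noteq> 0"
  proof -
    obtain w where "v0 = B w" using surjB by (metis surjD)
    then have "(\<Sum>j\<in>UNIV. Im (w $ j) * d j) \<noteq> 0" using nz \<rho>B by simp
    then have "\<exists>j. d j \<noteq> 0" by (metis (no_types, lifting) mult_zero_right sum.neutral)
    then show ?thesis using that by blast
  qed
  define q where "q j = complex_of_real ((1 + d j) / d j0)" for j
  define s where "s w = (\<Sum>j\<in>UNIV. w $ j * q j)" for w :: "complex ^ 'n"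
  define C where "C w = (\<chi> j. w $ j - (if j = j0 then s w else 0))" for w
  define M where "M w = B (C w)" for w
  have s_add: "s (x + y) = s x + s y" and s_scale: "s (c *\<^sub>C x) = c * s x" and s_scaleR: "s (a *\<^sub>R x) = a *\<^sub>R s x" for x y c a
    unfolding s_def sum_distrib_left scaleR_sum_right sum.distrib[symmetric]
    by (simp_all add: algebra_simps)
  have clC: "clinear C"
    unfolding clinear_def linear_iff C_def
    by (auto simp: vec_eq_iff s_add s_scale s_scaleR algebra_simps)
  have clM: "clinear M" unfolding M_def by (rule clinear_compose[OF clC clB])
  have C0: "w = 0" if "C w = 0" for w
  proof -
    have c: "w $ j = (if j = j0 then s w else 0)" for j
      using that by (simp add: C_def vec_eq_iff)
    define S where "S = s w"
    have cS: "w $ j = (if j = j0 then S else 0)" for j using c by (simp add: S_def)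
    have "S = (\<Sum>j\<in>UNIV. w $ j * q j)" by (simp add: S_def s_def)
    also have "\<dots> = (\<Sum>j\<in>UNIV. if j = j0 then S * q j0 else 0)" by (rule sum.cong) (auto simp: cS)
    also have "\<dots> = S * q j0" by simp
    finally have "s w = s w * of_real ((1 + d j0) / d j0)" unfolding S_def q_def .
    moreover have "complex_of_real ((1 + d j0) / d j0) \<noteq> 1"
    proof
      assume "complex_of_real ((1 + d j0) / d j0) = 1"
      then have "(1 + d j0) / d j0 = 1" by (metis of_real_eq_1_iff)
      then show False using j0 by simp
    qed
    ultimately have "s w = 0" by (metis mult_cancel_left1)
    then show ?thesis using c by (simp add: vec_eq_iff)
  qed
  have injM: "inj M"
    unfolding linear_injective_0[OF clinearD(1)[OF clM]]
  proof (intro allI impI)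
    fix w assume "M w = 0"
    then have "C w = 0" unfolding M_def
      using injB linear_injective_0[OF clinearD(1)[OF clB]] by blast
    then show "w = 0" by (rule C0)
  qed
  have bijM: "bij M" using linear_inv_of_inj(1)[OF clinearD(1)[OF clM] injM] .
  show ?thesis
  proof (rule that[OF clM bijM])
    fix w
    have "\<rho>' (M w) = (\<Sum>j\<in>UNIV. Im (w $ j) * d j - (if j = j0 then Im (s w) * d j0 else 0))"
      unfolding M_def \<rho>B C_def by (intro sum.cong) (auto simp: algebra_simps)
    also have "\<dots> = (\<Sum>j\<in>UNIV. Im (w $ j) * d j) - Im (s w) * d j0"
      by (simp add: sum_subtractf)
    also have "Im (s w) * d j0 = (\<Sum>j\<in>UNIV. Im (w $ j) * (1 + d j))"
      unfolding s_def q_def Im_sum sum_distrib_right using j0 by (intro sum.cong) (auto simp del: of_real_divide of_real_add)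
    finally show "\<rho>' (M w) = - (\<Sum>j\<in>UNIV. Im (w $ j))"
      by (simp add: algebra_simps sum.distrib)
  next
    fix j
    define u :: "complex ^ 'n" where "u = (\<chi> i. (if i = j then 1 else 0) - (if i = j0 then of_real (1 + d j) else 0))"
    have "s u = (\<Sum>i\<in>UNIV. (if i = j then of_real ((1 + d j) / d j0) else 0) - (if i = j0 then of_real (1 + d j) * of_real ((1 + d j0) / d j0) else 0))"
      unfolding s_def q_def u_def by (intro sum.cong) (auto simp: algebra_simps)
    also have "\<dots> = of_real ((1 + d j) / d j0) - of_real (1 + d j) * of_real ((1 + d j0) / d j0)"
      by (simp add: sum_subtractf)
    also have "\<dots> = of_real ((1 + d j) / d j0 - (1 + d j) * ((1 + d j0) / d j0))"
      by (simp only: of_real_diff of_real_mult)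
    also have "(1 + d j) / d j0 - (1 + d j) * ((1 + d j0) / d j0) = - (1 + d j)"
      using j0 by (simp add: field_simps)
    finally have su: "s u = of_real (- (1 + d j))" .
    have "C u = (\<chi> i. if i = j then 1 else 0)"
      unfolding C_def su by (auto simp: u_def vec_eq_iff)
    then have "M u = b j"
      unfolding M_def B_def by (simp add: if_distrib[of "\<lambda>c. c *\<^sub>C _"] cong: if_cong)
    then have "inv M (b j) = u" using inv_f_f[OF injM] by metis
    then show "inv M (b j) \<in> real_points" by (simp add: u_def real_points_def)
  next
    fix w :: "complex ^ 'n" assume w: "w \<in> real_points"
    have w': "w $ j = of_real (Re (w $ j))" for j using w by (simp add: real_points_def complex_eq_iff)
    have "s w = of_real (\<Sum>j\<in>UNIV. Re (w $ j) * ((1 + d j) / d j0))"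
      unfolding s_def q_def of_real_sum of_real_mult by (intro sum.cong refl) (metis w')
    then have "C w $ j = of_real (Re (C w $ j))" for j
      using w'[of j] by (auto simp: C_def complex_eq_iff)
    then have "M w = (\<Sum>j\<in>UNIV. Re (C w $ j) *\<^sub>R b j)"
      unfolding M_def B_def by (intro sum.cong refl) (metis scaleC_of_real)
    then show "\<exists>u. M w = (\<Sum>j\<in>UNIV. u j *\<^sub>R b j)" by (rule exI[of _ "\<lambda>j. Re (C w $ j)"])
  qed
qed

text \<open>
  A complex linear relation between \<open>b j\<close> says that a real combination is \<open>\<i>\<close> times another
  one; both then lie in the trivial intersection of the tangent space with its rotation.
\<close>

lemma totally_real_independent:
  fixes b :: "'n \<Rightarrow> complex ^ 'n"
  assumes TR: "tangent_space E p \<inter> (\<lambda>v. \<i> *s v) ` tangent_space E p = {0}"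
    and tan: "\<And>u. (\<Sum>j\<in>UNIV. u j *\<^sub>R b j) \<in> tangent_space E p"
    and indep: "\<And>u j. (\<Sum>j\<in>UNIV. u j *\<^sub>R b j) = 0 \<Longrightarrow> u j = 0"
    and w: "(\<Sum>j\<in>UNIV. w j *\<^sub>C b j) = 0"
  shows "w j = 0"
proof -
  define x where "x = (\<Sum>j\<in>UNIV. Re (w j) *\<^sub>R b j)"
  define y where "y = (\<Sum>j\<in>UNIV. Im (w j) *\<^sub>R b j)"
  have "(\<Sum>j\<in>UNIV. w j *\<^sub>C b j) = x + \<i> *\<^sub>C y"
    unfolding x_def y_def scaleC_sum_right scaleC_scaleR
    by (subst scaleC_eq_Re_Im) (simp add: sum.distrib)
  then have xy: "x = \<i> *\<^sub>C (- y)" using w by (simp add: add_eq_0_iff)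
  have "- y = (\<Sum>j\<in>UNIV. (- Im (w j)) *\<^sub>R b j)" by (simp add: y_def sum_negf)
  then have "- y \<in> tangent_space E p" using tan by metis
  then have "x \<in> (\<lambda>v. \<i> *s v) ` tangent_space E p" unfolding xy scaleC_vector_eq by (rule imageI)
  moreover have "x \<in> tangent_space E p" unfolding x_def by (rule tan)
  ultimately have x0: "x = 0" using TR by blast
  then have "\<i> *\<^sub>C \<i> *\<^sub>C y = 0" using xy by simp
  then have y0: "y = 0" unfolding scaleC_scaleC by simp
  show ?thesis
    using indep[of "\<lambda>j. Re (w j)" j] indep[of "\<lambda>j. Im (w j)" j] x0 y0 by (simp add: x_def y_def complex_eq_iff)
qed

lemma tangent_derivative_zero:
  fixes f :: "'a::real_normed_vector \<Rightarrow> 'b::real_normed_vector"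
  assumes v: "v \<in> tangent_space M p" and f: "(f has_derivative D) (at p)"
    and O: "open Q" "p \<in> Q" and zero: "\<And>x. x \<in> M \<inter> Q \<Longrightarrow> f x = 0"
  shows "D v = 0"
proof -
  obtain \<gamma> \<epsilon> where \<gamma>: "\<epsilon> > 0" "\<gamma> 0 = p" "\<And>t. \<bar>t\<bar> < \<epsilon> \<Longrightarrow> \<gamma> t \<in> M"
    "(\<gamma> has_vector_derivative v) (at (0::real))"
    using v unfolding tangent_space_def by blast
  have d: "((\<lambda>t. f (\<gamma> t)) has_derivative (\<lambda>t. D (t *\<^sub>R v))) (at 0)"
    using has_derivative_compose[of \<gamma> "\<lambda>t. t *\<^sub>R v" 0 UNIV f D] \<gamma>(2,4) f by (simp add: has_vector_derivative_def)
  have "isCont \<gamma> 0" using \<gamma>(4) has_vector_derivative_continuous by blast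
  then have "eventually (\<lambda>t. \<gamma> t \<in> Q) (at 0)"
    using topological_tendstoD[of \<gamma> "\<gamma> 0" "at 0" Q] O \<gamma>(2) by (simp add: isCont_def)
  moreover have "eventually (\<lambda>t. \<bar>t\<bar> < \<epsilon>) (at (0::real))"
    using \<gamma>(1) by (auto simp: eventually_at dist_real_def)
  ultimately have "eventually (\<lambda>t. f (\<gamma> t) = 0) (at 0)"
    by eventually_elim (use zero \<gamma>(3) in auto)
  moreover have "f (\<gamma> 0) = 0" using zero[of p] \<gamma>(1,2) \<gamma>(3)[of 0] O(2) by simp
  ultimately have "((\<lambda>t. 0) has_derivative (\<lambda>t. D (t *\<^sub>R v))) (at 0)"
    using has_derivative_transform_eventually[OF d] by auto
  then have "(\<lambda>t. D (t *\<^sub>R v)) = (\<lambda>t. 0)" by (rule has_derivative_unique) (rule has_derivative_const)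
  then show ?thesis by (metis scaleR_one)
qed

text \<open>
  On \<open>M\<close> the increment of \<open>h\<close> is given both by \<open>D\<close>, up to a small error, and by \<open>l\<close>; a curve in \<open>M\<close>
  with velocity \<open>v\<close> compares the two.
\<close>

lemma tangent_strict_derivative_eq:
  fixes h l D :: "'a::euclidean_space \<Rightarrow> 'b::real_normed_vector"
  assumes v: "v \<in> tangent_space M p" and l: "linear l" and D: "linear D"
    and h: "\<And>\<eta>. \<eta> > 0 \<Longrightarrow> \<exists>\<delta>>0. \<forall>x\<in>M \<inter> ball p \<delta>. norm (h x - h p - D (x - p)) \<le> \<eta> * norm (x - p)"
    and hl: "\<And>x. x \<in> M \<inter> ball p \<beta> \<Longrightarrow> h x - h p = l (x - p)" and \<beta>: "\<beta> > 0"
  shows "D v = l v"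
proof -
  obtain \<gamma> \<epsilon> where \<gamma>: "\<epsilon> > 0" "\<gamma> 0 = p" "\<And>t. \<bar>t\<bar> < \<epsilon> \<Longrightarrow> \<gamma> t \<in> M"
    "(\<gamma> has_vector_derivative v) (at (0::real))"
    using v unfolding tangent_space_def by blast
  have linDl: "linear (\<lambda>x. D x - l x)" using linear_compose_sub[OF D l] .
  obtain K where K: "K > 0" "\<And>x. norm (D x - l x) \<le> K * norm x"
    using linear_bounded_pos[OF linDl] by blast
  have bound: "norm (D v - l v) \<le> e * (K + norm v + 1)" if e: "0 < e" "e \<le> 1" for e
  proof -
    obtain \<delta> where \<delta>: "\<delta> > 0" "\<forall>x\<in>M \<inter> ball p \<delta>. norm (h x - h p - D (x - p)) \<le> e * norm (x - p)"
      using h[OF e(1)] by blast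
    obtain d where d: "d > 0" "\<And>t. norm (t - 0) < d \<Longrightarrow> norm (\<gamma> t - \<gamma> 0 - (t - 0) *\<^sub>R v) \<le> e * norm (t - 0)"
      using \<gamma>(4) e(1) unfolding has_vector_derivative_def has_derivative_at_alt by blast
    have "isCont \<gamma> 0" using \<gamma>(4) has_vector_derivative_continuous by blast
    then obtain d' where d': "d' > 0" "\<And>t. dist t 0 < d' \<Longrightarrow> dist (\<gamma> t) (\<gamma> 0) < min \<delta> \<beta>"
      unfolding continuous_at_eps_delta using \<delta>(1) \<beta> by (metis min_less_iff_conj)
    define t where "t = min (min d d') \<epsilon> / 2"
    have t: "t > 0" "t < d" "t < d'" "t < \<epsilon>" unfolding t_def using d d' \<gamma>(1) by auto
    define w where "w = \<gamma> t - p"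
    have wt: "norm (w - t *\<^sub>R v) \<le> e * t" using d(2)[of t] t \<gamma>(2) by (simp add: w_def)
    have mem: "\<gamma> t \<in> M" "dist p (\<gamma> t) < \<delta>" "dist p (\<gamma> t) < \<beta>"
      using \<gamma>(3)[of t] d'(2)[of t] t \<gamma>(2) by (auto simp: dist_commute)
    have "norm (l w - D w) \<le> e * norm w" using bspec[OF \<delta>(2), of "\<gamma> t"] hl[of "\<gamma> t"] mem by (simp add: w_def)
    then have 1: "norm (D w - l w) \<le> e * norm w" by (simp add: norm_minus_commute)
    have "norm w \<le> norm (w - t *\<^sub>R v) + norm (t *\<^sub>R v)" using norm_triangle_ineq[of "w - t *\<^sub>R v" "t *\<^sub>R v"] by simp
    also have "\<dots> \<le> e * t + t * norm v" using wt t by simp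
    also have "\<dots> \<le> 1 * t + t * norm v" using e t by (intro add_mono mult_right_mono) auto
    finally have w: "norm w \<le> t * (norm v + 1)" by (simp add: algebra_simps)
    have "t * norm (D v - l v) = norm (D (t *\<^sub>R v) - l (t *\<^sub>R v))"
      using t(1) by (simp add: linear_scale[OF D] linear_scale[OF l] flip: scaleR_diff_right)
    also have "\<dots> = norm ((D w - l w) - (D (w - t *\<^sub>R v) - l (w - t *\<^sub>R v)))"
      by (simp add: linear_diff[OF D] linear_diff[OF l])
    also have "\<dots> \<le> e * norm w + K * (e * t)"
      using norm_triangle_ineq4[of "D w - l w" "D (w - t *\<^sub>R v) - l (w - t *\<^sub>R v)"] 1
        K(2)[of "w - t *\<^sub>R v"] mult_left_mono[OF wt, of K] K(1) by linarith
    also have "\<dots> \<le> e * (t * (norm v + 1)) + K * (e * t)" using w e K(1) t(1) by (intro add_mono mult_left_mono) auto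
    also have "\<dots> = t * (e * (K + norm v + 1))" by (simp add: algebra_simps)
    finally show ?thesis using t(1) by (rule mult_left_le_imp_le)
  qed
  show ?thesis
  proof (rule ccontr)
    assume "D v \<noteq> l v"
    define n where "n = norm (D v - l v)"
    have n: "n > 0" using \<open>D v \<noteq> l v\<close> by (simp add: n_def)
    define c where "c = K + norm v + 1"
    have c: "c > 0" using K(1) norm_ge_zero[of v] unfolding c_def by linarith
    define e where "e = min 1 (n / (2 * c))"
    have e: "0 < e" "e \<le> 1" unfolding e_def using n c by auto
    have "e * c \<le> n / (2 * c) * c" using c unfolding e_def by (intro mult_right_mono) auto
    also have "\<dots> = n / 2" using c by simp
    finally show False using bound[OF e] n unfolding n_def[symmetric] c_def[symmetric] by linarith
  qed
qed

section \<open>Wedges attached to a totally real edge\<close>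

lemma C1_onD:
  assumes "C1_on f S"
  shows "continuous_on S f" "x \<in> S \<Longrightarrow> f differentiable (at x)"
    "continuous_on S (\<lambda>x. frechet_derivative f (at x) v)"
proof -
  have A: "\<exists>g. continuous_on S g \<and> (\<forall>x\<in>S. g x = f x)" and B: "\<forall>x\<in>S. f differentiable (at x)"
    and C: "\<exists>g. continuous_on S g \<and> (\<forall>x\<in>S. g x = frechet_derivative f (at x) v)"
    using assms by (simp_all add: C1_on_def)
  from A obtain g where g: "continuous_on S g" "\<And>x. x \<in> S \<Longrightarrow> g x = f x" by blast
  show "continuous_on S f" by (rule continuous_on_eq[OF g])
  show "x \<in> S \<Longrightarrow> f differentiable (at x)" using B by blast
  from C obtain g' where g': "continuous_on S g'" "\<And>x. x \<in> S \<Longrightarrow> g' x = frechet_derivative f (at x) v" by blast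
  show "continuous_on S (\<lambda>x. frechet_derivative f (at x) v)" by (rule continuous_on_eq[OF g'])
qed

definition re_vec :: "complex ^ 'n \<Rightarrow> complex ^ 'n" where "re_vec w = (\<chi> j. of_real (Re (w $ j)))"
definition im_vec :: "complex ^ 'n \<Rightarrow> complex ^ 'n" where "im_vec w = (\<chi> j. of_real (Im (w $ j)))"

lemma re_im_vec: "w = re_vec w + \<i> *\<^sub>C im_vec w"
  by (simp add: re_vec_def im_vec_def vec_eq_iff complex_eq_iff)

lemma re_vec_real: "re_vec w \<in> real_points" and im_vec_real: "im_vec w \<in> real_points"
  by (simp_all add: re_vec_def im_vec_def real_points_def)

lemma norm_re_vec: "norm (re_vec w) \<le> norm w" and norm_im_vec: "norm (im_vec w) \<le> norm w"
  unfolding re_vec_def im_vec_def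
  by (rule norm_le_componentwise_cart, simp add: abs_Re_le_cmod)
     (rule norm_le_componentwise_cart, simp add: abs_Im_le_cmod)

lemma re_vec_of_real: "w \<in> real_points \<Longrightarrow> re_vec w = w" and im_vec_of_real: "w \<in> real_points \<Longrightarrow> im_vec w = 0"
  by (simp_all add: re_vec_def im_vec_def real_points_def vec_eq_iff complex_eq_iff)

lemma linear_re_vec: "linear re_vec"
  by (rule linearI) (simp_all add: re_vec_def vec_eq_iff scaleR_conv_of_real[where 'a = complex])

lemma norm_vec_le_sum: "norm (w :: complex ^ 'n) \<le> (\<Sum>j\<in>UNIV. cmod (w $ j))"
  unfolding norm_vec_def by (rule L2_set_le_sum) simp

lemma polydisc_norm: "w \<in> polydisc \<sigma> \<Longrightarrow> norm (w :: complex ^ 'n) \<le> real CARD('n) * \<sigma>"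
  using norm_vec_le_sum[of w] sum_bounded_above[of UNIV "\<lambda>j. cmod (w $ j)" \<sigma>]
  by (force simp: polydisc_def less_imp_le)

text \<open>
  The map with real part \<open>re_vec (A (x - p))\<close> and with the equations of \<open>E\<close> as imaginary part is a
  local diffeomorphism, because \<open>A\<close> is injective on the tangent space and real there.  Its inverse \<open>e\<close>
  parametrizes \<open>E\<close> by real points.
\<close>

lemma straighten:
  fixes E :: "(complex ^ 'n) set" and b \<beta> :: "'n \<Rightarrow> complex ^ 'n" and A :: "complex ^ 'n \<Rightarrow> complex ^ 'n"
  assumes W: "open W" "p \<in> W" and \<phi>: "C1_on \<phi> W" and pE: "p \<in> E"
    and \<phi>': "(\<phi> has_derivative \<phi>') (at p)"
    and E: "\<And>x. x \<in> W \<Longrightarrow> x \<in> E \<longleftrightarrow> (\<forall>j. \<phi> x \<bullet> \<beta> j = 0)"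
    and T: "\<And>v. (\<forall>j. \<phi>' v \<bullet> \<beta> j = 0) \<longleftrightarrow> (\<exists>u. v = (\<Sum>j\<in>UNIV. u j *\<^sub>R b j))"
    and A: "clinear A" "\<And>v. A v = 0 \<Longrightarrow> v = 0" and Ab: "\<And>j. A (b j) \<in> real_points"
  obtains U \<kappa> e where "open U" "p \<in> U" "U \<subseteq> W" "\<kappa> > 0"
    "\<And>u. u \<in> real_points \<Longrightarrow> norm u < \<kappa> \<Longrightarrow> e u \<in> E \<and> re_vec (A (e u - p)) = u"
    "continuous_on {u. norm u < \<kappa>} e" "e 0 = p"
    "\<And>x. x \<in> E \<inter> U \<Longrightarrow> norm (re_vec (A (x - p))) < \<kappa> \<Longrightarrow> e (re_vec (A (x - p))) = x"
proof -
  define m where "m x = (\<chi> j. complex_of_real (x \<bullet> \<beta> j))" for x :: "complex ^ 'n"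
  have lm: "linear m" unfolding m_def by (rule linearI) (simp_all add: vec_eq_iff inner_add_left scaleR_conv_of_real[where 'a = complex])
  define l where "l v = re_vec (A v)" for v
  have ll: "linear l" unfolding l_def using linear_compose[OF clinearD(1)[OF A(1)] linear_re_vec] by (simp add: o_def)
  define k where "k x = l (x - p) + \<i> *\<^sub>C m (\<phi> x)" for x
  define k' where "k' x v = l v + \<i> *\<^sub>C m (frechet_derivative \<phi> (at x) v)" for x v
  have kRe: "re_vec (k x) = l (x - p)" and kIm: "im_vec (k x) = m (\<phi> x)" for x
    by (simp_all add: k_def l_def m_def re_vec_def im_vec_def vec_eq_iff)
  have dk: "(k has_derivative k' x) (at x)" if "x \<in> W" for x
  proof -
    have "(\<phi> has_derivative frechet_derivative \<phi> (at x)) (at x)"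
      using C1_onD(2)[OF \<phi> that] frechet_derivative_works by blast
    then have "((\<lambda>x. \<i> *\<^sub>C m (\<phi> x)) has_derivative (\<lambda>v. \<i> *\<^sub>C m (frechet_derivative \<phi> (at x) v))) (at x)"
      using has_derivative_compose[OF _ linear_imp_has_derivative[OF linear_compose[OF lm linear_scaleC[of \<i>]]]]
      by (simp add: o_def)
    moreover have "((\<lambda>x. l (x - p)) has_derivative (\<lambda>v. l (v - 0))) (at x)"
      by (rule has_derivative_compose[OF has_derivative_diff[OF has_derivative_ident has_derivative_const]
            linear_imp_has_derivative[OF ll]])
    ultimately show ?thesis unfolding k_def k'_def using has_derivative_add by fastforce
  qed
  have contk': "continuous_on W (\<lambda>x. k' x v)" for v
    unfolding k'_def
    by (intro continuous_on_add continuous_on_const linear_continuous_on_compose[OF C1_onD(3)[OF \<phi>]]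
        linear_continuous_on_compose[OF _ linear_scaleC] lm)
  have \<phi>p: "frechet_derivative \<phi> (at p) = \<phi>'" by (rule frechet_derivative_eq[OF \<phi>'])
  have inj: "v = 0" if "k' p v = 0" for v
  proof -
    have re: "l v $ j + \<i> * m (\<phi>' v) $ j = 0" for j
      using that unfolding k'_def \<phi>p by (simp add: vec_eq_iff)
    have "Re (l v $ j) = 0 \<and> \<phi>' v \<bullet> \<beta> j = 0" for j
      using arg_cong[OF re[of j], of Re] arg_cong[OF re[of j], of Im] by (simp add: l_def re_vec_def m_def)
    then have l0: "l v = 0" and "\<exists>u. v = (\<Sum>j\<in>UNIV. u j *\<^sub>R b j)"
      using T[of v] by (auto simp: vec_eq_iff complex_eq_iff l_def re_vec_def)
    then obtain u where u: "v = (\<Sum>j\<in>UNIV. u j *\<^sub>R b j)" by blast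
    have "A v = (\<Sum>j\<in>UNIV. u j *\<^sub>R A (b j))"
      unfolding u by (simp add: linear_sum[OF clinearD(1)[OF A(1)]] linear_scale[OF clinearD(1)[OF A(1)]])
    also have "\<dots> \<in> real_points" using Ab by (simp add: real_points_def)
    finally have "re_vec (A v) = A v" by (rule re_vec_of_real)
    then show "v = 0" using l0 A(2) by (simp add: l_def)
  qed
  obtain U V e where U: "open U" "p \<in> U" "U \<subseteq> W" and V: "open V" "k p \<in> V" and hom: "homeomorphism U V k e"
    by (rule C1_local_inverse[OF W dk contk' inj]) auto
  have kp: "k p = 0"
  proof -
    have "m (\<phi> p) = 0" using E[OF W(2)] pE by (simp add: m_def vec_eq_iff)
    then show ?thesis by (simp add: k_def linear_0[OF ll])
  qed
  obtain \<kappa> where \<kappa>: "\<kappa> > 0" "ball 0 \<kappa> \<subseteq> V" using V kp open_contains_ball by metis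
  have ek: "e (k x) = x" if "x \<in> U" for x using hom that by (auto simp: homeomorphism_def)
  have ke: "k (e u) = u" "e u \<in> U" if "norm u < \<kappa>" for u
    using hom \<kappa>(2) that unfolding homeomorphism_def by (auto simp: subset_iff image_iff) 
  have Ek: "x \<in> E \<longleftrightarrow> m (\<phi> x) = 0" if "x \<in> U" for x
    using E[of x] U(3) that by (auto simp: m_def vec_eq_iff)
  show ?thesis
  proof (rule that[OF U \<kappa>(1)])
    fix u :: "complex ^ 'n" assume u: "u \<in> real_points" "norm u < \<kappa>"
    have "im_vec (k (e u)) = 0" unfolding ke(1)[OF u(2)] by (rule im_vec_of_real[OF u(1)])
    then have "e u \<in> E" unfolding kIm using Ek[OF ke(2)[OF u(2)]] by simp
    moreover have "re_vec (A (e u - p)) = u"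
      using kRe[of "e u"] re_vec_of_real[OF u(1)] unfolding ke(1)[OF u(2)] l_def by simp
    ultimately show "e u \<in> E \<and> re_vec (A (e u - p)) = u" by blast
  next
    have "continuous_on V e" using hom by (simp add: homeomorphism_def)
    then show "continuous_on {u. norm u < \<kappa>} e" by (rule continuous_on_subset) (use \<kappa>(2) in auto)
    show "e 0 = p" using ek[OF U(2)] kp by simp
    fix x assume x: "x \<in> E \<inter> U" "norm (re_vec (A (x - p))) < \<kappa>"
    then have "m (\<phi> x) = 0" using Ek[of x] by simp
    then have "k x = re_vec (A (x - p))" by (simp add: k_def l_def)
    then show "e (re_vec (A (x - p))) = x" using ek[of x] x(1) by simp
  qed
qed

text \<open>
  A holomorphic function \<open>y\<close> in \<open>\<Omega>\<close>, of class \<open>C^1\<close> up to \<open>p\<close>, that equals the conjugate of \<open>x\<close> on the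
  edge: it substitutes for a reflection across \<open>E\<close>.
\<close>

locale reflection_data = C1_side \<Omega> N r r' p
  for \<Omega> N :: "(complex ^ 'n) set" and r r' p +
  fixes E :: "(complex ^ 'n) set" and \<beta> :: real and y :: "complex ^ 'n \<Rightarrow> complex ^ 'n" and y' D
  assumes E: "E \<subseteq> frontier \<Omega>" "p \<in> E" "submanifold C1_on CARD('n) E" "totally_real E"
    and \<beta>: "\<beta> > 0"
    and cont_y: "continuous_on (closure \<Omega> \<inter> ball p \<beta>) y"
    and deriv_y: "\<And>x. x \<in> \<Omega> \<inter> ball p \<beta> \<Longrightarrow> (y has_derivative y' x) (at x)"
    and clinear_y': "\<And>x. x \<in> \<Omega> \<inter> ball p \<beta> \<Longrightarrow> clinear (y' x)"
    and lim_y: "\<And>v. ((\<lambda>x. y' x v) \<longlongrightarrow> D v) (at p within \<Omega>)" and clinear_D: "clinear D"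
    and y_E: "\<And>x. x \<in> E \<inter> ball p \<beta> \<Longrightarrow> y x = cnjv x"
begin

lemma E_closure: "E \<subseteq> closure \<Omega>"
  using E(1) by (auto simp: frontier_def)

lemma E_zero: "x \<in> E \<inter> N \<Longrightarrow> r x = 0"
  using closure_le[of x] mem_\<Omega>_iff[of x] E(1) open_\<Omega> by (auto simp: frontier_def interior_open)

text \<open>
  On \<open>E\<close> the function \<open>h\<close>, built from \<open>x\<close> and \<open>y x\<close>, is the real part of the affine coordinate
  \<open>A (x - p)\<close>.  Hence its one-sided derivative at \<open>p\<close> agrees with the complex linear map \<open>A\<close> on the tangent space of \<open>E\<close>; this
  space spans \<open>\<complex>^n\<close> over \<open>\<complex>\<close>, so that the two complex linear maps are equal.
\<close>

lemma reflected_chart: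
  obtains A M :: "complex ^ 'n \<Rightarrow> complex ^ 'n" and h h' U \<kappa> e where "clinear A" "clinear M" "\<And>w. A (M w) = w" "\<And>x. M (A x) = x"
    "\<And>w. r' p (M w) = - (\<Sum>j\<in>UNIV. Im (w $ j))"
    "continuous_on (closure \<Omega> \<inter> ball p \<beta>) h"
    "\<And>x. x \<in> \<Omega> \<inter> ball p \<beta> \<Longrightarrow> (h has_derivative h' x) (at x)"
    "\<And>x. x \<in> \<Omega> \<inter> ball p \<beta> \<Longrightarrow> clinear (h' x)"
    "\<And>v. ((\<lambda>x. h' x v) \<longlongrightarrow> A v) (at p within \<Omega>)"
    "open U" "p \<in> U" "\<kappa> > 0" "continuous_on {u. norm u < \<kappa>} e" "e 0 = p"
    "\<And>u. u \<in> real_points \<Longrightarrow> norm u < \<kappa> \<Longrightarrow> e u \<in> E"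
    "\<And>u. u \<in> real_points \<Longrightarrow> norm u < \<kappa> \<Longrightarrow> e u \<in> ball p \<beta> \<Longrightarrow> h (e u) = u"
    "\<And>x. x \<in> E \<inter> U \<Longrightarrow> norm (re_vec (A (x - p))) < \<kappa> \<Longrightarrow> e (re_vec (A (x - p))) = x"
proof -
  obtain W \<phi> \<phi>' and nn b :: "'n \<Rightarrow> complex ^ 'n" where W: "open W" "p \<in> W" "C1_on \<phi> W"
    and d\<phi>: "(\<phi> has_derivative \<phi>') (at p)"
    and EW: "\<And>x. x \<in> W \<Longrightarrow> x \<in> E \<longleftrightarrow> (\<forall>j. \<phi> x \<bullet> nn j = 0)"
    and tan: "\<And>v. (\<forall>j. \<phi>' v \<bullet> nn j = 0) \<Longrightarrow> v \<in> tangent_space E p"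
    and T: "\<And>v. (\<forall>j. \<phi>' v \<bullet> nn j = 0) \<longleftrightarrow> (\<exists>u. v = (\<Sum>j\<in>UNIV. u j *\<^sub>R b j))"
    and indep: "\<And>u j. (\<Sum>j\<in>UNIV. u j *\<^sub>R b j) = 0 \<Longrightarrow> u j = 0"
  proof -
    show thesis by (rule submanifold_chart[OF E(3,2) C1_onD(2)], assumption, assumption, fact that)
  qed
  have tanb: "(\<Sum>j\<in>UNIV. u j *\<^sub>R b j) \<in> tangent_space E p" for u
    by (rule tan[OF iffD2[OF T]]) blast
  have tanbj: "b j \<in> tangent_space E p" for j
  proof -
    have "(\<Sum>i\<in>UNIV. (if i = j then 1 else 0) *\<^sub>R b i) = b j"
      by (simp add: if_distrib[of "\<lambda>c. c *\<^sub>R _"] cong: if_cong)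
    then show ?thesis using tanb[of "\<lambda>i. if i = j then 1 else 0"] by simp
  qed
  have r'tan: "r' p v = 0" if "v \<in> tangent_space E p" for v
    by (rule tangent_derivative_zero[OF that deriv[OF p(1)] open_N p(1) E_zero])
  have cindep: "w j = 0" if "(\<Sum>j\<in>UNIV. w j *\<^sub>C b j) = 0" for w j
  proof (rule totally_real_independent[of E p b w j])
    show "tangent_space E p \<inter> (\<lambda>v. \<i> *s v) ` tangent_space E p = {0}"
      using E(2,4) unfolding totally_real_def by blast
    show "(\<Sum>j\<in>UNIV. u j *\<^sub>R b j) \<in> tangent_space E p" for u by (rule tanb)
    show "u j = 0" if "(\<Sum>j\<in>UNIV. u j *\<^sub>R b j) = 0" for u j using that by (rule indep)
  qed (rule that)
  obtain v0 where v0: "r' p v0 \<noteq> 0" using nondegenerate by blast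
  obtain M :: "complex ^ 'n \<Rightarrow> complex ^ 'n" where M: "clinear M" "bij M" "\<And>w. r' p (M w) = - (\<Sum>j\<in>UNIV. Im (w $ j))"
    "\<And>j. inv M (b j) \<in> real_points"
    "\<And>w. w \<in> real_points \<Longrightarrow> \<exists>u. M w = (\<Sum>j\<in>UNIV. u j *\<^sub>R b j)"
  proof -
    show thesis
      by (rule adapted_basis[of "r' p" b v0], rule linear_r', rule r'tan, rule tanbj, erule cindep, rule v0, fact that)
  qed
  define A where "A = inv M"
  have AM: "A (M w) = w" for w unfolding A_def by (rule inv_f_f[OF bij_is_inj[OF M(2)]])
  have MA: "M (A x) = x" for x unfolding A_def by (rule surj_f_inv_f[OF bij_is_surj[OF M(2)]])
  have clA: "clinear A" unfolding A_def by (rule clinear_inv[OF M(1,2)])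
  have A0: "v = 0" if "A v = 0" for v using MA[of v] that linear_0[OF clinearD(1)[OF M(1)]] by simp
  have linA: "linear A" using clinearD(1)[OF clA] .
  obtain U \<kappa> e where U: "open U" "p \<in> U" "U \<subseteq> W" "\<kappa> > 0"
    and e: "\<And>u. u \<in> real_points \<Longrightarrow> norm u < \<kappa> \<Longrightarrow> e u \<in> E \<and> re_vec (A (e u - p)) = u"
    and e': "continuous_on {u. norm u < \<kappa>} e" "e 0 = p"
    and eU: "\<And>x. x \<in> E \<inter> U \<Longrightarrow> norm (re_vec (A (x - p))) < \<kappa> \<Longrightarrow> e (re_vec (A (x - p))) = x"
  proof -
    have Ab: "A (b j) \<in> real_points" for j by (simp add: A_def M(4))
    show thesis
      by (rule straighten[where W = W and p = p and \<phi> = \<phi> and E = E and \<phi>' = \<phi>' and \<beta> = nn and b = b and A = A],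
          rule W(1), rule W(2), rule W(3), rule E(2), rule d\<phi>, erule EW, rule T, rule clA, erule A0, rule Ab, fact that)
  qed
  define A' where "A' z = cnjv (A (cnjv z))" for z
  have clA': "clinear A'"
    using linear_add[OF linA] linear_scale[OF linA] clinearD(2)[OF clA]
    unfolding clinear_def linear_iff A'_def by (simp add: cnjv_simps)
  have reA: "re_vec (A x) = (1/2) *\<^sub>C (A x + A' (cnjv x))" for x
    by (simp add: A'_def vec_eq_iff re_vec_def complex_eq_iff)
  define h where "h x = (1/2) *\<^sub>C (A x + A' (y x)) - re_vec (A p)" for x
  define h' where "h' x v = (1/2) *\<^sub>C (A v + A' (y' x v))" for x v
  have hE: "h x = re_vec (A (x - p))" if "x \<in> E \<inter> ball p \<beta>" for x
    unfolding h_def y_E[OF that] reA[symmetric] linear_diff[OF linA] linear_diff[OF linear_re_vec] ..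
  have conth: "continuous_on (closure \<Omega> \<inter> ball p \<beta>) h"
    unfolding h_def
    by (intro continuous_intros linear_continuous_on_compose[OF _ linA]
        linear_continuous_on_compose[OF cont_y clinearD(1)[OF clA']])
  have dh: "(h has_derivative h' x) (at x)" if "x \<in> \<Omega> \<inter> ball p \<beta>" for x
  proof -
    have "((\<lambda>x. A' (y x)) has_derivative (\<lambda>v. A' (y' x v))) (at x)"
      by (rule has_derivative_compose[OF deriv_y[OF that] linear_imp_has_derivative[OF clinearD(1)[OF clA']]])
    then have "((\<lambda>x. A x + A' (y x)) has_derivative (\<lambda>v. A v + A' (y' x v))) (at x)"
      by (intro has_derivative_add linear_imp_has_derivative[OF linA])
    then have "((\<lambda>x. (1/2) *\<^sub>C (A x + A' (y x))) has_derivative (\<lambda>v. (1/2) *\<^sub>C (A v + A' (y' x v)))) (at x)"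
      by (rule has_derivative_compose[OF _ linear_imp_has_derivative[OF linear_scaleC]])
    then have "(h has_derivative (\<lambda>v. (1/2) *\<^sub>C (A v + A' (y' x v)) - 0)) (at x)"
      unfolding h_def by (intro has_derivative_diff has_derivative_const)
    then show ?thesis by (simp add: h'_def[abs_def])
  qed
  have clh': "clinear (h' x)" if "x \<in> \<Omega> \<inter> ball p \<beta>" for x
    unfolding h'_def
    by (rule clinear_compose[OF clinear_add[OF clA clinear_compose[OF clinear_y'[OF that] clA']] clinear_scaleC])
  define Dh where "Dh v = (1/2) *\<^sub>C (A v + A' (D v))" for v
  have clDh: "clinear Dh"
    unfolding Dh_def
    by (rule clinear_compose[OF clinear_add[OF clA clinear_compose[OF clinear_D clA']] clinear_scaleC])
  have limh: "((\<lambda>x. h' x v) \<longlongrightarrow> Dh v) (at p within \<Omega>)" for v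
  proof -
    have "bounded_linear A'" using clinearD(1)[OF clA'] linear_conv_bounded_linear by blast
    then show ?thesis unfolding h'_def Dh_def
      by (intro tendsto_intros bounded_linear.tendsto[OF _ lim_y])
  qed
  have pE: "p \<in> closure \<Omega> \<inter> ball p \<delta>" if "\<delta> > 0" for \<delta> using E(2) E_closure that by auto
  have Dhtan: "Dh v = re_vec (A v)" if v: "v \<in> tangent_space E p" for v
  proof (rule tangent_strict_derivative_eq[OF v _ clinearD(1)[OF clDh], where h = h])
    show "linear (\<lambda>v. re_vec (A v))" using linear_compose[OF linA linear_re_vec] by (simp add: o_def)
    show "\<exists>\<delta>>0. \<forall>x\<in>E \<inter> ball p \<delta>. norm (h x - h p - Dh (x - p)) \<le> \<eta> * norm (x - p)" if eta: "\<eta> > 0" for \<eta>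
    proof -
      obtain \<delta> where \<delta>: "\<delta> > 0" "\<And>x1 x2. x1 \<in> closure \<Omega> \<inter> ball p \<delta> \<Longrightarrow> x2 \<in> closure \<Omega> \<inter> ball p \<delta> \<Longrightarrow>
         norm (h x2 - h x1 - Dh (x2 - x1)) \<le> \<eta> * norm (x2 - x1)"
      proof -
        show thesis
          by (rule one_sided_strictly_differentiable[where h = h and h' = h' and D = Dh and \<eta> = \<eta> and \<beta> = \<beta>],
              rule \<beta>, rule conth, erule dh, rule limh, rule clinearD(1)[OF clDh], rule eta, rule that)
      qed
      have "norm (h x - h p - Dh (x - p)) \<le> \<eta> * norm (x - p)" if "x \<in> E \<inter> ball p \<delta>" for x
        by (rule \<delta>(2)[OF pE[OF \<delta>(1)]]) (use that E_closure in blast)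
      then show ?thesis using \<delta>(1) by blast
    qed
    show "h x - h p = re_vec (A (x - p))" if "x \<in> E \<inter> ball p \<beta>" for x
      using hE[OF that] hE[of p] E(2) \<beta> by (simp add: linear_0[OF linA] linear_0[OF linear_re_vec])
  qed (rule \<beta>)
  have "Dh v = A v" for v
  proof -
    have real: "Dh (M w) = w" if w: "w \<in> real_points" for w
    proof -
      obtain u where "M w = (\<Sum>j\<in>UNIV. u j *\<^sub>R b j)" using M(5)[OF w] by blast
      then have "M w \<in> tangent_space E p" using tanb by simp
      then have "Dh (M w) = re_vec (A (M w))" by (rule Dhtan)
      then show ?thesis by (simp add: AM re_vec_of_real[OF w])
    qed
    define w where "w = A v"
    have "v = M (re_vec w + \<i> *\<^sub>C im_vec w)" using MA[of v] re_im_vec[of w] by (simp add: w_def)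
    also have "\<dots> = M (re_vec w) + \<i> *\<^sub>C M (im_vec w)"
      by (simp add: linear_add[OF clinearD(1)[OF M(1)]] clinearD(2)[OF M(1)])
    finally have "Dh v = re_vec w + \<i> *\<^sub>C im_vec w"
      by (simp add: linear_add[OF clinearD(1)[OF clDh]] clinearD(2)[OF clDh] real re_vec_real im_vec_real)
    then show ?thesis using re_im_vec[of w] by (simp add: w_def)
  qed
  then have "Dh = A" by (rule ext)
  show ?thesis
  proof (rule that[of A M h h' U \<kappa> e], rule clA, rule M(1), rule AM, rule MA, rule M(3), rule conth, erule dh, erule clh')
    show "((\<lambda>x. h' x v) \<longlongrightarrow> A v) (at p within \<Omega>)" for v using limh \<open>Dh = A\<close> by simp
    show "e u \<in> E" if "u \<in> real_points" "norm u < \<kappa>" for u using e[OF that] by blast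
    show "h (e u) = u" if "u \<in> real_points" "norm u < \<kappa>" "e u \<in> ball p \<beta>" for u
      using e[OF that(1,2)] hE[of "e u"] that(3) by simp
    show "e (re_vec (A (x - p))) = x" if "x \<in> E \<inter> U" "norm (re_vec (A (x - p))) < \<kappa>" for x
      by (rule eU[OF that])
  qed (rule U e')+
qed

end

lemma norm_i_scaleC: "norm (\<i> *\<^sub>C v) = norm (v :: complex ^ 'n)"
  by (simp add: norm_vec_def norm_mult)

context reflection_data
begin

text \<open>
  For \<open>w\<close> in the wedge the equation \<open>h x = w\<close> is solved by a contraction on a ball that lies in \<open>\<Omega>\<close>:
  its centre is \<open>e (re_vec w) + M (\<i> im_vec w)\<close>, and its radius \<open>\<tau> |Im w|\<close> is small compared with the
  distance of the centre from the boundary.  The inverse is holomorphic in the wedge, continuous up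
  to the edge and equal to \<open>e\<close> there.  Since \<open>y\<close> is the conjugate of \<open>x\<close> on \<open>E\<close>, the functions
  \<open>x j + y j\<close> and \<open>\<i> (y j - x j)\<close> are real on the edge; the edge-of-the-wedge theorem extends them and thereby the
  inverse.  The same theorem yields the last clause, for every function that is real on \<open>E\<close>.
\<close>

theorem wedge_parametrization:
  obtains X :: "complex ^ 'n \<Rightarrow> complex ^ 'n" and \<sigma> l U
  where "\<sigma> > 0" "holo_on X (polydisc \<sigma>)" "X 0 = p"
    "\<And>v. frechet_derivative X (at 0) v = 0 \<Longrightarrow> v = 0"
    "\<And>w. w \<in> upper_wedge \<sigma> \<Longrightarrow> X w \<in> \<Omega> \<inter> ball p \<beta>"
    "\<And>w. w \<in> polydisc \<sigma> \<inter> real_points \<Longrightarrow> X w \<in> E \<inter> ball p \<beta>"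
    "continuous_on UNIV l" "l p = 0" "open U" "p \<in> U"
    "\<And>x. x \<in> E \<inter> U \<Longrightarrow> l x \<in> polydisc \<sigma> \<Longrightarrow> l x \<in> real_points \<and> X (l x) = x"
    "\<forall>k :: complex ^ 'n \<Rightarrow> complex. continuous_on (closure \<Omega> \<inter> ball p \<beta>) k \<longrightarrow> holo_on k (\<Omega> \<inter> ball p \<beta>) \<longrightarrow>
       (\<forall>x \<in> E \<inter> ball p \<beta>. Im (k x) = 0) \<longrightarrow>
       (\<exists>K. holo_on K (polydisc \<sigma>) \<and> (\<forall>w \<in> upper_wedge \<sigma> \<union> polydisc \<sigma> \<inter> real_points. K w = k (X w)))"
proof -
  obtain A M :: "complex ^ 'n \<Rightarrow> complex ^ 'n" and h h' U \<kappa> e where cl: "clinear A" "clinear M" and AM: "\<And>w. A (M w) = w" and MA: "\<And>x. M (A x) = x"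
    and rM: "\<And>w. r' p (M w) = - (\<Sum>j\<in>UNIV. Im (w $ j))"
    and conth: "continuous_on (closure \<Omega> \<inter> ball p \<beta>) h"
    and dh: "\<And>x. x \<in> \<Omega> \<inter> ball p \<beta> \<Longrightarrow> (h has_derivative h' x) (at x)"
    and clh': "\<And>x. x \<in> \<Omega> \<inter> ball p \<beta> \<Longrightarrow> clinear (h' x)"
    and limh: "\<And>v. ((\<lambda>x. h' x v) \<longlongrightarrow> A v) (at p within \<Omega>)"
    and U: "open U" "p \<in> U" and \<kappa>: "\<kappa> > 0" and conte: "continuous_on {u. norm u < \<kappa>} e" and e0: "e 0 = p"
    and eE: "\<And>u. u \<in> real_points \<Longrightarrow> norm u < \<kappa> \<Longrightarrow> e u \<in> E"
    and he: "\<And>u. u \<in> real_points \<Longrightarrow> norm u < \<kappa> \<Longrightarrow> e u \<in> ball p \<beta> \<Longrightarrow> h (e u) = u"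
    and eU: "\<And>x. x \<in> E \<inter> U \<Longrightarrow> norm (re_vec (A (x - p))) < \<kappa> \<Longrightarrow> e (re_vec (A (x - p))) = x"
  proof -
    show thesis by (rule reflected_chart, fact that)
  qed
  have linA: "linear A" and linM: "linear M" using cl clinearD(1) by blast+
  obtain cM where cM: "cM > 0" "\<And>w. norm (M w) \<le> cM * norm w" using linear_bounded_pos[OF linM] by blast
  obtain cA where cA: "cA > 0" "\<And>w. norm (A w) \<le> cA * norm w" using linear_bounded_pos[OF linA] by blast
  obtain cr where cr: "cr > 0" "\<And>v. norm (r' p v) \<le> cr * norm v" using linear_bounded_pos[OF linear_r'] by blast
  \<comment> \<open>a displacement by \<open>\<tau> |Im w|\<close> changes the linear part of \<open>r\<close> by at most a quarter of the gain \<open>|Im w|\<close> in the direction \<open>\<i> im_vec w\<close>\<close>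
  define \<tau> where "\<tau> = 1 / (4 * cr)"
  have \<tau>: "\<tau> > 0" "cr * \<tau> = 1 / 4" unfolding \<tau>_def using cr(1) by auto
  define \<eta>r where "\<eta>r = 1 / (4 * (cM + \<tau>))"
  have cM\<tau>: "cM + \<tau> > 0" using cM(1) \<tau>(1) by simp
  have \<eta>r: "\<eta>r > 0" "\<eta>r * (cM + \<tau>) = 1 / 4" unfolding \<eta>r_def using cM\<tau> by auto
  define \<eta>h where "\<eta>h = min (1 / (2 * cM)) (\<tau> / (2 * cM * cM))"
  have \<eta>h: "\<eta>h > 0" unfolding \<eta>h_def using cM \<tau> by auto
  have \<eta>h1: "cM * \<eta>h \<le> 1 / 2"
  proof -
    have "cM * \<eta>h \<le> cM * (1 / (2 * cM))" unfolding \<eta>h_def using cM(1) by (intro mult_left_mono) auto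
    then show ?thesis using cM(1) by simp
  qed
  have \<eta>h2: "cM * \<eta>h * cM \<le> \<tau> / 2"
  proof -
    have "cM * cM * \<eta>h \<le> cM * cM * (\<tau> / (2 * cM * cM))" unfolding \<eta>h_def using cM(1) by (intro mult_left_mono) auto
    then show ?thesis using cM(1) by (simp add: mult_ac)
  qed
  obtain \<delta>r where \<delta>r: "\<delta>r > 0" "ball p \<delta>r \<subseteq> N" "\<And>x y. x \<in> ball p \<delta>r \<Longrightarrow> y \<in> ball p \<delta>r \<Longrightarrow>
      norm (r y - r x - r' p (y - x)) \<le> \<eta>r * norm (y - x)"
    using C1_strictly_differentiable[OF open_N p(1) deriv cont_deriv \<eta>r(1)] by blast
  obtain \<delta>h where \<delta>h: "\<delta>h > 0" "\<And>x1 x2. x1 \<in> closure \<Omega> \<inter> ball p \<delta>h \<Longrightarrow> x2 \<in> closure \<Omega> \<inter> ball p \<delta>h \<Longrightarrow>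
       norm (h x2 - h x1 - A (x2 - x1)) \<le> \<eta>h * norm (x2 - x1)"
    "\<And>x v. x \<in> \<Omega> \<inter> ball p \<delta>h \<Longrightarrow> norm (h' x v - A v) \<le> \<eta>h * norm v"
  proof -
    show thesis
      by (rule one_sided_strictly_differentiable[where h = h and h' = h' and D = A and \<eta> = \<eta>h and \<beta> = \<beta>],
          rule \<beta>, rule conth, erule dh, rule limh, rule linA, rule \<eta>h, rule that)
  qed
  define \<delta> where "\<delta> = min (min \<delta>r \<delta>h) \<beta>"
  have \<delta>: "\<delta> > 0" "\<delta> \<le> \<delta>r" "\<delta> \<le> \<delta>h" "\<delta> \<le> \<beta>" unfolding \<delta>_def using \<delta>r \<delta>h \<beta> by auto
  have b\<beta>: "ball p \<delta> \<subseteq> ball p \<beta>" and bh: "ball p \<delta> \<subseteq> ball p \<delta>h" and br: "ball p \<delta> \<subseteq> ball p \<delta>r" using \<delta> by auto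
  have H: "norm (h x2 - h x1 - A (x2 - x1)) \<le> \<eta>h * norm (x2 - x1)"
    if "x1 \<in> closure \<Omega> \<inter> ball p \<delta>" "x2 \<in> closure \<Omega> \<inter> ball p \<delta>" for x1 x2
    by (rule \<delta>h(2)) (use that bh in auto)
  have half: "norm z \<le> 2 * cM * norm q" if "norm (q - A z) \<le> \<eta>h * norm z" for q z
  proof -
    have "norm z \<le> cM * norm (A z)" using cM(2)[of "A z"] MA by simp
    also have "norm (A z) \<le> norm q + \<eta>h * norm z"
      using norm_triangle_ineq4[of q "q - A z"] that by simp
    finally have "norm z \<le> cM * norm q + (cM * \<eta>h) * norm z" using cM(1) by (simp add: algebra_simps)
    also have "\<dots> \<le> cM * norm q + 1 / 2 * norm z" using \<eta>h1 by (intro add_mono mult_right_mono) auto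
    finally show ?thesis by simp
  qed
  have hinj: "norm (x2 - x1) \<le> 2 * cM * norm (h x2 - h x1)"
    if "x1 \<in> closure \<Omega> \<inter> ball p \<delta>" "x2 \<in> closure \<Omega> \<inter> ball p \<delta>" for x1 x2
    by (rule half[OF H[OF that]])
  have h'low: "norm v \<le> 2 * cM * norm (h' x v)" and h'up: "norm (h' x v) \<le> (cA + \<eta>h) * norm v"
    if "x \<in> \<Omega> \<inter> ball p \<delta>" for x v
  proof -
    have b: "norm (h' x v - A v) \<le> \<eta>h * norm v" by (rule \<delta>h(3)) (use that bh in auto)
    show "norm v \<le> 2 * cM * norm (h' x v)" by (rule half[OF b])
    have "norm (h' x v) \<le> norm (h' x v - A v) + norm (A v)" using norm_triangle_ineq[of "h' x v - A v" "A v"] by simp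
    then show "norm (h' x v) \<le> (cA + \<eta>h) * norm v" using b cA(2)[of v] by (simp add: algebra_simps)
  qed
  have "isCont e 0"
  proof -
    have "open {u :: complex ^ 'n. norm u < \<kappa>}" by (intro open_Collect_less continuous_intros)
    then show ?thesis using conte \<kappa> by (simp add: continuous_on_eq_continuous_at)
  qed
  then obtain \<kappa>1 where \<kappa>1: "\<kappa>1 > 0" "\<And>u. dist u 0 < \<kappa>1 \<Longrightarrow> dist (e u) (e 0) < \<delta> / 2"
    unfolding continuous_at_eps_delta using \<delta>(1) by (meson half_gt_zero)
  define \<mu> where "\<mu> = min (min \<kappa> \<kappa>1) (\<delta> / (2 * (cM + \<tau>)))"
  have \<mu>: "\<mu> > 0" unfolding \<mu>_def using \<kappa> \<kappa>1 \<delta> cM\<tau> by auto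
  define \<sigma>0 where "\<sigma>0 = \<mu> / (real CARD('n) + 1)"
  have \<sigma>0: "\<sigma>0 > 0" unfolding \<sigma>0_def using \<mu> by simp
  have nw: "norm w < \<mu>" if "w \<in> polydisc \<sigma>0" for w :: "complex ^ 'n"
  proof -
    have "(real CARD('n) + 1) * \<sigma>0 = \<mu>" unfolding \<sigma>0_def by simp
    then have "real CARD('n) * \<sigma>0 < \<mu>" using \<sigma>0 by (simp add: algebra_simps)
    then show ?thesis using polydisc_norm[OF that] by linarith
  qed
  define Q where "Q = {w :: complex ^ 'n. w \<in> polydisc \<sigma>0 \<and> (\<forall>j. 0 \<le> Im (w $ j))}"
  have clo: "\<Omega> \<subseteq> closure \<Omega>" by (rule closure_subset)
  have euE: "e u \<in> E \<and> e u \<in> closure \<Omega> \<inter> ball p (\<delta> / 2) \<and> h (e u) = u \<and> r (e u) = 0"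
    if u: "u \<in> real_points" "norm u < \<mu>" for u
  proof -
    have n: "norm u < \<kappa>" "dist u 0 < \<kappa>1" using u(2) by (auto simp: \<mu>_def)
    have b: "e u \<in> ball p (\<delta> / 2)" using \<kappa>1(2)[OF n(2)] e0 by (simp add: dist_commute)
    then have b': "e u \<in> ball p \<delta>" using \<delta>(1) by auto
    have E': "e u \<in> E" by (rule eE[OF u(1) n(1)])
    have "h (e u) = u" by (rule he[OF u(1) n(1)]) (use b' b\<beta> in blast)
    moreover have "r (e u) = 0" by (rule E_zero) (use E' b' br \<delta>r(2) in blast)
    ultimately show ?thesis using E' b E_closure by blast
  qed
  have solve: "\<exists>x. x \<in> closure \<Omega> \<inter> ball p \<delta> \<and> h x = w \<and> (im_vec w \<noteq> 0 \<longrightarrow> x \<in> \<Omega>) \<and> (im_vec w = 0 \<longrightarrow> x \<in> E \<and> x = e w)"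
    if w: "w \<in> Q" for w
  proof -
    define u v where "u = re_vec w" and "v = im_vec w"
    have wuv: "w = u + \<i> *\<^sub>C v" unfolding u_def v_def by (rule re_im_vec)
    have wp: "w \<in> polydisc \<sigma>0" and wIm: "\<And>j. 0 \<le> Im (w $ j)" using w by (auto simp: Q_def)
    have nu: "norm u < \<mu>" and nv: "norm v < \<mu>"
      using nw[OF wp] norm_re_vec[of w] norm_im_vec[of w] by (auto simp: u_def v_def)
    note eu = euE[OF re_vec_real[of w, folded u_def] nu]
    show ?thesis
    proof (cases "v = 0")
      case True
      then have "w = u" using wuv by simp
      moreover have "e u \<in> ball p \<delta>" using eu \<delta>(1) by auto
      ultimately show ?thesis using eu True v_def by (intro exI[of _ "e u"]) auto
    next
      case False
      define n where "n = norm v"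
      have n: "n > 0" using False by (simp add: n_def)
      define x0 where "x0 = e u"
      have x0: "x0 \<in> closure \<Omega>" "dist p x0 < \<delta> / 2" "h x0 = u" "r x0 = 0" using eu by (auto simp: x0_def)
      have x0b: "x0 \<in> ball p \<delta>" using x0(2) \<delta>(1) by auto
      define z where "z = x0 + M (\<i> *\<^sub>C v)"
      have nM: "norm (M (\<i> *\<^sub>C v)) \<le> cM * n" using cM(2)[of "\<i> *\<^sub>C v"] by (simp add: norm_i_scaleC n_def)
      define S where "S = cball z (\<tau> * n)"
      have inS: "x \<in> \<Omega> \<inter> ball p \<delta>" if x: "x \<in> S" for x
      proof -
        have q: "norm (x - z) \<le> \<tau> * n" using x by (simp add: S_def dist_norm norm_minus_commute)
        have d: "x - x0 = M (\<i> *\<^sub>C v) + (x - z)" by (simp add: z_def)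
        have nd: "norm (x - x0) \<le> (cM + \<tau>) * n"
          unfolding d using norm_triangle_ineq[of "M (\<i> *\<^sub>C v)" "x - z"] q nM by (simp add: algebra_simps)
        have "(cM + \<tau>) * n < (cM + \<tau>) * (\<delta> / (2 * (cM + \<tau>)))"
          by (rule mult_strict_left_mono[OF _ cM\<tau>]) (use nv in \<open>simp add: n_def \<mu>_def\<close>)
        also have "\<dots> = \<delta> / 2"
        proof -
          have "m * (\<delta> / (2 * m)) = \<delta> / 2" if "m > 0" for m :: real using that by simp
          from this[OF cM\<tau>] show ?thesis .
        qed
        finally have "dist p x < \<delta>"
          using x0(2) nd dist_triangle[of p x x0] by (simp add: dist_norm norm_minus_commute[of x0 x])
        then have xb: "x \<in> ball p \<delta>" by simp
        have "r x - r x0 - r' p (x - x0) \<le> \<eta>r * norm (x - x0)"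
        proof -
          have "x0 \<in> ball p \<delta>r" "x \<in> ball p \<delta>r" using xb x0b br by blast+
          from \<delta>r(3)[OF this] show ?thesis by (simp only: real_norm_def abs_le_iff)
        qed
        also have "\<dots> \<le> \<eta>r * ((cM + \<tau>) * n)" using nd \<eta>r(1) by (intro mult_left_mono) auto
        also have "\<dots> = n / 4" unfolding mult.assoc[symmetric] \<eta>r(2) by simp
        finally have 1: "r x \<le> r' p (x - x0) + n / 4" using x0(4) by simp
        have "r' p (x - x0) = r' p (M (\<i> *\<^sub>C v)) + r' p (x - z)" unfolding d by (rule linear_add[OF linear_r'])
        also have "r' p (M (\<i> *\<^sub>C v)) = - (\<Sum>j\<in>UNIV. Im (w $ j))"
          unfolding rM by (simp add: v_def im_vec_def)
        also have "r' p (x - z) \<le> cr * (\<tau> * n)"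
          using cr(2)[of "x - z"] mult_left_mono[OF q, of cr] cr(1) abs_ge_self[of "r' p (x - z)"]
          unfolding real_norm_def by linarith
        also have "cr * (\<tau> * n) = n / 4" using \<tau>(2) by (simp flip: mult.assoc)
        finally have 2: "r' p (x - x0) \<le> - (\<Sum>j\<in>UNIV. Im (w $ j)) + n / 4" by simp
        have "n \<le> (\<Sum>j\<in>UNIV. cmod (v $ j))" unfolding n_def by (rule norm_vec_le_sum)
        also have "\<dots> = (\<Sum>j\<in>UNIV. Im (w $ j))" using wIm by (simp add: v_def im_vec_def)
        finally have "r x < 0" using 1 2 n by linarith
        then show ?thesis using xb br \<delta>r(2) mem_\<Omega>_iff[of x] by blast
      qed
      have inS': "x \<in> closure \<Omega> \<inter> ball p \<delta>" if "x \<in> S" for x using inS[OF that] clo by auto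
      define T where "T x = x - M (h x - w)" for x
      have lip: "dist (T x1) (T x2) \<le> 1 / 2 * dist x1 x2" if x1: "x1 \<in> S" and x2: "x2 \<in> S" for x1 x2
      proof -
        have "T x2 - T x1 = M (A (x2 - x1)) - M (h x2 - h x1)"
          unfolding MA by (simp add: T_def linear_diff[OF linM])
        also have "\<dots> = - M (h x2 - h x1 - A (x2 - x1))"
          by (simp only: linear_diff[OF linM] minus_diff_eq)
        finally have "norm (T x2 - T x1) \<le> cM * norm (h x2 - h x1 - A (x2 - x1))" using cM(2) by simp
        also have "\<dots> \<le> cM * (\<eta>h * norm (x2 - x1))"
          using H[OF inS'[OF x1] inS'[OF x2]] cM(1) by (intro mult_left_mono) auto
        also have "\<dots> = (cM * \<eta>h) * norm (x2 - x1)" by simp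
        also have "\<dots> \<le> 1 / 2 * norm (x2 - x1)" using \<eta>h1 by (intro mult_right_mono) auto
        finally show ?thesis by (simp add: dist_norm norm_minus_commute[of "T x1"] norm_minus_commute[of x1])
      qed
      have zS: "z \<in> S" unfolding S_def using \<tau> n by simp
      have Tz: "dist z (T z) \<le> \<tau> / 2 * n"
      proof -
        have "A (z - x0) = \<i> *\<^sub>C v" by (simp add: z_def AM)
        then have hz: "h z - w = h z - h x0 - A (z - x0)" using x0(3) wuv by simp
        have "norm (z - T z) \<le> cM * norm (h z - w)" using cM(2) by (simp add: T_def)
        also have "\<dots> \<le> cM * (\<eta>h * norm (z - x0))"
          unfolding hz using H[OF _ inS'[OF zS], of x0] x0(1) x0b cM(1) by (intro mult_left_mono) auto
        also have "\<dots> \<le> cM * (\<eta>h * (cM * n))" using nM cM(1) \<eta>h by (intro mult_left_mono) (auto simp: z_def)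
        also have "\<dots> = (cM * \<eta>h * cM) * n" by simp
        also have "\<dots> \<le> \<tau> / 2 * n" using \<eta>h2 n by (intro mult_right_mono) auto
        finally show ?thesis by (simp add: dist_norm)
      qed
      have maps: "T ` S \<subseteq> S"
      proof (rule image_subsetI)
        fix x assume x: "x \<in> S"
        have "dist z (T x) \<le> dist z (T z) + dist (T z) (T x)" by (rule dist_triangle)
        also have "\<dots> \<le> \<tau> / 2 * n + 1 / 2 * dist z x" using Tz lip[OF zS x] by simp
        also have "\<dots> \<le> \<tau> / 2 * n + 1 / 2 * (\<tau> * n)" using x by (simp add: S_def)
        also have "\<dots> = \<tau> * n" by simp
        finally show "T x \<in> S" by (simp add: S_def)
      qed
      have "\<exists>!x. x \<in> S \<and> T x = x"
        using Banach_fix[OF _ _ _ _ maps, of "1/2"] lip zS complete_eq_closed[of S] by (auto simp: S_def)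
      then obtain x where x: "x \<in> S" "T x = x" by blast
      have "M (h x - w) = 0" using x(2) by (simp add: T_def)
      then have "h x - w = A 0" using AM by metis
      then have "h x = w" by (simp add: linear_0[OF linA])
      then show ?thesis using inS[OF x(1)] clo False v_def by (intro exI[of _ x]) auto
    qed
  qed
  define X0 where "X0 w = (SOME x. x \<in> closure \<Omega> \<inter> ball p \<delta> \<and> h x = w \<and> (im_vec w \<noteq> 0 \<longrightarrow> x \<in> \<Omega>) \<and> (im_vec w = 0 \<longrightarrow> x \<in> E \<and> x = e w))" for w
  have X0: "X0 w \<in> closure \<Omega> \<inter> ball p \<delta>" "h (X0 w) = w" "im_vec w \<noteq> 0 \<Longrightarrow> X0 w \<in> \<Omega>" "im_vec w = 0 \<Longrightarrow> X0 w \<in> E \<and> X0 w = e w"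
    if "w \<in> Q" for w
    using someI_ex[OF solve[OF that], folded X0_def] by blast+
  have contX0: "continuous_on Q X0"
  proof (rule lipschitz_on_continuous_on)
    show "(2 * cM)-lipschitz_on Q X0"
    proof (rule lipschitz_onI)
      fix w1 w2 assume "w1 \<in> Q" "w2 \<in> Q"
      then show "dist (X0 w1) (X0 w2) \<le> 2 * cM * dist w1 w2"
        using hinj[OF X0(1) X0(1), of w2 w1] X0(2) by (simp add: dist_norm)
    qed (use cM in simp)
  qed
  have WQ: "upper_wedge \<sigma>0 \<subseteq> Q" and RQ: "polydisc \<sigma>0 \<inter> real_points \<subseteq> Q"
    by (auto simp: Q_def upper_wedge_def real_points_def less_imp_le)
  have imW: "im_vec w \<noteq> 0" if "w \<in> upper_wedge \<sigma>0" for w :: "complex ^ 'n"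
  proof
    assume "im_vec w = 0"
    then have "Im (w $ undefined) = 0" by (simp add: im_vec_def vec_eq_iff)
    then show False using that by (simp add: upper_wedge_def) (metis less_irrefl)
  qed
  have XW: "X0 w \<in> \<Omega> \<inter> ball p \<delta>" if "w \<in> upper_wedge \<sigma>0" for w
    using X0(1,3)[of w] that WQ imW[OF that] by blast
  have dX0: "\<exists>G. (X0 has_derivative G) (at w) \<and> clinear G \<and> (\<forall>v. norm v \<le> (cA + \<eta>h) * norm (G v))"
    if w: "w \<in> upper_wedge \<sigma>0" for w
  proof -
    let ?h' = "h' (X0 w)"
    have xb: "X0 w \<in> \<Omega> \<inter> ball p \<beta>" using XW[OF w] b\<beta> by blast
    have cl: "clinear ?h'" by (rule clh'[OF xb])
    have "inj ?h'"
      unfolding linear_injective_0[OF clinearD(1)[OF cl]]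
    proof (intro allI impI)
      fix v assume "?h' v = 0"
      then show "v = 0" using h'low[OF XW[OF w], of v] by simp
    qed
    note inv = linear_inv_of_inj[OF clinearD(1)[OF cl] this]
    have "(X0 has_derivative inv ?h') (at w)"
    proof (rule has_derivative_inverse_basic[where f = h and g = X0 and f' = "?h'" and g' = "inv ?h'" and T = "upper_wedge \<sigma>0"])
      show "(h has_derivative ?h') (at (X0 w))" by (rule dh[OF xb])
      show "bounded_linear (inv ?h')" using inv(2) linear_conv_bounded_linear by blast
      show "inv ?h' \<circ> ?h' = id" using bij_is_inj[OF inv(1)] by simp
      show "continuous (at w) X0"
        using continuous_on_subset[OF contX0 WQ] w continuous_on_eq_continuous_at[OF open_upper_wedge] by blast
      show "h (X0 z) = z" if "z \<in> upper_wedge \<sigma>0" for z using X0(2) that WQ by blast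
    qed (rule open_upper_wedge w)+
    moreover have "norm v \<le> (cA + \<eta>h) * norm (inv ?h' v)" for v
      using h'up[OF XW[OF w], of "inv ?h' v"] surj_f_inv_f[OF bij_is_surj[OF inv(1)]] by simp
    ultimately show ?thesis using clinear_inv[OF cl inv(1)] by blast
  qed
  then have holX0: "holo_on X0 (upper_wedge \<sigma>0)" unfolding holo_on_def by blast
  define \<epsilon> where "\<epsilon> = \<sigma>0 / 4"
  define \<sigma> where "\<sigma> = \<epsilon> / 2"
  have \<epsilon>: "\<epsilon> > 0" "4 * \<epsilon> = \<sigma>0" and \<sigma>: "\<sigma> > 0" "\<sigma> \<le> \<sigma>0" using \<sigma>0 by (auto simp: \<epsilon>_def \<sigma>_def)
  have subP: "polydisc \<sigma> \<subseteq> (polydisc \<sigma>0 :: (complex ^ 'n) set)"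
    using \<sigma>(2) unfolding polydisc_def by (auto intro: less_le_trans)
  then have subW: "upper_wedge \<sigma> \<subseteq> (upper_wedge \<sigma>0 :: (complex ^ 'n) set)" by (auto simp: upper_wedge_def)
  have ext: "\<exists>K. holo_on K (polydisc \<sigma>) \<and> (\<forall>w \<in> upper_wedge \<sigma> \<union> polydisc \<sigma> \<inter> real_points. K w = k (X0 w))"
    if k: "continuous_on (closure \<Omega> \<inter> ball p \<beta>) k" "holo_on k (\<Omega> \<inter> ball p \<beta>)" "\<And>x. x \<in> E \<inter> ball p \<beta> \<Longrightarrow> Im (k x) = 0"
    for k :: "complex ^ 'n \<Rightarrow> complex"
  proof -
    have c: "continuous_on (upper_wedge (4 * \<epsilon>) \<union> polydisc (4 * \<epsilon>) \<inter> real_points) (\<lambda>w. k (X0 w))"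
      unfolding \<epsilon>(2)
    proof (rule continuous_on_subset)
      show "continuous_on Q (\<lambda>w. k (X0 w))"
        by (rule continuous_on_compose2[OF k(1) contX0]) (use X0(1) b\<beta> in blast)
    qed (use WQ RQ in blast)
    have h: "holo_on (\<lambda>w. k (X0 w)) (upper_wedge (4 * \<epsilon>))"
      unfolding \<epsilon>(2) by (rule holo_on_compose[OF holX0 k(2)]) (use XW b\<beta> in blast)
    have re: "Im (k (X0 w)) = 0" if "w \<in> polydisc (4 * \<epsilon>) \<inter> real_points" for w
    proof (rule k(3))
      have wQ: "w \<in> Q" "im_vec w = 0" using that RQ im_vec_of_real[of w] unfolding \<epsilon>(2) by auto
      show "X0 w \<in> E \<inter> ball p \<beta>" using X0(1)[OF wQ(1)] X0(4)[OF wQ] b\<beta> by blast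
    qed
    show ?thesis unfolding \<sigma>_def
    proof (rule edge_of_the_wedge[OF \<epsilon>(1) c h re], assumption)
      fix g assume g: "holo_on g (polydisc (\<epsilon> / 2))"
        "\<And>w. w \<in> upper_wedge (\<epsilon> / 2) \<union> polydisc (\<epsilon> / 2) \<inter> real_points \<Longrightarrow> g w = k (X0 w)"
      show "\<exists>K. holo_on K (polydisc (\<epsilon> / 2)) \<and> (\<forall>w\<in>upper_wedge (\<epsilon> / 2) \<union> polydisc (\<epsilon> / 2) \<inter> real_points. K w = k (X0 w))"
        by (rule exI[of _ g], rule conjI[OF g(1)], rule ballI, erule g(2))
    qed
  qed
  have Y: "\<exists>K. holo_on K (polydisc \<sigma>) \<and> (\<forall>w \<in> upper_wedge \<sigma> \<union> polydisc \<sigma> \<inter> real_points. K w = X0 w $ j)" for j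
  proof -
    have holy: "holo_on y (\<Omega> \<inter> ball p \<beta>)"
      unfolding holo_on_def using deriv_y clinear_y' by blast
    have "\<exists>K. holo_on K (polydisc \<sigma>) \<and> (\<forall>w \<in> upper_wedge \<sigma> \<union> polydisc \<sigma> \<inter> real_points. K w = (\<lambda>x. x $ j + y x $ j) (X0 w))"
      by (rule ext) (auto intro!: continuous_intros cont_y holo_on_add holo_on_vec_nth holo_on_id holy simp: y_E)
    then obtain K1 where K1: "holo_on K1 (polydisc \<sigma>)" "\<forall>w \<in> upper_wedge \<sigma> \<union> polydisc \<sigma> \<inter> real_points. K1 w = X0 w $ j + y (X0 w) $ j" by blast
    have "\<exists>K. holo_on K (polydisc \<sigma>) \<and> (\<forall>w \<in> upper_wedge \<sigma> \<union> polydisc \<sigma> \<inter> real_points. K w = (\<lambda>x. \<i> * (y x $ j - x $ j)) (X0 w))"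
      by (rule ext) (auto intro!: continuous_intros cont_y holo_on_mult holo_on_diff holo_on_vec_nth holo_on_id holy simp: y_E)
    then obtain K2 where K2: "holo_on K2 (polydisc \<sigma>)" "\<forall>w \<in> upper_wedge \<sigma> \<union> polydisc \<sigma> \<inter> real_points. K2 w = \<i> * (y (X0 w) $ j - X0 w $ j)" by blast
    have "holo_on (\<lambda>w. (1/2) *\<^sub>C (K1 w + \<i> *\<^sub>C K2 w)) (polydisc \<sigma>)"
      by (intro holo_on_scaleC holo_on_add K1 K2)
    moreover have "(1/2) *\<^sub>C (K1 w + \<i> *\<^sub>C K2 w) = X0 w $ j" if "w \<in> upper_wedge \<sigma> \<union> polydisc \<sigma> \<inter> real_points" for w
    proof -
      have "(1/2) * ((a + b) + \<i> * (\<i> * (b - a))) = a" for a b :: complex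
        by (simp add: mult.assoc[symmetric])
      then show ?thesis using bspec[OF K1(2) that] bspec[OF K2(2) that] by (simp add: scaleC_complex_def)
    qed
    ultimately show ?thesis by blast
  qed
  then obtain K where K: "\<And>j. holo_on (K j) (polydisc \<sigma>)"
    "\<And>j w. w \<in> upper_wedge \<sigma> \<union> polydisc \<sigma> \<inter> real_points \<Longrightarrow> K j w = X0 w $ j" by metis
  define X where "X w = (\<chi> j. K j w)" for w
  have holX: "holo_on X (polydisc \<sigma>)" by (rule holo_on_vecI) (simp add: X_def K)
  have XX0: "X w = X0 w" if "w \<in> upper_wedge \<sigma> \<union> polydisc \<sigma> \<inter> real_points" for w
    using K(2)[OF that] by (simp add: X_def vec_eq_iff)
  have z: "0 \<in> polydisc \<sigma> \<inter> (real_points :: (complex ^ 'n) set)" using \<sigma> by (simp add: polydisc_def real_points_def)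
  have Xreal: "X w = e w \<and> X w \<in> E \<inter> ball p \<beta>" if w: "w \<in> polydisc \<sigma> \<inter> real_points" for w
  proof -
    have "w \<in> Q" "im_vec w = 0" using w subP RQ im_vec_of_real[of w] by blast+
    then show ?thesis using XX0[of w] w X0(1,4)[of w] b\<beta> by auto
  qed
  show ?thesis
  proof (rule that[OF \<sigma>(1) holX])
    show "X 0 = p" using Xreal[OF z] e0 by simp
    show "X w \<in> \<Omega> \<inter> ball p \<beta>" if "w \<in> upper_wedge \<sigma>" for w
    proof -
      have "X w = X0 w" by (rule XX0) (use that in blast)
      moreover have "X0 w \<in> \<Omega> \<inter> ball p \<delta>" by (rule XW) (use that subW in blast)
      ultimately show ?thesis using b\<beta> by auto
    qed
    show "X w \<in> E \<inter> ball p \<beta>" if "w \<in> polydisc \<sigma> \<inter> real_points" for w using Xreal[OF that] by blast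
    show "open U" "p \<in> U" by (rule U)+
    have "linear (\<lambda>x. re_vec (A x))" using linear_compose[OF linA linear_re_vec] by (simp add: o_def)
    then show "continuous_on UNIV (\<lambda>x. re_vec (A (x - p)))"
      by (rule linear_continuous_on_compose[rotated]) (intro continuous_intros)
    show "re_vec (A (p - p)) = 0" by (simp add: linear_0[OF linA] linear_0[OF linear_re_vec])
    show "re_vec (A (x - p)) \<in> real_points \<and> X (re_vec (A (x - p))) = x"
      if x: "x \<in> E \<inter> U" "re_vec (A (x - p)) \<in> polydisc \<sigma>" for x
    proof -
      have "norm (re_vec (A (x - p))) < \<kappa>" using nw[of "re_vec (A (x - p))"] subP x(2) by (auto simp: \<mu>_def)
      from eU[OF x(1) this] show ?thesis using Xreal[of "re_vec (A (x - p))"] x(2) re_vec_real by auto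
    qed
    show "\<forall>k. continuous_on (closure \<Omega> \<inter> ball p \<beta>) k \<longrightarrow> holo_on k (\<Omega> \<inter> ball p \<beta>) \<longrightarrow>
       (\<forall>x \<in> E \<inter> ball p \<beta>. Im (k x) = 0) \<longrightarrow>
       (\<exists>K. holo_on K (polydisc \<sigma>) \<and> (\<forall>w \<in> upper_wedge \<sigma> \<union> polydisc \<sigma> \<inter> real_points. K w = k (X w)))"
    proof (intro allI impI)
      fix k :: "complex ^ 'n \<Rightarrow> complex"
      assume "continuous_on (closure \<Omega> \<inter> ball p \<beta>) k" "holo_on k (\<Omega> \<inter> ball p \<beta>)" "\<forall>x \<in> E \<inter> ball p \<beta>. Im (k x) = 0"
      from ext[OF this(1,2)] this(3) obtain K where "holo_on K (polydisc \<sigma>)"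
        "\<forall>w \<in> upper_wedge \<sigma> \<union> polydisc \<sigma> \<inter> real_points. K w = k (X0 w)" by blast
      then show "\<exists>K. holo_on K (polydisc \<sigma>) \<and> (\<forall>w \<in> upper_wedge \<sigma> \<union> polydisc \<sigma> \<inter> real_points. K w = k (X w))"
        using XX0 by (intro exI[of _ K]) auto
    qed
    fix v assume v: "frechet_derivative X (at 0) v = 0"
    have low: "norm v \<le> (cA + \<eta>h) * norm (frechet_derivative X (at w) v)" if w: "w \<in> upper_wedge \<sigma>" for w
    proof -
      obtain G where G: "(X0 has_derivative G) (at w)" "\<forall>v. norm v \<le> (cA + \<eta>h) * norm (G v)"
        using dX0 w subW by blast
      have "(X has_derivative G) (at w)"
        by (rule has_derivative_transform_within_open[OF G(1) open_upper_wedge w]) (simp add: XX0)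
      then show ?thesis using G(2) frechet_derivative_eq by metis
    qed
    define c :: "real \<Rightarrow> complex ^ 'n" where "c t = (\<chi> j. \<i> * complex_of_real t)" for t
    have cW: "c t \<in> upper_wedge \<sigma>" if "0 < t" "t < \<sigma>" for t
      using that by (simp add: c_def upper_wedge_def polydisc_def norm_mult)
    have contF: "continuous_on (polydisc \<sigma>) (\<lambda>w. frechet_derivative X (at w) v)"
      by (rule continuous_on_frechet_holo[OF open_polydisc holX])
    have "isCont (\<lambda>w. frechet_derivative X (at w) v) (c 0)"
      using contF z continuous_on_eq_continuous_at[OF open_polydisc] by (auto simp: c_def zero_vec_def)
    moreover have "isCont c 0"
    proof -
      have "c = (\<lambda>t. t *\<^sub>R c 1)"
        by (rule HOL.ext) (simp add: c_def vec_eq_iff scaleR_conv_of_real[where 'a = complex])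
      moreover have "isCont (\<lambda>t. t *\<^sub>R c 1) 0" by (intro continuous_intros)
      ultimately show ?thesis by simp
    qed
    ultimately have "isCont (\<lambda>t. frechet_derivative X (at (c t)) v) 0"
      by (rule isCont_o2[rotated])
    then have "((\<lambda>t. (cA + \<eta>h) * norm (frechet_derivative X (at (c t)) v)) \<longlongrightarrow> (cA + \<eta>h) * norm (frechet_derivative X (at (c 0)) v)) (at_right 0)"
      by (intro tendsto_intros tendsto_within_subset[OF isContD]) auto
    moreover have "c 0 = 0" by (simp add: c_def vec_eq_iff)
    ultimately have "((\<lambda>t. (cA + \<eta>h) * norm (frechet_derivative X (at (c t)) v)) \<longlongrightarrow> 0) (at_right 0)"
      using v by simp
    moreover have "eventually (\<lambda>t. norm v \<le> (cA + \<eta>h) * norm (frechet_derivative X (at (c t)) v)) (at_right 0)"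
      by (rule eventually_mono[OF eventually_at_right_real[OF \<sigma>(1)]]) (rule low, rule cW, simp_all)
    ultimately have "norm v \<le> 0"
      by (intro tendsto_lowerbound) auto
    then show "v = 0" by simp
  qed
qed

end

section \<open>Polarized functions and holomorphic reflections\<close>

lemma open_diagonal:
  assumes "open G" shows "open {y. (y, cnjv y) \<in> G}"
proof -
  have "open ((\<lambda>y. (y, cnjv y)) -` G)" by (rule open_vimage[OF assms]) (intro continuous_intros)
  then show ?thesis by (simp add: vimage_def)
qed

lemma cderiv_linear:
  assumes "holo_on f S" "x \<in> S"
  shows "cderiv f (u + v) x = cderiv f u x + cderiv f v x" "cderiv f (c *\<^sub>C v) x = c * cderiv f v x"
  using linear_add[OF clinearD(1)[OF holo_on_has_derivative_cderiv(2)[OF assms]], of u v]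
    clinearD(2)[OF holo_on_has_derivative_cderiv(2)[OF assms], of c v] by simp_all

lemma clinear_expand:
  assumes "clinear T" shows "T (v :: complex ^ 'n) = (\<Sum>k\<in>UNIV. v $ k *\<^sub>C T (axis k 1))"
proof -
  have v: "v = (\<Sum>k\<in>UNIV. v $ k *\<^sub>C axis k 1)"
    by (simp add: vec_eq_iff axis_def if_distrib[of "\<lambda>c. _ * c"] cong: if_cong)
  have "T (\<Sum>k\<in>UNIV. v $ k *\<^sub>C axis k 1) = (\<Sum>k\<in>UNIV. v $ k *\<^sub>C T (axis k 1))"
    by (simp add: linear_sum[OF clinearD(1)[OF assms]] clinearD(2)[OF assms])
  then show ?thesis using v by simp
qed

lemma cderiv_expand:
  fixes Q :: "(complex ^ 'n) \<times> (complex ^ 'n) \<Rightarrow> complex"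
  assumes "holo_on Q G" "z \<in> G"
  shows "cderiv Q (v, 0) z = (\<Sum>k\<in>UNIV. v $ k * cderiv Q (axis k 1, 0) z)"
proof -
  have "clinear (\<lambda>v. cderiv Q (v, 0) z)"
    by (rule clinear_compose[OF clinear_Pair[OF clinear_id clinear_const0] holo_on_has_derivative_cderiv(2)[OF assms]])
  from clinear_expand[OF this, of v] show ?thesis by simp
qed

lemma polarized_has_derivative:
  fixes Q :: "(complex ^ 'n) \<times> (complex ^ 'n) \<Rightarrow> complex"
  assumes G: "open G" "holo_on Q G" and g: "\<And>y. (y, cnjv y) \<in> G \<Longrightarrow> g y = Q (y, cnjv y)" and x: "(x, cnjv x) \<in> G"
  shows "(g has_derivative (\<lambda>v. cderiv Q (v, 0) (x, cnjv x) + cderiv Q (0, cnjv v) (x, cnjv x))) (at x)"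
proof -
  let ?D = "\<lambda>w. cderiv Q w (x, cnjv x)"
  have "((\<lambda>y. (y, cnjv y)) has_derivative (\<lambda>v. (v, cnjv v))) (at x)"
    by (intro has_derivative_Pair has_derivative_ident bounded_linear_imp_has_derivative bounded_linear_cnjv)
  moreover have "(Q has_derivative ?D) (at (x, cnjv x))" by (rule holo_on_has_derivative_cderiv(1)[OF G(2) x])
  ultimately have "((\<lambda>y. Q (y, cnjv y)) has_derivative (\<lambda>v. ?D (v, cnjv v))) (at x)"
    by (rule has_derivative_compose)
  moreover have "(\<lambda>v. ?D (v, cnjv v)) = (\<lambda>v. ?D (v, 0) + ?D (0, cnjv v))"
    using cderiv_linear(1)[OF G(2) x, of "(v,0)" "(0, cnjv v)" for v] by simp
  ultimately have "((\<lambda>y. Q (y, cnjv y)) has_derivative (\<lambda>v. ?D (v, 0) + ?D (0, cnjv v))) (at x)" by simp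
  from has_derivative_transform_within_open[OF this open_diagonal[OF G(1)]] show ?thesis
    using x g by auto
qed

lemma axis_i: "axis j \<i> = \<i> *\<^sub>C axis j (1::complex)"
  and cnjv_axis: "cnjv (axis j 1) = axis j 1" "cnjv (axis j \<i>) = (- \<i>) *\<^sub>C axis j (1::complex)"
  by (auto simp: vec_eq_iff axis_def)

lemma cderiv_i:
  fixes Q :: "(complex ^ 'n) \<times> (complex ^ 'n) \<Rightarrow> complex"
  assumes "holo_on Q G" "z \<in> G"
  shows "cderiv Q (c *\<^sub>C v, 0) z = c * cderiv Q (v, 0) z" "cderiv Q (0, c *\<^sub>C v) z = c * cderiv Q (0, v) z"
proof -
  have e: "(c *\<^sub>C v, 0) = c *\<^sub>C (v, 0 :: complex ^ 'n)" "(0, c *\<^sub>C v) = c *\<^sub>C (0 :: complex ^ 'n, v)"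
    by (simp_all add: prod_eq_iff)
  show "cderiv Q (c *\<^sub>C v, 0) z = c * cderiv Q (v, 0) z" "cderiv Q (0, c *\<^sub>C v) z = c * cderiv Q (0, v) z"
    unfolding e by (rule cderiv_linear(2)[OF assms])+
qed

text \<open>
  For a polarized function the Wirtinger derivatives are the derivatives in the two independent
  variables.
\<close>

lemma dz_polarized:
  fixes Q :: "(complex ^ 'n) \<times> (complex ^ 'n) \<Rightarrow> complex"
  assumes G: "open G" "holo_on Q G" and g: "\<And>y. (y, cnjv y) \<in> G \<Longrightarrow> g y = Q (y, cnjv y)" and x: "(x, cnjv x) \<in> G"
  shows "dz j g x = cderiv Q (axis j 1, 0) (x, cnjv x)" "dzbar j g x = cderiv Q (0, axis j 1) (x, cnjv x)"
proof -
  have fd: "frechet_derivative g (at x) = (\<lambda>v. cderiv Q (v, 0) (x, cnjv x) + cderiv Q (0, cnjv v) (x, cnjv x))"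
    by (rule frechet_derivative_eq, rule polarized_has_derivative[OF G _ x], rule g)
  show "dz j g x = cderiv Q (axis j 1, 0) (x, cnjv x)" "dzbar j g x = cderiv Q (0, axis j 1) (x, cnjv x)"
    unfolding dz_def dzbar_def fd axis_i cnjv_scaleC cnjv_axis(1) cderiv_i[OF G(2) x] by (simp_all add: algebra_simps)
qed

text \<open>
  Comparison of the derivatives of both sides along \<open>u\<close> and along \<open>\<i> u\<close> separates the complex linear
  from the antilinear part.
\<close>

lemma conj_polarized:
  fixes Q :: "(complex ^ 'n) \<times> (complex ^ 'n) \<Rightarrow> complex"
  assumes G: "open G" "holo_on Q G" "holo_on Q' G"
    and QQ: "\<And>y. (y, cnjv y) \<in> G \<Longrightarrow> Q' (y, cnjv y) = cnj (Q (y, cnjv y))" and x: "(x, cnjv x) \<in> G"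
  shows "cderiv Q' (u, 0) (x, cnjv x) = cnj (cderiv Q (0, cnjv u) (x, cnjv x))"
proof -
  let ?x = "(x, cnjv x)"
  have d1: "((\<lambda>y. cnj (Q (y, cnjv y))) has_derivative (\<lambda>v. cderiv Q' (v, 0) ?x + cderiv Q' (0, cnjv v) ?x)) (at x)"
    by (rule polarized_has_derivative[OF G(1,3) _ x]) (simp add: QQ)
  have "((\<lambda>y. Q (y, cnjv y)) has_derivative (\<lambda>v. cderiv Q (v, 0) ?x + cderiv Q (0, cnjv v) ?x)) (at x)"
    by (rule polarized_has_derivative[OF G(1,2) _ x]) simp
  from has_derivative_cnj[OF this] have d2: "((\<lambda>y. cnj (Q (y, cnjv y))) has_derivative
      (\<lambda>v. cnj (cderiv Q (v, 0) ?x + cderiv Q (0, cnjv v) ?x))) (at x)" .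
  have eq: "cderiv Q' (v, 0) ?x + cderiv Q' (0, cnjv v) ?x = cnj (cderiv Q (v, 0) ?x) + cnj (cderiv Q (0, cnjv v) ?x)" for v
    using fun_cong[OF has_derivative_unique[OF d1 d2], of v] by simp
  have "\<i> * cderiv Q' (u, 0) ?x - \<i> * cderiv Q' (0, cnjv u) ?x = - \<i> * cnj (cderiv Q (u, 0) ?x) + \<i> * cnj (cderiv Q (0, cnjv u) ?x)"
    using eq[of "\<i> *\<^sub>C u"] unfolding cnjv_scaleC cderiv_i[OF G(2) x] cderiv_i[OF G(3) x] by simp
  then have "\<i> * (cderiv Q' (u, 0) ?x - cderiv Q' (0, cnjv u) ?x) = \<i> * (- cnj (cderiv Q (u, 0) ?x) + cnj (cderiv Q (0, cnjv u) ?x))"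
    by (simp add: algebra_simps)
  then have "cderiv Q' (u, 0) ?x - cderiv Q' (0, cnjv u) ?x = - cnj (cderiv Q (u, 0) ?x) + cnj (cderiv Q (0, cnjv u) ?x)"
    by (simp only: mult_cancel_left complex_i_not_zero)  simp
  then have "2 * cderiv Q' (u, 0) ?x = 2 * cnj (cderiv Q (0, cnjv u) ?x)" using eq[of u] by algebra
  then show ?thesis by simp
qed

locale polarized =
  fixes G :: "((complex ^ 'n) \<times> (complex ^ 'n)) set" and R :: "(complex ^ 'n) \<times> (complex ^ 'n) \<Rightarrow> complex"
    and r :: "complex ^ 'n \<Rightarrow> real"
  assumes open_G: "open G" and holo_R: "holo_on R G"
    and R_diag: "\<And>x. (x, cnjv x) \<in> G \<Longrightarrow> R (x, cnjv x) = of_real (r x)"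
begin

definition grad :: "(complex ^ 'n) \<times> (complex ^ 'n) \<Rightarrow> complex ^ 'n" where
  "grad z = (\<chi> j. cderiv R (axis j 1, 0) z)"

definition rgrad :: "complex ^ 'n \<Rightarrow> complex ^ 'n" where
  "rgrad x = 2 *\<^sub>R cnjv (grad (x, cnjv x))"

lemma grad_nth: "grad z $ j = cderiv R (axis j 1, 0) z"
  by (simp add: grad_def)

lemma holo_grad: "holo_on grad G"
  by (rule holo_on_vecI) (simp add: grad_nth holo_on_cderiv[OF open_G holo_R])

lemma open_diag: "open {x. (x, cnjv x) \<in> G}"
  by (rule open_diagonal[OF open_G])

lemma dz_r: "(x, cnjv x) \<in> G \<Longrightarrow> dz j (\<lambda>y. complex_of_real (r y)) x = grad (x, cnjv x) $ j"
  unfolding grad_nth by (rule dz_polarized(1)[OF open_G holo_R]) (simp_all add: R_diag)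

lemma rgrad_inner: "rgrad x \<bullet> v = 2 * Re (\<Sum>j\<in>UNIV. grad (x, cnjv x) $ j * v $ j)"
  by (simp add: rgrad_def inner_vec_def inner_complex_def sum_distrib_left algebra_simps)

lemma real_conj: "(x, cnjv x) \<in> G \<Longrightarrow> cderiv R (u, 0) (x, cnjv x) = cnj (cderiv R (0, cnjv u) (x, cnjv x))"
  by (rule conj_polarized[OF open_G holo_R holo_R]) (simp_all add: R_diag)

lemma deriv_r:
  assumes x: "(x, cnjv x) \<in> G" shows "(r has_derivative (\<lambda>v. rgrad x \<bullet> v)) (at x)"
proof -
  have "((\<lambda>y. complex_of_real (r y)) has_derivative (\<lambda>v. cderiv R (v, 0) (x, cnjv x) + cderiv R (0, cnjv v) (x, cnjv x))) (at x)"
    by (rule polarized_has_derivative[OF open_G holo_R _ x]) (simp add: R_diag)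
  from has_derivative_Re[OF this]
  have "(r has_derivative (\<lambda>v. Re (cderiv R (v, 0) (x, cnjv x) + cderiv R (0, cnjv v) (x, cnjv x)))) (at x)" by simp
  moreover have "Re (cderiv R (v, 0) (x, cnjv x) + cderiv R (0, cnjv v) (x, cnjv x)) = rgrad x \<bullet> v" for v
  proof -
    have "Re (cderiv R (0, cnjv v) (x, cnjv x)) = Re (cderiv R (v, 0) (x, cnjv x))"
      using arg_cong[OF real_conj[OF x, of v], of Re] by simp
    then show ?thesis unfolding rgrad_inner cderiv_expand[OF holo_R x, where v = v] by (simp add: grad_nth mult.commute)
  qed
  ultimately show ?thesis by simp
qed

lemma continuous_grad: "continuous_on {x. (x, cnjv x) \<in> G} (\<lambda>x. grad (x, cnjv x))"
  by (rule continuous_on_compose2[OF holo_on_imp_continuous_on[OF holo_grad]]) (auto intro!: continuous_intros)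

lemma continuous_rgrad: "continuous_on {x. (x, cnjv x) \<in> G} rgrad"
  unfolding rgrad_def by (intro continuous_intros continuous_grad)

lemma rgrad_differentiable:
  assumes x: "(x, cnjv x) \<in> G" shows "rgrad differentiable (at x)"
proof -
  obtain D where D: "(grad has_derivative D) (at (x, cnjv x))" using holo_onE[OF holo_grad x] by blast
  have "((\<lambda>y. (y, cnjv y)) has_derivative (\<lambda>v. (v, cnjv v))) (at x)"
    by (intro has_derivative_Pair has_derivative_ident bounded_linear_imp_has_derivative bounded_linear_cnjv)
  from has_derivative_compose[OF this D] have "((\<lambda>y. grad (y, cnjv y)) has_derivative (\<lambda>v. D (v, cnjv v))) (at x)" .
  from has_derivative_scaleR_right[OF bounded_linear.has_derivative[OF bounded_linear_cnjv this], of 2]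
  have "(rgrad has_derivative (\<lambda>v. 2 *\<^sub>R cnjv (D (v, cnjv v)))) (at x)" by (simp only: rgrad_def[abs_def])
  then show ?thesis by (rule differentiableI)
qed

text \<open>
  Solve \<open>\<xi> = c \<partial>r (x, y)\<close>, \<open>r (x, y) = 0\<close> for \<open>(y, c)\<close>, where \<open>r (x, y)\<close> is the polarization.  On the boundary
  \<open>(conj x, c)\<close> is a solution for \<open>\<xi> = c \<partial>r x\<close>.  If \<open>(v, s)\<close> is in the kernel of the derivative, the second
  equation makes the conjugate of \<open>v\<close> a complex tangent vector, and pairing the first one with it
  annihilates the term with \<open>s\<close> and leaves the Levi form, whence \<open>v = 0\<close> and then \<open>s = 0\<close>.
\<close>

theorem conormal_reflection:
  assumes p: "(p, cnjv p) \<in> G" "r p = 0" and c0: "c0 > 0" and nz: "grad (p, cnjv p) \<noteq> 0"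
    and levi: "\<And>v. v \<in> complex_tangent r p \<Longrightarrow> v \<noteq> 0 \<Longrightarrow> levi_form r p v > 0"
  obtains A Y \<delta> where "open A" "holo_on Y A" "\<delta> > 0"
    "\<And>x c. x \<in> ball p \<delta> \<Longrightarrow> r x = 0 \<Longrightarrow> \<bar>c - c0\<bar> < \<delta> \<Longrightarrow>
       (x, complex_of_real c *\<^sub>C grad (x, cnjv x)) \<in> A \<and> Y (x, complex_of_real c *\<^sub>C grad (x, cnjv x)) = cnjv x"
proof -
  define \<pi> :: "((complex ^ 'n) \<times> (complex ^ 'n)) \<times> ((complex ^ 'n) \<times> complex) \<Rightarrow> (complex ^ 'n) \<times> (complex ^ 'n)"
    where "\<pi> z = (fst (fst z), fst (snd z))" for z
  define F :: "((complex ^ 'n) \<times> (complex ^ 'n)) \<times> ((complex ^ 'n) \<times> complex) \<Rightarrow> (complex ^ 'n) \<times> complex"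
    where "F z = ((\<chi> j. snd (fst z) $ j - snd (snd z) * grad (\<pi> z) $ j), R (\<pi> z))" for z
  define S where "S = \<pi> -` G"
  \<comment> \<open>the point of the conormal bundle at which the implicit function theorem is applied\<close>
  define z0 where "z0 = ((p, complex_of_real c0 *\<^sub>C grad (p, cnjv p)), (cnjv p, complex_of_real c0))"
  have cl\<pi>: "clinear \<pi>"
    unfolding \<pi>_def by (intro clinear_Pair clinear_compose[OF clinear_fst clinear_fst] clinear_compose[OF clinear_snd clinear_fst])
  have lin\<pi>: "linear \<pi>" using cl\<pi> by (rule clinearD)
  have S: "open S" unfolding S_def
    by (rule open_vimage[OF open_G]) (use linear_continuous_on[of \<pi> UNIV] lin\<pi> linear_conv_bounded_linear in blast)
  have hol\<pi>: "holo_on (\<lambda>z. H (\<pi> z)) S" if "holo_on H G" for H :: "_ \<Rightarrow> complex"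
    by (rule holo_on_compose[OF holo_on_clinear[OF cl\<pi>] that]) (auto simp: S_def)
  have \<pi>0: "\<pi> z0 = (p, cnjv p)" by (simp add: \<pi>_def z0_def)
  have z0S: "z0 \<in> S" unfolding S_def using p(1) \<pi>0 by simp
  have holF: "holo_on F S"
  proof -
    have "holo_on (\<lambda>z. \<chi> j. snd (fst z) $ j - snd (snd z) * grad (\<pi> z) $ j) S"
    proof (rule holo_on_vecI)
      fix j
      have "holo_on (\<lambda>z. snd (fst z) $ j - snd (snd z) * grad (\<pi> z) $ j) S"
        by (intro holo_on_diff holo_on_mult holo_on_vec_nth hol\<pi>[OF holo_on_vec_nth[OF holo_grad]]
            holo_on_clinear clinear_compose[OF clinear_fst clinear_snd] clinear_compose[OF clinear_snd clinear_snd])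
      then show "holo_on (\<lambda>z. (\<chi> j. snd (fst z) $ j - snd (snd z) * grad (\<pi> z) $ j) $ j) S" by simp
    qed
    then show ?thesis unfolding F_def by (rule holo_on_Pair[OF _ hol\<pi>[OF holo_R]])
  qed
  have d\<pi>: "((\<lambda>z. H (\<pi> z)) has_derivative (\<lambda>w. cderiv H (\<pi> w) (p, cnjv p))) (at z0)" if "holo_on H G" for H
  proof -
    have "(H has_derivative (\<lambda>w. cderiv H w (p, cnjv p))) (at (\<pi> z0))"
      unfolding \<pi>0 by (rule holo_on_has_derivative_cderiv(1)[OF that p(1)])
    then show ?thesis by (rule has_derivative_compose[OF linear_imp_has_derivative[OF lin\<pi>]])
  qed
  define D1 where "D1 j w = snd (fst w) $ j - (complex_of_real c0 * cderiv (\<lambda>z. grad z $ j) (\<pi> w) (p, cnjv p)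
      + snd (snd w) * grad (p, cnjv p) $ j)" for j and w :: "((complex ^ 'n) \<times> (complex ^ 'n)) \<times> ((complex ^ 'n) \<times> complex)"
  have dF: "(F has_derivative (\<lambda>w. (\<chi> j. D1 j w, cderiv R (\<pi> w) (p, cnjv p)))) (at z0)"
  proof -
    have "((\<lambda>z. snd (fst z) $ j - snd (snd z) * grad (\<pi> z) $ j) has_derivative D1 j) (at z0)" for j
    proof -
      have 1: "((\<lambda>z :: ((complex ^ 'n) \<times> (complex ^ 'n)) \<times> ((complex ^ 'n) \<times> complex). snd (fst z) $ j) has_derivative (\<lambda>w. snd (fst w) $ j)) (at z0)"
        by (rule linear_imp_has_derivative[OF clinearD(1)[OF clinear_compose[OF clinear_compose[OF clinear_fst clinear_snd] clinear_vec_nth]]])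
      have 2: "((\<lambda>z :: ((complex ^ 'n) \<times> (complex ^ 'n)) \<times> ((complex ^ 'n) \<times> complex). snd (snd z)) has_derivative (\<lambda>w. snd (snd w))) (at z0)"
        by (rule linear_imp_has_derivative[OF clinearD(1)[OF clinear_compose[OF clinear_snd clinear_snd]]])
      have "((\<lambda>z. snd (fst z) $ j - snd (snd z) * grad (\<pi> z) $ j) has_derivative (\<lambda>w. snd (fst w) $ j -
          (snd (snd z0) * cderiv (\<lambda>z. grad z $ j) (\<pi> w) (p, cnjv p) + snd (snd w) * grad (\<pi> z0) $ j))) (at z0)"
        by (rule has_derivative_diff[OF 1 has_derivative_mult[OF 2 d\<pi>[OF holo_on_vec_nth[OF holo_grad]]]])
      then show ?thesis unfolding \<pi>0 by (simp add: z0_def D1_def[abs_def])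
    qed
    then have "((\<lambda>z. \<chi> j. snd (fst z) $ j - snd (snd z) * grad (\<pi> z) $ j) has_derivative (\<lambda>w. \<chi> j. D1 j w)) (at z0)"
      unfolding has_derivative_vec_nth_iff by simp
    then show ?thesis unfolding F_def by (rule has_derivative_Pair[OF _ d\<pi>[OF holo_R]])
  qed
  have inj: "v = 0 \<and> s = 0" if z: "((\<chi> j. D1 j (0, (v, s))), cderiv R (\<pi> (0, (v, s))) (p, cnjv p)) = 0" for v s
  proof -
    let ?g = "\<lambda>j. cderiv (\<lambda>z. grad z $ j) (0, v) (p, cnjv p)"
    define u where "u = cnjv v"
    have uv: "cnjv u = v" by (simp add: u_def)
    have "D1 j (0, (v, s)) = 0" for j using arg_cong[OF z, of "\<lambda>w. fst w $ j"] by simp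
    moreover have "D1 j (0, (v, s)) = - (complex_of_real c0 * ?g j + s * grad (p, cnjv p) $ j)" for j
      by (simp add: D1_def \<pi>_def)
    ultimately have eq1: "complex_of_real c0 * ?g j + s * grad (p, cnjv p) $ j = 0" for j
      using neg_equal_0_iff_equal by metis
    have eq2: "cderiv R (0, v) (p, cnjv p) = 0" using arg_cong[OF z, of snd] by (simp add: \<pi>_def)
    have "cderiv R (u, 0) (p, cnjv p) = 0" unfolding real_conj[OF p(1)] uv eq2 by simp
    then have tan: "(\<Sum>j\<in>UNIV. u $ j * grad (p, cnjv p) $ j) = 0"
      unfolding cderiv_expand[OF holo_R p(1), where v = u] by (simp add: grad_nth)
    have "(\<Sum>j\<in>UNIV. u $ j * (complex_of_real c0 * ?g j + s * grad (p, cnjv p) $ j)) = 0" unfolding eq1 by simp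
    then have "complex_of_real c0 * (\<Sum>j\<in>UNIV. u $ j * ?g j) + s * (\<Sum>j\<in>UNIV. u $ j * grad (p, cnjv p) $ j) = 0"
      by (simp add: algebra_simps sum.distrib sum_distrib_left)
    then have g0: "(\<Sum>j\<in>UNIV. u $ j * ?g j) = 0" using tan c0 by simp
    define Q where "Q k = cderiv R (0, axis k 1)" for k
    have holQ: "holo_on (Q k) G" for k unfolding Q_def by (rule holo_on_cderiv[OF open_G holo_R])
    have Qg: "Q k (y, cnjv y) = cnj (grad (y, cnjv y) $ k)" if "(y, cnjv y) \<in> G" for k y
      unfolding Q_def grad_nth using real_conj[OF that, of "axis k 1"] by (simp add: cnjv_axis)
    have dzz: "dz j (dzbar k (\<lambda>y. complex_of_real (r y))) p = cderiv (Q k) (axis j 1, 0) (p, cnjv p)" for j k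
    proof (rule dz_polarized(1)[OF open_G holQ _ p(1)])
      fix y assume "(y, cnjv y) \<in> G"
      then show "dzbar k (\<lambda>y. complex_of_real (r y)) y = Q k (y, cnjv y)"
        unfolding Q_def by (rule dz_polarized(2)[OF open_G holo_R, rotated]) (simp add: R_diag)
    qed
    have "(\<Sum>j\<in>UNIV. \<Sum>k\<in>UNIV. dz j (dzbar k (\<lambda>y. complex_of_real (r y))) p * u $ j * cnj (u $ k))
        = (\<Sum>k\<in>UNIV. cnj (u $ k) * (\<Sum>j\<in>UNIV. u $ j * cderiv (Q k) (axis j 1, 0) (p, cnjv p)))"
      unfolding dzz by (subst sum.swap) (simp add: sum_distrib_left mult_ac)
    also have "\<dots> = (\<Sum>k\<in>UNIV. cnj (u $ k) * cderiv (Q k) (u, 0) (p, cnjv p))"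
      unfolding cderiv_expand[OF holQ p(1), where v = u, symmetric] ..
    also have "\<dots> = (\<Sum>k\<in>UNIV. cnj (u $ k) * cnj (?g k))"
    proof -
      have "cderiv (Q k) (u, 0) (p, cnjv p) = cnj (?g k)" for k
        using conj_polarized[OF open_G holo_on_vec_nth[OF holo_grad] holQ Qg p(1), of k u] by (simp add: uv)
      then show ?thesis by simp
    qed
    also have "\<dots> = cnj (\<Sum>k\<in>UNIV. u $ k * ?g k)" by simp
    also have "\<dots> = 0" unfolding g0 by simp
    finally have "levi_form r p u = 0" by (simp add: levi_form_def)
    moreover have "u \<in> complex_tangent r p"
      using tan unfolding complex_tangent_def dz_r[OF p(1)] by (simp add: mult.commute)
    ultimately have "u = 0" using levi[of u] by auto
    then have v: "v = 0" using uv by (simp add: cnjv_simps)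
    obtain j where j: "grad (p, cnjv p) $ j \<noteq> 0" using nz by (auto simp: vec_eq_iff)
    have "?g j = 0" using cderiv_i(2)[OF holo_on_vec_nth[OF holo_grad, of j] p(1), of 0 v] v by simp
    then have "s = 0" using eq1[of j] j by simp
    then show ?thesis using v by simp
  qed
  have inj': "w = 0" if "((\<chi> j. D1 j (0, w)), cderiv R (\<pi> (0, w)) (p, cnjv p)) = 0" for w
    using inj[of "fst w" "snd w"] that by (simp add: prod_eq_iff)
  have F0: "F z0 = 0"
    unfolding F_def \<pi>0 R_diag[OF p(1)] p(2) by (simp add: z0_def prod_eq_iff vec_eq_iff)
  obtain A B Y where AB: "open A" "fst z0 \<in> A" "open B" "snd z0 \<in> B" "A \<times> B \<subseteq> S" "holo_on Y A"
    and Y: "\<And>x y. x \<in> A \<Longrightarrow> y \<in> B \<Longrightarrow> F (x, y) = 0 \<longleftrightarrow> y = Y x"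
  proof -
    show thesis
      by (rule holo_implicit_function[of S "fst z0" "snd z0" F, OF S _ holF _ _ inj'])
        (use z0S F0 dF that in \<open>simp_all only: prod.collapse\<close>)
  qed
  define m where "m z = ((fst z, complex_of_real (snd z) *\<^sub>C grad (fst z, cnjv (fst z))), (cnjv (fst z), complex_of_real (snd z)))"
    for z :: "(complex ^ 'n) \<times> real"
  define T where "T = {x. (x, cnjv x) \<in> G} \<times> (UNIV :: real set)"
  have "continuous_on T (\<lambda>z. grad (fst z, cnjv (fst z)))"
    by (rule continuous_on_compose2[OF continuous_grad continuous_on_fst[OF continuous_on_id]]) (auto simp: T_def)
  then have contm: "continuous_on T m" unfolding m_def by (intro continuous_intros)
  have "open T" unfolding T_def by (intro open_Times open_diag open_UNIV)
  then have "open (T \<inter> m -` (A \<times> B))" by (intro continuous_open_preimage contm open_Times AB)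
  moreover have "(p, c0) \<in> T \<inter> m -` (A \<times> B)" using AB(2,4) p(1) by (simp add: T_def m_def z0_def)
  ultimately obtain e where e: "e > 0" "ball (p, c0) e \<subseteq> T \<inter> m -` (A \<times> B)" using open_contains_ball by metis
  show ?thesis
  proof (rule that[of A "\<lambda>x. fst (Y x)" "e / 2"])
    show "open A" by fact
    show "holo_on (\<lambda>x. fst (Y x)) A" by (rule holo_on_fst[OF AB(6)])
    show "e / 2 > 0" using e by simp
    fix x c assume x: "x \<in> ball p (e / 2)" "r x = 0" "\<bar>c - c0\<bar> < e / 2"
    have "dist (p, c0) (x, c) \<le> dist p x + dist c0 c"
      unfolding dist_Pair_Pair by (rule sqrt_sum_squares_le_sum) auto
    also have "\<dots> < e" using x by (simp add: dist_real_def abs_minus_commute)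
    finally have "(x, c) \<in> T \<inter> m -` (A \<times> B)" using e(2) by auto
    then have xG: "(x, cnjv x) \<in> G" and a: "(x, complex_of_real c *\<^sub>C grad (x, cnjv x)) \<in> A" and b: "(cnjv x, complex_of_real c) \<in> B"
      by (auto simp: T_def m_def)
    have "F ((x, complex_of_real c *\<^sub>C grad (x, cnjv x)), (cnjv x, complex_of_real c)) = 0"
      using R_diag[OF xG] x(2) by (simp add: F_def \<pi>_def prod_eq_iff vec_eq_iff)
    then have "(cnjv x, complex_of_real c) = Y (x, complex_of_real c *\<^sub>C grad (x, cnjv x))" using Y[OF a b] by blast
    then show "(x, complex_of_real c *\<^sub>C grad (x, cnjv x)) \<in> A \<and> fst (Y (x, complex_of_real c *\<^sub>C grad (x, cnjv x))) = cnjv x"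
      using a by (metis fst_conv)
  qed
qed

end

lemma real_analytic_polarized:
  fixes u :: "complex ^ 'n \<Rightarrow> real"
  assumes "real_analytic_on u S" "a \<in> S"
  obtains G R where "polarized G R u" "(a, cnjv a) \<in> G"
proof -
  obtain G and R :: "(complex ^ 'n) \<times> (complex ^ 'n) \<Rightarrow> complex" where G: "open G" "(a, cnjv a) \<in> G" "holo_on R G"
    and R: "\<And>x. (x, cnjv x) \<in> G \<Longrightarrow> R (x, cnjv x) = of_real (u x)"
  proof -
    show thesis by (rule real_analytic_polarization[OF assms], rule that)
  qed
  have "polarized G R u" by (rule polarized.intro[OF G(1,3) R])
  then show thesis using G(2) by (rule that)
qed

lemma real_analytic_differentiable:
  fixes f :: "complex ^ 'n \<Rightarrow> complex ^ 'm"
  assumes f: "real_analytic_on f S" and x: "x \<in> S"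
  shows "f differentiable (at x)"
  unfolding differentiable_componentwise_within[of f x UNIV]
proof
  fix b :: "complex ^ 'm"
  have "real_analytic_on (\<lambda>x. f x \<bullet> b) S"
    by (rule real_analytic_on_bounded_linear[OF f bounded_linear_inner_left])
  then obtain G R where "polarized G R (\<lambda>x. f x \<bullet> b)" "(x, cnjv x) \<in> G" using real_analytic_polarized x by blast
  from differentiableI[OF polarized.deriv_r[OF this]] show "(\<lambda>x. f x \<bullet> b) differentiable (at x)" .
qed

text \<open>
  Polarize the real equations of \<open>M\<close> and solve them for the second variable.  A vector in the kernel of
  the derivative has a conjugate all of whose complex multiples are tangent to \<open>M\<close>, so it vanishes.
\<close>

theorem totally_real_reflection:
  fixes M :: "(complex ^ 'm) set"
  assumes M: "submanifold real_analytic_on CARD('m) M" "totally_real M" and q: "q \<in> M"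
  obtains A S where "open A" "q \<in> A" "holo_on S A" "\<And>x. x \<in> M \<inter> A \<Longrightarrow> S x = cnjv x"
proof -
  obtain W \<phi> \<phi>' and \<beta> b :: "'m \<Rightarrow> complex ^ 'm" where W: "open W" "q \<in> W" and \<phi>: "real_analytic_on \<phi> W"
    and d\<phi>: "(\<phi> has_derivative \<phi>') (at q)"
    and MW: "\<And>x. x \<in> W \<Longrightarrow> x \<in> M \<longleftrightarrow> (\<forall>j. \<phi> x \<bullet> \<beta> j = 0)"
    and tan: "\<And>v. (\<forall>j. \<phi>' v \<bullet> \<beta> j = 0) \<Longrightarrow> v \<in> tangent_space M q"
  proof -
    show thesis
      by (rule submanifold_chart[OF M(1) q real_analytic_differentiable], assumption, assumption, rule that)
  qed
  define \<sigma> where "\<sigma> j x = \<phi> x \<bullet> \<beta> j" for j x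
  have "\<exists>G R. polarized G R (\<sigma> j) \<and> (q, cnjv q) \<in> G" for j
  proof -
    have "real_analytic_on (\<sigma> j) W"
      unfolding \<sigma>_def by (rule real_analytic_on_bounded_linear[OF \<phi> bounded_linear_inner_left])
    then show ?thesis using real_analytic_polarized W(2) by metis
  qed
  then obtain G R where GR: "\<And>j. polarized (G j) (R j) (\<sigma> j)" "\<And>j. (q, cnjv q) \<in> G j" by metis
  define S where "S = (\<Inter>j. G j)"
  have S: "open S" "(q, cnjv q) \<in> S"
    unfolding S_def by (rule open_INT) (simp_all add: polarized.open_G[OF GR(1)] GR(2))
  have SG: "S \<subseteq> G j" for j by (auto simp: S_def)
  define F where "F z = (\<chi> j. R j z)" for z
  have holR: "holo_on (R j) S" for j using holo_on_subset[OF polarized.holo_R[OF GR(1)] SG] .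
  have holF: "holo_on F S" by (rule holo_on_vecI) (simp add: F_def holR)
  have dF: "(F has_derivative (\<lambda>w. \<chi> j. cderiv (R j) w (q, cnjv q))) (at (q, cnjv q))"
    unfolding has_derivative_vec_nth_iff using holo_on_has_derivative_cderiv(1)[OF holR S(2)] by (simp add: F_def)
  have Fdiag: "F (x, cnjv x) = 0" if "(x, cnjv x) \<in> S" "x \<in> W" "x \<in> M" for x
  proof -
    have "R j (x, cnjv x) = of_real (\<sigma> j x)" for j using polarized.R_diag[OF GR(1)] that(1) SG by blast
    then show ?thesis using MW[OF that(2)] that(3) by (simp add: F_def vec_eq_iff \<sigma>_def)
  qed
  have inj: "v = 0" if z: "(\<chi> j. cderiv (R j) (0, v) (q, cnjv q)) = 0" for v
  proof -
    have b0: "cderiv (R j) (0, v) (q, cnjv q) = 0" for j using arg_cong[OF z, of "\<lambda>w. w $ j"] by simp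
    have a0: "cderiv (R j) (cnjv v, 0) (q, cnjv q) = 0" for j
      using polarized.real_conj[OF GR, of j "cnjv v"] b0 by simp
    have T: "c *\<^sub>C cnjv v \<in> tangent_space M q" for c
    proof (rule tan, rule allI)
      fix j
      let ?w = "c *\<^sub>C cnjv v"
      have "((\<lambda>x. \<phi> x \<bullet> \<beta> j) has_derivative (\<lambda>w. \<phi>' w \<bullet> \<beta> j)) (at q)"
        by (rule has_derivative_inner_left[OF d\<phi>])
      then have "((\<lambda>x. complex_of_real (\<sigma> j x)) has_derivative (\<lambda>w. complex_of_real (\<phi>' w \<bullet> \<beta> j))) (at q)"
        unfolding \<sigma>_def by (rule has_derivative_of_real)
      moreover have "((\<lambda>x. complex_of_real (\<sigma> j x)) has_derivative
          (\<lambda>w. cderiv (R j) (w, 0) (q, cnjv q) + cderiv (R j) (0, cnjv w) (q, cnjv q))) (at q)"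
        by (rule polarized_has_derivative[OF polarized.open_G[OF GR(1)] polarized.holo_R[OF GR(1)] _ GR(2)])
          (simp add: polarized.R_diag[OF GR(1)])
      ultimately have "(\<lambda>w. complex_of_real (\<phi>' w \<bullet> \<beta> j)) =
          (\<lambda>w. cderiv (R j) (w, 0) (q, cnjv q) + cderiv (R j) (0, cnjv w) (q, cnjv q))"
        by (rule has_derivative_unique)
      from fun_cong[OF this, of ?w] have "complex_of_real (\<phi>' ?w \<bullet> \<beta> j) =
          cderiv (R j) (?w, 0) (q, cnjv q) + cderiv (R j) (0, cnjv ?w) (q, cnjv q)" .
      also have "\<dots> = 0" by (simp add: cderiv_i[OF holR S(2)] a0 b0)
      finally show "\<phi>' ?w \<bullet> \<beta> j = 0" by simp
    qed
    have "cnjv v \<in> tangent_space M q" using T[of 1] by simp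
    moreover have "cnjv v = \<i> *s ((- \<i>) *\<^sub>C cnjv v)" by (simp add: scaleC_vector_eq[symmetric] vec_eq_iff)
    ultimately have "cnjv v = 0" using M(2) q T[of "- \<i>"] unfolding totally_real_def by blast
    then have "cnjv (cnjv v) = cnjv 0" by (rule arg_cong)
    then show "v = 0" by (simp add: cnjv_simps)
  qed
  obtain A B Y where AB: "open A" "q \<in> A" "open B" "cnjv q \<in> B" "A \<times> B \<subseteq> S" "holo_on Y A"
    and Y: "\<And>x y. x \<in> A \<Longrightarrow> y \<in> B \<Longrightarrow> F (x, y) = 0 \<longleftrightarrow> y = Y x"
  proof -
    show thesis
      by (rule holo_implicit_function[OF S holF Fdiag[OF S(2) W(2) q] dF inj], assumption, rule that)
  qed
  have "open (cnjv -` B)" by (rule open_vimage[OF AB(3)]) (intro continuous_intros)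
  then have op: "open (A \<inter> W \<inter> cnjv -` B)" by (intro open_Int AB W)
  show ?thesis
  proof (rule that[OF op])
    show "q \<in> A \<inter> W \<inter> cnjv -` B" using AB W by simp
    show "holo_on Y (A \<inter> W \<inter> cnjv -` B)" by (rule holo_on_subset[OF AB(6)]) blast
    fix x assume x: "x \<in> M \<inter> (A \<inter> W \<inter> cnjv -` B)"
    then have "F (x, cnjv x) = 0" using AB(5) by (intro Fdiag) auto
    then show "Y x = cnjv x" using Y[of x "cnjv x"] x by simp
  qed
qed

section \<open>Derivatives at a boundary point\<close>

lemma directional_derivative_le:
  fixes h :: "'a::real_normed_vector \<Rightarrow> 'b::real_normed_vector" and \<rho> :: "'b \<Rightarrow> real"
  assumes h: "(h has_derivative D) (at p within T)" and \<rho>: "(\<rho> has_derivative \<rho>') (at (h p))" and p: "p \<in> T"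
    and e: "e > 0" "\<And>t. 0 < t \<Longrightarrow> t < e \<Longrightarrow> p + t *\<^sub>R v \<in> T \<and> \<rho> (h (p + t *\<^sub>R v)) \<le> \<rho> (h p) - \<kappa> * t"
  shows "\<rho>' (D v) \<le> - \<kappa>"
proof (rule ccontr)
  assume "\<not> \<rho>' (D v) \<le> - \<kappa>"
  then have pos: "\<rho>' (D v) + \<kappa> > 0" by simp
  define g where "g t = \<rho> (h (p + t *\<^sub>R v)) + \<kappa> * t" for t
  let ?I = "{0..<e}" and ?\<gamma> = "\<lambda>t. p + t *\<^sub>R v"
  have "?\<gamma> ` ?I \<subseteq> T"
  proof (rule image_subsetI)
    fix t assume "t \<in> ?I" then show "p + t *\<^sub>R v \<in> T" using e(2)[of t] p by (cases "t = 0") auto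
  qed
  then have 1: "(h has_derivative D) (at (?\<gamma> 0) within ?\<gamma> ` ?I)" using has_derivative_subset[OF h] by simp
  have 2: "(?\<gamma> has_derivative (\<lambda>t. t *\<^sub>R v)) (at 0 within ?I)" by (auto intro!: derivative_eq_intros)
  have 3: "((\<lambda>t. h (?\<gamma> t)) has_derivative (\<lambda>t. D (t *\<^sub>R v))) (at 0 within ?I)" by (rule has_derivative_in_compose[OF 2 1])
  have "((\<lambda>t. \<rho> (h (?\<gamma> t))) has_derivative (\<lambda>t. \<rho>' (D (t *\<^sub>R v)))) (at 0 within ?I)"
    using has_derivative_compose[OF 3, of \<rho> \<rho>'] \<rho> by simp
  moreover have "\<rho>' (D (t *\<^sub>R v)) = \<rho>' (D v) * t" for t
    using linear_scale[OF has_derivative_linear[OF h]] linear_scale[OF has_derivative_linear[OF \<rho>]] by simp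
  ultimately have "((\<lambda>t. \<rho> (h (?\<gamma> t))) has_real_derivative \<rho>' (D v)) (at 0 within ?I)"
    by (simp add: has_field_derivative_def)
  then have "(g has_real_derivative (\<rho>' (D v) + \<kappa>)) (at 0 within ?I)"
    unfolding g_def by (auto intro!: derivative_eq_intros)
  from has_real_derivative_pos_inc_right[OF this pos] obtain d where
    d: "d > 0" "\<And>t. t > 0 \<Longrightarrow> t \<in> ?I \<Longrightarrow> t < d \<Longrightarrow> g 0 < g t" by auto
  define t where "t = min d e / 2"
  have t: "0 < t" "t < d" "t < e" using d(1) e(1) by (auto simp: t_def)
  show False using d(2)[of t] t e(2)[of t] by (simp add: g_def)
qed

text \<open>
  The functional \<open>b\<close> is nonpositive on the half space \<open>a < 0\<close>, hence on its boundary, and vanishes there by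
  symmetry.
\<close>

lemma functional_proportional:
  fixes a b :: "'a::real_vector \<Rightarrow> real"
  assumes a: "linear a" and b: "linear b" and \<nu>: "a \<nu> = -1" and le: "\<And>v. a v < 0 \<Longrightarrow> b v \<le> 0"
  shows "b v = (- b \<nu>) * a v"
proof -
  define c where "c = - b \<nu>"
  have c: "c \<ge> 0" using le[of \<nu>] \<nu> by (simp add: c_def)
  have ker: "b w \<le> 0" if "a w = 0" for w
  proof (rule ccontr)
    assume "\<not> b w \<le> 0"
    then have w: "b w > 0" by simp
    define \<epsilon> where "\<epsilon> = b w / (2 * (c + 1))"
    have \<epsilon>: "\<epsilon> > 0" "\<epsilon> * (c + 1) = b w / 2" using w c by (auto simp: \<epsilon>_def field_simps)
    have "b (w + \<epsilon> *\<^sub>R \<nu>) \<le> 0"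
      by (rule le) (use \<epsilon>(1) that in \<open>simp add: linear_add[OF a] linear_scale[OF a] \<nu>\<close>)
    then have "b w \<le> \<epsilon> * c" by (simp add: linear_add[OF b] linear_scale[OF b] c_def)
    then show False using \<epsilon> w by (simp add: algebra_simps)
  qed
  define w where "w = v + a v *\<^sub>R \<nu>"
  have "a w = 0" by (simp add: w_def linear_add[OF a] linear_scale[OF a] \<nu>)
  then have "b w = 0" using ker[of w] ker[of "- w"] by (simp add: linear_neg[OF a] linear_neg[OF b])
  then show ?thesis by (simp add: w_def linear_add[OF b] linear_scale[OF b] mult.commute)
qed

lemma quadratic_remainder:
  fixes r :: "'a::euclidean_space \<Rightarrow> real"
  assumes N: "open N" "p \<in> N" and r: "\<And>x. x \<in> N \<Longrightarrow> (r has_derivative (\<lambda>v. g x \<bullet> v)) (at x)"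
    and g: "g differentiable (at p)"
  obtains C e where "C > 0" "e > 0" "\<And>w. norm w < e \<Longrightarrow> \<bar>r (p + w) - r p - g p \<bullet> w\<bar> \<le> C * (norm w)\<^sup>2"
proof -
  obtain D where D: "(g has_derivative D) (at p)" using g by (auto simp: differentiable_def)
  obtain K where K: "K > 0" "\<And>v. norm (D v) \<le> K * norm v"
    using linear_bounded_pos[OF has_derivative_linear[OF D]] by blast
  obtain d where d: "d > 0" "\<And>y. norm (y - p) < d \<Longrightarrow> norm (g y - g p - D (y - p)) \<le> 1 * norm (y - p)"
    using D unfolding has_derivative_at_alt by (metis zero_less_one)
  obtain e1 where e1: "e1 > 0" "ball p e1 \<subseteq> N" using N open_contains_ball by blast
  define C where "C = K + 1"
  have gb: "norm (g y - g p) \<le> C * norm (y - p)" if "norm (y - p) < d" for y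
    using d(2)[OF that] K(2)[of "y - p"] norm_triangle_ineq[of "g y - g p - D (y - p)" "D (y - p)"]
    by (simp add: C_def algebra_simps)
  show ?thesis
  proof (rule that[of C "min d e1"])
    show "C > 0" "min d e1 > 0" using K d e1 by (auto simp: C_def)
    fix w :: 'a assume w: "norm w < min d e1"
    let ?S = "closed_segment p (p + w)"
    have seg: "norm (x - p) \<le> norm w" if "x \<in> ?S" for x
      using segment_bound(1)[OF that] by (simp add: norm_minus_commute)
    have "norm ((r (p + w) - g p \<bullet> (p + w)) - (r p - g p \<bullet> p)) \<le> (C * norm w) * norm (p + w - p)"
    proof (rule differentiable_bound[where f = "\<lambda>x. r x - g p \<bullet> x" and S = ?S and f' = "\<lambda>x v. g x \<bullet> v - g p \<bullet> v"])
      fix x assume x: "x \<in> ?S"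
      have xN: "x \<in> N" using seg[OF x] w e1(2) by (auto simp: dist_norm norm_minus_commute subset_iff)
      show "((\<lambda>x. r x - g p \<bullet> x) has_derivative (\<lambda>v. g x \<bullet> v - g p \<bullet> v)) (at x within ?S)"
        by (intro has_derivative_diff has_derivative_at_withinI[OF r[OF xN]]
            bounded_linear_imp_has_derivative bounded_linear_inner_right)
      show "onorm (\<lambda>v. g x \<bullet> v - g p \<bullet> v) \<le> C * norm w"
      proof (rule onorm_le)
        fix v
        have "norm (g x \<bullet> v - g p \<bullet> v) \<le> norm (g x - g p) * norm v"
          unfolding inner_diff_left[symmetric] real_norm_def by (rule Cauchy_Schwarz_ineq2)
        also have "\<dots> \<le> (C * norm (x - p)) * norm v" using gb[of x] seg[OF x] w by (intro mult_right_mono) auto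
        also have "\<dots> \<le> (C * norm w) * norm v"
          using seg[OF x] K(1) by (intro mult_right_mono mult_left_mono) (auto simp: C_def)
        finally show "norm (g x \<bullet> v - g p \<bullet> v) \<le> C * norm w * norm v" .
      qed
    qed auto
    then show "\<bar>r (p + w) - r p - g p \<bullet> w\<bar> \<le> C * (norm w)\<^sup>2"
      by (simp add: inner_add_right power2_eq_square algebra_simps)
  qed
qed

lemma clinear_limit:
  fixes T :: "'x \<Rightarrow> 'a::complex_space \<Rightarrow> 'b::complex_space"
  assumes F: "F \<noteq> bot" and T: "eventually (\<lambda>x. clinear (T x)) F" and lim: "\<And>v. ((\<lambda>x. T x v) \<longlongrightarrow> D v) F"
  shows "clinear D"
proof -
  have "D (u + v) = D u + D v" for u v
  proof (rule tendsto_unique[OF F lim])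
    have "eventually (\<lambda>x. T x u + T x v = T x (u + v)) F"
      using T by eventually_elim (simp add: linear_add[OF clinearD(1)])
    then show "((\<lambda>x. T x (u + v)) \<longlongrightarrow> D u + D v) F"
      by (rule Lim_transform_eventually[OF tendsto_add[OF lim lim]])
  qed
  moreover have "D (c *\<^sub>C v) = c *\<^sub>C D v" for c v
  proof (rule tendsto_unique[OF F lim])
    have "eventually (\<lambda>x. c *\<^sub>C T x v = T x (c *\<^sub>C v)) F"
      using T by eventually_elim (simp add: clinearD(2))
    then show "((\<lambda>x. T x (c *\<^sub>C v)) \<longlongrightarrow> c *\<^sub>C D v) F"
      by (rule Lim_transform_eventually[OF bounded_linear.tendsto[OF bounded_bilinear.bounded_linear_right[OF bounded_bilinear_scaleC] lim]])
  qed
  moreover from this(1) have "D (of_real c *\<^sub>C v) = of_real c *\<^sub>C D v" for c :: real and v by blast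
  then have "D (c *\<^sub>R v) = c *\<^sub>R D v" for c v by (simp only: scaleC_of_real)
  ultimately show ?thesis unfolding clinear_def linear_iff by blast
qed

lemma subspace_real_points: "subspace (real_points :: (complex ^ 'n) set)"
  by (auto simp: subspace_def real_points_def)

lemma dim_real_points: "dim (real_points :: (complex ^ 'n) set) = CARD('n)"
proof -
  define f :: "real ^ 'n \<Rightarrow> complex ^ 'n" where "f x = (\<chi> j. of_real (x $ j))" for x
  have "linear f" by (rule linearI) (simp_all add: f_def vec_eq_iff scaleR_conv_of_real[where 'a = complex])
  moreover have "inj f" by (rule injI) (simp add: f_def vec_eq_iff)
  ultimately have "dim (f ` UNIV) = dim (UNIV :: (real ^ 'n) set)" by (intro dim_image_eq) auto
  moreover have "f ` UNIV = real_points"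
  proof
    show "f ` UNIV \<subseteq> real_points" by (auto simp: f_def real_points_def)
    show "real_points \<subseteq> f ` UNIV"
    proof
      fix w :: "complex ^ 'n" assume "w \<in> real_points"
      then have "w = f (\<chi> j. Re (w $ j))" by (simp add: f_def real_points_def vec_eq_iff complex_eq_iff)
      then show "w \<in> f ` UNIV" by blast
    qed
  qed
  ultimately show ?thesis by (simp add: dim_UNIV)
qed

context C1_side
begin

lemma one_sided_has_derivative:
  fixes h :: "'a \<Rightarrow> 'b::euclidean_space"
  assumes pc: "p \<in> closure \<Omega>" and \<beta>: "\<beta> > 0" and cont: "continuous_on (closure \<Omega> \<inter> ball p \<beta>) h"
    and h': "\<And>x. x \<in> \<Omega> \<inter> ball p \<beta> \<Longrightarrow> (h has_derivative h' x) (at x)"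
    and lim: "\<And>v. ((\<lambda>x. h' x v) \<longlongrightarrow> D v) (at p within \<Omega>)" and D: "linear D"
  shows "(h has_derivative D) (at p within closure \<Omega>)"
  unfolding has_derivative_within_alt
proof (intro conjI allI impI)
  show "bounded_linear D" using D linear_conv_bounded_linear by blast
  fix \<eta> :: real assume eta: "0 < \<eta>"
  obtain \<delta> where \<delta>: "\<delta> > 0" "\<And>x1 x2. x1 \<in> closure \<Omega> \<inter> ball p \<delta> \<Longrightarrow> x2 \<in> closure \<Omega> \<inter> ball p \<delta> \<Longrightarrow>
       norm (h x2 - h x1 - D (x2 - x1)) \<le> \<eta> * norm (x2 - x1)"
  proof -
    show thesis
      by (rule one_sided_strictly_differentiable[where h = h and h' = h' and D = D and \<eta> = \<eta> and \<beta> = \<beta>],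
          rule \<beta>, rule cont, erule h', rule lim, rule D, rule eta, rule that)
  qed
  have "norm (h y - h p - D (y - p)) \<le> \<eta> * norm (y - p)" if "y \<in> closure \<Omega>" "norm (y - p) < \<delta>" for y
    by (rule \<delta>(2)) (use that pc \<delta>(1) in \<open>auto simp: dist_norm norm_minus_commute\<close>)
  then show "\<exists>d>0. \<forall>y\<in>closure \<Omega>. norm (y - p) < d \<longrightarrow> norm (h y - h p - D (y - p)) \<le> \<eta> * norm (y - p)"
    using \<delta>(1) by blast
qed

lemma ray:
  assumes "r' p v < 0" obtains s where "s > 0" "\<And>t. 0 < t \<Longrightarrow> t < s \<Longrightarrow> p + t *\<^sub>R v \<in> \<Omega>"
proof -
  have "((\<lambda>t. p + t *\<^sub>R v) has_derivative (\<lambda>t. t *\<^sub>R v)) (at 0)" by (auto intro!: derivative_eq_intros)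
  from has_derivative_compose[OF this, of r "r' p"] have "((\<lambda>t. r (p + t *\<^sub>R v)) has_derivative (\<lambda>t. r' p (t *\<^sub>R v))) (at 0)"
    using deriv[OF p(1)] by simp
  moreover have "r' p (t *\<^sub>R v) = r' p v * t" for t by (simp add: linear_scale[OF linear_r'])
  ultimately have "((\<lambda>t. r (p + t *\<^sub>R v)) has_real_derivative r' p v) (at 0)" by (simp add: has_field_derivative_def)
  from DERIV_neg_dec_right[OF this assms] obtain d where d: "d > 0" "\<And>t. 0 < t \<Longrightarrow> t < d \<Longrightarrow> r (p + t *\<^sub>R v) < 0"
    using p(2) by auto
  have "open ((\<lambda>t. p + t *\<^sub>R v) -` N)" by (rule open_vimage[OF open_N]) (intro continuous_intros)
  moreover have "0 \<in> (\<lambda>t. p + t *\<^sub>R v) -` N" using p(1) by simp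
  ultimately obtain e where e: "e > 0" "ball 0 e \<subseteq> (\<lambda>t. p + t *\<^sub>R v) -` N" using open_contains_ball by metis
  show thesis
  proof (rule that[of "min d e"])
    show "min d e > 0" using d e by simp
    fix t :: real assume t: "0 < t" "t < min d e"
    then have "t \<in> ball 0 e" by simp
    then have "p + t *\<^sub>R v \<in> N" using e(2) by blast
    then show "p + t *\<^sub>R v \<in> \<Omega>" using mem_\<Omega>_iff d(2)[of t] t by simp
  qed
qed

text \<open>
  The identity theorem needs a connected set.  Here it consists of all segments from points of \<open>\<Omega>\<close> near
  \<open>p\<close> in the inward direction, which end in one common ball.
\<close>

lemma connected_inner_neighbourhood:
  assumes pc: "p \<in> closure \<Omega>" and T: "open T" "p \<in> T"
  obtains \<delta> Z where "\<delta> > 0" "open Z" "connected Z" "Z \<subseteq> \<Omega> \<inter> T" "\<Omega> \<inter> ball p \<delta> \<subseteq> Z"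
proof -
  obtain \<nu> \<delta>0 where \<delta>0: "\<delta>0 > 0"
    and leg: "\<And>x t. x \<in> closure \<Omega> \<inter> ball p \<delta>0 \<Longrightarrow> 0 < t \<Longrightarrow> t < 2 * \<delta>0 \<Longrightarrow> x + t *\<^sub>R \<nu> \<in> \<Omega>"
  proof -
    show thesis by (rule inward, rule that)
  qed
  obtain e where e: "e > 0" "ball p e \<subseteq> T" using T open_contains_ball by metis
  define \<tau> where "\<tau> = min \<delta>0 (e / (2 * (norm \<nu> + 1)))"
  have n1: "norm \<nu> + 1 > 0" by (simp add: add_nonneg_pos)
  have \<tau>: "\<tau> > 0" "\<tau> < 2 * \<delta>0" using \<delta>0 e n1 by (auto simp: \<tau>_def min_def)
  have "\<tau> * (norm \<nu> + 1) \<le> e / (2 * (norm \<nu> + 1)) * (norm \<nu> + 1)"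
    using n1 by (intro mult_right_mono) (auto simp: \<tau>_def)
  also have "\<dots> = e / 2"
  proof -
    have "e / (2 * m) * m = e / 2" if "m > 0" for m using that by simp
    from this[OF n1] show ?thesis .
  qed
  finally have \<tau>e: "\<tau> * norm \<nu> < e / 2" using \<tau>(1) by (simp add: algebra_simps)
  have "p + \<tau> *\<^sub>R \<nu> \<in> \<Omega>" by (rule leg) (use pc \<delta>0 \<tau> in auto)
  then obtain d1 where d1: "d1 > 0" "ball (p + \<tau> *\<^sub>R \<nu>) d1 \<subseteq> \<Omega>" using open_\<Omega> open_contains_ball by metis
  define \<delta> where "\<delta> = min \<delta>0 (min d1 (e / 2))"
  have \<delta>: "\<delta> > 0" "\<delta> \<le> \<delta>0" "\<delta> \<le> d1" "\<delta> \<le> e / 2" using \<delta>0 d1 e by (auto simp: \<delta>_def)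
  define B where "B = ball (p + \<tau> *\<^sub>R \<nu>) \<delta>"
  define L where "L x = (\<lambda>s. x + s *\<^sub>R \<nu>) ` {0..\<tau>}" for x
  define Z where "Z = B \<union> (\<Union>x\<in>\<Omega> \<inter> ball p \<delta>. L x)"
  have dist: "x + s *\<^sub>R \<nu> \<in> ball p e" if "x \<in> ball p \<delta>" "0 \<le> s" "s \<le> \<tau>" for x s
  proof -
    have "norm (s *\<^sub>R \<nu>) \<le> \<tau> * norm \<nu>" using that by (simp add: mult_right_mono)
    then have "dist p (x + s *\<^sub>R \<nu>) \<le> dist p x + \<tau> * norm \<nu>"
      using norm_triangle_ineq4[of "p - x" "s *\<^sub>R \<nu>"] by (simp add: dist_norm diff_diff_eq)
    then show ?thesis using that(1) \<tau>e \<delta>(4) by simp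
  qed
  have BT: "B \<subseteq> \<Omega> \<inter> T"
  proof
    fix y assume y: "y \<in> B"
    have "y - \<tau> *\<^sub>R \<nu> \<in> ball p \<delta>" using y by (simp add: B_def dist_norm algebra_simps)
    from dist[OF this, of \<tau>] \<tau>(1) have "y \<in> ball p e" by simp
    then show "y \<in> \<Omega> \<inter> T" using y e(2) d1(2) \<delta>(3) by (auto simp: B_def subset_iff)
  qed
  have LT: "L x \<subseteq> \<Omega> \<inter> T" if x: "x \<in> \<Omega> \<inter> ball p \<delta>" for x
    unfolding L_def
  proof (rule image_subsetI)
    fix s assume s: "s \<in> {0..\<tau>}"
    have "x + s *\<^sub>R \<nu> \<in> \<Omega>"
    proof (cases "s = 0")
      case False
      show ?thesis by (rule leg) (use False s \<tau>(2) x \<delta>(2) closure_subset[of \<Omega>] in auto)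
    qed (use x in simp)
    then show "x + s *\<^sub>R \<nu> \<in> \<Omega> \<inter> T" using dist[of x s] x s e(2) by auto
  qed
  show thesis
  proof (rule that[OF \<delta>(1)])
    have "(\<Union>x\<in>\<Omega> \<inter> ball p \<delta>. L x) = (\<Union>s\<in>{0..\<tau>}. (\<lambda>x. s *\<^sub>R \<nu> + x) ` (\<Omega> \<inter> ball p \<delta>))"
      by (auto simp: L_def image_iff add.commute)
    then show "open Z"
      unfolding Z_def B_def using open_\<Omega> by (auto intro!: open_Un open_UN open_translation open_Int)
    show "Z \<subseteq> \<Omega> \<inter> T" unfolding Z_def using BT LT by blast
    show "\<Omega> \<inter> ball p \<delta> \<subseteq> Z"
    proof
      fix x assume x: "x \<in> \<Omega> \<inter> ball p \<delta>"
      have "x \<in> L x" unfolding L_def by (rule image_eqI[of _ _ 0]) (use \<tau>(1) in auto)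
      then show "x \<in> Z" using x by (auto simp: Z_def)
    qed
    have Z: "Z = \<Union> (insert B ((\<lambda>x. B \<union> L x) ` (\<Omega> \<inter> ball p \<delta>)))" unfolding Z_def by auto
    have cB: "connected B" by (simp add: B_def)
    have cL: "connected (B \<union> L x)" if x: "x \<in> \<Omega> \<inter> ball p \<delta>" for x
    proof (rule connected_Un[OF cB])
      show "connected (L x)" unfolding L_def by (rule connected_continuous_image) (auto intro!: continuous_intros)
      have "x + \<tau> *\<^sub>R \<nu> \<in> B" using x by (simp add: B_def dist_norm)
      moreover have "x + \<tau> *\<^sub>R \<nu> \<in> L x" using \<tau>(1) by (auto simp: L_def)
      ultimately show "B \<inter> L x \<noteq> {}" by blast
    qed
    have "p + \<tau> *\<^sub>R \<nu> \<in> B" using \<delta>(1) by (simp add: B_def)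
    then show "connected Z" unfolding Z by (intro connected_Union) (use cB cL in auto)
  qed
qed

end

section \<open>Extension across the edge\<close>

lemma continuous_on_nbhd:
  fixes h :: "'a::metric_space \<Rightarrow> 'b::topological_space"
  assumes h: "continuous_on K h" and p: "p \<in> K" "open T" "h p \<in> T"
  obtains d where "d > 0" "\<And>x. x \<in> K \<inter> ball p d \<Longrightarrow> h x \<in> T"
proof -
  obtain A where A: "open A" "A \<inter> K = h -` T \<inter> K"
    using h p(2) unfolding continuous_on_open_invariant by blast
  then have "p \<in> A" using p by blast
  then obtain d where d: "d > 0" "ball p d \<subseteq> A" using A(1) open_contains_ball by metis
  show thesis
  proof (rule that[OF d(1)])
    fix x assume "x \<in> K \<inter> ball p d" then show "h x \<in> T" using A(2) d(2) by blast
  qed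
qed

lemma continuous_eq_on_closure:
  fixes f g :: "'a::metric_space \<Rightarrow> 'b::real_normed_vector"
  assumes f: "continuous_on (closure \<Omega> \<inter> ball p \<delta>) f" and g: "continuous_on (closure \<Omega> \<inter> ball p \<delta>) g"
    and eq: "\<And>x. x \<in> \<Omega> \<inter> ball p \<delta> \<Longrightarrow> f x = g x" and x: "x \<in> closure \<Omega> \<inter> ball p \<delta>"
  shows "f x = g x"
proof -
  let ?S = "closure \<Omega> \<inter> ball p \<delta>"
  have "closedin (top_of_set ?S) {x \<in> ?S. f x - g x = 0}"
    by (rule continuous_closedin_preimage_constant) (intro continuous_intros f g)
  then obtain T where T: "closed T" "{x \<in> ?S. f x - g x = 0} = ?S \<inter> T" unfolding closedin_closed by blast
  have "\<Omega> \<inter> ball p \<delta> \<subseteq> {x \<in> ?S. f x - g x = 0}" using eq closure_subset[of \<Omega>] by auto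
  then have "\<Omega> \<inter> ball p \<delta> \<subseteq> T" using T(2) by blast
  then have "closure (\<Omega> \<inter> ball p \<delta>) \<subseteq> T" by (rule closure_minimal[OF _ T(1)])
  moreover have "x \<in> closure (\<Omega> \<inter> ball p \<delta>)"
    using open_Int_closure_subset[of "ball p \<delta>" \<Omega>] x by (auto simp: Int_commute)
  ultimately have "x \<in> {x \<in> ?S. f x - g x = 0}" unfolding T(2) using x by blast
  then show ?thesis by simp
qed

lemma holo_on_vec_lambda:
  fixes g :: "'a::complex_space \<Rightarrow> 'j::finite \<Rightarrow> 'b::complex_space"
  assumes "\<And>j. holo_on (\<lambda>x. g x j) S" shows "holo_on (\<lambda>x. \<chi> j. g x j) S"
  by (rule holo_on_vecI) (simp add: assms)

context reflection_data
begin

lemma p_closure: "p \<in> closure \<Omega>"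
  using E(2) E_closure by blast

text \<open>
  The function \<open>s\<close> stands for \<open>f\<close> followed by a holomorphic reflection of the target; the functions
  \<open>f j + s j\<close> and \<open>\<i> (s j - f j)\<close> are real on \<open>E\<close>, so that \<open>f \<circ> X\<close> extends across the edge.  The
  inverse of \<open>X\<close> is at the same time a chart that maps \<open>E\<close> to the real points.
\<close>

theorem extension_and_chart:
  fixes f s :: "complex ^ 'n \<Rightarrow> complex ^ 'm"
  assumes f: "continuous_on (closure \<Omega> \<inter> ball p \<beta>) f" "holo_on f (\<Omega> \<inter> ball p \<beta>)"
    and s: "continuous_on (closure \<Omega> \<inter> ball p \<beta>) s" "holo_on s (\<Omega> \<inter> ball p \<beta>)"
    and sf: "\<And>x. x \<in> E \<inter> ball p \<beta> \<Longrightarrow> s x = cnjv (f x)"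
  shows "\<exists>\<delta> F. \<delta> > 0 \<and> \<delta> \<le> \<beta> \<and> holo_on F (ball p \<delta>) \<and> (\<forall>x \<in> closure \<Omega> \<inter> ball p \<delta>. F x = f x)" (is ?ext)
    and "\<exists>W (\<phi> :: complex ^ 'n \<Rightarrow> complex ^ 'n) \<psi> L. open W \<and> p \<in> W \<and> open (\<phi> ` W) \<and> real_analytic_on \<phi> W \<and> real_analytic_on \<psi> (\<phi> ` W) \<and>
      (\<forall>x\<in>W. \<psi> (\<phi> x) = x) \<and> subspace L \<and> dim L = CARD('n) \<and> \<phi> ` (W \<inter> E) = \<phi> ` W \<inter> L" (is ?chart)
proof -
  obtain X :: "complex ^ 'n \<Rightarrow> complex ^ 'n" and \<sigma> l U where \<sigma>: "\<sigma> > 0" and holX: "holo_on X (polydisc \<sigma>)" and X0: "X 0 = p"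
    and injX: "\<And>v. frechet_derivative X (at 0) v = 0 \<Longrightarrow> v = 0"
    and XW: "\<And>w. w \<in> upper_wedge \<sigma> \<Longrightarrow> X w \<in> \<Omega> \<inter> ball p \<beta>"
    and XE: "\<And>w. w \<in> polydisc \<sigma> \<inter> real_points \<Longrightarrow> X w \<in> E \<inter> ball p \<beta>"
    and l: "continuous_on UNIV l" "l p = 0" and U: "open U" "p \<in> U"
    and lX: "\<And>x. x \<in> E \<inter> U \<Longrightarrow> l x \<in> polydisc \<sigma> \<Longrightarrow> l x \<in> real_points \<and> X (l x) = x"
    and ext: "\<forall>k :: complex ^ 'n \<Rightarrow> complex. continuous_on (closure \<Omega> \<inter> ball p \<beta>) k \<longrightarrow> holo_on k (\<Omega> \<inter> ball p \<beta>) \<longrightarrow>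
       (\<forall>x \<in> E \<inter> ball p \<beta>. Im (k x) = 0) \<longrightarrow>
       (\<exists>K. holo_on K (polydisc \<sigma>) \<and> (\<forall>w \<in> upper_wedge \<sigma> \<union> polydisc \<sigma> \<inter> real_points. K w = k (X w)))"
  proof -
    show thesis by (rule wedge_parametrization, rule that)
  qed
  have "\<exists>K. holo_on K (polydisc \<sigma>) \<and> (\<forall>w \<in> upper_wedge \<sigma>. K w = f (X w) $ j)" for j
  proof -
    have c: "continuous_on (closure \<Omega> \<inter> ball p \<beta>) (\<lambda>x. f x $ j + s x $ j)"
      "continuous_on (closure \<Omega> \<inter> ball p \<beta>) (\<lambda>x. \<i> * (s x $ j - f x $ j))" by (intro continuous_intros f s)+
    have h: "holo_on (\<lambda>x. f x $ j + s x $ j) (\<Omega> \<inter> ball p \<beta>)"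
      "holo_on (\<lambda>x. \<i> * (s x $ j - f x $ j)) (\<Omega> \<inter> ball p \<beta>)"
      by (intro holo_on_add holo_on_mult holo_on_diff holo_on_const holo_on_vec_nth f s)+
    have r: "\<forall>x \<in> E \<inter> ball p \<beta>. Im (f x $ j + s x $ j) = 0" "\<forall>x \<in> E \<inter> ball p \<beta>. Im (\<i> * (s x $ j - f x $ j)) = 0"
      by (simp_all add: sf)
    obtain K1 where K1: "holo_on K1 (polydisc \<sigma>)" "\<forall>w \<in> upper_wedge \<sigma> \<union> polydisc \<sigma> \<inter> real_points. K1 w = f (X w) $ j + s (X w) $ j"
      using ext[rule_format, OF c(1) h(1)] r(1) by blast
    obtain K2 where K2: "holo_on K2 (polydisc \<sigma>)" "\<forall>w \<in> upper_wedge \<sigma> \<union> polydisc \<sigma> \<inter> real_points. K2 w = \<i> * (s (X w) $ j - f (X w) $ j)"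
      using ext[rule_format, OF c(2) h(2)] r(2) by blast
    have "(1/2) * ((a + b) + \<i> * (\<i> * (b - a))) = a" for a b :: complex
      by (simp add: mult.assoc[symmetric])
    then have "\<forall>w \<in> upper_wedge \<sigma>. (1/2) * (K1 w + \<i> * K2 w) = f (X w) $ j" using K1(2) K2(2) by simp
    moreover have "holo_on (\<lambda>w. (1/2) * (K1 w + \<i> * K2 w)) (polydisc \<sigma>)"
      by (intro holo_on_mult holo_on_const holo_on_add K1 K2)
    ultimately show ?thesis by blast
  qed
  then obtain K where K: "\<And>j. holo_on (K j) (polydisc \<sigma>)" "\<And>j w. w \<in> upper_wedge \<sigma> \<Longrightarrow> K j w = f (X w) $ j" by metis
  define ft where "ft w = (\<chi> j. K j w)" for w
  have holft: "holo_on ft (polydisc \<sigma>)" unfolding ft_def by (rule holo_on_vec_lambda, rule K)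
  have ftX: "ft w = f (X w)" if "w \<in> upper_wedge \<sigma>" for w using K(2)[OF that] by (simp add: ft_def vec_eq_iff)
  have z: "0 \<in> (polydisc \<sigma> :: (complex ^ 'n) set)" using \<sigma> by (simp add: polydisc_def)
  obtain U1 V1 H where U1: "open U1" "0 \<in> U1" "U1 \<subseteq> polydisc \<sigma>" and V1: "open V1" "X 0 \<in> V1"
    and hom: "homeomorphism U1 V1 X H" and holH: "holo_on H V1"
  proof -
    show thesis by (rule holo_local_inverse[OF open_polydisc z holX holo_on_frechet(1)[OF holX z] injX], assumption, rule that)
  qed
  have HX: "H (X w) = w" "X w \<in> V1" if "w \<in> U1" for w using hom that by (auto simp: homeomorphism_def)
  have XH: "X (H x) = x" "H x \<in> U1" if "x \<in> V1" for x using hom that by (auto simp: homeomorphism_def)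
  have pV: "p \<in> V1" using V1(2) X0 by simp
  have Hp: "H p = 0" using HX(1)[OF U1(2)] X0 by simp
  have contH: "continuous_on V1 H" using hom by (simp add: homeomorphism_def)
  have contX: "continuous_on U1 X" using hom by (simp add: homeomorphism_def)
  show ?ext
  proof -
    define F where "F x = ft (H x)" for x
    have holF: "holo_on F V1" unfolding F_def
      by (rule holo_on_compose[OF holH holft]) (use XH(2) U1(3) in blast)
    have T: "open (V1 \<inter> ball p \<beta>)" "p \<in> V1 \<inter> ball p \<beta>" using V1(1) pV \<beta> by auto
    obtain \<delta>0 Z where \<delta>0: "\<delta>0 > 0" and Z: "open Z" "connected Z" "Z \<subseteq> \<Omega> \<inter> (V1 \<inter> ball p \<beta>)" "\<Omega> \<inter> ball p \<delta>0 \<subseteq> Z"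
    proof -
      show thesis by (rule connected_inner_neighbourhood[OF p_closure T], rule that)
    qed
    obtain d where d: "d > 0" "ball p d \<subseteq> V1 \<inter> ball p \<beta>" using T open_contains_ball by metis
    define \<delta> where "\<delta> = min (min \<delta>0 d) \<beta>"
    have \<delta>: "\<delta> > 0" "\<delta> \<le> \<delta>0" "\<delta> \<le> d" "\<delta> \<le> \<beta>" using \<delta>0 d \<beta> by (auto simp: \<delta>_def)
    have bZ: "\<Omega> \<inter> ball p \<delta> \<subseteq> Z" and bV: "ball p \<delta> \<subseteq> V1" using Z(4) \<delta> d(2) by auto
    define T1 where "T1 = Z \<inter> (V1 \<inter> H -` upper_wedge \<sigma>)"
    have "open T1" unfolding T1_def by (intro open_Int Z continuous_open_preimage contH V1 open_upper_wedge)
    moreover have "T1 \<subseteq> Z" by (auto simp: T1_def)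
    moreover have "T1 \<noteq> {}"
    proof -
      have "open (U1 \<inter> X -` ball p \<delta>)" by (intro continuous_open_preimage contX U1 open_ball)
      moreover have "0 \<in> U1 \<inter> X -` ball p \<delta>" using U1(2) X0 \<delta>(1) by simp
      ultimately obtain e where e: "e > 0" "ball 0 e \<subseteq> U1 \<inter> X -` ball p \<delta>" using open_contains_ball by metis
      define c :: "complex ^ 'n" where "c = (\<chi> j. \<i>)"
      define t where "t = min (\<sigma> / 2) (e / (2 * (norm c + 1)))"
      have nc: "norm c + 1 > 0" by (simp add: add_nonneg_pos)
      have "e / (2 * (norm c + 1)) > 0" using e nc by simp
      then have t: "t > 0" using \<sigma> by (simp add: t_def)
      have "t \<le> \<sigma> / 2" unfolding t_def by (rule min.cobounded1)
      then have t\<sigma>: "t < \<sigma>" using \<sigma> by simp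
      have "t * (norm c + 1) \<le> e / (2 * (norm c + 1)) * (norm c + 1)"
        using nc by (intro mult_right_mono) (auto simp: t_def)
      also have "\<dots> = e / 2"
      proof -
        have "e / (2 * m) * m = e / 2" if "m > 0" for m using that by simp
        from this[OF nc] show ?thesis .
      qed
      finally have "t * norm c < e" using t e(1) by (simp add: algebra_simps)
      then have "t *\<^sub>R c \<in> ball 0 e" using t by simp
      then have "t *\<^sub>R c \<in> U1 \<inter> X -` ball p \<delta>" by (rule subsetD[OF e(2)])
      then have tb: "t *\<^sub>R c \<in> U1" "X (t *\<^sub>R c) \<in> ball p \<delta>" by simp_all
      have tw: "t *\<^sub>R c \<in> upper_wedge \<sigma>"
        using t t\<sigma> by (simp add: c_def upper_wedge_def polydisc_def scaleR_conv_of_real[where 'a = complex] norm_mult)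
      have "X (t *\<^sub>R c) \<in> Z" using XW[OF tw] tb(2) bZ by blast
      then have "X (t *\<^sub>R c) \<in> T1" using HX[OF tb(1)] tw by (simp add: T1_def)
      then show ?thesis by blast
    qed
    moreover have "F x = f x" if x: "x \<in> T1" for x
    proof -
      have "x \<in> V1" "H x \<in> upper_wedge \<sigma>" using x by (auto simp: T1_def)
      then show ?thesis using ftX[of "H x"] XH(1)[of x] by (simp add: F_def)
    qed
    moreover have "holo_on F Z" "holo_on f Z"
      by (rule holo_on_subset[OF holF], use Z(3) in blast, rule holo_on_subset[OF f(2)], use Z(3) in blast)
    ultimately have FZ: "F x = f x" if "x \<in> Z" for x
      using holo_identity[OF Z(1,2), of F f T1 x] that by blast
    have "F x = f x" if x: "x \<in> closure \<Omega> \<inter> ball p \<delta>" for x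
    proof (rule continuous_eq_on_closure[OF _ _ _ x])
      show "continuous_on (closure \<Omega> \<inter> ball p \<delta>) F"
        by (rule continuous_on_subset[OF holo_on_imp_continuous_on[OF holF]]) (use bV in blast)
      show "continuous_on (closure \<Omega> \<inter> ball p \<delta>) f"
        by (rule continuous_on_subset[OF f(1)]) (use \<delta>(4) in auto)
      show "F x = f x" if "x \<in> \<Omega> \<inter> ball p \<delta>" for x using FZ bZ that by blast
    qed
    moreover have "holo_on F (ball p \<delta>)" by (rule holo_on_subset[OF holF bV])
    ultimately show ?thesis using \<delta>(1,4) by blast
  qed
  show ?chart
  proof -
    define W where "W = V1 \<inter> U \<inter> l -` U1"
    have "open (l -` U1)" by (rule open_vimage[OF U1(1) l(1)])
    then have oW: "open W" unfolding W_def by (intro open_Int V1 U)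
    have pW: "p \<in> W" unfolding W_def using pV U(2) l(2) U1(2) by simp
    have WV: "W \<subseteq> V1" by (auto simp: W_def)
    have im: "H ` W = U1 \<inter> X -` W"
    proof
      show "H ` W \<subseteq> U1 \<inter> X -` W" using XH WV by auto
      show "U1 \<inter> X -` W \<subseteq> H ` W"
      proof
        fix w assume w: "w \<in> U1 \<inter> X -` W"
        then show "w \<in> H ` W" using HX(1)[of w] by (intro image_eqI[of _ _ "X w"]) auto
      qed
    qed
    have oH: "open (H ` W)" unfolding im by (intro continuous_open_preimage contX U1 oW)
    have raH: "real_analytic_on H W" by (rule holo_on_imp_real_analytic_on[OF oW holo_on_subset[OF holH WV]])
    have raX: "real_analytic_on X (H ` W)"
      by (rule holo_on_imp_real_analytic_on[OF oH holo_on_subset[OF holX]]) (use im U1(3) in blast)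
    have inv: "\<forall>x\<in>W. X (H x) = x" using XH(1) WV by blast
    have img: "H ` (W \<inter> E) = H ` W \<inter> real_points"
    proof
      show "H ` (W \<inter> E) \<subseteq> H ` W \<inter> real_points"
      proof (rule image_subsetI)
        fix x assume x: "x \<in> W \<inter> E"
        then have lU: "l x \<in> U1" "x \<in> E \<inter> U" by (auto simp: W_def)
        then have "l x \<in> real_points" "X (l x) = x" using lX[of x] U1(3) by blast+
        then have "H x \<in> real_points" using HX(1)[OF lU(1)] by simp
        then show "H x \<in> H ` W \<inter> real_points" using x by blast
      qed
      show "H ` W \<inter> real_points \<subseteq> H ` (W \<inter> E)"
      proof
        fix w assume w: "w \<in> H ` W \<inter> real_points"
        then obtain x where x: "x \<in> W" "w = H x" by blast
        have "H x \<in> U1" by (rule XH(2)) (use x(1) WV in blast)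
        then have "H x \<in> polydisc \<sigma> \<inter> real_points" using w U1(3) unfolding x(2) by blast
        then have "X (H x) \<in> E" using XE[of "H x"] by simp
        then show "w \<in> H ` (W \<inter> E)" using x XH(1)[of x] WV by auto
      qed
    qed
    have "open W \<and> p \<in> W \<and> open (H ` W) \<and> real_analytic_on H W \<and> real_analytic_on X (H ` W) \<and>
      (\<forall>x\<in>W. X (H x) = x) \<and> subspace (real_points :: (complex ^ 'n) set) \<and>
      dim (real_points :: (complex ^ 'n) set) = CARD('n) \<and> H ` (W \<inter> E) = H ` W \<inter> real_points"
      using oW pW oH raH raX inv subspace_real_points dim_real_points img by (intro conjI) assumption+
    then show ?thesis
      by - (rule exI[of _ W], rule exI[of _ H], rule exI[of _ X], rule exI[of _ "real_points :: (complex ^ 'n) set"], assumption)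
  qed
qed

end

section \<open>Maps of class C2 up to the boundary\<close>

lemma norm_scaleC_vec: "norm (c *\<^sub>C v) = cmod c * norm (v :: complex ^ 'n)"
  unfolding norm_vec_def by (simp add: L2_set_right_distrib norm_mult)

lemma analytic_defining_function_C1:
  fixes D :: "(complex ^ 'n) set"
  assumes "analytic_defining_function D N r"
  shows "x \<in> N \<Longrightarrow> (r has_derivative frechet_derivative r (at x)) (at x)"
    and "continuous_on N (\<lambda>x. frechet_derivative r (at x) v)"
proof -
  have N: "open N" and r: "real_analytic_on r N" using assms by (auto simp: analytic_defining_function_def)
  have "(r has_derivative frechet_derivative r (at x)) (at x) \<and> isCont (\<lambda>x. frechet_derivative r (at x) v) x"
    if x: "x \<in> N" for x
  proof -
    obtain G R where P: "polarized G R r" and xG: "(x, cnjv x) \<in> G" by (rule real_analytic_polarized[OF r x])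
    interpret polarized G R r by (rule P)
    let ?S = "{x. (x, cnjv x) \<in> G}"
    have fd: "frechet_derivative r (at y) = (\<lambda>v. rgrad y \<bullet> v)" if "y \<in> ?S" for y
      using that by (intro frechet_derivative_eq deriv_r) simp
    have "continuous_on ?S (\<lambda>x. frechet_derivative r (at x) v)"
      by (rule continuous_on_eq[of _ "\<lambda>x. rgrad x \<bullet> v"]) (simp_all add: fd continuous_on_inner continuous_rgrad)
    then have "isCont (\<lambda>x. frechet_derivative r (at x) v) x"
      using xG continuous_on_eq_continuous_at[OF open_diag] by blast
    then show ?thesis using deriv_r[OF xG] fd[of x] xG by simp
  qed
  then show "x \<in> N \<Longrightarrow> (r has_derivative frechet_derivative r (at x)) (at x)"
    and "continuous_on N (\<lambda>x. frechet_derivative r (at x) v)"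
    using continuous_at_imp_continuous_on by blast+
qed

lemma defining_function_zero:
  fixes D :: "(complex ^ 'n) set"
  assumes r: "analytic_defining_function D N r" and D: "open D" and x: "x \<in> frontier D" "x \<in> N"
  shows "r x = 0"
proof -
  have N: "open N" "D \<inter> N = {x \<in> N. r x < 0}" using r by (auto simp: analytic_defining_function_def)
  have "x \<notin> D" using x(1) D by (simp add: frontier_def interior_open)
  then have "r x \<ge> 0" using N(2) x(2) by force
  moreover have "r x \<le> 0"
  proof (rule ccontr)
    assume "\<not> r x \<le> 0"
    have "continuous_on N r"
      using analytic_defining_function_C1(1)[OF r] has_derivative_continuous continuous_at_imp_continuous_on by blast
    then have "open (N \<inter> r -` {0<..})" by (intro continuous_open_preimage N) auto
    moreover have "x \<in> N \<inter> r -` {0<..}" using \<open>\<not> r x \<le> 0\<close> x by simp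
    moreover have "x \<in> closure D" using x(1) by (simp add: frontier_def)
    ultimately have "D \<inter> (N \<inter> r -` {0<..}) \<noteq> {}"
      using open_Int_closure_eq_empty[of "N \<inter> r -` {0<..}" D] by blast
    then obtain y where y: "y \<in> D" "y \<in> N" "r y > 0" by auto
    then have "y \<in> {x \<in> N. r x < 0}" using N(2) by blast
    then show False using y(3) by simp
  qed
  ultimately show ?thesis by simp
qed

text \<open>
  The extension of \<open>f\<close> and of its derivatives to the closure is what makes one-sided derivatives at
  points of \<open>E\<close> available.
\<close>

locale C2_map =
  fixes \<Omega> U :: "(complex ^ 'n) set" and f :: "complex ^ 'n \<Rightarrow> complex ^ 'm"
  assumes open_domain: "open \<Omega>" and open_U: "open U" and holo_f: "holo_on f (\<Omega> \<inter> U)"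
    and C2: "Ck_extends 2 f (\<Omega> \<inter> U) (closure \<Omega> \<inter> U)" and cont_f: "continuous_on (closure \<Omega> \<inter> U) f"
begin

definition partials :: "complex ^ 'n \<Rightarrow> complex ^ 'm ^ 'n" where
  "partials x = (\<chi> j. (SOME g. continuous_on (closure \<Omega> \<inter> U) g \<and>
      (\<forall>x \<in> \<Omega> \<inter> U. g x = frechet_derivative f (at x) (axis j 1))) x)"

lemma C2': "Ck_extends 1 (\<lambda>x. frechet_derivative f (at x) v) (\<Omega> \<inter> U) (closure \<Omega> \<inter> U)"
  using C2 by (simp add: numeral_2_eq_2)

lemma partials:
  shows continuous_partials: "continuous_on (closure \<Omega> \<inter> U) (\<lambda>x. partials x $ j)"
    and partials_eq: "x \<in> \<Omega> \<inter> U \<Longrightarrow> partials x $ j = frechet_derivative f (at x) (axis j 1)"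
proof -
  have "\<exists>g. continuous_on (closure \<Omega> \<inter> U) g \<and> (\<forall>x \<in> \<Omega> \<inter> U. g x = frechet_derivative f (at x) (axis j 1))"
    using C2'[of "axis j 1"] by simp
  from someI_ex[OF this] show "continuous_on (closure \<Omega> \<inter> U) (\<lambda>x. partials x $ j)"
    "x \<in> \<Omega> \<inter> U \<Longrightarrow> partials x $ j = frechet_derivative f (at x) (axis j 1)"
    unfolding partials_def vec_lambda_beta by blast+
qed

lemma tendsto_of_extension:
  fixes T g :: "complex ^ 'n \<Rightarrow> 'c::real_normed_vector"
  assumes g: "continuous_on (closure \<Omega> \<inter> U) g" and T: "\<And>x. x \<in> \<Omega> \<inter> U \<Longrightarrow> g x = T x" and a: "a \<in> closure \<Omega> \<inter> U"
  shows "(T \<longlongrightarrow> g a) (at a within \<Omega>)"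
proof -
  have "(g \<longlongrightarrow> g a) (at a within closure \<Omega> \<inter> U)" using g a by (simp add: continuous_on_def)
  then have "(g \<longlongrightarrow> g a) (at a within \<Omega> \<inter> U)" by (rule tendsto_within_subset) (use closure_subset in blast)
  then have 1: "(T \<longlongrightarrow> g a) (at a within \<Omega> \<inter> U)" by (rule Lim_transform_within[OF _ zero_less_one]) (use T in blast)
  have "eventually (\<lambda>x. x \<in> U) (at a)" using open_U a by (intro eventually_at_in_open') auto
  then have "eventually (\<lambda>x. x \<in> \<Omega> \<inter> U \<longleftrightarrow> x \<in> \<Omega>) (at a)" by (rule eventually_mono) blast
  from Lim_transform_within_set_eq[OF this] show ?thesis using 1 by blast
qed

definition Df :: "complex ^ 'n \<Rightarrow> complex ^ 'n \<Rightarrow> complex ^ 'm" where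
  "Df x v = (\<Sum>j\<in>UNIV. v $ j *\<^sub>C partials x $ j)"

lemma Df_eq: assumes "x \<in> \<Omega> \<inter> U" shows "Df x v = frechet_derivative f (at x) v"
  unfolding Df_def partials_eq[OF assms] using clinear_expand[OF holo_on_frechet(2)[OF holo_f assms], of v] by simp

lemma continuous_Df: "continuous_on (closure \<Omega> \<inter> U) (\<lambda>x. Df x v)"
  unfolding Df_def by (intro continuous_intros continuous_partials)

lemma linear_Df: "linear (Df x)"
  by (rule linearI) (simp_all add: Df_def vec_eq_iff algebra_simps sum.distrib sum_distrib_left scaleC_add_left
      scaleR_conv_of_real[where 'a = complex])

lemma has_derivative_at_boundary:
  assumes "C1_side \<Omega> N r r' x" and x: "x \<in> closure \<Omega> \<inter> U"
  shows "(f has_derivative Df x) (at x within closure \<Omega>)"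
proof -
  interpret C1_side \<Omega> N r r' x by fact
  obtain \<beta> where \<beta>: "\<beta> > 0" "ball x \<beta> \<subseteq> U" using x open_U open_contains_ball by blast
  show ?thesis
  proof (rule one_sided_has_derivative[where \<beta> = \<beta> and h' = "\<lambda>x. frechet_derivative f (at x)"])
    show "x \<in> closure \<Omega>" "\<beta> > 0" using x \<beta> by auto
    show "continuous_on (closure \<Omega> \<inter> ball x \<beta>) f" by (rule continuous_on_subset[OF cont_f]) (use \<beta>(2) in blast)
    show "(f has_derivative frechet_derivative f (at z)) (at z)" if "z \<in> \<Omega> \<inter> ball x \<beta>" for z
      by (rule holo_on_frechet(1)[OF holo_f]) (use that \<beta>(2) in blast)
    show "((\<lambda>z. frechet_derivative f (at z) v) \<longlongrightarrow> Df x v) (at x within \<Omega>)" for v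
      by (rule tendsto_of_extension[OF continuous_Df Df_eq x])
    show "linear (Df x)" by (rule linear_Df)
  qed
qed

text \<open>
  Along every direction into \<open>\<Omega>\<close> the function \<open>\<rho> \<circ> f\<close> does not increase from its boundary value \<open>0\<close>.
\<close>

lemma boundary_gradient_proportional:
  assumes C1s: "C1_side \<Omega> N r r' x" and x: "x \<in> closure \<Omega> \<inter> U" and \<rho>: "(\<rho> has_derivative \<rho>') (at (f x))"
    and zero: "\<rho> (f x) = 0" and neg: "\<And>y. y \<in> \<Omega> \<inter> U \<Longrightarrow> \<rho> (f y) \<le> 0" and \<nu>: "r' x \<nu> = -1"
  shows "\<rho>' (Df x v) = - \<rho>' (Df x \<nu>) * r' x v"
proof -
  interpret C1_side \<Omega> N r r' x by fact
  have "linear (\<lambda>v. \<rho>' (Df x v))"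
    using linear_compose[OF linear_Df has_derivative_linear[OF \<rho>]] by (simp add: o_def)
  then show ?thesis
  proof (rule functional_proportional[OF linear_r' _ \<nu>])
    fix v assume "r' x v < 0"
    then obtain s where s: "s > 0" "\<And>t. 0 < t \<Longrightarrow> t < s \<Longrightarrow> x + t *\<^sub>R v \<in> \<Omega>" using ray by metis
    have "open ((\<lambda>t. x + t *\<^sub>R v) -` U)" by (rule open_vimage[OF open_U]) (intro continuous_intros)
    moreover have "0 \<in> (\<lambda>t. x + t *\<^sub>R v) -` U" using x by simp
    ultimately obtain e where e: "e > 0" "ball 0 e \<subseteq> (\<lambda>t. x + t *\<^sub>R v) -` U" using open_contains_ball by metis
    have "\<rho>' (Df x v) \<le> - 0"
    proof (rule directional_derivative_le[OF has_derivative_at_boundary[OF C1s x] \<rho>])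
      show "x \<in> closure \<Omega>" "min s e > 0" using x s e by auto
      fix t assume t: "0 < t" "t < min s e"
      then have "t \<in> ball 0 e" by simp
      then have "x + t *\<^sub>R v \<in> U" using e(2) by blast
      then show "x + t *\<^sub>R v \<in> closure \<Omega> \<and> \<rho> (f (x + t *\<^sub>R v)) \<le> \<rho> (f x) - 0 * t"
        using neg[of "x + t *\<^sub>R v"] s(2)[of t] t zero closure_subset[of \<Omega>] by auto
    qed
    then show "\<rho>' (Df x v) \<le> 0" by simp
  qed
qed

text \<open>
  The defining function has a second order expansion at \<open>p\<close>, so that a small disc in the complex normal direction touches it from inside
  at \<open>p\<close> only.  The Hopf lemma on the image of this disc bounds \<open>\<rho> \<circ> f\<close> along the normal by \<open>- \<kappa> t\<close>.
\<close>

lemma normal_derivative_negative: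
  assumes C1s: "C1_side \<Omega> N r (\<lambda>x v. g x \<bullet> v) p" and g: "g differentiable (at p)" and pc: "p \<in> closure \<Omega> \<inter> U"
    and \<nu>: "\<And>\<zeta>. g p \<bullet> (\<zeta> *\<^sub>C \<nu>) = - Re \<zeta>"
    and V: "open V" and \<rho>: "\<And>z. z \<in> V \<Longrightarrow> (\<rho> has_derivative \<rho>' z) (at z)" "\<And>v. continuous_on V (\<lambda>z. \<rho>' z v)"
    and psh: "plurisubharmonic_on \<rho> V" and neg: "\<And>y. y \<in> \<Omega> \<inter> U \<Longrightarrow> f y \<in> V \<and> \<rho> (f y) < 0"
    and zero: "f p \<in> V" "\<rho> (f p) = 0"
  shows "\<rho>' (f p) (Df p \<nu>) < 0"
proof -
  interpret C1_side \<Omega> N r "\<lambda>x v. g x \<bullet> v" p by fact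
  have "\<And>x. x \<in> N \<Longrightarrow> (r has_derivative (\<lambda>v. g x \<bullet> v)) (at x)" by (rule deriv)
  then obtain C e where C: "C > 0" "e > 0" "\<And>w. norm w < e \<Longrightarrow> \<bar>r (p + w) - r p - g p \<bullet> w\<bar> \<le> C * (norm w)\<^sup>2"
    using quadratic_remainder[OF open_N C1_side.p(1)[OF C1s] _ g, of r] by metis
  have "open (N \<inter> U)" "p \<in> N \<inter> U" using open_N open_U C1_side.p(1)[OF C1s] pc by auto
  then obtain e' where e': "e' > 0" "ball p e' \<subseteq> N \<inter> U" using open_contains_ball by metis
  define n where "n = norm \<nu> + 1"
  have n: "n > 0" "norm \<nu> \<le> n" by (simp_all add: n_def add_nonneg_pos)
  \<comment> \<open>on the disc \<open>|\<zeta>|^2 \<le> 2 s Re \<zeta>\<close>, so that the quadratic remainder is at most half of \<open>Re \<zeta>\<close>\<close>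
  define s where "s = min (min e e' / (4 * n)) (1 / (4 * C * n * n))"
  have s: "s > 0" using C e' n by (auto simp: s_def)
  have s1: "2 * s * n < min e e'"
  proof -
    have "2 * s * n \<le> 2 * (min e e' / (4 * n)) * n" using n by (intro mult_right_mono mult_left_mono) (auto simp: s_def)
    also have "\<dots> = min e e' / 2" using n by simp
    also have "\<dots> < min e e'" using C(2) e'(1) by (auto simp: min_def)
    finally show ?thesis .
  qed
  have s2: "C * (2 * s) * (n * n) \<le> 1 / 2"
  proof -
    have "C * (2 * s) * (n * n) \<le> C * (2 * (1 / (4 * C * n * n))) * (n * n)"
      using n C by (intro mult_right_mono mult_left_mono) (auto simp: s_def)
    also have "\<dots> = 1 / 2" using n C by simp
    finally show ?thesis .
  qed
  have disc: "p + \<zeta> *\<^sub>C \<nu> \<in> \<Omega> \<inter> U" if z: "\<zeta> \<in> cball (of_real s) s" "\<zeta> \<noteq> 0" for \<zeta>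
  proof -
    have "cmod (\<zeta> - of_real s) \<le> s" using z(1) by (simp add: dist_norm norm_minus_commute)
    then have "(cmod (\<zeta> - of_real s))\<^sup>2 \<le> s\<^sup>2" by (intro power_mono) auto
    then have "(Re \<zeta> - s)\<^sup>2 + (Im \<zeta>)\<^sup>2 \<le> s\<^sup>2" unfolding cmod_power2 by simp
    then have sq: "(cmod \<zeta>)\<^sup>2 \<le> 2 * s * Re \<zeta>"
      unfolding cmod_power2 by (simp add: power2_eq_square algebra_simps)
    moreover have "0 < (cmod \<zeta>)\<^sup>2" using z(2) by simp
    ultimately have "0 < (2 * s) * Re \<zeta>" by linarith
    then have Re: "Re \<zeta> > 0" using s by (simp add: zero_less_mult_iff)
    have "cmod \<zeta> \<le> 2 * s"
      using z(1) norm_triangle_ineq2[of \<zeta> "of_real s"] s by (simp add: dist_norm norm_minus_commute)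
    then have "norm (\<zeta> *\<^sub>C \<nu>) \<le> 2 * s * n"
      unfolding norm_scaleC_vec using n s by (intro mult_mono) auto
    then have w: "norm (\<zeta> *\<^sub>C \<nu>) < e" "norm (\<zeta> *\<^sub>C \<nu>) < e'" using s1 by auto
    have "(norm (\<zeta> *\<^sub>C \<nu>))\<^sup>2 = (cmod \<zeta>)\<^sup>2 * (norm \<nu> * norm \<nu>)"
      by (simp add: norm_scaleC_vec power2_eq_square mult_ac)
    also have "\<dots> \<le> (2 * s * Re \<zeta>) * (n * n)"
      using sq n s Re by (intro mult_mono) auto
    finally have "C * (norm (\<zeta> *\<^sub>C \<nu>))\<^sup>2 \<le> C * ((2 * s * Re \<zeta>) * (n * n))" using C(1) by (intro mult_left_mono) auto
    also have "\<dots> = (C * (2 * s) * (n * n)) * Re \<zeta>" by simp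
    also have "\<dots> \<le> 1 / 2 * Re \<zeta>" using s2 Re by (intro mult_right_mono) auto
    finally have "r (p + \<zeta> *\<^sub>C \<nu>) < 0"
      using C(3)[OF w(1)] \<nu>[of \<zeta>] C1_side.p(2)[OF C1s] Re by (simp add: abs_le_iff)
    moreover have "p + \<zeta> *\<^sub>C \<nu> \<in> ball p e'" using w(2) by (simp add: dist_norm)
    ultimately show ?thesis using e'(2) mem_\<Omega>_iff by blast
  qed
  define q where "q \<zeta> = f (p + \<zeta> *\<^sub>C \<nu>)" for \<zeta>
  have 0: "0 \<notin> ball (complex_of_real s) s" using s by (simp add: dist_norm)
  have clz: "clinear (\<lambda>\<zeta>::complex. \<zeta> *\<^sub>C \<nu>)"
    unfolding clinear_def linear_iff
    by (simp add: scaleC_add_left scaleC_scaleC scaleR_conv_of_real[where 'a = complex] flip: scaleC_of_real)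
  have holq: "holo_on q (ball (of_real s) s)"
    unfolding q_def
  proof (rule holo_on_compose[OF _ holo_f])
    show "holo_on (\<lambda>\<zeta>. p + \<zeta> *\<^sub>C \<nu>) (ball (of_real s) s)" by (intro holo_on_add holo_on_const holo_on_clinear clz)
    show "(\<lambda>\<zeta>. p + \<zeta> *\<^sub>C \<nu>) ` ball (of_real s) s \<subseteq> \<Omega> \<inter> U"
    proof (rule image_subsetI)
      fix \<zeta> assume z: "\<zeta> \<in> ball (complex_of_real s) s"
      have "\<zeta> \<noteq> 0" using z 0 by blast
      then show "p + \<zeta> *\<^sub>C \<nu> \<in> \<Omega> \<inter> U" by (intro disc) (use z in simp_all)
    qed
  qed
  have inU: "p + \<zeta> *\<^sub>C \<nu> \<in> closure \<Omega> \<inter> U" if "\<zeta> \<in> cball (of_real s) s" for \<zeta>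
    using disc[OF that] pc closure_subset[of \<Omega>] by (cases "\<zeta> = 0") auto
  have contq: "continuous_on (cball (of_real s) s) q"
    unfolding q_def by (rule continuous_on_compose2[OF cont_f]) (use inU in \<open>auto intro!: continuous_intros\<close>)
  have qV: "q ` cball (of_real s) s \<subseteq> V"
  proof (rule image_subsetI)
    fix \<zeta> assume "\<zeta> \<in> cball (complex_of_real s) s"
    then show "q \<zeta> \<in> V" using neg[OF disc, of \<zeta>] zero(1) by (cases "\<zeta> = 0") (auto simp: q_def)
  qed
  have negq: "\<rho> (q \<zeta>) < 0" if "\<zeta> \<in> cball (of_real s) s" "\<zeta> \<noteq> 0" for \<zeta>
    using neg[OF disc[OF that]] by (simp add: q_def)
  have q0: "\<rho> (q 0) = 0" using zero by (simp add: q_def)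
  obtain \<kappa> where \<kappa>: "\<kappa> > 0" "\<And>t. 0 \<le> t \<Longrightarrow> t \<le> s / 2 \<Longrightarrow> \<rho> (q (of_real t)) \<le> - \<kappa> * t"
  proof -
    show thesis
      by (rule Hopf_psh[where q = q and \<rho> = \<rho> and \<rho>' = \<rho>' and V = V and s = s], rule s, rule holq, rule contq, rule qV, rule V,
          erule \<rho>(1), rule \<rho>(2), rule psh, erule (1) negq, rule q0, rule that)
  qed
  have "\<rho>' (f p) (Df p \<nu>) \<le> - \<kappa>"
  proof (rule directional_derivative_le[OF has_derivative_at_boundary[OF C1s pc] \<rho>(1)[OF zero(1)]])
    show "p \<in> closure \<Omega>" "s / 2 > 0" using pc s by auto
    fix t assume t: "0 < t" "t < s / 2"
    have tR: "complex_of_real t *\<^sub>C \<nu> = t *\<^sub>R \<nu>" by (rule scaleC_of_real)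
    have "complex_of_real t \<in> cball (of_real s) s" using t s by (simp add: dist_norm flip: of_real_diff)
    then show "p + t *\<^sub>R \<nu> \<in> closure \<Omega> \<and> \<rho> (f (p + t *\<^sub>R \<nu>)) \<le> \<rho> (f p) - \<kappa> * t"
      using inU[of "complex_of_real t"] \<kappa>(2)[of t] t zero(2) unfolding q_def tR by simp
  qed
  then show ?thesis using \<kappa>(1) by simp
qed

end

lemma tendsto_frechet_holo:
  fixes \<Upsilon> :: "'a::complex_space \<Rightarrow> 'b::complex_space"
  assumes S: "open S" "holo_on \<Upsilon> S" and u: "(u \<longlongrightarrow> u0) F" "u0 \<in> S" and w: "(w \<longlongrightarrow> w0) F"
  shows "((\<lambda>x. frechet_derivative \<Upsilon> (at (u x)) (w x)) \<longlongrightarrow> frechet_derivative \<Upsilon> (at u0) w0) F"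
proof -
  have exp: "(\<Sum>b\<in>Basis. (v \<bullet> b) *\<^sub>R frechet_derivative \<Upsilon> (at z) b) = frechet_derivative \<Upsilon> (at z) v" if "z \<in> S" for z v
  proof -
    note lin = clinearD(1)[OF holo_on_frechet(2)[OF S(2) that]]
    have "frechet_derivative \<Upsilon> (at z) (\<Sum>b\<in>Basis. (v \<bullet> b) *\<^sub>R b) = (\<Sum>b\<in>Basis. (v \<bullet> b) *\<^sub>R frechet_derivative \<Upsilon> (at z) b)"
      by (simp add: linear_sum[OF lin] linear_scale[OF lin])
    then show ?thesis by (simp add: euclidean_representation)
  qed
  have "((\<lambda>x. frechet_derivative \<Upsilon> (at (u x)) b) \<longlongrightarrow> frechet_derivative \<Upsilon> (at u0) b) F" for b
  proof (rule isCont_tendsto_compose[OF _ u(1)])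
    show "isCont (\<lambda>z. frechet_derivative \<Upsilon> (at z) b) u0"
      using continuous_on_frechet_holo[OF S] u(2) continuous_on_eq_continuous_at[OF S(1)] by blast
  qed
  then have "((\<lambda>x. \<Sum>b\<in>Basis. (w x \<bullet> b) *\<^sub>R frechet_derivative \<Upsilon> (at (u x)) b) \<longlongrightarrow>
      (\<Sum>b\<in>Basis. (w0 \<bullet> b) *\<^sub>R frechet_derivative \<Upsilon> (at u0) b)) F"
    by (intro tendsto_intros w)
  then have "((\<lambda>x. \<Sum>b\<in>Basis. (w x \<bullet> b) *\<^sub>R frechet_derivative \<Upsilon> (at (u x)) b) \<longlongrightarrow> frechet_derivative \<Upsilon> (at u0) w0) F"
    unfolding exp[OF u(2)] .
  moreover have "eventually (\<lambda>x. (\<Sum>b\<in>Basis. (w x \<bullet> b) *\<^sub>R frechet_derivative \<Upsilon> (at (u x)) b) = frechet_derivative \<Upsilon> (at (u x)) (w x)) F"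
    by (rule eventually_mono[OF topological_tendstoD[OF u(1) S(1) u(2)]]) (rule exp)
  ultimately show ?thesis by (rule Lim_transform_eventually)
qed

lemma tendsto_vec_lambda:
  fixes g :: "'x \<Rightarrow> 'j::finite \<Rightarrow> 'c::real_normed_vector"
  assumes "\<And>j. ((\<lambda>x. g x j) \<longlongrightarrow> l j) F" shows "((\<lambda>x. \<chi> j. g x j) \<longlongrightarrow> (\<chi> j. l j)) F"
  by (rule vec_tendstoI) (simp add: assms)

section \<open>Local extension and patching\<close>

lemma inner_scaleC_self: "x \<bullet> (\<zeta> *\<^sub>C x) = Re \<zeta> * (x \<bullet> (x :: complex ^ 'n))"
  by (simp add: inner_vec_def inner_complex_def sum_distrib_left algebra_simps)

lemma inner_cnjv: "(2 *\<^sub>R cnjv a) \<bullet> v = 2 * Re (\<Sum>j\<in>UNIV. a $ j * v $ j)"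
  by (simp add: inner_vec_def inner_complex_def sum_distrib_left algebra_simps)

text \<open>
  It remains to see that \<open>y = Y (x, g x)\<close> satisfies the conditions on the reflecting
  function.  It is written as \<open>\<Upsilon> \<circ> \<Phi>\<close> with \<open>\<Upsilon>\<close> holomorphic near \<open>\<Phi> p\<close> and \<open>\<Phi>\<close> the tuple of \<open>x\<close>, \<open>f x\<close> and
  the partial derivatives of \<open>f\<close>; thus \<open>\<Phi>\<close> is \<open>C^1\<close> up to the boundary, and so is \<open>y\<close>.
\<close>

theorem local_extension:
  fixes \<Omega> E U :: "(complex ^ 'n) set" and \<Omega>' E' V :: "(complex ^ 'm) set"
    and \<rho> :: "complex ^ 'm \<Rightarrow> real" and f :: "complex ^ 'n \<Rightarrow> complex ^ 'm"
  assumes \<Omega>: "open \<Omega>" "E \<subseteq> frontier \<Omega>" "submanifold C1_on CARD('n) E" "totally_real E"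
      "boundary_analytic_strictly_pseudoconvex_near \<Omega> E"
    and \<Omega>': "open \<Omega>'" "E' \<subseteq> frontier \<Omega>'" "submanifold real_analytic_on CARD('m) E'" "totally_real E'" "E' \<subseteq> V"
    and \<rho>: "analytic_defining_function \<Omega>' V \<rho>" "plurisubharmonic_on \<rho> V"
    and f: "C2_map \<Omega> U f" "E \<subseteq> U" "f ` (\<Omega> \<inter> U) \<subseteq> \<Omega>' \<inter> V" "f ` E \<subseteq> E'"
    and p: "p \<in> E"
  shows "\<exists>\<delta> F. \<delta> > 0 \<and> ball p \<delta> \<subseteq> U \<and> holo_on F (ball p \<delta>) \<and> (\<forall>x \<in> closure \<Omega> \<inter> ball p \<delta>. F x = f x)"
    and "\<exists>W (\<phi> :: complex ^ 'n \<Rightarrow> complex ^ 'n) \<psi> L. open W \<and> p \<in> W \<and> open (\<phi> ` W) \<and> real_analytic_on \<phi> W \<and> real_analytic_on \<psi> (\<phi> ` W) \<and>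
      (\<forall>x\<in>W. \<psi> (\<phi> x) = x) \<and> subspace L \<and> dim L = CARD('n) \<and> \<phi> ` (W \<inter> E) = \<phi> ` W \<inter> L"
proof -
  interpret C2_map \<Omega> U f by (rule f(1))
  have EC: "E \<subseteq> closure \<Omega>" using \<Omega>(2) by (auto simp: frontier_def)
  have pK: "p \<in> closure \<Omega> \<inter> U" using EC f(2) p by blast
  have pF: "p \<in> frontier \<Omega>" using \<Omega>(2) p by blast
  obtain W0 where W0: "E \<subseteq> W0" and W0': "\<forall>p \<in> frontier \<Omega> \<inter> W0. \<exists>N r. p \<in> N \<and> analytic_defining_function \<Omega> N r \<and>
       (\<forall>x \<in> frontier \<Omega> \<inter> N. \<forall>v \<in> complex_tangent r x. v \<noteq> 0 \<longrightarrow> levi_form r x v > 0)"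
    using \<Omega>(5) unfolding boundary_analytic_strictly_pseudoconvex_near_def by blast
  have "p \<in> frontier \<Omega> \<inter> W0" using pF W0 p by blast
  from bspec[OF W0' this] obtain N r where pN: "p \<in> N" and r: "analytic_defining_function \<Omega> N r"
    and levi: "\<forall>x \<in> frontier \<Omega> \<inter> N. \<forall>v \<in> complex_tangent r x. v \<noteq> 0 \<longrightarrow> levi_form r x v > 0" by blast
  have N: "open N" "real_analytic_on r N" "\<Omega> \<inter> N = {x \<in> N. r x < 0}" "\<And>x. x \<in> N \<Longrightarrow> frechet_derivative r (at x) \<noteq> (\<lambda>_. 0)"
    using r by (auto simp: analytic_defining_function_def)
  have rp: "r p = 0" by (rule defining_function_zero[OF r \<Omega>(1) pF pN])
  obtain G R where P: "polarized G R r" and pG: "(p, cnjv p) \<in> G" by (rule real_analytic_polarized[OF N(2) pN])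
  interpret S: polarized G R r by (rule P)
  define N1 where "N1 = N \<inter> {x. (x, cnjv x) \<in> G}"
  have oN1: "open N1" unfolding N1_def by (intro open_Int N S.open_diag)
  have pN1: "p \<in> N1" using pN pG by (simp add: N1_def)
  have rg: "S.rgrad x \<noteq> 0" if x: "x \<in> N1" for x
  proof
    assume z: "S.rgrad x = 0"
    have "frechet_derivative r (at x) = (\<lambda>v. S.rgrad x \<bullet> v)"
      by (rule frechet_derivative_eq, rule S.deriv_r) (use x in \<open>simp add: N1_def\<close>)
    then show False using N(4)[of x] x z by (simp add: N1_def)
  qed
  have C1s: "C1_side \<Omega> N1 r (\<lambda>x v. S.rgrad x \<bullet> v) x" if x: "x \<in> N1" "r x = 0" for x
  proof (rule C1_side.intro[OF \<Omega>(1) oN1])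
    show "(r has_derivative (\<lambda>v. S.rgrad z \<bullet> v)) (at z)" if "z \<in> N1" for z
      using that by (intro S.deriv_r) (simp add: N1_def)
    show "continuous_on N1 (\<lambda>x. S.rgrad x \<bullet> v)" for v
      by (intro continuous_intros continuous_on_subset[OF S.continuous_rgrad]) (auto simp: N1_def)
    show "\<Omega> \<inter> N1 = {x \<in> N1. r x < 0}" using N(3) by (auto simp: N1_def)
    show "x \<in> N1" "r x = 0" using x by auto
    show "\<exists>v. S.rgrad x \<bullet> v \<noteq> 0" using rg[OF x(1)] inner_eq_zero_iff[of "S.rgrad x"] by blast
  qed
  have E0: "r x = 0" if "x \<in> E" "x \<in> N1" for x
    by (rule defining_function_zero[OF r \<Omega>(1)]) (use that \<Omega>(2) in \<open>auto simp: N1_def\<close>)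

  have V: "open V" "real_analytic_on \<rho> V" "\<Omega>' \<inter> V = {x \<in> V. \<rho> x < 0}"
    using \<rho>(1) by (auto simp: analytic_defining_function_def)
  have \<rho>0: "\<rho> z = 0" if "z \<in> E'" for z
    by (rule defining_function_zero[OF \<rho>(1) \<Omega>'(1)]) (use that \<Omega>'(2,5) in auto)
  have neg: "f y \<in> V \<and> \<rho> (f y) < 0" if "y \<in> \<Omega> \<inter> U" for y
  proof -
    have "f y \<in> \<Omega>' \<inter> V" using f(3) that by blast
    then show ?thesis unfolding V(3) by simp
  qed
  define q where "q = f p"
  have qE: "q \<in> E'" using f(4) p by (auto simp: q_def)
  have qV: "q \<in> V" using qE \<Omega>'(5) by blast
  obtain H P' where P': "polarized H P' \<rho>" and qH: "(q, cnjv q) \<in> H" by (rule real_analytic_polarized[OF V(2) qV])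
  interpret T: polarized H P' \<rho> by (rule P')
  obtain A0 S' where A0: "open A0" "q \<in> A0" "holo_on S' A0" and S'E: "\<And>z. z \<in> E' \<inter> A0 \<Longrightarrow> S' z = cnjv z"
    by (rule totally_real_reflection[OF \<Omega>'(3,4) qE], rule that)
  have holPair: "holo_on (\<lambda>z. (z, S' z)) A0" by (intro holo_on_Pair holo_on_id A0)
  define A2 where "A2 = A0 \<inter> (\<lambda>z. (z, S' z)) -` H"
  have oA2: "open A2" unfolding A2_def
    by (intro continuous_open_preimage holo_on_imp_continuous_on[OF holPair] A0 T.open_G)
  have A20: "A2 \<subseteq> A0" by (auto simp: A2_def)
  have qA2: "q \<in> A2" using A0(2) S'E[of q] qE qH by (simp add: A2_def)
  define \<eta> where "\<eta> z = T.grad (z, S' z)" for z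
  have hol\<eta>: "holo_on \<eta> A2" unfolding \<eta>_def
    by (rule holo_on_compose[OF holo_on_subset[OF holPair A20] T.holo_grad]) (auto simp: A2_def)
  have \<eta>E: "\<eta> z = T.grad (z, cnjv z)" "(z, cnjv z) \<in> H" if "z \<in> E'" "z \<in> A2" for z
    using S'E[of z] that A20 by (auto simp: \<eta>_def A2_def)
  define m where "m z a = (\<chi> j. \<Sum>k\<in>UNIV. \<eta> z $ k * a $ j $ k)" for z and a :: "complex ^ 'm ^ 'n"
  define g where "g x = m (f x) (partials x)" for x
  have T_rgrad: "T.rgrad (f x) \<bullet> Df x v = (2 *\<^sub>R cnjv (g x)) \<bullet> v" if "f x \<in> E'" "f x \<in> A2" for x v
  proof -
    have "(\<Sum>k\<in>UNIV. T.grad (f x, cnjv (f x)) $ k * Df x v $ k) = (\<Sum>k\<in>UNIV. \<Sum>j\<in>UNIV. \<eta> (f x) $ k * (v $ j * partials x $ j $ k))"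
      unfolding \<eta>E(1)[OF that, symmetric] by (simp add: Df_def sum_distrib_left)
    also have "\<dots> = (\<Sum>j\<in>UNIV. g x $ j * v $ j)"
    proof -
      have "g x $ j * v $ j = (\<Sum>k\<in>UNIV. \<eta> (f x) $ k * (v $ j * partials x $ j $ k))" for j
        unfolding g_def m_def vec_lambda_beta sum_distrib_right by (rule sum.cong[OF refl]) (simp add: mult_ac)
      then show ?thesis by (simp only: sum.swap[of "\<lambda>k j. \<eta> (f x) $ k * (v $ j * partials x $ j $ k)"])
    qed
    finally show ?thesis unfolding T.rgrad_inner inner_cnjv by simp
  qed
  have T_deriv: "(\<rho> has_derivative (\<lambda>v. T.rgrad (f x) \<bullet> v)) (at (f x))" if "f x \<in> E'" "f x \<in> A2" for x
    by (rule T.deriv_r[OF \<eta>E(2)[OF that]])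
  have g_prop: "g x = complex_of_real (- (T.rgrad (f x) \<bullet> Df x \<nu>)) *\<^sub>C S.grad (x, cnjv x)"
    if x: "x \<in> E" "x \<in> N1" "f x \<in> A2" and \<nu>: "S.rgrad x \<bullet> \<nu> = -1" for x \<nu>
  proof -
    have xE': "f x \<in> E'" using f(4) x(1) by blast
    define c where "c = - (T.rgrad (f x) \<bullet> Df x \<nu>)"
    have xK: "x \<in> closure \<Omega> \<inter> U" using EC f(2) x(1) by blast
    have "T.rgrad (f x) \<bullet> Df x v = c * (S.rgrad x \<bullet> v)" for v
      unfolding c_def
      by (rule boundary_gradient_proportional[OF C1s[OF x(2) E0[OF x(1,2)]] xK T_deriv[OF xE' x(3)] \<rho>0[OF xE'] _ \<nu>])
        (use neg in \<open>simp add: less_imp_le\<close>)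
    then have "(2 *\<^sub>R cnjv (g x)) \<bullet> v = (c *\<^sub>R S.rgrad x) \<bullet> v" for v
      unfolding T_rgrad[OF xE' x(3), symmetric] by simp
    then have "2 *\<^sub>R cnjv (g x) = c *\<^sub>R S.rgrad x" using vector_eq_rdot[of "2 *\<^sub>R cnjv (g x)" "c *\<^sub>R S.rgrad x"] by blast
    then have "2 *\<^sub>R cnjv (g x) = 2 *\<^sub>R (c *\<^sub>R cnjv (S.grad (x, cnjv x)))" by (simp add: S.rgrad_def)
    then have "cnjv (g x) = c *\<^sub>R cnjv (S.grad (x, cnjv x))" by (simp only: scaleR_cancel_left) simp
    then have "cnjv (cnjv (g x)) = cnjv (c *\<^sub>R cnjv (S.grad (x, cnjv x)))" by (rule arg_cong)
    then have "g x = c *\<^sub>R S.grad (x, cnjv x)" by (simp add: cnjv_simps)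
    then show ?thesis unfolding c_def scaleC_of_real .
  qed
  \<comment> \<open>the inner complex normal, scaled so that the differential of \<open>r\<close> is \<open>- Re \<zeta>\<close> on \<open>\<zeta> dir x\<close>\<close>
  define dir where "dir x = (- 1 / (S.rgrad x \<bullet> S.rgrad x)) *\<^sub>R S.rgrad x" for x
  have dir: "S.rgrad x \<bullet> (\<zeta> *\<^sub>C dir x) = - Re \<zeta>" if "x \<in> N1" for x \<zeta>
    using rg[OF that] by (simp add: dir_def scaleC_scaleR inner_scaleC_self)
  have dir1: "S.rgrad x \<bullet> dir x = -1" if "x \<in> N1" for x using dir[OF that, of 1] by simp
  define c0 where "c0 = - (T.rgrad (f p) \<bullet> Df p (dir p))"
  have c0: "c0 > 0"
  proof -
    have "frechet_derivative \<rho> (at (f p)) (Df p (dir p)) < 0"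
      by (rule normal_derivative_negative[OF C1s[OF pN1 rp] S.rgrad_differentiable[OF pG] pK dir[OF pN1] V(1)
            analytic_defining_function_C1[OF \<rho>(1)] \<rho>(2) neg])
        (use qV \<rho>0[OF qE] in \<open>simp_all add: q_def\<close>)
    moreover have "frechet_derivative \<rho> (at (f p)) = (\<lambda>v. T.rgrad (f p) \<bullet> v)"
      by (rule frechet_derivative_eq, rule T_deriv) (use qE qA2 in \<open>simp_all add: q_def\<close>)
    ultimately show ?thesis by (simp add: c0_def)
  qed
  have gp: "g p = complex_of_real c0 *\<^sub>C S.grad (p, cnjv p)"
    unfolding c0_def by (rule g_prop[OF p pN1 _ dir1[OF pN1]]) (use qA2 in \<open>simp add: q_def\<close>)
  have anz: "S.grad (p, cnjv p) \<noteq> 0" using rg[OF pN1] by (auto simp: S.rgrad_def cnjv_simps)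
  have levi_p: "levi_form r p v > 0" if "v \<in> complex_tangent r p" "v \<noteq> 0" for v using levi pF pN that by blast
  obtain A Y \<delta> where A: "open A" and holY: "holo_on Y A" and \<delta>: "\<delta> > 0"
    and Y: "\<And>x c. x \<in> ball p \<delta> \<Longrightarrow> r x = 0 \<Longrightarrow> \<bar>c - c0\<bar> < \<delta> \<Longrightarrow>
       (x, complex_of_real c *\<^sub>C S.grad (x, cnjv x)) \<in> A \<and> Y (x, complex_of_real c *\<^sub>C S.grad (x, cnjv x)) = cnjv x"
  proof -
    show thesis by (rule S.conormal_reflection[OF pG rp c0 anz levi_p], assumption, assumption, rule that)
  qed

  define \<D>0 :: "((complex ^ 'n) \<times> (complex ^ 'm) \<times> (complex ^ 'm ^ 'n)) set" where "\<D>0 = UNIV \<times> A2 \<times> UNIV"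
  define M where "M u = (fst u, m (fst (snd u)) (snd (snd u)))" for u :: "(complex ^ 'n) \<times> (complex ^ 'm) \<times> (complex ^ 'm ^ 'n)"
  have o\<D>0: "open \<D>0" unfolding \<D>0_def by (intro open_Times open_UNIV oA2)
  have holM: "holo_on M \<D>0"
  proof -
    have 1: "holo_on (\<lambda>u :: (complex ^ 'n) \<times> (complex ^ 'm) \<times> (complex ^ 'm ^ 'n). \<eta> (fst (snd u))) \<D>0"
      by (rule holo_on_compose[OF holo_on_clinear[OF clinear_compose[OF clinear_snd clinear_fst]] hol\<eta>]) (auto simp: \<D>0_def)
    have 2: "holo_on (\<lambda>u :: (complex ^ 'n) \<times> (complex ^ 'm) \<times> (complex ^ 'm ^ 'n). snd (snd u)) \<D>0"
      by (rule holo_on_clinear[OF clinear_compose[OF clinear_snd clinear_snd]])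
    have "holo_on (\<lambda>u :: (complex ^ 'n) \<times> (complex ^ 'm) \<times> (complex ^ 'm ^ 'n). m (fst (snd u)) (snd (snd u))) \<D>0"
      unfolding m_def
      by (rule holo_on_vec_lambda, rule holo_on_sum, rule holo_on_mult[OF holo_on_vec_nth[OF 1] holo_on_vec_nth[OF holo_on_vec_nth[OF 2]]])
    then show ?thesis unfolding M_def by (rule holo_on_Pair[OF holo_on_clinear[OF clinear_fst]])
  qed
  define \<D> where "\<D> = \<D>0 \<inter> M -` A"
  have o\<D>: "open \<D>" unfolding \<D>_def by (intro continuous_open_preimage holo_on_imp_continuous_on[OF holM] o\<D>0 A)
  define \<Upsilon> where "\<Upsilon> u = Y (M u)" for u
  have hol\<Upsilon>: "holo_on \<Upsilon> \<D>" unfolding \<Upsilon>_def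
    by (rule holo_on_compose[OF holo_on_subset[OF holM] holY]) (auto simp: \<D>_def)
  define \<Phi> where "\<Phi> x = (x, f x, partials x)" for x
  have M\<Phi>: "M (\<Phi> x) = (x, g x)" for x by (simp add: M_def \<Phi>_def g_def)
  have cont\<Phi>: "continuous_on (closure \<Omega> \<inter> U) \<Phi>"
  proof -
    have "continuous_on (closure \<Omega> \<inter> U) partials"
      unfolding continuous_on_def
    proof (intro ballI, rule vec_tendstoI)
      fix x j assume "x \<in> closure \<Omega> \<inter> U"
      then show "((\<lambda>z. partials z $ j) \<longlongrightarrow> partials x $ j) (at x within closure \<Omega> \<inter> U)"
        using continuous_partials[of j] unfolding continuous_on_def by blast
    qed
    then show ?thesis unfolding \<Phi>_def by (intro continuous_on_Pair continuous_on_id cont_f)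
  qed
  have \<Phi>p: "\<Phi> p \<in> \<D>"
  proof -
    have "(p, g p) \<in> A" using Y[of p c0] \<delta> rp gp by simp
    then show ?thesis using qA2 M\<Phi>[of p] by (simp add: \<D>_def \<D>0_def \<Phi>_def q_def)
  qed
  obtain b1 where b1: "b1 > 0" "ball p b1 \<subseteq> N1 \<inter> U"
    using open_contains_ball[of "N1 \<inter> U"] open_Int[OF oN1 open_U] pN1 pK by blast
  obtain d1 where d1: "d1 > 0" "\<And>x. x \<in> (closure \<Omega> \<inter> U) \<inter> ball p d1 \<Longrightarrow> \<Phi> x \<in> \<D>"
  proof -
    show thesis by (rule continuous_on_nbhd[OF cont\<Phi> pK o\<D> \<Phi>p], rule that)
  qed
  obtain j0 where j0: "S.grad (p, cnjv p) $ j0 \<noteq> 0" using anz by (auto simp: vec_eq_iff)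
  define K1 where "K1 = closure \<Omega> \<inter> U \<inter> ball p (min b1 d1)"
  have pK1: "p \<in> K1" using pK b1 d1 by (simp add: K1_def)
  have K1: "K1 \<subseteq> closure \<Omega> \<inter> U" "K1 \<subseteq> N1" using b1(2) by (auto simp: K1_def)
  have \<Phi>K1: "\<Phi> x \<in> \<D>" if "x \<in> K1" for x by (rule d1(2)) (use that in \<open>auto simp: K1_def\<close>)
  have fK1: "f x \<in> A2" if "x \<in> K1" for x using \<Phi>K1[OF that] by (simp add: \<D>_def \<D>0_def \<Phi>_def)
  have contgrad: "continuous_on K1 (\<lambda>x. S.grad (x, cnjv x) $ j0)"
    by (intro continuous_intros continuous_on_subset[OF S.continuous_grad]) (use K1(2) in \<open>auto simp: N1_def\<close>)
  have contg: "continuous_on K1 (\<lambda>x. g x $ j0)"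
  proof -
    have "continuous_on K1 (\<lambda>x. M (\<Phi> x))"
      by (rule continuous_on_compose2[OF holo_on_imp_continuous_on[OF holM] continuous_on_subset[OF cont\<Phi> K1(1)]])
        (use \<Phi>K1 in \<open>auto simp: \<D>_def\<close>)
    then have "continuous_on K1 (\<lambda>x. snd (M (\<Phi> x)))" by (rule continuous_on_snd)
    then show ?thesis unfolding M\<Phi> snd_conv by (intro continuous_intros)
  qed
  obtain d2 where d2: "d2 > 0" "\<And>x. x \<in> K1 \<inter> ball p d2 \<Longrightarrow> S.grad (x, cnjv x) $ j0 \<in> - {0}"
  proof -
    have o: "open (- {0 :: complex})" by (rule open_Compl[OF closed_singleton])
    have n: "S.grad (p, cnjv p) $ j0 \<in> - {0}" using j0 by simp
    show thesis by (rule continuous_on_nbhd[OF contgrad pK1 o n], rule that)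
  qed
  define K2 where "K2 = K1 \<inter> ball p d2"
  have pK2: "p \<in> K2" using pK1 d2 by (simp add: K2_def)
  \<comment> \<open>the factor of proportionality between \<open>g x\<close> and the gradient, as a continuous function on the closure near \<open>p\<close>\<close>
  define c where "c x = Re (g x $ j0 / S.grad (x, cnjv x) $ j0)" for x
  have contc: "continuous_on K2 c"
  proof -
    have "K2 \<subseteq> K1" by (simp add: K2_def)
    note cK2 = continuous_on_subset[OF contg this] continuous_on_subset[OF contgrad this]
    have nz: "\<forall>x\<in>K2. S.grad (x, cnjv x) $ j0 \<noteq> 0" using d2(2) by (auto simp: K2_def)
    show ?thesis unfolding c_def by (rule continuous_on_Re[OF continuous_on_divide[OF cK2 nz]])
  qed
  have "c p = c0" using j0 by (simp add: c_def gp)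
  then have cp: "c p \<in> ball c0 \<delta>" using \<delta> by simp
  obtain d3 where d3: "d3 > 0" "\<And>x. x \<in> K2 \<inter> ball p d3 \<Longrightarrow> c x \<in> ball c0 \<delta>"
  proof -
    show thesis by (rule continuous_on_nbhd[OF contc pK2 open_ball cp], rule that)
  qed
  define \<beta> where "\<beta> = min (min (min b1 d1) (min d2 d3)) \<delta>"
  have \<beta>: "\<beta> > 0" using b1 d1 d2 d3 \<delta> by (simp add: \<beta>_def)
  have \<beta>U: "ball p \<beta> \<subseteq> U" using b1(2) by (auto simp: \<beta>_def)
  have \<beta>K: "x \<in> K2 \<inter> ball p d3" if "x \<in> closure \<Omega> \<inter> ball p \<beta>" for x
    using that \<beta>U by (auto simp: K2_def K1_def \<beta>_def)
  have \<beta>K1: "x \<in> K1" if "x \<in> closure \<Omega> \<inter> ball p \<beta>" for x using \<beta>K[OF that] by (simp add: K2_def)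
  have in\<Omega>: "x \<in> closure \<Omega> \<inter> ball p \<beta>" "x \<in> \<Omega> \<inter> U" if "x \<in> \<Omega> \<inter> ball p \<beta>" for x
    using that \<beta>U closure_subset[of \<Omega>] by auto
  define y where "y x = \<Upsilon> (\<Phi> x)" for x
  have y_E: "y x = cnjv x" if x: "x \<in> E \<inter> ball p \<beta>" for x
  proof -
    have xK: "x \<in> closure \<Omega> \<inter> ball p \<beta>" using x EC by blast
    have xN: "x \<in> N1" using \<beta>K1[OF xK] K1(2) by blast
    define t where "t = - (T.rgrad (f x) \<bullet> Df x (dir x))"
    have gx: "g x = complex_of_real t *\<^sub>C S.grad (x, cnjv x)"
      unfolding t_def by (rule g_prop[OF _ xN fK1[OF \<beta>K1[OF xK]] dir1[OF xN]]) (use x in blast)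
    have "S.grad (x, cnjv x) $ j0 \<noteq> 0" using d2(2)[of x] \<beta>K[OF xK] by (simp add: K2_def)
    then have "c x = t" by (simp add: c_def gx)
    then have "\<bar>t - c0\<bar> < \<delta>" using d3(2)[OF \<beta>K[OF xK]] by (simp add: dist_real_def abs_minus_commute)
    moreover have "x \<in> ball p \<delta>" using x by (auto simp: \<beta>_def)
    moreover have "r x = 0" using E0 x xN by blast
    ultimately show ?thesis using Y[of x t] unfolding y_def \<Upsilon>_def M\<Phi> gx by blast
  qed
  have cont_y: "continuous_on (closure \<Omega> \<inter> ball p \<beta>) y"
    unfolding y_def
    by (rule continuous_on_compose2[OF holo_on_imp_continuous_on[OF hol\<Upsilon>] continuous_on_subset[OF cont\<Phi>]])
      (use \<beta>U \<Phi>K1[OF \<beta>K1] in auto)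
  have o\<Omega>U: "open (\<Omega> \<inter> U)" using \<Omega>(1) open_U by (rule open_Int)
  define \<Phi>' where "\<Phi>' x v = (v, frechet_derivative f (at x) v,
      \<chi> j. frechet_derivative (\<lambda>z. frechet_derivative f (at z) (axis j 1)) (at x) v)" for x v
  have d\<Phi>: "(\<Phi> has_derivative \<Phi>' x) (at x)" if x: "x \<in> \<Omega> \<inter> U" for x
  proof -
    have "((\<lambda>z. partials z $ j) has_derivative frechet_derivative (\<lambda>z. frechet_derivative f (at z) (axis j 1)) (at x)) (at x)" for j
      by (rule has_derivative_transform_within_open[OF holo_on_frechet(1)[OF holo_on_frechet_vec[OF o\<Omega>U holo_f] x] o\<Omega>U x])
        (simp add: partials_eq)
    then have "(partials has_derivative (\<lambda>v. \<chi> j. frechet_derivative (\<lambda>z. frechet_derivative f (at z) (axis j 1)) (at x) v)) (at x)"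
      unfolding has_derivative_vec_nth_iff by simp
    then show ?thesis unfolding \<Phi>_def \<Phi>'_def
      by (intro has_derivative_Pair has_derivative_ident holo_on_frechet(1)[OF holo_f x])
  qed
  have hol_partials: "holo_on partials (\<Omega> \<inter> U)"
  proof (rule holo_on_vecI)
    fix j
    show "holo_on (\<lambda>x. partials x $ j) (\<Omega> \<inter> U)"
      by (rule holo_on_cong[OF o\<Omega>U _ holo_on_frechet_vec[OF o\<Omega>U holo_f, of "axis j 1"]]) (simp add: partials_eq)
  qed
  have hol\<Phi>: "holo_on \<Phi> (\<Omega> \<inter> U)" unfolding \<Phi>_def by (intro holo_on_Pair holo_on_id holo_f hol_partials)
  have sub: "\<Omega> \<inter> ball p \<beta> \<subseteq> \<Omega> \<inter> U" using \<beta>U by blast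
  have hol_y: "holo_on y (\<Omega> \<inter> ball p \<beta>)"
    unfolding y_def
    by (rule holo_on_compose[OF holo_on_subset[OF hol\<Phi> sub] hol\<Upsilon>]) (use \<Phi>K1[OF \<beta>K1[OF in\<Omega>(1)]] in blast)
  have "\<forall>j v. \<exists>L. ((\<lambda>x. frechet_derivative (\<lambda>z. frechet_derivative f (at z) (axis j 1)) (at x) v) \<longlongrightarrow> L) (at p within \<Omega>)"
  proof (intro allI)
    fix j v
    have "\<exists>h. continuous_on (closure \<Omega> \<inter> U) h \<and> (\<forall>x\<in>\<Omega> \<inter> U. h x = frechet_derivative (\<lambda>z. frechet_derivative f (at z) (axis j 1)) (at x) v)"
      using C2'[of "axis j 1"] by simp
    then obtain h where h: "continuous_on (closure \<Omega> \<inter> U) h"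
      "\<And>x. x \<in> \<Omega> \<inter> U \<Longrightarrow> h x = frechet_derivative (\<lambda>z. frechet_derivative f (at z) (axis j 1)) (at x) v" by blast
    show "\<exists>L. ((\<lambda>x. frechet_derivative (\<lambda>z. frechet_derivative f (at z) (axis j 1)) (at x) v) \<longlongrightarrow> L) (at p within \<Omega>)"
      by (rule exI, rule tendsto_of_extension[OF h pK])
  qed
  then obtain L where L: "\<And>j v. ((\<lambda>x. frechet_derivative (\<lambda>z. frechet_derivative f (at z) (axis j 1)) (at x) v) \<longlongrightarrow> L j v) (at p within \<Omega>)"
    by metis
  define D where "D v = frechet_derivative \<Upsilon> (at (\<Phi> p)) (v, Df p v, \<chi> j. L j v)" for v
  have lim_y: "((\<lambda>x. frechet_derivative y (at x) v) \<longlongrightarrow> D v) (at p within \<Omega>)" for v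
  proof -
    have "((\<lambda>x. \<Phi>' x v) \<longlongrightarrow> (v, Df p v, \<chi> j. L j v)) (at p within \<Omega>)"
      unfolding \<Phi>'_def
      by (intro tendsto_Pair tendsto_const tendsto_vec_lambda L tendsto_of_extension[OF continuous_Df Df_eq pK])
    moreover have "(\<Phi> \<longlongrightarrow> \<Phi> p) (at p within \<Omega>)" by (rule tendsto_of_extension[OF cont\<Phi> refl pK])
    ultimately have "((\<lambda>x. frechet_derivative \<Upsilon> (at (\<Phi> x)) (\<Phi>' x v)) \<longlongrightarrow> D v) (at p within \<Omega>)"
      unfolding D_def by (intro tendsto_frechet_holo[OF o\<D> hol\<Upsilon> _ \<Phi>p])
    then show ?thesis
    proof (rule Lim_transform_within[OF _ \<beta>])
      fix x assume "x \<in> \<Omega>" "0 < dist x p" "dist x p < \<beta>"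
      then have x: "x \<in> \<Omega> \<inter> ball p \<beta>" by (simp add: dist_commute)
      have "(\<Upsilon> has_derivative frechet_derivative \<Upsilon> (at (\<Phi> x))) (at (\<Phi> x))"
        by (rule holo_on_frechet(1)[OF hol\<Upsilon> \<Phi>K1[OF \<beta>K1[OF in\<Omega>(1)[OF x]]]])
      from has_derivative_compose[OF d\<Phi>[OF in\<Omega>(2)[OF x]] this]
      have "(y has_derivative (\<lambda>v. frechet_derivative \<Upsilon> (at (\<Phi> x)) (\<Phi>' x v))) (at x)" unfolding y_def .
      from frechet_derivative_eq[OF this]
      show "frechet_derivative \<Upsilon> (at (\<Phi> x)) (\<Phi>' x v) = frechet_derivative y (at x) v" by simp
    qed
  qed
  have clinear_D: "clinear D"
  proof (rule clinear_limit[OF _ _ lim_y])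
    have "p \<notin> \<Omega>" using pF \<Omega>(1) by (simp add: frontier_def interior_open)
    then show "at p within \<Omega> \<noteq> bot" using pK by (simp add: trivial_limit_within islimpt_in_closure)
    show "eventually (\<lambda>x. clinear (frechet_derivative y (at x))) (at p within \<Omega>)"
      unfolding eventually_at
    proof (intro exI[of _ \<beta>] conjI \<beta> ballI impI)
      fix x assume "x \<in> \<Omega>" "x \<noteq> p \<and> dist x p < \<beta>"
      then show "clinear (frechet_derivative y (at x))"
        by (intro holo_on_frechet(2)[OF hol_y]) (simp add: dist_commute)
    qed
  qed
  have RD: "reflection_data \<Omega> N1 r (\<lambda>x v. S.rgrad x \<bullet> v) p E \<beta> y (\<lambda>x. frechet_derivative y (at x)) D"
    by (rule reflection_data.intro[OF C1s[OF pN1 rp]], rule reflection_data_axioms.intro)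
      (use \<Omega>(2,3,4) p \<beta> cont_y holo_on_frechet[OF hol_y] lim_y clinear_D y_E in blast)+
  have cf: "continuous_on (closure \<Omega> \<inter> ball p \<beta>) f" by (rule continuous_on_subset[OF cont_f]) (use \<beta>U in blast)
  have hf: "holo_on f (\<Omega> \<inter> ball p \<beta>)" by (rule holo_on_subset[OF holo_f sub])
  have fA: "f x \<in> A0" if "x \<in> closure \<Omega> \<inter> ball p \<beta>" for x using fK1[OF \<beta>K1[OF that]] A20 by blast
  have cs: "continuous_on (closure \<Omega> \<inter> ball p \<beta>) (\<lambda>x. S' (f x))"
    by (rule continuous_on_compose2[OF holo_on_imp_continuous_on[OF A0(3)] cf]) (use fA in blast)
  have hs: "holo_on (\<lambda>x. S' (f x)) (\<Omega> \<inter> ball p \<beta>)"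
    by (rule holo_on_compose[OF hf A0(3)]) (use fA in\<Omega>(1) in blast)
  have sE: "S' (f x) = cnjv (f x)" if "x \<in> E \<inter> ball p \<beta>" for x
    by (rule S'E) (use that fA EC f(4) in blast)
  note final = reflection_data.extension_and_chart[OF RD cf hf cs hs sE]
  obtain \<delta>' F where "\<delta>' > 0" "\<delta>' \<le> \<beta>" "holo_on F (ball p \<delta>')" "\<forall>x \<in> closure \<Omega> \<inter> ball p \<delta>'. F x = f x"
    using final(1) by blast
  moreover have "ball p \<delta>' \<subseteq> U" using \<open>\<delta>' \<le> \<beta>\<close> \<beta>U by auto
  ultimately show "\<exists>\<delta> F. \<delta> > 0 \<and> ball p \<delta> \<subseteq> U \<and> holo_on F (ball p \<delta>) \<and> (\<forall>x \<in> closure \<Omega> \<inter> ball p \<delta>. F x = f x)" by blast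
  show "\<exists>W (\<phi> :: complex ^ 'n \<Rightarrow> complex ^ 'n) \<psi> L. open W \<and> p \<in> W \<and> open (\<phi> ` W) \<and> real_analytic_on \<phi> W \<and> real_analytic_on \<psi> (\<phi> ` W) \<and>
      (\<forall>x\<in>W. \<psi> (\<phi> x) = x) \<and> subspace L \<and> dim L = CARD('n) \<and> \<phi> ` (W \<inter> E) = \<phi> ` W \<inter> L"
    by (rule final(2))
qed

text \<open>
  Halving the radii ensures that of two overlapping small balls the larger full ball contains the centre of
  the other one.  The full balls then meet in a convex set around a point of the closure of \<open>\<Omega>\<close>, and on its part
  inside \<open>\<Omega>\<close> both extensions equal \<open>f\<close>.
\<close>

lemma patch_local_extensions:
  fixes f :: "complex ^ 'n \<Rightarrow> complex ^ 'm"
  assumes \<Omega>: "open \<Omega>" and E: "E \<subseteq> closure \<Omega>"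
    and loc: "\<And>p. p \<in> E \<Longrightarrow> \<exists>\<delta> F. \<delta> > 0 \<and> holo_on F (ball p \<delta>) \<and> (\<forall>x \<in> closure \<Omega> \<inter> ball p \<delta>. F x = f x)"
  obtains W F where "open W" "E \<subseteq> W" "holo_on F W" "\<And>x. x \<in> closure \<Omega> \<inter> W \<Longrightarrow> F x = f x"
proof -
  have "\<forall>p. \<exists>\<delta> F. p \<in> E \<longrightarrow> \<delta> > 0 \<and> holo_on F (ball p \<delta>) \<and> (\<forall>x \<in> closure \<Omega> \<inter> ball p \<delta>. F x = f x)" using loc by blast
  then obtain \<delta> F where \<delta>: "\<And>p. p \<in> E \<Longrightarrow> \<delta> p > 0" and F: "\<And>p. p \<in> E \<Longrightarrow> holo_on (F p) (ball p (\<delta> p))"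
    and Ff: "\<And>p x. p \<in> E \<Longrightarrow> x \<in> closure \<Omega> \<inter> ball p (\<delta> p) \<Longrightarrow> F p x = f x" by metis
  define B where "B p = ball p (\<delta> p / 2)" for p
  have Bsub: "B p \<subseteq> ball p (\<delta> p)" if "p \<in> E" for p using \<delta>[OF that] by (auto simp: B_def)
  have agree1: "F p x = F q x" if pq: "p \<in> E" "q \<in> E" and x: "x \<in> B p" "x \<in> B q" and le: "\<delta> q \<le> \<delta> p" for p q x
  proof -
    define S where "S = ball p (\<delta> p) \<inter> ball q (\<delta> q)"
    have "dist p q \<le> dist p x + dist q x" using dist_triangle2[of p q x] .
    also have "\<dots> < \<delta> p" using x le by (simp add: B_def)
    finally have qS: "q \<in> S" using \<delta>[OF pq(2)] by (simp add: S_def)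
    have oS: "open S" unfolding S_def by (intro open_Int open_ball)
    have cS: "connected S" unfolding S_def by (intro convex_connected convex_Int convex_ball)
    have ne: "\<Omega> \<inter> S \<noteq> {}" using open_Int_closure_eq_empty[OF oS, of \<Omega>] qS E pq(2) by blast
    have eq: "F p z = F q z" if z: "z \<in> \<Omega> \<inter> S" for z
    proof -
      have "z \<in> closure \<Omega>" using z closure_subset by blast
      then show ?thesis using Ff[OF pq(1), of z] Ff[OF pq(2), of z] z by (simp add: S_def)
    qed
    have hol: "holo_on (F p) S" "holo_on (F q) S"
      by (rule holo_on_subset[OF F[OF pq(1)]], simp add: S_def, rule holo_on_subset[OF F[OF pq(2)]], simp add: S_def)
    have xS: "x \<in> S"
      using subsetD[OF Bsub[OF pq(1)] x(1)] subsetD[OF Bsub[OF pq(2)] x(2)] by (simp add: S_def)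
    show ?thesis
    proof (rule holo_identity[where S = S and T = "\<Omega> \<inter> S" and f = "F p" and g = "F q"])
      show "F p z = F q z" if "z \<in> \<Omega> \<inter> S" for z by (rule eq[OF that])
    qed (rule oS cS hol open_Int[OF \<Omega> oS] Int_lower2 ne xS)+
  qed
  have agree: "F p x = F q x" if "p \<in> E" "q \<in> E" "x \<in> B p" "x \<in> B q" for p q x
  proof (cases "\<delta> q \<le> \<delta> p")
    case True
    then show ?thesis by (rule agree1[OF that])
  next
    case False
    then have "\<delta> p \<le> \<delta> q" by simp
    from agree1[OF that(2,1,4,3) this] show ?thesis by (rule sym)
  qed
  define W where "W = (\<Union>p\<in>E. B p)"
  define \<Psi> where "\<Psi> x = F (SOME p. p \<in> E \<and> x \<in> B p) x" for x
  have \<Psi>: "\<Psi> x = F p x" if "p \<in> E" "x \<in> B p" for p x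
  proof -
    have "\<exists>p. p \<in> E \<and> x \<in> B p" using that by blast
    from someI_ex[OF this] show ?thesis unfolding \<Psi>_def using agree that by blast
  qed
  show thesis
  proof (rule that[of W \<Psi>])
    show "open W" unfolding W_def B_def by (intro open_UN ballI open_ball)
    show "E \<subseteq> W" using \<delta> by (force simp: W_def B_def)
    have "holo_on \<Psi> (B p)" if "p \<in> E" for p
      by (rule holo_on_cong[OF _ _ holo_on_subset[OF F[OF that] Bsub[OF that]]]) (simp_all add: B_def \<Psi>[OF that, unfolded B_def])
    then show "holo_on \<Psi> W" unfolding holo_on_def W_def by blast
    fix x assume x: "x \<in> closure \<Omega> \<inter> W"
    then obtain p where p: "p \<in> E" "x \<in> B p" by (auto simp: W_def)
    then have "x \<in> closure \<Omega> \<inter> ball p (\<delta> p)" using x Bsub by blast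
    then show "\<Psi> x = f x" using \<Psi>[OF p] Ff[OF p(1)] by simp
  qed
qed

theorem theorem2:
  fixes \<Omega> E U :: "(complex ^ 'n) set"
    and \<Omega>' E' V :: "(complex ^ 'm) set"
    and \<rho> :: "complex ^ 'm \<Rightarrow> real"
    and f :: "complex ^ 'n \<Rightarrow> complex ^ 'm"
  assumes "domain_in \<Omega>"
    and "E \<subseteq> frontier \<Omega>"
    and "submanifold C1_on CARD('n) E"
    and "totally_real E"
    and "boundary_analytic_strictly_pseudoconvex_near \<Omega> E"
    and "domain_in \<Omega>'"
    and "E' \<subseteq> frontier \<Omega>'"
    and "submanifold real_analytic_on CARD('m) E'"
    and "totally_real E'"
    and "open V" and "E' \<subseteq> V"
    and "analytic_defining_function \<Omega>' V \<rho>"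
    and "plurisubharmonic_on \<rho> V"
    and "open U" and "E \<subseteq> U"
    and "holomorphic_map_on f (\<Omega> \<inter> U)"
    and "f ` (\<Omega> \<inter> U) \<subseteq> \<Omega>' \<inter> V"
    and "Ck_extends 2 f (\<Omega> \<inter> U) (closure \<Omega> \<inter> U)"
    \<comment> \<open>on \<open>closure \<Omega> \<inter> U\<close>, \<open>f\<close> denotes its continuous extension\<close>
    and "continuous_on (closure \<Omega> \<inter> U) f"
    and "f ` E \<subseteq> E'"
  shows "(\<exists>W F. open W \<and> E \<subseteq> W \<and> holomorphic_map_on F W \<and>
            (\<forall>x \<in> closure \<Omega> \<inter> U \<inter> W. F x = f x)) \<and>
         submanifold real_analytic_on CARD('n) E"
proof -
  have op: "open \<Omega>" "open \<Omega>'" using assms(1,6) by (simp_all add: domain_in_def)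
  have map: "C2_map \<Omega> U f"
    using op(1) assms(14,16,18,19) by (simp add: C2_map_def holomorphic_map_on_eq_holo_on)
  note loc = local_extension[OF op(1) assms(2-5) op(2) assms(7-9,11-13) map assms(15,17,20)]
  have EC: "E \<subseteq> closure \<Omega>" using assms(2) by (auto simp: frontier_def)
  have ext: "\<exists>\<delta> F. \<delta> > 0 \<and> holo_on F (ball p \<delta>) \<and> (\<forall>x \<in> closure \<Omega> \<inter> ball p \<delta>. F x = f x)" if "p \<in> E" for p
    using loc(1)[OF that] by blast
  obtain W F where W: "open W" "E \<subseteq> W" "holo_on F W" "\<And>x. x \<in> closure \<Omega> \<inter> W \<Longrightarrow> F x = f x"
  proof -
    show thesis by (rule patch_local_extensions[OF op(1) EC ext], assumption, rule that)
  qed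
  have "submanifold real_analytic_on CARD('n) E"
    unfolding submanifold_def by (rule ballI, rule loc(2))
  moreover have "holomorphic_map_on F W" using W(3) by (simp add: holomorphic_map_on_eq_holo_on)
  ultimately show ?thesis using W(1,2,4) by blast
qed

end
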